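(* Let $(M,g,\xi)$ be a global selfsimilar manifold with a potential homothetic vector field. (i) If $\xi$ vanishes at a point, then $(M,g,\xi)$ is (isomorphic to) the Euclidean space with the radiant vector field $\left(\mathbb{R}^n,\ \sum_{i=1}^n(dx^i)^2,\ \sum_{i=1}^n x^i\frac{\partial}{\partial x^i}\right)$. (ii) If $\xi$ does not vanish at any point, then $(M,g,\xi)$ is (isomorphic to) a Riemannian cone $\left(N\times\mathbb{R}^{>0},\ s^2g_N+ds^2,\ s\frac{\partial}{\partial s}\right)$ over some Riemannian manifold $(N,g_N)$, where $s$ is the coordinate on $\mathbb{R}^{>0}$.
   Context: Manifolds are smooth and connected. A selfsimilar manifold $(M,g,\xi)$ is a Riemannian manifold $(M,g)$ endowed with a vector field $\xi$ (the homothetic vector field) satisfying $\mathcal{L}_\xi g=2g$. It is called global if $\xi$ is complete. The field $\xi$ is potential if it is locally the gradient of a function; equivalently $d(\iota_\xi g)=0$, where $\iota_\xi g=g(\xi,\cdot)$. Isomorphisms are diffeomorphisms carrying metric to metric and vector field to vector field. *)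

theory Defs
  imports "HOL-Analysis.Analysis"
begin

section \<open>Smooth functions on open subsets of coordinate spaces\<close>

text \<open>
  Coordinate spaces of variable dimension: for a set \<open>B\<close> of standard basis vectors of a Euclidean
  space \<open>'e\<close>, the subspace \<open>span B\<close> with the coordinates \<open>x \<bullet> b\<close>, \<open>b \<in> B\<close>, is the space
  \<open>\<real>\<^sup>n\<close> with \<open>n = card B\<close>. The case \<open>B = {}\<close> is \<open>n = 0\<close>.
\<close>

definition dir_deriv :: "('e::real_normed_vector \<Rightarrow> 'f::real_normed_vector) \<Rightarrow> 'e \<Rightarrow> 'e \<Rightarrow> 'f" where
  "dir_deriv f x v = vector_derivative (\<lambda>t. f (x + t *\<^sub>R v)) (at 0)"

primrec Ck_on :: "nat \<Rightarrow> 'e::real_normed_vector set \<Rightarrow> 'e set \<Rightarrow> ('e \<Rightarrow> 'f::real_normed_vector) \<Rightarrow> bool" where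
  "Ck_on 0 B U f \<longleftrightarrow> continuous_on U f"
| "Ck_on (Suc k) B U f \<longleftrightarrow> continuous_on U f \<and>
     (\<forall>b\<in>B. (\<forall>x\<in>U. (\<lambda>t. f (x + t *\<^sub>R b)) differentiable (at 0)) \<and>
            Ck_on k B U (\<lambda>x. dir_deriv f x b))"

text \<open>Only used for \<open>U\<close> open in \<open>span B\<close>: all iterated partial derivatives in the
  coordinates \<open>B\<close> exist on \<open>U\<close> and are continuous.\<close>

definition smooth_on :: "'e::real_normed_vector set \<Rightarrow> 'e set \<Rightarrow> ('e \<Rightarrow> 'f::real_normed_vector) \<Rightarrow> bool" where
  "smooth_on B U f \<longleftrightarrow> (\<forall>k. Ck_on k B U f)"


section \<open>Smooth manifolds\<close>

text \<open>A chart \<open>(U, \<phi>)\<close>; the values of \<open>\<phi>\<close> outside \<open>U\<close> are irrelevant.\<close>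

type_synonym ('a, 'e) chart = "'a set \<times> ('a \<Rightarrow> 'e)"

record ('a, 'e) manifold =
  mtop :: "'a topology"
  coords :: "'e set"
  atlas :: "('a, 'e) chart set"

definition chart_inv :: "('a, 'e) chart \<Rightarrow> 'e \<Rightarrow> 'a" where
  "chart_inv c = inv_into (fst c) (snd c)"

definition charts_at :: "('a, 'e) manifold \<Rightarrow> 'a \<Rightarrow> ('a, 'e) chart set" where
  "charts_at M p = {c \<in> atlas M. p \<in> fst c}"

definition chart_at :: "('a, 'e) manifold \<Rightarrow> 'a \<Rightarrow> ('a, 'e) chart" where
  "chart_at M p = (SOME c. c \<in> charts_at M p)"

text \<open>Manifolds are nonempty, connected, Hausdorff and second countable; the dimension is
  \<open>card (coords M)\<close>. The atlas is not required to be maximal.\<close>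

definition smooth_manifold :: "('a, 'e::euclidean_space) manifold \<Rightarrow> bool" where
  "smooth_manifold M \<longleftrightarrow>
     coords M \<subseteq> Basis \<and>
     topspace (mtop M) \<noteq> {} \<and> connected_space (mtop M) \<and>
     Hausdorff_space (mtop M) \<and> second_countable (mtop M) \<and>
     (\<Union>c\<in>atlas M. fst c) = topspace (mtop M) \<and>
     (\<forall>(U, \<phi>)\<in>atlas M.
        openin (mtop M) U \<and>
        openin (top_of_set (span (coords M))) (\<phi> ` U) \<and>
        homeomorphic_map (subtopology (mtop M) U) (top_of_set (\<phi> ` U)) \<phi>) \<and>
     (\<forall>c\<in>atlas M. \<forall>d\<in>atlas M.
        smooth_on (coords M) (snd c ` (fst c \<inter> fst d)) (snd d \<circ> chart_inv c))"

definition smooth_map ::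
  "('a, 'e::euclidean_space) manifold \<Rightarrow> ('b, 'f::euclidean_space) manifold \<Rightarrow> ('a \<Rightarrow> 'b) \<Rightarrow> bool" where
  "smooth_map M N F \<longleftrightarrow>
     continuous_map (mtop M) (mtop N) F \<and>
     (\<forall>c\<in>atlas M. \<forall>d\<in>atlas N.
        smooth_on (coords M) (snd c ` {x \<in> fst c. F x \<in> fst d}) (snd d \<circ> F \<circ> chart_inv c))"

definition diffeomorphism ::
  "('a, 'e::euclidean_space) manifold \<Rightarrow> ('b, 'f::euclidean_space) manifold \<Rightarrow> ('a \<Rightarrow> 'b) \<Rightarrow> bool" where
  "diffeomorphism M N F \<longleftrightarrow>
     bij_betw F (topspace (mtop M)) (topspace (mtop N)) \<and>
     smooth_map M N F \<and> smooth_map N M (inv_into (topspace (mtop M)) F)"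

definition smooth_function_on ::
  "('a, 'e::euclidean_space) manifold \<Rightarrow> 'a set \<Rightarrow> ('a \<Rightarrow> real) \<Rightarrow> bool" where
  "smooth_function_on M W f \<longleftrightarrow>
     (\<forall>c\<in>atlas M. smooth_on (coords M) (snd c ` (fst c \<inter> W)) (f \<circ> chart_inv c))"


section \<open>Tangent vectors and vector fields\<close>

text \<open>
  A tangent vector at \<open>p\<close> is the family of its components \<open>V c\<close> in the charts \<open>c\<close> around \<open>p\<close>, which
  transform by the derivatives of the transition maps; the family is \<open>0\<close> at other indices \<open>c\<close>,
  so that tangent vectors are equal iff their components are.
\<close>

type_synonym ('a, 'e) tangent = "('a, 'e) chart \<Rightarrow> 'e"

definition tangent_space :: "('a, 'e::euclidean_space) manifold \<Rightarrow> 'a \<Rightarrow> ('a, 'e) tangent set" where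
  "tangent_space M p = {V.
     (\<forall>c\<in>charts_at M p. V c \<in> span (coords M)) \<and>
     (\<forall>c\<in>charts_at M p. \<forall>d\<in>charts_at M p.
        V d = dir_deriv (snd d \<circ> chart_inv c) (snd c p) (V c)) \<and>
     (\<forall>c. c \<notin> charts_at M p \<longrightarrow> V c = 0)}"

text \<open>The tangent vector at \<open>p\<close> with component \<open>v\<close> in the chart \<open>c\<close>.\<close>

definition coord_vector ::
  "('a, 'e::euclidean_space) manifold \<Rightarrow> 'a \<Rightarrow> ('a, 'e) chart \<Rightarrow> 'e \<Rightarrow> ('a, 'e) tangent" where
  "coord_vector M p c v =
     (\<lambda>d. if d \<in> charts_at M p then dir_deriv (snd d \<circ> chart_inv c) (snd c p) v else 0)"

definition tangent_map ::
  "('a, 'e::euclidean_space) manifold \<Rightarrow> ('b, 'f::euclidean_space) manifold \<Rightarrow> ('a \<Rightarrow> 'b) \<Rightarrow> 'a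
     \<Rightarrow> ('a, 'e) tangent \<Rightarrow> ('b, 'f) tangent" where
  "tangent_map M N F p V = (let c = chart_at M p in
     (\<lambda>d. if d \<in> charts_at N (F p)
          then dir_deriv (snd d \<circ> F \<circ> chart_inv c) (snd c p) (V c) else 0))"

definition differential ::
  "('a, 'e::euclidean_space) manifold \<Rightarrow> ('a \<Rightarrow> real) \<Rightarrow> 'a \<Rightarrow> ('a, 'e) tangent \<Rightarrow> real" where
  "differential M f p V = (let c = chart_at M p in dir_deriv (f \<circ> chart_inv c) (snd c p) (V c))"

definition vector_field ::
  "('a, 'e::euclidean_space) manifold \<Rightarrow> ('a \<Rightarrow> ('a, 'e) tangent) \<Rightarrow> bool" where
  "vector_field M X \<longleftrightarrow>
     (\<forall>p\<in>topspace (mtop M). X p \<in> tangent_space M p) \<and>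
     (\<forall>c\<in>atlas M. smooth_on (coords M) (snd c ` fst c) (\<lambda>x. X (chart_inv c x) c))"

definition integral_curve ::
  "('a, 'e::euclidean_space) manifold \<Rightarrow> ('a \<Rightarrow> ('a, 'e) tangent) \<Rightarrow> (real \<Rightarrow> 'a) \<Rightarrow> bool" where
  "integral_curve M X \<gamma> \<longleftrightarrow>
     continuous_map euclideanreal (mtop M) \<gamma> \<and>
     (\<forall>t. \<forall>c\<in>charts_at M (\<gamma> t). ((snd c \<circ> \<gamma>) has_vector_derivative X (\<gamma> t) c) (at t))"

definition complete_vector_field ::
  "('a, 'e::euclidean_space) manifold \<Rightarrow> ('a \<Rightarrow> ('a, 'e) tangent) \<Rightarrow> bool" where
  "complete_vector_field M X \<longleftrightarrow>
     (\<forall>p\<in>topspace (mtop M). \<exists>\<gamma>. \<gamma> 0 = p \<and> integral_curve M X \<gamma>)"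

definition vanishes_at :: "('a \<Rightarrow> ('a, 'e::euclidean_space) tangent) \<Rightarrow> 'a \<Rightarrow> bool" where
  "vanishes_at X p \<longleftrightarrow> X p = (\<lambda>c. 0)"


section \<open>Riemannian metrics\<close>

type_synonym ('a, 'e) tensor2 = "'a \<Rightarrow> ('a, 'e) tangent \<Rightarrow> ('a, 'e) tangent \<Rightarrow> real"

text \<open>The expression of a covariant 2-tensor field in a chart, as a bilinear form on
  \<open>span (coords M)\<close> depending on the point \<open>x\<close> of the image of the chart.\<close>

definition tensor_in_chart ::
  "('a, 'e::euclidean_space) manifold \<Rightarrow> ('a, 'e) tensor2 \<Rightarrow> ('a, 'e) chart
     \<Rightarrow> 'e \<Rightarrow> 'e \<Rightarrow> 'e \<Rightarrow> real" where
  "tensor_in_chart M g c x v w = (let p = chart_inv c x in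
     g p (coord_vector M p c v) (coord_vector M p c w))"

definition riemannian_metric ::
  "('a, 'e::euclidean_space) manifold \<Rightarrow> ('a, 'e) tensor2 \<Rightarrow> bool" where
  "riemannian_metric M g \<longleftrightarrow> (\<forall>c\<in>atlas M.
     let E = span (coords M); gc = tensor_in_chart M g c in
     (\<forall>x\<in>snd c ` fst c.
        (\<forall>u\<in>E. \<forall>v\<in>E. \<forall>w\<in>E. \<forall>a b. gc x (a *\<^sub>R u + b *\<^sub>R v) w = a * gc x u w + b * gc x v w) \<and>
        (\<forall>v\<in>E. \<forall>w\<in>E. gc x v w = gc x w v) \<and>
        (\<forall>v\<in>E. v \<noteq> 0 \<longrightarrow> gc x v v > 0)) \<and>
     (\<forall>v\<in>E. \<forall>w\<in>E. smooth_on (coords M) (snd c ` fst c) (\<lambda>x. gc x v w)))"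

definition riemannian_manifold ::
  "('a, 'e::euclidean_space) manifold \<Rightarrow> ('a, 'e) tensor2 \<Rightarrow> bool" where
  "riemannian_manifold M g \<longleftrightarrow> smooth_manifold M \<and> riemannian_metric M g"

text \<open>
  The Lie derivative of a covariant 2-tensor field in a chart,
  \<open>(L\<^sub>X g)\<^sub>i\<^sub>j = X\<^sup>k \<partial>\<^sub>k g\<^sub>i\<^sub>j + g\<^sub>k\<^sub>j \<partial>\<^sub>i X\<^sup>k + g\<^sub>i\<^sub>k \<partial>\<^sub>j X\<^sup>k\<close>,
  contracted with constant vectors \<open>v\<close> and \<open>w\<close>.
\<close>

definition lie_derivative_in_chart ::
  "('a, 'e::euclidean_space) manifold \<Rightarrow> ('a \<Rightarrow> ('a, 'e) tangent) \<Rightarrow> ('a, 'e) tensor2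
     \<Rightarrow> ('a, 'e) chart \<Rightarrow> 'e \<Rightarrow> 'e \<Rightarrow> 'e \<Rightarrow> real" where
  "lie_derivative_in_chart M X g c x v w =
     (let gc = tensor_in_chart M g c; Xc = (\<lambda>y. X (chart_inv c y) c) in
      dir_deriv (\<lambda>y. gc y v w) x (Xc x)
        + gc x (dir_deriv Xc x v) w + gc x v (dir_deriv Xc x w))"

definition homothetic ::
  "('a, 'e::euclidean_space) manifold \<Rightarrow> ('a, 'e) tensor2 \<Rightarrow> ('a \<Rightarrow> ('a, 'e) tangent) \<Rightarrow> bool" where
  "homothetic M g \<xi> \<longleftrightarrow>
     (\<forall>c\<in>atlas M. \<forall>x\<in>snd c ` fst c. \<forall>v\<in>span (coords M). \<forall>w\<in>span (coords M).
        lie_derivative_in_chart M \<xi> g c x v w = 2 * tensor_in_chart M g c x v w)"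

definition is_gradient_on ::
  "('a, 'e::euclidean_space) manifold \<Rightarrow> ('a, 'e) tensor2 \<Rightarrow> 'a set \<Rightarrow> ('a \<Rightarrow> real)
     \<Rightarrow> ('a \<Rightarrow> ('a, 'e) tangent) \<Rightarrow> bool" where
  "is_gradient_on M g W f X \<longleftrightarrow>
     (\<forall>q\<in>W. \<forall>V\<in>tangent_space M q. g q (X q) V = differential M f q V)"

definition potential_field ::
  "('a, 'e::euclidean_space) manifold \<Rightarrow> ('a, 'e) tensor2 \<Rightarrow> ('a \<Rightarrow> ('a, 'e) tangent) \<Rightarrow> bool" where
  "potential_field M g X \<longleftrightarrow>
     (\<forall>p\<in>topspace (mtop M). \<exists>W f. openin (mtop M) W \<and> p \<in> W \<and>
        smooth_function_on M W f \<and> is_gradient_on M g W f X)"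


section \<open>Selfsimilar manifolds\<close>

definition selfsimilar_manifold ::
  "('a, 'e::euclidean_space) manifold \<Rightarrow> ('a, 'e) tensor2 \<Rightarrow> ('a \<Rightarrow> ('a, 'e) tangent) \<Rightarrow> bool" where
  "selfsimilar_manifold M g \<xi> \<longleftrightarrow>
     riemannian_manifold M g \<and> vector_field M \<xi> \<and> homothetic M g \<xi>"

definition global_selfsimilar_manifold ::
  "('a, 'e::euclidean_space) manifold \<Rightarrow> ('a, 'e) tensor2 \<Rightarrow> ('a \<Rightarrow> ('a, 'e) tangent) \<Rightarrow> bool" where
  "global_selfsimilar_manifold M g \<xi> \<longleftrightarrow>
     selfsimilar_manifold M g \<xi> \<and> complete_vector_field M \<xi>"

definition isomorphic ::
  "('a, 'e::euclidean_space) manifold \<times> ('a, 'e) tensor2 \<times> ('a \<Rightarrow> ('a, 'e) tangent) \<Rightarrow>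
   ('b, 'f::euclidean_space) manifold \<times> ('b, 'f) tensor2 \<times> ('b \<Rightarrow> ('b, 'f) tangent) \<Rightarrow> bool" where
  "isomorphic = (\<lambda>(M, g, \<xi>) (M', g', \<xi>'). \<exists>F. diffeomorphism M M' F \<and>
     (\<forall>p\<in>topspace (mtop M).
        (\<forall>V\<in>tangent_space M p. \<forall>W\<in>tangent_space M p.
           g' (F p) (tangent_map M M' F p V) (tangent_map M M' F p W) = g p V W) \<and>
        tangent_map M M' F p (\<xi> p) = \<xi>' (F p)))"


section \<open>The two models\<close>

definition euclid :: "'e::euclidean_space set \<Rightarrow> ('e, 'e) manifold" where
  "euclid B = \<lparr>mtop = top_of_set (span B), coords = B, atlas = {(span B, \<lambda>x. x)}\<rparr>"

text \<open>\<open>\<Sum>\<^sub>i (dx\<^sup>i)\<^sup>2\<close> and \<open>\<Sum>\<^sub>i x\<^sup>i \<partial>/\<partial>x\<^sup>i\<close> on \<open>\<real>\<^sup>n\<close>, where \<open>n = card B\<close>.\<close>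

definition euclid_metric :: "'e::euclidean_space set \<Rightarrow> ('e, 'e) tensor2" where
  "euclid_metric B p V W =
     (\<Sum>b\<in>B. differential (euclid B) (\<lambda>x. x \<bullet> b) p V * differential (euclid B) (\<lambda>x. x \<bullet> b) p W)"

definition radiant_field :: "'e::euclidean_space set \<Rightarrow> 'e \<Rightarrow> ('e, 'e) tangent" where
  "radiant_field B p =
     (\<lambda>d. \<Sum>b\<in>B. (p \<bullet> b) *\<^sub>R coord_vector (euclid B) p (span B, \<lambda>x. x) b d)"

definition riemannian_cone ::
  "('a, 'e::euclidean_space) manifold \<Rightarrow> ('a \<times> real, 'e \<times> real) manifold" where
  "riemannian_cone N = \<lparr>mtop = prod_topology (mtop N) (top_of_set {0<..}),
     coords = insert (0, 1) ((\<lambda>b. (b, 0)) ` coords N),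
     atlas = (\<lambda>(U, \<phi>). (U \<times> {0<..}, \<lambda>(x, s). (\<phi> x, s))) ` atlas N\<rparr>"

definition cone_metric ::
  "('a, 'e::euclidean_space) manifold \<Rightarrow> ('a, 'e) tensor2 \<Rightarrow> ('a \<times> real, 'e \<times> real) tensor2" where
  "cone_metric N gN p V W =
     (snd p)\<^sup>2 * gN (fst p) (tangent_map (riemannian_cone N) N fst p V)
                         (tangent_map (riemannian_cone N) N fst p W)
     + differential (riemannian_cone N) snd p V * differential (riemannian_cone N) snd p W"

text \<open>\<open>s \<partial>/\<partial>s\<close>; all charts of the cone share the last coordinate \<open>s\<close>, so \<open>\<partial>/\<partial>s\<close> does not depend
  on the chart.\<close>

definition cone_field ::
  "('a, 'e::euclidean_space) manifold \<Rightarrow> 'a \<times> real \<Rightarrow> ('a \<times> real, 'e \<times> real) tangent" where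
  "cone_field N p = (let C = riemannian_cone N in
     (\<lambda>d. snd p *\<^sub>R coord_vector C p (chart_at C p) (0, 1) d))"

end

theory Submission
  imports Defs
begin

text \<open>The proof follows the function \<open>f = g(\<xi>, \<xi>)\<close>. Because \<open>\<xi>\<close> is locally a gradient and
\<open>L\<^sub>\<xi> g = 2 g\<close>, the differential of \<open>f\<close> is \<open>2 g(\<xi>, _)\<close>, and the flow of \<open>\<xi>\<close> at time \<open>t\<close>
multiplies both \<open>g\<close> (\<open>pb_flow\<close>) and \<open>f\<close> (\<open>f_flow\<close>) by \<open>exp (2 t)\<close>.

Without zeros \<open>f\<close> is positive, so each flow line meets the level set \<open>N = {f = 1}\<close> exactly once.
As \<open>df \<noteq> 0\<close>, this is a hypersurface; sending \<open>p\<close> to its point on \<open>N\<close> and to \<open>s = sqrt (f p)\<close>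
identifies \<open>M\<close> with \<open>N \<times> {s > 0}\<close>. The field \<open>\<xi>\<close> has length \<open>s\<close> and is orthogonal to the level sets, and
the flow carries \<open>N\<close> to the level \<open>s\<close> with the metric scaled by \<open>s\<^sup>2\<close>: this is the cone
(\<open>isomorphic_cone\<close>).

At a zero \<open>p0\<close> the two conditions on \<open>\<xi>\<close> say that its derivative is both symmetric and \<open>g\<close>-adjoint to
\<open>2 - D\<xi>\<close>, so \<open>D\<xi>\<close> is the identity. Hence \<open>f\<close> grows quadratically at \<open>p0\<close>, the backward flow
contracts a neighbourhood to \<open>p0\<close>, and since \<open>f\<close> decreases by a factor, the set of points that flow back
to \<open>p0\<close> is closed as well as open: it is \<open>M\<close> (\<open>basin\<close>). In a chart centred at \<open>p0\<close> the rescaled orbit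
\<open>z(s) = flow (ln s) q / s\<close> solves an equation \<open>z' = Y(s, z)\<close> with \<open>Y\<close> smooth up to \<open>s = 0\<close>, because \<open>\<xi>\<close>
differs from the radial field by a term of second order (\<open>blow_up_field\<close>). So the limit \<open>H q = z(0)\<close>
exists and depends smoothly on \<open>q\<close>. Letting \<open>s\<close> tend to \<open>0\<close> in the scaling law of the metric shows that \<open>H\<close>
pulls the inner product \<open>g\<close> at \<open>p0\<close> back to \<open>g\<close> (\<open>H_linearizes\<close>), and \<open>H (flow t q) = exp t *\<^sub>R H q\<close>. A
linear isometry turns \<open>H\<close> into \<open>\<Phi>\<close>, a local isometry to Euclidean space; by scaling it inherits
injectivity and surjectivity from a neighbourhood of \<open>p0\<close> (\<open>isomorphic_euclid\<close>).

The analysis behind this is developed for functions on open subsets of coordinate subspaces: Taylor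
estimates, the inverse function theorem, and smooth dependence of solutions of differential equations on
parameters. On a manifold, all arguments are about \<open>plots\<close>, smooth maps from such sets into \<open>M\<close>.\<close>

abbreviation (input) open_in :: "'e::euclidean_space set => 'e set => bool" where
 "open_in B == openin (top_of_set (span B))"

abbreviation (input) points :: "('a, 'e) manifold => 'a set" where
 "points M == topspace (mtop M)"

section \<open>Calculus of iterated directional derivatives\<close>

text \<open>Open subsets of \<open>span B\<close>, of translates of it, and sets like \<open>{0..1} \<times> V\<close> with derivatives only in the
second factor are all of this form: near each point, all small steps in the directions \<open>B\<close> stay in the set.\<close>

definition open_along :: "'e::euclidean_space set => 'e set => bool" where
 "open_along B U \<longleftrightarrow>
   (\<exists>S G. U = S Int G & open G & (\<forall>s\<in>S. \<forall>v\<in>span B. s + v \<in> S))"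

lemma open_along_openin:
 assumes "open_in B U"
 shows "open_along B U"
 using assms unfolding open_along_def openin_open by (metis span_add)

lemma open_along_UNIV: "open U ==> open_along B U"
 unfolding open_along_def by auto

lemma open_along_radius:
 assumes "open_along B U" "compact K" "K \<subseteq> U"
 obtains d where "d > 0" "!!p v. p \<in> K ==> v \<in> span B ==> norm v <= d ==> p + v \<in> U"
proof -
 obtain S G where U: "U = S Int G" "open G" "\<forall>s\<in>S. \<forall>v\<in>span B. s + v \<in> S"
  using assms(1) unfolding open_along_def by blast
 obtain e where e: "e > 0" "(\<Union>x\<in>K. cball x e) \<subseteq> G"
  using compact_subset_open_imp_cball_epsilon_subset[of K G] assms U by blast
 show ?thesis
 proof
  fix p v assume "p \<in> K" "v \<in> span B" "norm v <= e"
  then have "p + v \<in> cball p e" by (simp add: dist_norm)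
  then have "p + v \<in> G" using \<open>p \<in> K\<close> e by blast
  then show "p + v \<in> U" using U \<open>p \<in> K\<close> \<open>v \<in> span B\<close> assms by auto
 qed (use e in auto)
qed

lemma open_along_radius_point:
 assumes "open_along B U" "p \<in> U"
 obtains d where "d > 0" "!!v. v \<in> span B ==> norm v <= d ==> p + v \<in> U"
proof -
 obtain d where "d > 0" "!!q v. q \<in> {p} ==> v \<in> span B ==> norm v <= d ==> q + v \<in> U"
  using open_along_radius[of B U "{p}"] assms by (metis compact_sing empty_subsetI insert_subset)
 then show ?thesis using that[of d] by simp
qed

lemma open_along_line:
 assumes "open_along B U" "p \<in> U" "v \<in> span B"
 shows "eventually (%t. p + t *\<^sub>R v \<in> U) (at 0)"
proof -
 obtain d where d: "d > 0" "!!v. v \<in> span B ==> norm v <= d ==> p + v \<in> U"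
  using open_along_radius_point assms by metis
 have "((%t. norm (t *\<^sub>R v)) \<longlongrightarrow> norm (0 *\<^sub>R v)) (at 0)"
  by (intro tendsto_intros)
 then have "eventually (%t. norm (t *\<^sub>R v) < d) (at 0)"
  using d(1) by (intro order_tendstoD) auto
 then show ?thesis
 proof eventually_elim
  case (elim t)
  then show ?case using d(2)[of "t *\<^sub>R v"] assms(3) by (simp add: span_scale less_imp_le)
 qed
qed

lemma dir_deriv_eqI:
 assumes "((%t. f (x + t *\<^sub>R v)) has_vector_derivative d) (at 0)"
 shows "dir_deriv f x v = d"
 unfolding dir_deriv_def using assms by (rule vector_derivative_at)

lemma Ck_on_SucI:
 assumes "continuous_on U f"
  and "!!b x. b \<in> B ==> x \<in> U ==>
      ((%t. f (x + t *\<^sub>R b)) has_vector_derivative dir_deriv f x b) (at 0)"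
  and "!!b. b \<in> B ==> Ck_on k B U (%x. dir_deriv f x b)"
 shows "Ck_on (Suc k) B U f"
 using assms by (auto intro: differentiableI_vector)

lemma Ck_on_dir_deriv:
 assumes "Ck_on (Suc k) B U f" "b \<in> B" "x \<in> U"
 shows "((%t. f (x + t *\<^sub>R b)) has_vector_derivative dir_deriv f x b) (at 0)"
 using assms unfolding dir_deriv_def by (auto simp: vector_derivative_works)

lemma Ck_on_continuous: "Ck_on k B U f ==> continuous_on U f"
 by (cases k) auto

lemma Ck_on_Suc_le: "Ck_on (Suc k) B U f ==> Ck_on k B U f"
 by (induction k arbitrary: f) auto

lemma Ck_on_le: "Ck_on k B U f ==> j <= k ==> Ck_on j B U f"
proof (induction k)
 case (Suc k)
 then show ?case using Ck_on_Suc_le le_Suc_eq by blast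
qed auto

lemma Ck_on_subset: "Ck_on k B U f ==> V \<subseteq> U ==> Ck_on k B V f"
 by (induction k arbitrary: f) (auto intro: continuous_on_subset)

lemma has_vector_derivative_line_cong:
 assumes "open_along B U" "x \<in> U" "v \<in> span B" "!!y. y \<in> U ==> f y = g y"
 shows "((%t. f (x + t *\<^sub>R v)) has_vector_derivative d) (at 0)
   \<longleftrightarrow> ((%t. g (x + t *\<^sub>R v)) has_vector_derivative d) (at 0)"
 by (rule has_vector_derivative_cong_ev)
  (use open_along_line[OF assms(1-3)] assms(2,4) in \<open>auto simp: eventually_nhds_conv_at elim: eventually_mono\<close>)

lemma dir_deriv_cong:
 assumes "open_along B U" "x \<in> U" "v \<in> span B" "!!y. y \<in> U ==> f y = g y"
 shows "dir_deriv f x v = dir_deriv g x v"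
 unfolding dir_deriv_def vector_derivative_def
 using has_vector_derivative_line_cong[OF assms(1-3), of f g] assms(4) by presburger

lemma Ck_on_cong:
 assumes "open_along B U" "!!y. y \<in> U ==> f y = g y" "Ck_on k B U f"
 shows "Ck_on k B U g"
 using assms(2,3)
proof (induction k arbitrary: f g)
 case 0
 then show ?case by (metis Ck_on.simps(1) continuous_on_cong)
next
 case (Suc k)
 show ?case
 proof (rule Ck_on_SucI)
  show "continuous_on U g" using Suc.prems by (metis Ck_on_continuous continuous_on_cong)
  fix b assume b: "b \<in> B"
  have eq: "dir_deriv f x b = dir_deriv g x b" if "x \<in> U" for x
   using dir_deriv_cong[OF assms(1) that] Suc.prems(1) b span_base by metis
  show "((%t. g (x + t *\<^sub>R b)) has_vector_derivative dir_deriv g x b) (at 0)" if "x \<in> U" for x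
   using Ck_on_dir_deriv[OF Suc.prems(2) b that] eq[OF that] b
    has_vector_derivative_line_cong[OF assms(1) that span_base[OF b], of f g] Suc.prems(1) by simp
  show "Ck_on k B U (%x. dir_deriv g x b)"
   by (rule Suc.IH[of "%x. dir_deriv f x b"]) (use Suc.prems(2) eq b in auto)
 qed
qed

lemma Ck_on_SucI':
 assumes "open_along B U" "continuous_on U f"
  and "!!b x. b \<in> B ==> x \<in> U ==> ((%t. f (x + t *\<^sub>R b)) has_vector_derivative f' b x) (at 0)"
  and "!!b. b \<in> B ==> Ck_on k B U (f' b)"
 shows "Ck_on (Suc k) B U f"
proof (rule Ck_on_SucI)
 fix b assume b: "b \<in> B"
 show "((%t. f (x + t *\<^sub>R b)) has_vector_derivative dir_deriv f x b) (at 0)" if "x \<in> U" for x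
  using assms(3)[OF b that] dir_deriv_eqI by metis
 show "Ck_on k B U (%x. dir_deriv f x b)"
  by (rule Ck_on_cong[OF assms(1) _ assms(4)[OF b]]) (metis assms(3) b dir_deriv_eqI)
qed fact

lemma continuous_on_local:
 fixes f :: "'a::metric_space => 'b::metric_space"
 assumes "!!x. x \<in> U ==> \<exists>G. open G & x \<in> G & continuous_on (U Int G) f"
 shows "continuous_on U f"
proof (rule continuous_on_eq_continuous_within[THEN iffD2], rule ballI)
 fix x assume "x \<in> U"
 then obtain G where G: "open G" "x \<in> G" "continuous_on (U Int G) f" using assms by blast
 then have "continuous (at x within (U Int G)) f"
  using \<open>x \<in> U\<close> by (simp add: continuous_on_eq_continuous_within)
 then show "continuous (at x within U) f"
  unfolding continuous_within using at_within_nhd[of x G U "U Int G"] G by (metis Int_assoc Int_absorb Diff_Int_distrib2)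
qed

lemma Ck_on_local:
 assumes "!!x. x \<in> U ==> \<exists>G. open G & x \<in> G & Ck_on k B (U Int G) f"
 shows "Ck_on k B U f"
 using assms
proof (induction k arbitrary: f)
 case 0
 show ?case
  using 0 continuous_on_local by auto
next
 case (Suc k)
 show ?case unfolding Ck_on.simps
 proof (intro conjI ballI)
  show "continuous_on U f"
   using Suc.prems Ck_on_continuous continuous_on_local by meson
  fix b assume b: "b \<in> B"
  show "(%t. f (x + t *\<^sub>R b)) differentiable at 0" if "x \<in> U" for x
   using Suc.prems[OF that] that b by auto
  show "Ck_on k B U (%x. dir_deriv f x b)"
  proof (rule Suc.IH)
   fix x assume "x \<in> U"
   then show "\<exists>G. open G & x \<in> G & Ck_on k B (U Int G) (%x. dir_deriv f x b)"
    using Suc.prems[of x] b by auto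
  qed
 qed
qed

lemma Ck_on_const [simp]: "Ck_on k B U (%x. c)"
proof (induction k arbitrary: c)
 case (Suc k)
 have "dir_deriv (%x. c) x b = 0" for x b :: 'a
  by (rule dir_deriv_eqI) auto
 then show ?case using Suc[of 0] by simp
qed auto

lemma Ck_on_bounded_linear:
 assumes "open_along B U" "bounded_linear f"
 shows "Ck_on k B U f"
proof (cases k)
 case 0
 then show ?thesis using assms by (simp add: linear_continuous_on)
next
 case (Suc j)
 have "((%t. f (x + t *\<^sub>R b)) has_vector_derivative f b) (at 0)" for x b
 proof -
  have "((%t. x + t *\<^sub>R b) has_vector_derivative b) (at 0)"
   by (auto intro!: derivative_eq_intros)
  from bounded_linear.has_vector_derivative[OF assms(2) this] show ?thesis .
 qed
 then show ?thesis
  unfolding Suc by (intro Ck_on_SucI'[where f' = "%b x. f b"])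
   (use assms in \<open>auto simp: linear_continuous_on\<close>)
qed

lemma Ck_on_add:
 assumes "open_along B U" "Ck_on k B U f" "Ck_on k B U g"
 shows "Ck_on k B U (%x. f x + g x)"
 using assms(2,3)
proof (induction k arbitrary: f g)
 case 0
 then show ?case by (auto intro: continuous_intros)
next
 case (Suc k)
 show ?case
 proof (rule Ck_on_SucI'[OF assms(1), where f' = "%b x. dir_deriv f x b + dir_deriv g x b"])
  show "continuous_on U (%x. f x + g x)"
   using Suc.prems by (intro continuous_intros) (auto intro: Ck_on_continuous)
  show "((%t. f (x + t *\<^sub>R b) + g (x + t *\<^sub>R b)) has_vector_derivative
    dir_deriv f x b + dir_deriv g x b) (at 0)" if "b \<in> B" "x \<in> U" for b x
   using Suc.prems that Ck_on_dir_deriv by (intro has_vector_derivative_add) blast+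
 qed (use Suc in auto)
qed

lemma Ck_on_bilinear:
 fixes f :: "'e::euclidean_space => 'a::real_normed_vector"
  and g :: "'e => 'b::real_normed_vector" and h :: "'a => 'b => 'c::real_normed_vector"
 assumes "bounded_bilinear h" "open_along B U" "Ck_on k B U f" "Ck_on k B U g"
 shows "Ck_on k B U (%x. h (f x) (g x))"
 using assms(3,4)
proof (induction k arbitrary: f g)
 case 0
 then show ?case by (auto intro: bounded_bilinear.continuous_on[OF assms(1)])
next
 case (Suc k)
 show ?case
 proof (rule Ck_on_SucI'[OF assms(2), where f' = "%b x. h (f x) (dir_deriv g x b) + h (dir_deriv f x b) (g x)"])
  show "continuous_on U (%x. h (f x) (g x))"
   using Suc.prems by (intro bounded_bilinear.continuous_on[OF assms(1)]) (auto intro: Ck_on_continuous)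
  fix b assume b: "b \<in> B"
  show "Ck_on k B U (%x. h (f x) (dir_deriv g x b) + h (dir_deriv f x b) (g x))"
   using Suc.prems b
   by (intro Ck_on_add[OF assms(2)] Suc.IH) (auto intro: Ck_on_Suc_le)
  fix x assume x: "x \<in> U"
  show "((%t. h (f (x + t *\<^sub>R b)) (g (x + t *\<^sub>R b))) has_vector_derivative
      h (f x) (dir_deriv g x b) + h (dir_deriv f x b) (g x)) (at 0)"
   using bounded_bilinear.has_vector_derivative[OF assms(1)
     Ck_on_dir_deriv[OF Suc.prems(1) b x] Ck_on_dir_deriv[OF Suc.prems(2) b x]]
   by simp
 qed
qed

lemma Ck_on_sum:
 assumes "open_along B U" "!!i. i \<in> I ==> Ck_on k B U (f i)"
 shows "Ck_on k B U (%x. \<Sum>i\<in>I. f i x)"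
 using assms(2)
proof (induction I rule: infinite_finite_induct)
 case (insert i I)
 then show ?case by (auto intro: Ck_on_add[OF assms(1)])
qed auto

lemma vector_derivative_bound:
 fixes f :: "real => 'f::real_normed_vector"
 assumes "convex S" "!!t. t \<in> S ==> (f has_vector_derivative f' t) (at t within S)"
  and "!!t. t \<in> S ==> norm (f' t) <= C" "a \<in> S" "b \<in> S"
 shows "norm (f b - f a) <= C * \<bar>b - a\<bar>"
proof -
 have "norm (f b - f a) <= C * norm (b - a)"
 proof (rule differentiable_bound[OF assms(1)])
  show "(f has_derivative (%h. h *\<^sub>R f' t)) (at t within S)" if "t \<in> S" for t
   using assms(2)[OF that] by (simp add: has_vector_derivative_def)
  show "onorm (%h. h *\<^sub>R f' t) <= C" if "t \<in> S" for t
   using assms(3)[OF that] norm_ge_zero[of "f' t"]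
   by (intro onorm_bound) (auto simp: mult.commute[of C] mult_left_mono simp del: norm_ge_zero intro: order_trans)
 qed (use assms in auto)
 then show ?thesis by simp
qed

text \<open>Derivatives along a line are by definition taken at parameter \<open>0\<close>; this moves them to other parameters.\<close>

lemma shift_line_derivative:
 fixes f :: "'a::real_normed_vector => 'b::real_normed_vector"
 assumes "((%t. f ((q + s *\<^sub>R b) + t *\<^sub>R b)) has_vector_derivative d) (at 0)"
 shows "((%t. f (q + t *\<^sub>R b)) has_vector_derivative d) (at s)"
proof -
 have "((%t. t - s) has_real_derivative 1) (at s)" by (auto intro!: derivative_eq_intros)
 then have "((%t. t - s) has_vector_derivative 1) (at s)"
  by (simp add: has_real_derivative_iff_has_vector_derivative)
 from vector_diff_chain_at[OF this, of "%t. f ((q + s *\<^sub>R b) + t *\<^sub>R b)" d] assms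
 have "((%x. f (q + s *\<^sub>R b + (x - s) *\<^sub>R b)) has_vector_derivative d) (at s)"
  by (simp add: o_def)
 moreover have "q + s *\<^sub>R b + (x - s) *\<^sub>R b = q + x *\<^sub>R b" for x
  by (simp add: scaleR_left_diff_distrib)
 ultimately show ?thesis by simp
qed

lemma sum_Basis_inner: 
 assumes "B \<subseteq> Basis" "v \<in> span B"
 shows "(\<Sum>b\<in>B. (v \<bullet> b) *\<^sub>R b) = v"
proof -
 have *: "v \<bullet> c = 0" if "c \<in> Basis" "c \<notin> B" for c
  using assms(2)
 proof (induction rule: span_induct)
  case base
  show ?case by (auto simp: subspace_def inner_left_distrib)
 next
  case (step x)
  then show ?case using that assms(1) inner_Basis by (metis subset_iff)
 qed
 have "(\<Sum>b\<in>B. (v \<bullet> b) *\<^sub>R b) = (\<Sum>b\<in>Basis. (v \<bullet> b) *\<^sub>R b)"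
  by (rule sum.mono_neutral_left) (use assms * in auto)
 then show ?thesis by (simp add: euclidean_representation)
qed

lemma sum_inner_in_span:
 "A \<subseteq> B ==> (\<Sum>b\<in>A. (v \<bullet> b) *\<^sub>R b) \<in> span B"
 by (intro span_sum span_scale) (auto intro: span_base)

lemma norm_sum_inner_le:
 fixes v :: "'e::euclidean_space"
 assumes "A \<subseteq> Basis"
 shows "norm (\<Sum>b\<in>A. (v \<bullet> b) *\<^sub>R b) <= real DIM('e) * norm v"
proof -
 have "norm (\<Sum>b\<in>A. (v \<bullet> b) *\<^sub>R b) <= (\<Sum>b\<in>A. norm v)"
  by (rule sum_norm_le) (use assms in \<open>auto simp: Basis_le_norm norm_Basis subset_iff\<close>)
 also have "... <= real DIM('e) * norm v"
  using assms by (simp add: card_mono mult_right_mono)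
 finally show ?thesis .
qed

lemma finite_Basis_subset: "B \<subseteq> (Basis :: 'e::euclidean_space set) ==> finite B"
 using finite_subset finite_Basis by blast

text \<open>Partial derivatives are continuous, so a step is decomposed into steps along the coordinate axes and the
mean value inequality applies to each; compactness makes the radius uniform.\<close>

lemma uniform_taylor:
 fixes f :: "'e::euclidean_space => 'f::real_normed_vector"
 assumes B: "B \<subseteq> Basis" and U: "open_along B U" and f: "Ck_on 1 B U f"
  and K: "compact K" "K \<subseteq> U" and e: "e > 0"
 obtains d where "d > 0"
  "!!p v. p \<in> K ==> v \<in> span B ==> norm v <= d ==> p + v \<in> U &
    norm (f (p + v) - f p - (\<Sum>b\<in>B. (v \<bullet> b) *\<^sub>R dir_deriv f p b)) <= e * norm v"
proof -
 have fB: "finite B" using B finite_Basis_subset by blast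
 obtain r where r: "r > 0" "!!p v. p \<in> K ==> v \<in> span B ==> norm v <= r ==> p + v \<in> U"
  using open_along_radius[OF U K] by metis
 define K' where "K' = (%(p, v). p + v) ` (K \<times> (span B Int cball 0 r))"
 have "compact K'"
  unfolding K'_def
  by (intro compact_continuous_image compact_Times K closed_Int_compact closed_span compact_cball)
   (auto intro!: continuous_intros simp: case_prod_unfold)
 have K'U: "K' \<subseteq> U" unfolding K'_def using r by auto
 define N where "N = real DIM('e)"
 have N: "N \<ge> 1" unfolding N_def using DIM_positive[where 'a='e] by linarith
 define e' where "e' = e / N"
 have e': "e' > 0" unfolding e'_def using e N by simp
 have unif: "\<exists>d>0. \<forall>x\<in>K'. \<forall>y\<in>K'. dist y x < d --> dist (dir_deriv f y b) (dir_deriv f x b) < e'"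
  if "b \<in> B" for b
 proof -
  have "continuous_on U (%x. dir_deriv f x b)" using f that by simp
  then have "uniformly_continuous_on K' (%x. dir_deriv f x b)"
   using K'U \<open>compact K'\<close> compact_uniformly_continuous continuous_on_subset by blast
  then show ?thesis unfolding uniformly_continuous_on_def using e' by blast
 qed
 then obtain d where d: "!!b. b \<in> B ==> d b > 0"
  "!!b x y. b \<in> B ==> x \<in> K' ==> y \<in> K' ==> dist y x < d b ==> dist (dir_deriv f y b) (dir_deriv f x b) < e'"
  by metis
 define d0 where "d0 = Min (insert r (d ` B)) / (2 * N)"
 have m: "Min (insert r (d ` B)) > 0" using fB d(1) r(1) by (subst Min_gr_iff) auto
 have d0: "d0 > 0" unfolding d0_def using N m by simp
 have le: "N * d0 <= r" "b \<in> B ==> N * d0 < d b" for b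
 proof -
  have "N * d0 = Min (insert r (d ` B)) / 2" unfolding d0_def using N by simp
  moreover have "Min (insert r (d ` B)) <= r" "b \<in> B ==> Min (insert r (d ` B)) <= d b" using fB by auto
  ultimately show "N * d0 <= r" "b \<in> B ==> N * d0 < d b" using m d(1) by force+
 qed
 show ?thesis
 proof
  show "d0 > 0" by fact
  fix p v assume p: "p \<in> K" and v: "v \<in> span B" "norm v <= d0"
  define P where "P A = (\<Sum>b\<in>A. (v \<bullet> b) *\<^sub>R b)" for A
  have small: "norm w <= N * d0" if "A \<subseteq> B" "norm w <= norm (P A)" for A w
  proof -
   have "norm (P A) <= N * norm v" unfolding P_def N_def using norm_sum_inner_le that B by blast
   then show ?thesis using that v N mult_left_mono[of "norm v" d0 N] by linarith
  qed
  have inK': "p + w \<in> K'" if "w \<in> span B" "norm w <= N * d0" for w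
   unfolding K'_def using p that le(1) by force
  have step: "norm (f (p + P A) - f p - (\<Sum>b\<in>A. (v \<bullet> b) *\<^sub>R dir_deriv f p b)) <= (\<Sum>b\<in>A. e' * norm v)"
   if "A \<subseteq> B" for A
   using finite_subset[OF that fB] that
  proof (induction A rule: finite_induct)
   case empty
   then show ?case by (simp add: P_def)
  next
   case (insert b A)
   then have b: "b \<in> B" "A \<subseteq> B" by auto
   define q where "q = p + P A"
   have seg: "q + t *\<^sub>R b \<in> K'" "dist (q + t *\<^sub>R b) p < d b" if "t \<in> closed_segment 0 (v \<bullet> b)" for t
   proof -
    have abs_t: "\<bar>t\<bar> <= \<bar>v \<bullet> b\<bar>" using that by (auto simp: closed_segment_eq_real_ivl split: if_splits)
    have bb: "b \<in> Basis" using b B by auto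
    have orth: "P A \<bullet> b = 0"
     unfolding P_def inner_sum_left using insert b B
     by (intro sum.neutral) (auto simp: inner_Basis subset_iff)
    have Pins: "P (insert b A) = P A + (v \<bullet> b) *\<^sub>R b" unfolding P_def using insert by simp
    have "norm (P A + t *\<^sub>R b)^2 <= norm (P (insert b A))^2"
     unfolding Pins power2_norm_eq_inner using orth bb abs_t
     by (simp add: inner_left_distrib inner_right_distrib inner_commute flip: power2_eq_square)
       (simp add: abs_le_square_iff)
    then have n: "norm (P A + t *\<^sub>R b) <= norm (P (insert b A))"
     by (simp add: power2_le_iff_abs_le)
    have sp: "P A + t *\<^sub>R b \<in> span B"
     unfolding P_def using b by (intro span_add sum_inner_in_span span_scale span_base) auto
    have nn: "norm (P A + t *\<^sub>R b) <= N * d0" using small[OF insert.prems n] .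
    show "q + t *\<^sub>R b \<in> K'" using inK'[OF sp nn] by (simp add: q_def add.assoc)
    show "dist (q + t *\<^sub>R b) p < d b" using nn le(2)[OF b(1)] by (simp add: q_def dist_norm add.assoc)
   qed
   have pK': "p \<in> K'" using inK'[of 0] N d0 by (simp add: span_zero)
   define D where "D = dir_deriv f p b"
   have "norm ((f (q + (v \<bullet> b) *\<^sub>R b) - (v \<bullet> b) *\<^sub>R D) - (f (q + 0 *\<^sub>R b) - 0 *\<^sub>R D)) <= e' * \<bar>v \<bullet> b - 0\<bar>"
   proof (rule vector_derivative_bound[where S = "closed_segment 0 (v \<bullet> b)" and f' = "%t. dir_deriv f (q + t *\<^sub>R b) b - D"])
    fix t assume t: "t \<in> closed_segment 0 (v \<bullet> b)"
    have "q + t *\<^sub>R b \<in> U" using seg(1)[OF t] K'U by auto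
    then have "((%s. f ((q + t *\<^sub>R b) + s *\<^sub>R b)) has_vector_derivative dir_deriv f (q + t *\<^sub>R b) b) (at 0)"
     using Ck_on_dir_deriv[of 0 B U f b] f b by simp
    then have "((%t. f (q + t *\<^sub>R b)) has_vector_derivative dir_deriv f (q + t *\<^sub>R b) b) (at t within closed_segment 0 (v \<bullet> b))"
     using shift_line_derivative has_vector_derivative_at_within by blast
    then show "((%t. f (q + t *\<^sub>R b) - t *\<^sub>R D) has_vector_derivative dir_deriv f (q + t *\<^sub>R b) b - D) (at t within closed_segment 0 (v \<bullet> b))"
     using has_vector_derivative_scaleR[OF DERIV_ident has_vector_derivative_const[of D]]
     by (auto intro!: has_vector_derivative_diff)
    show "norm (dir_deriv f (q + t *\<^sub>R b) b - D) <= e'"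
     using d(2)[OF b(1) pK' seg(1)[OF t] seg(2)[OF t]] by (simp add: dist_norm D_def)
   qed auto
   moreover have "\<bar>v \<bullet> b\<bar> * e' <= e' * norm v"
    using e' Basis_le_norm[of b v] b B by (auto simp: mult.commute)
   ultimately have 1: "norm (f (q + (v \<bullet> b) *\<^sub>R b) - f q - (v \<bullet> b) *\<^sub>R dir_deriv f p b) <= e' * norm v"
    by (simp add: D_def algebra_simps)
   have 2: "norm (f q - f p - (\<Sum>b\<in>A. (v \<bullet> b) *\<^sub>R dir_deriv f p b)) <= (\<Sum>b\<in>A. e' * norm v)"
    using insert b unfolding q_def by auto
   have "p + P (insert b A) = q + (v \<bullet> b) *\<^sub>R b" unfolding P_def q_def using insert by simp
   then have "f (p + P (insert b A)) - f p - (\<Sum>b\<in>insert b A. (v \<bullet> b) *\<^sub>R dir_deriv f p b)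
     = (f (q + (v \<bullet> b) *\<^sub>R b) - f q - (v \<bullet> b) *\<^sub>R dir_deriv f p b) + (f q - f p - (\<Sum>b\<in>A. (v \<bullet> b) *\<^sub>R dir_deriv f p b))"
    using insert by simp
   then show ?case using 1 2 insert norm_triangle_mono[OF 1 2] by (simp add: algebra_simps)
  qed
  have "P B = v" unfolding P_def using sum_Basis_inner B v by blast
  have "(\<Sum>b\<in>B. e' * norm v) <= N * (e' * norm v)"
   using B e' by (simp add: N_def card_mono mult_right_mono)
  then have "(\<Sum>b\<in>B. e' * norm v) <= e * norm v" using N by (simp add: e'_def)
  moreover have "norm v <= r" 
  proof -
   have "d0 <= N * d0" using N d0 by simp
   then show ?thesis using v le(1) by linarith
  qed
  ultimately show "p + v \<in> U & norm (f (p + v) - f p - (\<Sum>b\<in>B. (v \<bullet> b) *\<^sub>R dir_deriv f p b)) <= e * norm v"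
   using step[of B] r(2)[OF p v(1)] unfolding \<open>P B = v\<close> by auto
 qed
qed

section \<open>Chain rule and composition\<close>

lemma C1_has_derivative:
 fixes f :: "'e::euclidean_space => 'f::real_normed_vector"
 assumes "B \<subseteq> Basis" "open_along B U" "Ck_on 1 B U f" "p \<in> U"
 shows "((%v. f (p + v)) has_derivative (%v. \<Sum>b\<in>B. (v \<bullet> b) *\<^sub>R dir_deriv f p b)) (at 0 within span B)"
 unfolding has_derivative_within_alt
proof (intro conjI allI impI)
 show "bounded_linear (%v. \<Sum>b\<in>B. (v \<bullet> b) *\<^sub>R dir_deriv f p b)"
  by (intro bounded_linear_sum bounded_linear_scaleR_const bounded_linear_inner_left)
 fix e :: real assume "0 < e"
 obtain d where d: "d > 0" "!!q v. q \<in> {p} ==> v \<in> span B ==> norm v <= d ==> q + v \<in> U &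
    norm (f (q + v) - f q - (\<Sum>b\<in>B. (v \<bullet> b) *\<^sub>R dir_deriv f q b)) <= e * norm v"
  using uniform_taylor[OF assms(1-3), of "{p}" e] assms(4) \<open>0 < e\<close> by auto
 show "\<exists>d>0. \<forall>y\<in>span B. norm (y - 0) < d -->
   norm (f (p + y) - f (p + 0) - (\<Sum>b\<in>B. ((y - 0) \<bullet> b) *\<^sub>R dir_deriv f p b)) <= e * norm (y - 0)"
  using d by (intro exI[of _ d]) auto
qed

lemma C1_chain_curve:
 fixes f :: "'e::euclidean_space => 'f::real_normed_vector"
 assumes "B \<subseteq> Basis" "open_along B U" "Ck_on 1 B U f" "z t \<in> U"
  and "(z has_vector_derivative z') (at t within T)"
  and "!!s. s \<in> T ==> z s - z t \<in> span B"
 shows "((%s. f (z s)) has_vector_derivative (\<Sum>b\<in>B. (z' \<bullet> b) *\<^sub>R dir_deriv f (z t) b)) (at t within T)"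
proof -
 have "((%s. z s - z t) has_derivative (%h. h *\<^sub>R z')) (at t within T)"
  using assms(5) unfolding has_vector_derivative_def by (auto intro!: derivative_eq_intros)
 moreover have "((%v. f (z t + v)) has_derivative (%v. \<Sum>b\<in>B. (v \<bullet> b) *\<^sub>R dir_deriv f (z t) b))
   (at (z t - z t) within (%s. z s - z t) ` T)"
  unfolding diff_self
  by (rule has_derivative_subset[OF C1_has_derivative[OF assms(1-4)]]) (use assms(6) in auto)
 ultimately have "((%s. f (z t + (z s - z t))) has_derivative
   (%h. \<Sum>b\<in>B. ((h *\<^sub>R z') \<bullet> b) *\<^sub>R dir_deriv f (z t) b)) (at t within T)"
  by (rule has_derivative_in_compose)
 then show ?thesis
  by (simp add: has_vector_derivative_def scaleR_sum_right)
qed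

lemma C1_dir_deriv:
 fixes f :: "'e::euclidean_space => 'f::real_normed_vector"
 assumes "B \<subseteq> Basis" "open_along B U" "Ck_on 1 B U f" "p \<in> U" "v \<in> span B"
 shows "((%t. f (p + t *\<^sub>R v)) has_vector_derivative dir_deriv f p v) (at 0)"
  and "dir_deriv f p v = (\<Sum>b\<in>B. (v \<bullet> b) *\<^sub>R dir_deriv f p b)"
proof -
 have "((%t. p + t *\<^sub>R v) has_vector_derivative v) (at 0 within UNIV)"
  by (auto intro!: derivative_eq_intros)
 then have *: "((%t. f (p + t *\<^sub>R v)) has_vector_derivative (\<Sum>b\<in>B. (v \<bullet> b) *\<^sub>R dir_deriv f p b)) (at 0)"
  using C1_chain_curve[OF assms(1-3), of "%t. p + t *\<^sub>R v" 0 v UNIV] assms(4) span_scale[OF assms(5)] by simp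
 then show "dir_deriv f p v = (\<Sum>b\<in>B. (v \<bullet> b) *\<^sub>R dir_deriv f p b)" by (rule dir_deriv_eqI)
 then show "((%t. f (p + t *\<^sub>R v)) has_vector_derivative dir_deriv f p v) (at 0)" using * by simp
qed

lemma C1_chain:
 fixes f :: "'e::euclidean_space => 'f::real_normed_vector"
 assumes "B \<subseteq> Basis" "open_along B U" "Ck_on 1 B U f" "z t \<in> U"
  and "(z has_vector_derivative z') (at t within T)"
  and "!!s. s \<in> T ==> z s - z t \<in> span B" "z' \<in> span B"
 shows "((%s. f (z s)) has_vector_derivative dir_deriv f (z t) z') (at t within T)"
 using C1_chain_curve[OF assms(1-6)] C1_dir_deriv(2)[OF assms(1-4,7)] by simp

lemma in_span_iff_inner:
 assumes "C \<subseteq> Basis"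
 shows "v \<in> span C \<longleftrightarrow> (\<forall>c\<in>Basis - C. v \<bullet> c = 0)"
proof
 assume "v \<in> span C"
 then have v: "v = (\<Sum>b\<in>C. (v \<bullet> b) *\<^sub>R b)" using sum_Basis_inner[OF assms] by simp
 show "\<forall>c\<in>Basis - C. v \<bullet> c = 0"
  by (subst v) (use assms in \<open>auto simp: inner_sum_left inner_Basis subset_iff intro!: sum.neutral\<close>)
next
 assume *: "\<forall>c\<in>Basis - C. v \<bullet> c = 0"
 have "(\<Sum>b\<in>C. (v \<bullet> b) *\<^sub>R b) = (\<Sum>b\<in>Basis. (v \<bullet> b) *\<^sub>R b)"
  by (rule sum.mono_neutral_left) (use assms * in auto)
 then show "v \<in> span C" using sum_inner_in_span[of C C v] by (simp add: euclidean_representation)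
qed

lemma vector_derivative_in_span:
 fixes z :: "real => 'e::euclidean_space"
 assumes "C \<subseteq> Basis" "(z has_vector_derivative z') (at t)"
  and "eventually (%s. z s - z t \<in> span C) (at t)"
 shows "z' \<in> span C"
 unfolding in_span_iff_inner[OF assms(1)]
proof
 fix c assume c: "c \<in> Basis - C"
 have "((%s. z s \<bullet> c) has_vector_derivative z' \<bullet> c) (at t)"
  using bounded_linear.has_vector_derivative[OF bounded_linear_inner_left assms(2)] .
 moreover have "((%s. z s \<bullet> c) has_vector_derivative z' \<bullet> c) (at t) \<longleftrightarrow>
   ((%s. z t \<bullet> c) has_vector_derivative z' \<bullet> c) (at t)"
  using assms(3) c
  by (intro has_vector_derivative_cong_ev)
   (auto simp: eventually_nhds_conv_at in_span_iff_inner[OF assms(1)] inner_diff_left elim: eventually_mono)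
 ultimately have "((%s. z t \<bullet> c) has_vector_derivative z' \<bullet> c) (at t)" by simp
 then show "z' \<bullet> c = 0"
  using vector_derivative_unique_at[OF _ has_vector_derivative_const] by blast
qed

lemma dir_deriv_in_span:
 fixes f :: "'e::euclidean_space => 'f::euclidean_space"
 assumes "C \<subseteq> Basis" "open_along B U" "x \<in> U" "v \<in> span B"
  and "((%t. f (x + t *\<^sub>R v)) has_vector_derivative dir_deriv f x v) (at 0)"
  and "!!w. w \<in> span B ==> x + w \<in> U ==> f (x + w) - f x \<in> span C"
 shows "dir_deriv f x v \<in> span C"
proof (rule vector_derivative_in_span[OF assms(1,5)])
 show "\<forall>\<^sub>F s in at 0. f (x + s *\<^sub>R v) - f (x + 0 *\<^sub>R v) \<in> span C"
  using open_along_line[OF assms(2-4)]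
  by eventually_elim (use assms(4,6) span_scale in auto)
qed

lemma Ck_on_compose:
 fixes f :: "'e::euclidean_space => 'f::euclidean_space" and g :: "'f => 'h::real_normed_vector"
 assumes "B \<subseteq> Basis" "C \<subseteq> Basis" "open_along B U" "open_along C W"
  and "!!x. x \<in> U ==> f x \<in> W"
  and "!!x v. x \<in> U ==> v \<in> span B ==> x + v \<in> U ==> f (x + v) - f x \<in> span C"
  and "Ck_on k B U f" "Ck_on k C W g"
 shows "Ck_on k B U (%x. g (f x))"
 using assms(7,8)
proof (induction k arbitrary: g)
 case 0
 have "continuous_on (f ` U) g" using 0 assms(5) continuous_on_subset by (metis Ck_on.simps(1) image_subsetI)
 then show ?case using 0 by (auto intro: continuous_on_compose2)
next
 case (Suc k)
 have g1: "Ck_on 1 C W g" and f0: "Ck_on k B U f" and f1: "Ck_on 1 B U f"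
  using Ck_on_le[OF Suc.prems(2), of 1] Ck_on_le[OF Suc.prems(1), of 1] Ck_on_Suc_le[OF Suc.prems(1)]
  by simp_all
 show ?case
 proof (rule Ck_on_SucI'[OF assms(3), where f' = "%b x. \<Sum>c\<in>C. (dir_deriv f x b \<bullet> c) *\<^sub>R dir_deriv g (f x) c"])
  have "continuous_on (f ` U) g"
   using Suc.prems(2) Ck_on_continuous assms(5) continuous_on_subset by (metis image_subsetI)
  then show "continuous_on U (%x. g (f x))"
   using Ck_on_continuous[OF f0] by (auto intro: continuous_on_compose2)
  fix b assume b: "b \<in> B"
  show "Ck_on k B U (%x. \<Sum>c\<in>C. (dir_deriv f x b \<bullet> c) *\<^sub>R dir_deriv g (f x) c)"
  proof (rule Ck_on_sum[OF assms(3)])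
   fix c assume c: "c \<in> C"
   have "Ck_on k B U (%x. dir_deriv f x b \<bullet> c)"
    using Suc.prems b by (intro Ck_on_bilinear[OF bounded_bilinear_inner assms(3)]) auto
   moreover have "Ck_on k B U (%x. dir_deriv g (f x) c)"
    using Suc.IH[OF f0, of "%y. dir_deriv g y c"] Suc.prems(2) c by simp
   ultimately show "Ck_on k B U (%x. (dir_deriv f x b \<bullet> c) *\<^sub>R dir_deriv g (f x) c)"
    by (rule Ck_on_bilinear[OF bounded_bilinear_scaleR assms(3)])
  qed
  fix x assume x: "x \<in> U"
  obtain d where d: "d > 0" "!!v. v \<in> span B ==> norm v <= d ==> x + v \<in> U"
   using open_along_radius_point[OF assms(3) x] by metis
  have bs: "b \<in> span B" using b by (rule span_base)
  have nb: "norm b = 1" using b assms(1) by auto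
  let ?T = "{-d<..<d}"
  have D: "((%t. f (x + t *\<^sub>R b)) has_vector_derivative dir_deriv f x b) (at 0)"
   using Ck_on_dir_deriv[OF Suc.prems(1) b x] .
  have in_U: "x + t *\<^sub>R b \<in> U" if "t \<in> ?T" for t
   using that nb by (intro d span_scale bs) auto
  have "((%t. g (f (x + t *\<^sub>R b))) has_vector_derivative
    (\<Sum>c\<in>C. (dir_deriv f x b \<bullet> c) *\<^sub>R dir_deriv g (f (x + 0 *\<^sub>R b)) c)) (at 0 within ?T)"
  proof (intro C1_chain_curve[OF assms(2,4) g1] has_vector_derivative_at_within[OF D])
   show "f (x + t *\<^sub>R b) - f (x + 0 *\<^sub>R b) \<in> span C" if "t \<in> ?T" for t
    using assms(6)[OF x span_scale[OF bs] in_U[OF that]] by simp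
  qed (use assms(5) x in auto)
  then show "((%t. g (f (x + t *\<^sub>R b))) has_vector_derivative
    (\<Sum>c\<in>C. (dir_deriv f x b \<bullet> c) *\<^sub>R dir_deriv g (f x) c)) (at 0)"
   using at_within_open[of 0 ?T] d(1) by simp
 qed
qed

lemma Ck_on_linear_compose:
 assumes "open_along B U" "bounded_linear h" "Ck_on k B U f"
 shows "Ck_on k B U (%x. h (f x))"
 using assms(3)
proof (induction k arbitrary: f)
 case 0
 then show ?case by (auto intro: bounded_linear.continuous_on[OF assms(2)])
next
 case (Suc k)
 show ?case
 proof (rule Ck_on_SucI'[OF assms(1), where f' = "%b x. h (dir_deriv f x b)"])
  show "continuous_on U (%x. h (f x))"
   using Suc.prems by (intro bounded_linear.continuous_on[OF assms(2)]) (auto intro: Ck_on_continuous)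
  show "((%t. h (f (x + t *\<^sub>R b))) has_vector_derivative h (dir_deriv f x b)) (at 0)"
   if "b \<in> B" "x \<in> U" for b x
   using bounded_linear.has_vector_derivative[OF assms(2) Ck_on_dir_deriv[OF Suc.prems that]] .
 qed (use Suc in auto)
qed

lemma Ck_on_Pair:
 assumes "open_along B U" "Ck_on k B U f" "Ck_on k B U g"
 shows "Ck_on k B U (%x. (f x, g x))"
proof -
 have "Ck_on k B U (%x. (f x, 0) + (0, g x))"
  using assms by (intro Ck_on_add Ck_on_linear_compose[of _ _ "%y. (y, 0)"] Ck_on_linear_compose[of _ _ "%y. (0, y)"])
   (auto intro: bounded_linear_Pair bounded_linear_ident bounded_linear_zero)
 then show ?thesis by simp
qed

lemma Ck_on_inverse:
 fixes f :: "'e::euclidean_space => real"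
 assumes "open_along B U" "!!x. x \<in> U ==> f x ~= 0" "Ck_on k B U f"
 shows "Ck_on k B U (%x. inverse (f x))"
 using assms(3)
proof (induction k)
 case 0
 then show ?case using assms(2) by (auto intro!: continuous_intros)
next
 case (Suc k)
 have f0: "Ck_on k B U f" using Suc.prems by (rule Ck_on_Suc_le)
 note inv = Suc.IH[OF f0]
 show ?case
 proof (rule Ck_on_SucI'[OF assms(1), where f' = "%b x. - 1 * (inverse (f x) * (dir_deriv f x b * inverse (f x)))"])
  show "continuous_on U (%x. inverse (f x))" using inv by (rule Ck_on_continuous)
  show "Ck_on k B U (%x. - 1 * (inverse (f x) * (dir_deriv f x b * inverse (f x))))" if "b \<in> B" for b
   using inv Suc.prems that
   by (intro Ck_on_bilinear[OF bounded_bilinear_mult assms(1)] Ck_on_const) auto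
  fix b x assume b: "b \<in> B" and x: "x \<in> U"
  have "((%t. f (x + t *\<^sub>R b)) has_real_derivative dir_deriv f x b) (at 0)"
   using Ck_on_dir_deriv[OF Suc.prems b x] by (simp add: has_real_derivative_iff_has_vector_derivative)
  then have "((%t. inverse (f (x + t *\<^sub>R b))) has_real_derivative - 1 * (inverse (f x) * (dir_deriv f x b * inverse (f x)))) (at 0)"
   using assms(2)[OF x] by (auto intro!: derivative_eq_intros)
  then show "((%t. inverse (f (x + t *\<^sub>R b))) has_vector_derivative - 1 * (inverse (f x) * (dir_deriv f x b * inverse (f x)))) (at 0)"
   by (simp add: has_real_derivative_iff_has_vector_derivative)
 qed
qed

lemma Ck_on_sqrt:
 fixes f :: "'e::euclidean_space => real"
 assumes "open_along B U" "!!x. x \<in> U ==> f x > 0" "Ck_on k B U f"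
 shows "Ck_on k B U (%x. sqrt (f x))"
 using assms(3)
proof (induction k)
 case 0
 then show ?case by (auto intro!: continuous_intros)
next
 case (Suc k)
 have f0: "Ck_on k B U f" using Suc.prems by (rule Ck_on_Suc_le)
 note inv = Suc.IH[OF f0]
 show ?case
 proof (rule Ck_on_SucI'[OF assms(1), where f' = "%b x. dir_deriv f x b * (inverse (sqrt (f x)) * (1/2))"])
  show "continuous_on U (%x. sqrt (f x))" using inv by (rule Ck_on_continuous)
  show "Ck_on k B U (%x. dir_deriv f x b * (inverse (sqrt (f x)) * (1/2)))" if "b \<in> B" for b
   using inv Suc.prems that assms(2)
   by (intro Ck_on_bilinear[OF bounded_bilinear_mult assms(1)] Ck_on_inverse assms(1) Ck_on_const) force+
  fix b x assume b: "b \<in> B" and x: "x \<in> U"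
  have "((%t. f (x + t *\<^sub>R b)) has_real_derivative dir_deriv f x b) (at 0)"
   using Ck_on_dir_deriv[OF Suc.prems b x] by (simp add: has_real_derivative_iff_has_vector_derivative)
  then have "((%t. sqrt (f (x + t *\<^sub>R b))) has_real_derivative dir_deriv f x b * (inverse (sqrt (f x)) * (1/2))) (at 0)"
   using assms(2)[OF x] by (auto intro!: derivative_eq_intros simp: field_simps)
  then show "((%t. sqrt (f (x + t *\<^sub>R b))) has_vector_derivative dir_deriv f x b * (inverse (sqrt (f x)) * (1/2))) (at 0)"
   by (simp add: has_real_derivative_iff_has_vector_derivative)
 qed
qed

lemma Ck_on_ln:
 fixes f :: "'e::euclidean_space => real"
 assumes "open_along B U" "!!x. x \<in> U ==> f x > 0" "Ck_on k B U f"
 shows "Ck_on k B U (%x. ln (f x))"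
proof (cases k)
 case 0
 have "f x ~= 0" if "x \<in> U" for x using assms(2)[OF that] by simp
 then show ?thesis using assms 0 by (auto intro!: continuous_intros)
next
 case (Suc j)
 have f0: "Ck_on j B U f" using assms(3) unfolding Suc by (rule Ck_on_Suc_le)
 have nz: "f x ~= 0" if "x \<in> U" for x using assms(2)[OF that] by simp
 show ?thesis unfolding Suc
 proof (rule Ck_on_SucI'[OF assms(1), where f' = "%b x. dir_deriv f x b * inverse (f x)"])
  show "continuous_on U (%x. ln (f x))"
   using nz Ck_on_continuous[OF f0] by (auto intro!: continuous_intros)
  show "Ck_on j B U (%x. dir_deriv f x b * inverse (f x))" if "b \<in> B" for b
   using f0 assms that Suc nz
   by (intro Ck_on_bilinear[OF bounded_bilinear_mult assms(1)] Ck_on_inverse assms(1)) auto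
  fix b x assume b: "b \<in> B" and x: "x \<in> U"
  have "((%t. f (x + t *\<^sub>R b)) has_real_derivative dir_deriv f x b) (at 0)"
   using Ck_on_dir_deriv[OF assms(3)[unfolded Suc] b x] by (simp add: has_real_derivative_iff_has_vector_derivative)
  then have "((%t. ln (f (x + t *\<^sub>R b))) has_real_derivative dir_deriv f x b * inverse (f x)) (at 0)"
   using assms(2)[OF x] by (auto intro!: derivative_eq_intros simp: field_simps)
  then show "((%t. ln (f (x + t *\<^sub>R b))) has_vector_derivative dir_deriv f x b * inverse (f x)) (at 0)"
   by (simp add: has_real_derivative_iff_has_vector_derivative)
 qed
qed

section \<open>Symmetry of second derivatives\<close>

lemma Ck_on_dir_deriv_span:
 fixes f :: "'e::euclidean_space => 'f::real_normed_vector"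
 assumes "B \<subseteq> Basis" "open_along B U" "Ck_on (Suc k) B U f" "v \<in> span B"
 shows "Ck_on k B U (%x. dir_deriv f x v)"
proof (rule Ck_on_cong[OF assms(2)])
 have f1: "Ck_on 1 B U f" by (rule Ck_on_le[OF assms(3)]) simp
 show "(\<Sum>b\<in>B. (v \<bullet> b) *\<^sub>R dir_deriv f x b) = dir_deriv f x v" if "x \<in> U" for x
  by (rule C1_dir_deriv(2)[OF assms(1,2) f1 that assms(4), symmetric])
 show "Ck_on k B U (%x. \<Sum>b\<in>B. (v \<bullet> b) *\<^sub>R dir_deriv f x b)"
  by (intro Ck_on_sum Ck_on_linear_compose[OF _ bounded_linear_scaleR_right] assms(2)) (use assms(3) in simp)
qed

text \<open>For \<open>F(s, t) = f (x + s v + t w)\<close>, differentiating \<open>F(s, t) = F(0, t) + \<integral> \<partial>\<^sub>s F\<close> with respect to \<open>t\<close> under the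
integral sign expresses \<open>\<partial>\<^sub>t F\<close> as an integral over \<open>s\<close> of \<open>\<partial>\<^sub>t \<partial>\<^sub>s F\<close>.\<close>

lemma symmetric_second_derivative:
 fixes f :: "'e::euclidean_space => 'f::euclidean_space"
 assumes "B \<subseteq> Basis" "open_along B U" "Ck_on 2 B U f" "x \<in> U" "v \<in> span B" "w \<in> span B"
 shows "dir_deriv (%y. dir_deriv f y v) x w = dir_deriv (%y. dir_deriv f y w) x v"
proof -
 have f2: "Ck_on (Suc 1) B U f" using assms(3) by (simp only: Suc_1)
 have f1: "Ck_on 1 B U f" by (rule Ck_on_le[OF f2]) simp
 note P1 = Ck_on_dir_deriv_span[OF assms(1,2) f2 assms(5)] and Q1 = Ck_on_dir_deriv_span[OF assms(1,2) f2 assms(6)]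
 let ?P = "%y. dir_deriv f y v" and ?Q = "%y. dir_deriv f y w"
 let ?R = "%y. dir_deriv ?P y w"
 have Rc: "continuous_on U ?R" by (rule Ck_on_continuous[OF Ck_on_dir_deriv_span[of B U 0, OF assms(1,2) _ assms(6)]]) (use P1 in simp)
 obtain d where d: "d > 0" "!!u. u \<in> span B ==> norm u <= d ==> x + u \<in> U"
  using open_along_radius_point[OF assms(2,4)] by blast
 define e where "e = d / (norm v + norm w + 1)"
 have n1: "norm v + norm w + 1 > 0" by (intro add_nonneg_pos add_nonneg_nonneg) simp_all
 have e: "e > 0" using d(1) n1 by (simp add: e_def)
 define y where "y s t = (x + s *\<^sub>R v) + t *\<^sub>R w" for s t
 have y: "y s t \<in> U" if s: "\<bar>s\<bar> <= e" and t: "\<bar>t\<bar> <= e" for s t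
 proof -
  have "norm (s *\<^sub>R v + t *\<^sub>R w) <= \<bar>s\<bar> * norm v + \<bar>t\<bar> * norm w"
   using norm_triangle_ineq[of "s *\<^sub>R v" "t *\<^sub>R w"] by simp
  also have "... <= e * norm v + e * norm w" using s t by (intro add_mono mult_right_mono) simp_all
  also have "... <= e * (norm v + norm w + 1)" using e by (simp add: algebra_simps)
  also have "... = d" using n1 by (simp add: e_def)
  finally show ?thesis
   using d(2)[of "s *\<^sub>R v + t *\<^sub>R w"] assms(5,6) by (simp add: y_def span_add span_scale add.assoc)
 qed
 have dw: "((%t. h (y s t)) has_vector_derivative dir_deriv h (y s t) w) (at t)"
  if "Ck_on 1 B U h" "\<bar>s\<bar> <= e" "\<bar>t\<bar> <= e" for h :: "'e => 'f" and s t
  using C1_dir_deriv(1)[OF assms(1,2) that(1) y[OF that(2,3)] assms(6)] unfolding y_def by (rule shift_line_derivative)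
 have dv: "((%s. h (y s t)) has_vector_derivative dir_deriv h (y s t) v) (at s)"
  if "Ck_on 1 B U h" "\<bar>s\<bar> <= e" "\<bar>t\<bar> <= e" for h :: "'e => 'f" and s t
 proof -
  have eq: "y s t = (x + t *\<^sub>R w) + s *\<^sub>R v" for s by (simp add: y_def)
  show ?thesis
   using C1_dir_deriv(1)[OF assms(1,2) that(1) y[OF that(2,3)] assms(5)] unfolding eq by (rule shift_line_derivative)
 qed
 have yc: "continuous_on A (%p. h (y (a p) (b p)))"
  if "continuous_on U h" "continuous_on A a" "continuous_on A b" "!!p. p \<in> A ==> \<bar>a p\<bar> <= e & \<bar>b p\<bar> <= e"
  for h :: "'e => 'f" and A :: "'c::topological_space set" and a b
  unfolding y_def
  by (rule continuous_on_compose2[OF that(1)])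
   (use that y in \<open>auto intro!: continuous_intros simp: y_def\<close>)
 \<comment> \<open>differentiate the fundamental theorem of calculus for \<open>f\<close> along \<open>v\<close> in the direction \<open>w\<close>\<close>
 have Q: "?Q (y s 0) = ?Q (y 0 0) + integral {0..s} (%\<sigma>. ?R (y \<sigma> 0))" if s: "s \<in> {0..e}" for s
 proof -
  have F: "((%\<sigma>. ?P (y \<sigma> t)) has_integral f (y s t) - f (y 0 t)) {0..s}" if t: "t \<in> {- e..e}" for t
   by (rule fundamental_theorem_of_calculus)
    (use s t in \<open>auto intro!: has_vector_derivative_at_within[OF dv[OF f1]]\<close>)
  have "((%t. integral (cbox 0 s) (%\<sigma>. ?P (y \<sigma> t))) has_vector_derivative integral (cbox 0 s) (%\<sigma>. ?R (y \<sigma> 0)))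
    (at 0 within {- e..e})"
  proof (rule leibniz_rule_vector_derivative)
   show "((%t. ?P (y \<sigma> t)) has_vector_derivative ?R (y \<sigma> t)) (at t within {- e..e})"
    if "t \<in> {- e..e}" "\<sigma> \<in> cbox 0 s" for t \<sigma>
    by (rule has_vector_derivative_at_within[OF dw[OF P1]]) (use that s in auto)
   show "(%\<sigma>. ?P (y \<sigma> t)) integrable_on cbox 0 s" if "t \<in> {- e..e}" for t
    using has_integral_integrable[OF F[OF that]] by simp
   show "continuous_on ({- e..e} \<times> cbox 0 s) (%(t, \<sigma>). ?R (y \<sigma> t))"
    unfolding case_prod_beta by (rule yc[OF Rc]) (use s in \<open>auto intro!: continuous_intros\<close>)
  qed (use e in auto)
  moreover have "integral (cbox 0 s) (%\<sigma>. ?P (y \<sigma> t)) = f (y s t) - f (y 0 t)" if "t \<in> {- e..e}" for t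
   using integral_unique[OF F[OF that]] by simp
  ultimately have "((%t. f (y s t) - f (y 0 t)) has_vector_derivative integral {0..s} (%\<sigma>. ?R (y \<sigma> 0))) (at 0 within {- e..e})"
   by (auto intro: has_vector_derivative_transform[rotated 2] simp: e less_imp_le)
  moreover have "((%t. f (y s t) - f (y 0 t)) has_vector_derivative ?Q (y s 0) - ?Q (y 0 0)) (at 0 within {- e..e})"
   by (rule has_vector_derivative_at_within[OF has_vector_derivative_diff[OF dw[OF f1] dw[OF f1]]]) (use s e in auto)
  moreover have "at 0 within {- e..e} ~= bot" using e by (simp add: at_within_Icc_at)
  ultimately have "?Q (y s 0) - ?Q (y 0 0) = integral {0..s} (%\<sigma>. ?R (y \<sigma> 0))"
   using vector_derivative_unique_within by blast
  then show ?thesis by (simp add: algebra_simps)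
 qed
 have "continuous_on {0..e} (%\<sigma>. ?R (y \<sigma> 0))" by (rule yc[OF Rc]) (use e in \<open>auto intro!: continuous_intros\<close>)
 from has_vector_derivative_add[OF has_vector_derivative_const integral_has_vector_derivative[OF this, of 0], of "?Q (y 0 0)"]
 have "((%s. ?Q (y 0 0) + integral {0..s} (%\<sigma>. ?R (y \<sigma> 0))) has_vector_derivative ?R (y 0 0)) (at 0 within {0..e})"
  using e by simp
 from has_vector_derivative_transform[OF _ Q this]
 have "((%s. ?Q (y s 0)) has_vector_derivative ?R (y 0 0)) (at 0 within {0..e})" using e by simp
 moreover have "((%s. ?Q (y s 0)) has_vector_derivative dir_deriv ?Q (y 0 0) v) (at 0 within {0..e})"
  by (rule has_vector_derivative_at_within[OF dv[OF Q1]]) (use e in auto)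
 moreover have "at 0 within {0..e} ~= bot" using e by (simp add: at_within_Icc_at_right)
 ultimately have "?R (y 0 0) = dir_deriv ?Q (y 0 0) v" using vector_derivative_unique_within by blast
 then show ?thesis by (simp add: y_def)
qed

section \<open>Inverse function theorem and the algebra of smooth functions\<close>

lemma smooth_on_Ck: "smooth_on B U f ==> Ck_on k B U f"
 unfolding smooth_on_def by blast

lemma Ck_on_mono_directions: "Ck_on k C U f ==> B \<subseteq> C ==> Ck_on k B U f"
 by (induction k arbitrary: f) auto

lemma has_vector_derivative_at_0_iff:
 fixes f :: "real => 'f::real_normed_vector"
 shows "(f has_vector_derivative D) (at 0) \<longleftrightarrow> ((%h. (f h - f 0) /\<^sub>R h) \<longlongrightarrow> D) (at 0)"
proof -
 have "(f has_vector_derivative D) (at 0) \<longleftrightarrow> ((%h. norm (f h - f 0 - h *\<^sub>R D) / norm h) \<longlongrightarrow> 0) (at 0)"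
  unfolding has_vector_derivative_def has_derivative_at
  using bounded_linear_scaleR_left by auto
 also have "... \<longleftrightarrow> ((%h. norm ((f h - f 0) /\<^sub>R h - D)) \<longlongrightarrow> 0) (at 0)"
 proof (intro tendsto_cong)
  have "norm (f h - f 0 - h *\<^sub>R D) / norm h = norm ((f h - f 0) /\<^sub>R h - D)" if "h ~= 0" for h
  proof -
   have "(f h - f 0) /\<^sub>R h - D = (f h - f 0 - h *\<^sub>R D) /\<^sub>R h"
    using that by (simp add: scaleR_diff_right)
   then show ?thesis by (simp add: divide_inverse mult.commute)
  qed
  then show "\<forall>\<^sub>F h in at 0. norm (f h - f 0 - h *\<^sub>R D) / norm h = norm ((f h - f 0) /\<^sub>R h - D)"
   by (auto simp: eventually_at_filter)
 qed
 also have "... \<longleftrightarrow> ((%h. (f h - f 0) /\<^sub>R h) \<longlongrightarrow> D) (at 0)"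
  by (simp add: tendsto_norm_zero_iff LIM_zero_iff)
 finally show ?thesis .
qed

text \<open>The limit system is injective, hence bounded below, so a small change of the coefficients changes the solution little.\<close>

lemma linear_solution_tendsto:
 fixes \<alpha> :: "'f::euclidean_space => 'i => 'f"
 assumes "!!c. c \<in> Basis ==> (\<alpha> c \<longlongrightarrow> a c) F"
  and "(\<rho> \<longlongrightarrow> (\<Sum>c\<in>Basis. (q0 \<bullet> c) *\<^sub>R a c)) F"
  and "eventually (%i. (\<Sum>c\<in>Basis. (q i \<bullet> c) *\<^sub>R \<alpha> c i) = \<rho> i) F"
  and inj: "!!w. (\<Sum>c\<in>Basis. (w \<bullet> c) *\<^sub>R a c) = 0 ==> w = 0"
 shows "(q \<longlongrightarrow> q0) F"
proof -
 define A where "A w = (\<Sum>c\<in>Basis. (w \<bullet> c) *\<^sub>R a c)" for w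
 have lin: "linear A"
  unfolding A_def
  by (intro bounded_linear.linear bounded_linear_sum bounded_linear_scaleR_const bounded_linear_inner_left)
 have "inj A"
  using inj unfolding linear_injective_0[OF lin] by (simp add: A_def)
 then obtain m where m: "m > 0" "!!w. m * norm w <= norm (A w)"
  by (rule linear_inj_bounded_below_pos[OF lin]) auto
 define \<delta> where "\<delta> i = (\<Sum>c\<in>Basis. norm (a c - \<alpha> c i))" for i
 have \<delta>: "(\<delta> \<longlongrightarrow> 0) F"
 proof -
  have "(\<delta> \<longlongrightarrow> (\<Sum>c\<in>(Basis::'f set). norm (a c - a c))) F"
   unfolding \<delta>_def by (intro tendsto_sum tendsto_norm tendsto_diff tendsto_const assms(1))
  then show ?thesis by simp
 qed
 have ev: "eventually (%i. norm (q i - q0) <= 2 / m * (\<delta> i * norm q0 + norm (\<rho> i - A q0))) F"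
  using assms(3) order_tendstoD(2)[OF \<delta> half_gt_zero[OF m(1)]]
 proof eventually_elim
  case (elim i)
  have \<delta>0: "\<delta> i \<ge> 0" unfolding \<delta>_def by (intro sum_nonneg) auto
  have "A (q i - q0) = (\<Sum>c\<in>Basis. (q i \<bullet> c) *\<^sub>R (a c - \<alpha> c i)) + (\<rho> i - A q0)"
   unfolding linear_diff[OF lin] elim(1)[symmetric]
   by (simp add: A_def scaleR_diff_right sum_subtractf)
  moreover have "norm (\<Sum>c\<in>Basis. (q i \<bullet> c) *\<^sub>R (a c - \<alpha> c i)) <= norm (q i) * \<delta> i"
   unfolding \<delta>_def sum_distrib_left
   by (intro sum_norm_le) (auto intro!: mult_right_mono Basis_le_norm)
  ultimately have "norm (A (q i - q0)) <= norm (q i) * \<delta> i + norm (\<rho> i - A q0)"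
   by (smt (verit) norm_triangle_ineq)
  moreover have "norm (q i) * \<delta> i <= (norm (q i - q0) + norm q0) * \<delta> i"
   using \<delta>0 norm_triangle_sub[of "q i" q0] by (intro mult_right_mono) auto
  moreover have "norm (q i - q0) * \<delta> i <= norm (q i - q0) * (m / 2)"
   using elim by (intro mult_left_mono) auto
  ultimately have "m * norm (q i - q0) <= norm (q i - q0) * (m / 2) + norm q0 * \<delta> i + norm (\<rho> i - A q0)"
   using m(2)[of "q i - q0"] by (simp add: distrib_right)
  then have "norm (q i - q0) * (m / 2) <= \<delta> i * norm q0 + norm (\<rho> i - A q0)"
   by (simp add: algebra_simps)
  then show ?case using m(1) by (simp add: field_simps)
 qed
 have "((%i. 2 / m * (\<delta> i * norm q0 + norm (\<rho> i - A q0))) \<longlongrightarrow> 2 / m * (0 * norm q0 + norm (A q0 - A q0))) F"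
  using assms(2) unfolding A_def by (intro tendsto_intros \<delta>)
 then have "((%i. 2 / m * (\<delta> i * norm q0 + norm (\<rho> i - A q0))) \<longlongrightarrow> 0) F" by simp
 then have "((%i. q i - q0) \<longlongrightarrow> 0) F" by (rule Lim_null_comparison[OF ev])
 then show ?thesis by (simp add: LIM_zero_iff)
qed

text \<open>Differentiating \<open>\<Sum> Q\<^sub>c a\<^sub>c = r\<close> gives a system with the same coefficients for the derivatives of \<open>Q\<close>, so
induction on \<open>k\<close> applies. This makes the inverse in the inverse function theorem smooth.\<close>

lemma Ck_on_linear_solution:
 fixes a :: "'f::euclidean_space => 'e::euclidean_space => 'f"
 assumes U: "open_along B U"
  and "!!c. c \<in> Basis ==> Ck_on k B U (a c)" "Ck_on k B U r"
  and "!!x. x \<in> U ==> (\<Sum>c\<in>Basis. (Q x \<bullet> c) *\<^sub>R a c x) = r x"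
  and inj: "!!x w. x \<in> U ==> (\<Sum>c\<in>Basis. (w \<bullet> c) *\<^sub>R a c x) = 0 ==> w = 0"
 shows "Ck_on k B U Q"
 using assms(2-4)
proof (induction k arbitrary: r Q)
 case 0
 show ?case unfolding Ck_on.simps continuous_on_def
 proof
  fix x assume x: "x \<in> U"
  show "(Q \<longlongrightarrow> Q x) (at x within U)"
  proof (rule linear_solution_tendsto[OF _ _ _ inj[OF x]])
   show "(a c \<longlongrightarrow> a c x) (at x within U)" if "c \<in> Basis" for c
    using 0(1)[OF that] x by (simp add: continuous_on_def)
   show "(r \<longlongrightarrow> (\<Sum>c\<in>Basis. (Q x \<bullet> c) *\<^sub>R a c x)) (at x within U)"
    using 0(2) 0(3)[OF x] x by (simp add: continuous_on_def)
   show "\<forall>\<^sub>F y in at x within U. (\<Sum>c\<in>Basis. (Q y \<bullet> c) *\<^sub>R a c y) = r y"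
    using 0(3) by (simp add: eventually_at_filter)
  qed
 qed
next
 case (Suc k)
 have a0: "Ck_on k B U (a c)" if "c \<in> Basis" for c using Suc.prems(1)[OF that] by (rule Ck_on_Suc_le)
 have r0: "Ck_on k B U r" using Suc.prems(2) by (rule Ck_on_Suc_le)
 have Q0: "Ck_on k B U Q" by (rule Suc.IH[OF a0 r0 Suc.prems(3)])
 define \<rho> where "\<rho> b x = dir_deriv r x b - (\<Sum>c\<in>Basis. (Q x \<bullet> c) *\<^sub>R dir_deriv (a c) x b)" for b x
 define A where "A x w = (\<Sum>c\<in>Basis. (w \<bullet> c) *\<^sub>R a c x)" for x w
 have lin: "linear (A x)" for x
  unfolding A_def
  by (intro bounded_linear.linear bounded_linear_sum bounded_linear_scaleR_const bounded_linear_inner_left)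
 have surj: "surj (A x)" if "x \<in> U" for x
 proof (rule linear_injective_imp_surjective[OF lin _ refl])
  show "inj (A x)" unfolding linear_injective_0[OF lin] using inj[OF that] by (auto simp: A_def)
 qed
 define Q' where "Q' b x = (SOME w. A x w = \<rho> b x)" for b x
 have Q': "A x (Q' b x) = \<rho> b x" if "x \<in> U" for b x
  unfolding Q'_def by (rule someI_ex) (metis surj[OF that] surjD)
 show ?case
 proof (rule Ck_on_SucI'[OF U, where f' = Q'])
  show "continuous_on U Q" using Q0 by (rule Ck_on_continuous)
  fix b assume b: "b \<in> B"
  have neg: "Ck_on k B U (%x. - (\<Sum>c\<in>Basis. (Q x \<bullet> c) *\<^sub>R dir_deriv (a c) x b))"
  proof (rule Ck_on_linear_compose[OF U bounded_linear_minus[OF bounded_linear_ident]], rule Ck_on_sum[OF U])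
   fix c :: 'f assume c: "c \<in> Basis"
   have "Ck_on k B U (%x. Q x \<bullet> c)"
    using Q0 by (intro Ck_on_bilinear[OF bounded_bilinear_inner U]) auto
   then show "Ck_on k B U (%x. (Q x \<bullet> c) *\<^sub>R dir_deriv (a c) x b)"
    using Suc.prems(1)[OF c] b by (intro Ck_on_bilinear[OF bounded_bilinear_scaleR U]) auto
  qed
  have "Ck_on k B U (\<rho> b)"
   unfolding \<rho>_def diff_conv_add_uminus using Suc.prems(2) b by (intro Ck_on_add[OF U] neg) auto
  from Suc.IH[OF a0 this, of "Q' b"] show "Ck_on k B U (Q' b)"
   using Q' by (simp add: A_def)
  fix x assume x: "x \<in> U"
  have bs: "b \<in> span B" using b by (rule span_base)
  note line = open_along_line[OF U x bs]
  define R where "R h = r (x + h *\<^sub>R b) - (\<Sum>c\<in>Basis. (Q x \<bullet> c) *\<^sub>R a c (x + h *\<^sub>R b))" for h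
  have R: "(R has_vector_derivative \<rho> b x) (at 0)"
   unfolding R_def \<rho>_def
  proof (intro has_vector_derivative_diff has_vector_derivative_sum)
   show "((%h. r (x + h *\<^sub>R b)) has_vector_derivative dir_deriv r x b) (at 0)"
    using Ck_on_dir_deriv[OF Suc.prems(2) b x] .
   fix c :: 'f assume c: "c \<in> Basis"
   from bounded_linear.has_vector_derivative[OF bounded_linear_scaleR_right Ck_on_dir_deriv[OF Suc.prems(1)[OF c] b x]]
   show "((%h. (Q x \<bullet> c) *\<^sub>R a c (x + h *\<^sub>R b)) has_vector_derivative (Q x \<bullet> c) *\<^sub>R dir_deriv (a c) x b) (at 0)" .
  qed
  have R0: "R 0 = 0" unfolding R_def using Suc.prems(3)[OF x] by simp
  have "((%h. (Q (x + h *\<^sub>R b) - Q x) /\<^sub>R h) \<longlongrightarrow> Q' b x) (at 0)"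
  proof (rule linear_solution_tendsto[where \<alpha> = "%c h. a c (x + h *\<^sub>R b)" and \<rho> = "%h. (R h - R 0) /\<^sub>R h", OF _ _ _ inj[OF x]])
   fix c :: 'f assume c: "c \<in> Basis"
   have "continuous (at 0) (%h. a c (x + h *\<^sub>R b))"
    using Ck_on_dir_deriv[OF Suc.prems(1)[OF c] b x] by (rule has_vector_derivative_continuous)
   then show "((%h. a c (x + h *\<^sub>R b)) \<longlongrightarrow> a c x) (at 0)"
    unfolding continuous_at by simp
  next
   show "((%h. (R h - R 0) /\<^sub>R h) \<longlongrightarrow> (\<Sum>c\<in>Basis. (Q' b x \<bullet> c) *\<^sub>R a c x)) (at 0)"
    using R Q'[OF x] unfolding has_vector_derivative_at_0_iff A_def by simp
  next
   show "\<forall>\<^sub>F h in at 0. (\<Sum>c\<in>Basis. (((Q (x + h *\<^sub>R b) - Q x) /\<^sub>R h) \<bullet> c) *\<^sub>R a c (x + h *\<^sub>R b)) = (R h - R 0) /\<^sub>R h"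
    using line
   proof eventually_elim
    case (elim h)
    have "(\<Sum>c\<in>Basis. (((Q (x + h *\<^sub>R b) - Q x) /\<^sub>R h) \<bullet> c) *\<^sub>R a c (x + h *\<^sub>R b))
     = A (x + h *\<^sub>R b) ((Q (x + h *\<^sub>R b) - Q x) /\<^sub>R h)" by (simp add: A_def)
    also have "... = (A (x + h *\<^sub>R b) (Q (x + h *\<^sub>R b)) - A (x + h *\<^sub>R b) (Q x)) /\<^sub>R h"
     by (simp add: linear_cmul[OF lin] linear_diff[OF lin])
    finally show ?case using Suc.prems(3)[OF elim] R0 by (simp add: R_def A_def)
   qed
  qed
  then show "((%h. Q (x + h *\<^sub>R b)) has_vector_derivative Q' b x) (at 0)"
   unfolding has_vector_derivative_at_0_iff by simp
 qed
qed

lemma Basis_directional_derivative: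
 fixes f :: "'e::euclidean_space => 'f::real_normed_vector"
 assumes "open U" "Ck_on 1 Basis U f" "x \<in> U"
 shows "(f has_derivative (%v. \<Sum>b\<in>Basis. (v \<bullet> b) *\<^sub>R dir_deriv f x b)) (at x)"
proof -
 have "((%v. f (x + v)) has_derivative (%v. \<Sum>b\<in>Basis. (v \<bullet> b) *\<^sub>R dir_deriv f x b)) (at (x - x))"
  using C1_has_derivative[OF subset_refl open_along_UNIV[OF assms(1)] assms(2,3)] by simp
 moreover have "((%y. y - x) has_derivative (%v. v)) (at x)" by (auto intro!: derivative_eq_intros)
 ultimately have "((%y. f (x + (y - x))) has_derivative (%v. \<Sum>b\<in>Basis. (v \<bullet> b) *\<^sub>R dir_deriv f x b)) (at x)"
  using has_derivative_compose by blast
 then show ?thesis by simp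
qed

lemma smooth_inverse_function_open:
 fixes G :: "'e::euclidean_space => 'e"
 assumes U: "open U" and G: "smooth_on Basis U G" and x0: "x0 \<in> U"
  and inj: "!!v. (\<Sum>b\<in>Basis. (v \<bullet> b) *\<^sub>R dir_deriv G x0 b) = 0 ==> v = 0"
 obtains U' V H where "open U'" "U' \<subseteq> U" "x0 \<in> U'" "open V" "G x0 \<in> V" "homeomorphism U' V G H"
  "smooth_on Basis V H"
proof -
 define L where "L x v = (\<Sum>b\<in>Basis. (v \<bullet> b) *\<^sub>R dir_deriv G x b)" for x v
 have bl: "bounded_linear (L x)" for x
  unfolding L_def by (intro bounded_linear_sum bounded_linear_scaleR_const bounded_linear_inner_left)
 define G' where "G' x = Blinfun (L x)" for x
 have G': "blinfun_apply (G' x) = L x" for x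
  unfolding G'_def using bl by (rule bounded_linear_Blinfun_apply)
 have L_Basis: "L x b = dir_deriv G x b" if "b \<in> Basis" for x b
 proof -
  have "L x b = (\<Sum>c\<in>Basis. (if c = b then dir_deriv G x c else 0))"
   unfolding L_def using that by (intro sum.cong) (auto simp: inner_Basis)
  then show ?thesis using that by simp
 qed
 have C1: "Ck_on 1 Basis U G" using G by (rule smooth_on_Ck)
 have der: "(G has_derivative blinfun_apply (G' x)) (at x)" if "x \<in> U" for x
  using Basis_directional_derivative[OF U C1 that] unfolding G' L_def .
 have cont: "continuous_on U G'"
 proof (rule continuous_on_blinfun_componentwise)
  fix b :: 'e assume "b \<in> Basis"
  then show "continuous_on U (%x. blinfun_apply (G' x) b)"
   unfolding G' using L_Basis C1 by simp
 qed
 have "inj (L x0)"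
  using inj unfolding linear_injective_0[OF bounded_linear.linear[OF bl]] by (simp add: L_def)
 then obtain g where g: "linear g" "g o L x0 = id"
  using linear_injective_left_inverse[OF bounded_linear.linear[OF bl]] by blast
 have "Blinfun g o\<^sub>L G' x0 = id_blinfun"
  by (rule blinfun_eqI) (use g in \<open>simp add: G' bounded_linear_Blinfun_apply linear_conv_bounded_linear fun_eq_iff\<close>)
 then obtain U' V H H' where UV: "open U'" "U' \<subseteq> U" "x0 \<in> U'" "open V" "G x0 \<in> V" "homeomorphism U' V G H"
  "!!y. y \<in> V ==> (H has_derivative (H' y)) (at y)"
  "!!y. y \<in> V ==> H' y = inv (blinfun_apply (G' (H y)))"
  "!!y. y \<in> V ==> bij (blinfun_apply (G' (H y)))"
  using inverse_function_theorem[OF U der cont x0] by blast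
 have HU: "H y \<in> U" if "y \<in> V" for y
  using UV(2,6) that unfolding homeomorphism_def by blast
 have "Ck_on k Basis V H" for k
 proof (induction k)
  case 0
  show ?case using UV(6) by (simp add: homeomorphism_def)
 next
  case (Suc k)
  show ?case
  proof (rule Ck_on_SucI'[OF open_along_UNIV[OF UV(4)], where f' = "%b y. H' y b"])
   show "continuous_on V H" using UV(6) by (simp add: homeomorphism_def)
   fix b :: 'e assume b: "b \<in> Basis"
   show "((%t. H (y + t *\<^sub>R b)) has_vector_derivative H' y b) (at 0)" if "y \<in> V" for y
   proof -
    have lin: "linear (H' y)" using UV(7)[OF that] has_derivative_linear by blast
    have "((%t. y + t *\<^sub>R b) has_derivative (%t. t *\<^sub>R b)) (at 0)" by (auto intro!: derivative_eq_intros)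
    moreover have "(H has_derivative H' y) (at (y + 0 *\<^sub>R b))" using UV(7)[OF that] by simp
    ultimately have "((%t. H (y + t *\<^sub>R b)) has_derivative (%t. H' y (t *\<^sub>R b))) (at 0)"
     by (rule has_derivative_compose)
    then show ?thesis by (simp add: has_vector_derivative_def linear_cmul[OF lin])
   qed
   show "Ck_on k Basis V (%y. H' y b)"
   proof (rule Ck_on_linear_solution[OF open_along_UNIV[OF UV(4)], where r = "%y. b" and a = "%c y. dir_deriv G (H y) c"])
    fix c :: 'e assume c: "c \<in> Basis"
    show "Ck_on k Basis V (%y. dir_deriv G (H y) c)"
    proof (rule Ck_on_compose[OF subset_refl subset_refl open_along_UNIV[OF UV(4)] open_along_UNIV[OF U],
      where f = H and g = "%x. dir_deriv G x c"])
     show "Ck_on k Basis U (%x. dir_deriv G x c)"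
      using smooth_on_Ck[OF G, of "Suc k"] c by simp
    qed (use HU Suc in \<open>auto simp: span_Basis\<close>)
   next
    fix y assume y: "y \<in> V"
    have "L (H y) (H' y b) = b"
     using UV(8,9)[OF y] by (simp add: G' bij_is_surj surj_f_inv_f)
    then show "(\<Sum>c\<in>Basis. (H' y b \<bullet> c) *\<^sub>R dir_deriv G (H y) c) = b" by (simp add: L_def)
    fix w assume "(\<Sum>c\<in>Basis. (w \<bullet> c) *\<^sub>R dir_deriv G (H y) c) = 0"
    then have "L (H y) w = 0" by (simp add: L_def)
    moreover have "inj (L (H y))" using UV(9)[OF y] by (simp add: G' bij_is_inj)
    ultimately show "w = 0" unfolding linear_injective_0[OF bounded_linear.linear[OF bl]] by blast
   qed auto
  qed
 qed
 then show ?thesis using that UV unfolding smooth_on_def by blast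
qed

definition proj_span :: "'e::euclidean_space set => 'e => 'e" where
 "proj_span B x = (\<Sum>b\<in>B. (x \<bullet> b) *\<^sub>R b)"

lemma bounded_linear_proj_span: "bounded_linear (proj_span B)"
 unfolding proj_span_def
 by (intro bounded_linear_sum bounded_linear_scaleR_const bounded_linear_inner_left)

lemma proj_span_in [simp]: "proj_span B x \<in> span B"
 unfolding proj_span_def by (rule sum_inner_in_span) simp

lemma proj_span_id: "B \<subseteq> Basis ==> x \<in> span B ==> proj_span B x = x"
 unfolding proj_span_def by (rule sum_Basis_inner)

lemma open_vimage_proj_span:
 assumes "open_in B U"
 shows "open (proj_span B -` U)"
proof -
 obtain G where G: "open G" "U = span B Int G" using assms unfolding openin_open by blast
 then have "proj_span B -` U = proj_span B -` G" by auto
 then show ?thesis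
  using G(1) linear_continuous_on[OF bounded_linear_proj_span] open_vimage
  by (metis continuous_on_eq_continuous_at continuous_at_imp_continuous_on)
qed

lemma smooth_on_subset: "smooth_on B U f ==> V \<subseteq> U ==> smooth_on B V f"
 unfolding smooth_on_def using Ck_on_subset by blast

lemma smooth_on_cong:
 assumes "open_along B U" "!!y. y \<in> U ==> f y = g y" "smooth_on B U f"
 shows "smooth_on B U g"
 using assms Ck_on_cong unfolding smooth_on_def by blast

lemma smooth_on_local:
 assumes "!!x. x \<in> U ==> \<exists>G. open G & x \<in> G & smooth_on B (U Int G) f"
 shows "smooth_on B U f"
 unfolding smooth_on_def
proof
 fix k show "Ck_on k B U f"
  by (rule Ck_on_local) (use assms in \<open>auto simp: smooth_on_def\<close>)
qed

lemma smooth_on_compose: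
 fixes f :: "'e::euclidean_space => 'f::euclidean_space" and g :: "'f => 'h::real_normed_vector"
 assumes "B \<subseteq> Basis" "C \<subseteq> Basis" "open_along B U" "open_along C W"
  and "!!x. x \<in> U ==> f x \<in> W"
  and "!!x v. x \<in> U ==> v \<in> span B ==> x + v \<in> U ==> f (x + v) - f x \<in> span C"
  and "smooth_on B U f" "smooth_on C W g"
 shows "smooth_on B U (%x. g (f x))"
 unfolding smooth_on_def using Ck_on_compose[OF assms(1-6)] assms(7,8) unfolding smooth_on_def by blast

lemma smooth_on_compose_span:
 fixes f :: "'e::euclidean_space => 'f::euclidean_space" and g :: "'f => 'h::real_normed_vector"
 assumes "B \<subseteq> Basis" "C \<subseteq> Basis" "open_along B U" "open_in C W"
  and "!!x. x \<in> U ==> f x \<in> W" and "smooth_on B U f" "smooth_on C W g"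
 shows "smooth_on B U (%x. g (f x))"
proof (rule smooth_on_compose[OF assms(1-3) open_along_openin[OF assms(4)] assms(5) _ assms(6,7)])
 fix x v assume "x \<in> U" "x + v \<in> U"
 then have "f (x + v) \<in> span C" "f x \<in> span C"
  using assms(4,5) openin_imp_subset by blast+
 then show "f (x + v) - f x \<in> span C" by (rule span_diff)
qed

lemma smooth_on_bounded_linear: "open_along B U ==> bounded_linear f ==> smooth_on B U f"
 unfolding smooth_on_def by (blast intro: Ck_on_bounded_linear)

lemma smooth_on_linear_compose:
 "open_along B U ==> bounded_linear h ==> smooth_on B U f ==> smooth_on B U (%x. h (f x))"
 unfolding smooth_on_def by (blast intro: Ck_on_linear_compose)

lemma smooth_on_const [simp]: "smooth_on B U (%x. c)"
 unfolding smooth_on_def by simp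

lemma smooth_on_id: "open_along B U ==> smooth_on B U (%x. x)"
 by (rule smooth_on_bounded_linear[OF _ bounded_linear_ident])

lemma smooth_on_add:
 "open_along B U ==> smooth_on B U f ==> smooth_on B U g ==> smooth_on B U (%x. f x + g x)"
 unfolding smooth_on_def by (blast intro: Ck_on_add)

lemma smooth_on_minus:
 "open_along B U ==> smooth_on B U f ==> smooth_on B U (%x. - f x)"
 by (rule smooth_on_linear_compose[OF _ bounded_linear_minus[OF bounded_linear_ident]])

lemma smooth_on_diff:
 "open_along B U ==> smooth_on B U f ==> smooth_on B U g ==> smooth_on B U (%x. f x - g x)"
 unfolding diff_conv_add_uminus by (intro smooth_on_add smooth_on_minus)

lemma smooth_on_bilinear:
 fixes f :: "'e::euclidean_space => 'a::real_normed_vector"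
  and g :: "'e => 'b::real_normed_vector" and h :: "'a => 'b => 'c::real_normed_vector"
 shows "bounded_bilinear h ==> open_along B U ==> smooth_on B U f ==> smooth_on B U g
  ==> smooth_on B U (%x. h (f x) (g x))"
 unfolding smooth_on_def by (blast intro: Ck_on_bilinear)

lemmas smooth_on_scaleR = smooth_on_bilinear[OF bounded_bilinear_scaleR]
lemmas smooth_on_inner = smooth_on_bilinear[OF bounded_bilinear_inner]
lemmas smooth_on_mult = smooth_on_bilinear[OF bounded_bilinear_mult]

lemma smooth_on_sum:
 "open_along B U ==> (!!i. i \<in> I ==> smooth_on B U (f i)) ==> smooth_on B U (%x. \<Sum>i\<in>I. f i x)"
 unfolding smooth_on_def by (blast intro: Ck_on_sum)

lemma smooth_on_Pair:
 "open_along B U ==> smooth_on B U f ==> smooth_on B U g ==> smooth_on B U (%x. (f x, g x))"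
 unfolding smooth_on_def by (blast intro: Ck_on_Pair)

lemma smooth_on_dir_deriv:
 assumes "smooth_on B U f" "b \<in> B"
 shows "smooth_on B U (%x. dir_deriv f x b)"
 unfolding smooth_on_def
proof
 fix k show "Ck_on k B U (%x. dir_deriv f x b)"
  using smooth_on_Ck[OF assms(1), of "Suc k"] assms(2) by simp
qed

lemma smooth_on_dir_deriv_span:
 fixes f :: "'e::euclidean_space => 'f::real_normed_vector"
 assumes "B \<subseteq> Basis" "open_along B U" "smooth_on B U f" "v \<in> span B"
 shows "smooth_on B U (%x. dir_deriv f x v)"
 unfolding smooth_on_def using Ck_on_dir_deriv_span[OF assms(1,2) smooth_on_Ck[OF assms(3)] assms(4)] by blast

lemma smooth_inverse_function:
 fixes G :: "'e::euclidean_space => 'e"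
 assumes B: "B \<subseteq> Basis" and U: "open_in B U" and G: "smooth_on B U G"
  and GB: "!!x. x \<in> U ==> G x \<in> span B" and x0: "x0 \<in> U"
  and inj: "!!v. v \<in> span B ==> dir_deriv G x0 v = 0 ==> v = 0"
 obtains U' V H where "open_in B U'" "U' \<subseteq> U" "x0 \<in> U'"
  "open_in B V" "G x0 \<in> V" "homeomorphism U' V G H" "smooth_on B V H"
proof -
 let ?\<pi> = "proj_span B"
 define W where "W = ?\<pi> -` U"
 define K where "K x = G (?\<pi> x) + (x - ?\<pi> x)" for x
 have W: "open W" unfolding W_def using open_vimage_proj_span[OF U] .
 note oW = open_along_UNIV[OF W, of Basis]
 have UB: "U \<subseteq> span B" using U openin_imp_subset by blast
 have \<pi>U: "?\<pi> x = x" if "x \<in> U" for x using proj_span_id[OF B] UB that by blast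
 have UW: "U \<subseteq> W" using \<pi>U by (auto simp: W_def)
 have lin\<pi>: "linear ?\<pi>" using bounded_linear_proj_span bounded_linear.linear by blast
 have sK: "smooth_on Basis W K"
  unfolding K_def
 proof (intro smooth_on_add smooth_on_diff smooth_on_id oW)
  show "smooth_on Basis W (%x. G (?\<pi> x))"
   by (rule smooth_on_compose_span[OF subset_refl B oW U _ smooth_on_bounded_linear[OF oW bounded_linear_proj_span] G])
    (simp add: W_def)
  show "smooth_on Basis W ?\<pi>"
   by (rule smooth_on_bounded_linear[OF oW bounded_linear_proj_span])
 qed
 have C1: "Ck_on 1 B U G" using G by (rule smooth_on_Ck)
 have injK: "v = 0" if "(\<Sum>b\<in>Basis. (v \<bullet> b) *\<^sub>R dir_deriv K x0 b) = 0" for v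
 proof -
  have "((%t. G (x0 + t *\<^sub>R ?\<pi> v) + t *\<^sub>R (v - ?\<pi> v)) has_vector_derivative dir_deriv G x0 (?\<pi> v) + (v - ?\<pi> v)) (at 0)"
   using C1_dir_deriv(1)[OF B open_along_openin[OF U] C1 x0 proj_span_in[of B v]]
    has_vector_derivative_scaleR[OF DERIV_ident has_vector_derivative_const[of "v - ?\<pi> v"]]
   by (intro has_vector_derivative_add) auto
  moreover have "K (x0 + t *\<^sub>R v) = G (x0 + t *\<^sub>R ?\<pi> v) + t *\<^sub>R (v - ?\<pi> v)" for t
   using \<pi>U[OF x0] by (simp add: K_def linear_add[OF lin\<pi>] linear_cmul[OF lin\<pi>] scaleR_diff_right)
  ultimately have "dir_deriv K x0 v = dir_deriv G x0 (?\<pi> v) + (v - ?\<pi> v)"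
   by (intro dir_deriv_eqI) simp
  moreover have "dir_deriv K x0 v = 0"
   using C1_dir_deriv(2)[OF subset_refl oW smooth_on_Ck[OF sK], of x0 v] that x0 UW
   by (auto simp: span_Basis)
  ultimately have eq: "dir_deriv G x0 (?\<pi> v) + (v - ?\<pi> v) = 0" by simp
  have "dir_deriv G x0 (?\<pi> v) \<in> span B"
   by (rule dir_deriv_in_span[OF B open_along_openin[OF U] x0 proj_span_in C1_dir_deriv(1)[OF B open_along_openin[OF U] C1 x0 proj_span_in]])
    (use GB x0 in \<open>auto intro: span_diff\<close>)
  then have "?\<pi> (dir_deriv G x0 (?\<pi> v)) = dir_deriv G x0 (?\<pi> v)" using proj_span_id[OF B] by blast
  moreover have "?\<pi> (v - ?\<pi> v) = 0" using proj_span_id[OF B proj_span_in] by (simp add: linear_diff[OF lin\<pi>])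
  ultimately have "dir_deriv G x0 (?\<pi> v) = 0"
   using eq by (metis add.right_neutral lin\<pi> linear_0 linear_add)
  moreover from this have "v = ?\<pi> v" using eq by simp
  ultimately show "v = 0" using inj[of "?\<pi> v"] proj_span_in[of B v] by metis
 qed
 obtain U1 V1 H where H: "open U1" "U1 \<subseteq> W" "x0 \<in> U1" "open V1" "K x0 \<in> V1" "homeomorphism U1 V1 K H"
  "smooth_on Basis V1 H"
  by (rule smooth_inverse_function_open[OF W sK _ injK, of x0]) (use x0 UW in auto)
 have KU: "K x = G x" if "x \<in> U" for x using \<pi>U[OF that] by (simp add: K_def)
 have in_span: "x \<in> span B" if "x \<in> W" "K x \<in> span B" for x
 proof -
  have "G (?\<pi> x) \<in> span B" using that GB by (simp add: W_def)
  then have "x - ?\<pi> x \<in> span B" using that span_diff[of "K x" B "G (?\<pi> x)"] by (simp add: K_def)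
  then show ?thesis using span_add[OF _ proj_span_in[of B x]] by fastforce
 qed
 have WU: "W Int span B = U" using \<pi>U UW UB proj_span_id[OF B] by (auto simp: W_def)
 have hom: "homeomorphism (span B Int U1) (span B Int V1) G H"
 proof (rule homeomorphismI)
  have s: "span B Int U1 \<subseteq> U" using H(2) WU by blast
  show "continuous_on (span B Int U1) G"
   using Ck_on_continuous[OF C1] s continuous_on_subset by blast
  show "continuous_on (span B Int V1) H"
   by (rule continuous_on_subset[of V1]) (use H(6) in \<open>auto simp: homeomorphism_def\<close>)
  have K1: "K x \<in> V1" "H (K x) = x" if "x \<in> U1" for x
   using H(6) that unfolding homeomorphism_def by auto
  have H1: "H y \<in> U1" "K (H y) = y" if "y \<in> V1" for y
   using H(6) that unfolding homeomorphism_def by auto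
  show "G ` (span B Int U1) \<subseteq> span B Int V1"
  proof (rule image_subsetI)
   fix x assume "x \<in> span B Int U1"
   then show "G x \<in> span B Int V1" using s GB[of x] KU[of x] K1(1)[of x] by auto
  qed
  have HyB: "H y \<in> span B" if "y \<in> span B Int V1" for y
   using in_span[of "H y"] H1[of y] H(2) that by auto
  then show "H ` (span B Int V1) \<subseteq> span B Int U1" using H1(1) by blast
  show "H (G x) = x" if "x \<in> span B Int U1" for x
   using that s KU[of x] K1(2)[of x] by auto
  show "G (H y) = y" if "y \<in> span B Int V1" for y
   using that s KU[of "H y"] H1[of y] HyB[of y] by auto
 qed
 show ?thesis
 proof (rule that[OF _ _ _ _ _ hom])
  show "open_in B (span B Int U1)" "open_in B (span B Int V1)"
   using H by (auto simp: openin_open)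
  show "span B Int U1 \<subseteq> U" using H(2) WU by blast
  show "x0 \<in> span B Int U1" using H(3) x0 UB by blast
  show "G x0 \<in> span B Int V1" using H(5) KU[OF x0] GB[OF x0] by simp
  show "smooth_on B (span B Int V1) H"
   using H(7) Ck_on_mono_directions[OF _ B] Ck_on_subset unfolding smooth_on_def by blast
 qed
qed

section \<open>Differential equations with parameters: differentiability\<close>

text \<open>The square of the norm is differentiated; absorbing the mixed term costs the summand 1 in the growth rate.\<close>

lemma gronwall:
 fixes u :: "real => 'b::real_inner"
 assumes "!!t. t \<in> {0..1} ==> (u has_vector_derivative u' t) (at t within {0..1})"
  and "!!t. t \<in> {0..1} ==> norm (u' t) <= L * norm (u t) + y"
  and "L \<ge> 0" "y \<ge> 0" "t \<in> {0..1}"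
 shows "norm (u t) <= (norm (u 0) + y) * exp (L + 1)"
proof -
 define a where "a = 2 * L + 1"
 have a: "a \<ge> 0" using assms(3) by (simp add: a_def)
 define w where "w s = (u s \<bullet> u s + y\<^sup>2) * exp (- a * s)" for s
 define w' where "w' s = (2 * (u s \<bullet> u' s) - a * (u s \<bullet> u s + y\<^sup>2)) * exp (- a * s)" for s
 have der: "(w has_derivative (%h. h * w' s)) (at s within {0..t})" if "0 <= s" "s <= t" for s
 proof -
  have s: "s \<in> {0..1}" using that assms(5) by auto
  have "(u has_derivative (%h. h *\<^sub>R u' s)) (at s within {0..t})"
   by (rule has_derivative_subset[OF assms(1)[OF s, unfolded has_vector_derivative_def]])
    (use assms(5) in auto)
  then show ?thesis
   unfolding w_def w'_def
   by (auto intro!: derivative_eq_intros ext simp: algebra_simps inner_commute)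
 qed
 have "\<exists>s\<in>{0..t}. w t - w 0 = (%h. h * w' s) (t - 0)"
  using der assms(5) by (intro mvt_very_simple) auto
 then obtain s where s: "s \<in> {0..t}" "w t - w 0 = t * w' s" by auto
 have "w' s <= 0"
 proof -
  have s1: "s \<in> {0..1}" using s assms(5) by auto
  have "2 * (u s \<bullet> u' s) <= 2 * (norm (u s) * norm (u' s))"
   using norm_cauchy_schwarz[of "u s" "u' s"] by simp
  also have "... <= 2 * (norm (u s) * (L * norm (u s) + y))"
   using assms(2)[OF s1] by (simp add: mult_left_mono)
  also have "... <= a * ((norm (u s))\<^sup>2 + y\<^sup>2)"
  proof -
   have "0 <= (norm (u s) - y)\<^sup>2 + 2 * L * y\<^sup>2" using assms(3) by simp
   then show ?thesis by (simp add: a_def power2_eq_square algebra_simps)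
  qed
  finally show ?thesis unfolding w'_def power2_norm_eq_inner
   by (intro mult_nonpos_nonneg) auto
 qed
 then have "t * w' s <= 0" using assms(5) by (simp add: mult_nonneg_nonpos)
 then have "w t <= w 0" using s by linarith
 then have "((norm (u t))\<^sup>2 + y\<^sup>2) * exp (- a * t) <= (norm (u 0))\<^sup>2 + y\<^sup>2"
  by (simp add: w_def power2_norm_eq_inner)
 then have "(norm (u t))\<^sup>2 + y\<^sup>2 <= ((norm (u 0))\<^sup>2 + y\<^sup>2) * exp (a * t)"
  by (simp add: exp_minus field_simps)
 also have "... <= (norm (u 0) + y)\<^sup>2 * exp (2 * (L + 1))"
 proof (rule mult_mono)
  show "(norm (u 0))\<^sup>2 + y\<^sup>2 <= (norm (u 0) + y)\<^sup>2"
   using assms(4) by (simp add: power2_sum)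
  have "a * t <= a * 1" using assms(5) a by (intro mult_left_mono) auto
  then show "exp (a * t) <= exp (2 * (L + 1))" by (simp add: a_def)
 qed auto
 also have "... = ((norm (u 0) + y) * exp (L + 1))\<^sup>2"
  unfolding exp_double by (simp add: power_mult_distrib)
 finally have "(norm (u t))\<^sup>2 <= ((norm (u 0) + y) * exp (L + 1))\<^sup>2"
  using zero_le_power2[of y] by linarith
 then show ?thesis using assms(4) by (simp add: power2_le_iff_abs_le)
qed

text \<open>Directions of differentiation on \<open>{0..1} \<times> V\<close> and \<open>{0..1} \<times> V \<times> W\<close>: the time coordinate comes first and is never
differentiated, so that closed time intervals cause no trouble.\<close>

definition pdirs :: "'a::euclidean_space set => (real \<times> 'a) set" where
 "pdirs B = (%b. (0, b)) ` B"

definition sdirs :: "'a::euclidean_space set => (real \<times> 'a \<times> 'b::euclidean_space) set" where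
 "sdirs B = (%b. (0, b, 0)) ` B \<union> (%c. (0, 0, c)) ` Basis"

lemma pdirs_Basis: "B \<subseteq> Basis ==> pdirs B \<subseteq> Basis"
 unfolding pdirs_def Basis_prod_def by auto

lemma sdirs_Basis: "B \<subseteq> Basis ==> sdirs B \<subseteq> Basis"
 unfolding sdirs_def Basis_prod_def by auto

lemma span_pdirs: "v \<in> span (pdirs B) \<longleftrightarrow> fst v = 0 & snd v \<in> span B"
proof -
 have "linear (%b::'a. (0::real, b))" by (auto intro!: linearI)
 from span_linear_image[OF this] show ?thesis
  unfolding pdirs_def by (cases v) auto
qed

lemma span_sdirs: "v \<in> span (sdirs B :: (real \<times> 'a::euclidean_space \<times> 'b::euclidean_space) set)
  \<longleftrightarrow> fst v = 0 & fst (snd v) \<in> span B"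
proof
 assume "v \<in> span (sdirs B)"
 then show "fst v = 0 & fst (snd v) \<in> span B"
 proof (induction rule: span_induct)
  case base
  show ?case by (auto simp: subspace_def span_add span_scale span_zero)
 next
  case (step x)
  then show ?case by (auto simp: sdirs_def span_base span_zero)
 qed
next
 assume *: "fst v = 0 & fst (snd v) \<in> span B"
 have l1: "linear (%b::'a. (0::real, b, 0::'b))" and l2: "linear (%c::'b. (0::real, 0::'a, c))"
  by (auto intro!: linearI)
 have "(0::real, fst (snd v), 0::'b) \<in> span ((%b. (0, b, 0)) ` B)"
  by (subst span_linear_image[OF l1]) (use * in auto)
 then have 1: "(0, fst (snd v), 0) \<in> span (sdirs B :: (real \<times> 'a \<times> 'b) set)"
  unfolding sdirs_def using span_mono by (metis (no_types, lifting) Un_upper1 subsetD)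
 have "(0::real, 0::'a, snd (snd v)) \<in> span ((%c. (0, 0, c)) ` Basis)"
  using span_linear_image[OF l2, of Basis] by (auto simp: span_Basis)
 then have 2: "(0, 0, snd (snd v)) \<in> span (sdirs B :: (real \<times> 'a \<times> 'b) set)"
  unfolding sdirs_def using span_mono by (metis (no_types, lifting) Un_upper2 subsetD)
 show "v \<in> span (sdirs B)" using span_add[OF 1 2] * by (cases v) auto
qed

lemma open_along_pdirs:
 assumes "open_along B V"
 shows "open_along (pdirs B) ({0..1::real} \<times> V)"
proof -
 obtain S G where S: "V = S Int G" "open G" "\<forall>s\<in>S. \<forall>v\<in>span B. s + v \<in> S"
  using assms unfolding open_along_def by blast
 show ?thesis unfolding open_along_def
  by (intro exI[of _ "{0..1} \<times> S"] exI[of _ "UNIV \<times> G"])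
   (use S in \<open>auto simp: span_pdirs open_Times\<close>)
qed

lemma open_along_sdirs:
 assumes "open_along B V" "open W"
 shows "open_along (sdirs B) ({0..1::real} \<times> V \<times> (W :: 'b::euclidean_space set))"
proof -
 obtain S G where S: "V = S Int G" "open G" "\<forall>s\<in>S. \<forall>v\<in>span B. s + v \<in> S"
  using assms unfolding open_along_def by blast
 show ?thesis unfolding open_along_def
  by (intro exI[of _ "{0..1} \<times> S \<times> UNIV"] exI[of _ "UNIV \<times> G \<times> W"])
   (use S assms(2) in \<open>auto simp: span_sdirs open_Times\<close>)
qed

lemma compact_bounded_norm:
 fixes f :: "'a::metric_space => 'b::real_normed_vector"
 assumes "compact K" "continuous_on K f"
 obtains M where "M \<ge> 0" "!!x. x \<in> K ==> norm (f x) <= M"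
proof -
 have "bounded (f ` K)" using assms compact_continuous_image compact_imp_bounded by blast
 then obtain M where "M > 0" "!!x. x \<in> K ==> norm (f x) <= M" unfolding bounded_pos by auto
 then show ?thesis using that[of M] by auto
qed

text \<open>For \<open>C\<^sup>1\<close> functions this is the derivative; written as a sum it is linear for arbitrary \<open>f\<close>.\<close>

definition lin_part :: "'a::euclidean_space set => ('a => 'b::real_normed_vector) => 'a => 'a => 'b" where
 "lin_part B f x v = (\<Sum>b\<in>B. (v \<bullet> b) *\<^sub>R dir_deriv f x b)"

lemma linear_lin_part: "linear (lin_part B f x)"
 unfolding lin_part_def
 by (intro bounded_linear.linear bounded_linear_sum bounded_linear_scaleR_const bounded_linear_inner_left)

lemma lin_part_bound:
 fixes f :: "'a::euclidean_space => 'b::real_normed_vector"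
 assumes "B \<subseteq> Basis" "Ck_on 1 B U f" "compact K" "K \<subseteq> U"
 obtains M where "M \<ge> 0" "!!x v. x \<in> K ==> norm (lin_part B f x v) <= M * norm v"
proof -
 have "\<exists>M\<ge>0. \<forall>x\<in>K. norm (dir_deriv f x b) <= M" if "b \<in> B" for b
 proof -
  have "continuous_on K (%x. dir_deriv f x b)"
   using assms that by (auto intro: continuous_on_subset)
  from compact_bounded_norm[OF assms(3) this] show ?thesis by metis
 qed
 then obtain m where m: "!!b. b \<in> B ==> m b \<ge> 0" "!!b x. b \<in> B ==> x \<in> K ==> norm (dir_deriv f x b) <= m b"
  by metis
 show ?thesis
 proof
  show "0 <= (\<Sum>b\<in>B. m b)" using m by (intro sum_nonneg) auto
  fix x v assume x: "x \<in> K"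
  have "norm (lin_part B f x v) <= (\<Sum>b\<in>B. m b * norm v)"
   unfolding lin_part_def
  proof (rule sum_norm_le)
   fix b assume b: "b \<in> B"
   have "norm ((v \<bullet> b) *\<^sub>R dir_deriv f x b) = \<bar>v \<bullet> b\<bar> * norm (dir_deriv f x b)" by simp
   also have "... <= norm v * m b"
    using m[OF b] x Basis_le_norm[of b v] b assms(1) by (intro mult_mono) auto
   finally show "norm ((v \<bullet> b) *\<^sub>R dir_deriv f x b) <= m b * norm v" by (simp add: mult.commute)
  qed
  then show "norm (lin_part B f x v) <= (\<Sum>b\<in>B. m b) * norm v" by (simp add: sum_distrib_right)
 qed
qed

lemma lin_part_base:
 assumes "B \<subseteq> Basis" "b \<in> B"
 shows "lin_part B f x b = dir_deriv f x b"
proof -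
 have "lin_part B f x b = (\<Sum>c\<in>B. if c = b then dir_deriv f x c else 0)"
  unfolding lin_part_def using assms by (intro sum.cong) (auto simp: inner_Basis subset_iff)
 then show ?thesis using assms finite_Basis_subset[OF assms(1)] by simp
qed

text \<open>Gronwall's inequality bounds the difference quotients in the parameter; the Taylor estimate then shows that
they solve the variational equation up to an arbitrarily small error, uniformly near \<open>x0\<close>.\<close>

lemma variation_estimates:
 fixes X :: "real \<times> 'a::euclidean_space \<times> 'b::euclidean_space => 'b" and Z :: "real \<times> 'a => 'b"
 assumes B: "B \<subseteq> Basis" and V: "open_in B V" and W: "open W"
  and X: "Ck_on 1 (sdirs B) ({0..1} \<times> V \<times> W) X"
  and cont: "continuous_on ({0..1} \<times> V) Z"
  and ZW: "!!t x. t \<in> {0..1} ==> x \<in> V ==> Z (t, x) \<in> W"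
  and ode: "!!t x. t \<in> {0..1} ==> x \<in> V ==>
   ((%t. Z (t, x)) has_vector_derivative X (t, x, Z (t, x))) (at t within {0..1})"
  and init: "Ck_on 1 B V (%x. Z (0, x))"
  and b: "b \<in> B" and x0: "x0 \<in> V"
 obtains r M where "r > 0" "M \<ge> 0" "cball x0 r Int span B \<subseteq> V"
  "!!t x v. t \<in> {0..1} ==> x \<in> cball x0 r Int span B ==>
    norm (lin_part (sdirs B) X (t, x, Z (t, x)) v) <= M * norm v"
  "!!e. e > 0 ==> \<exists>y>0. \<forall>x\<in>cball x0 r Int span B. \<forall>h. 0 < \<bar>h\<bar> & \<bar>h\<bar> < y -->
    x + h *\<^sub>R b \<in> V &
    norm ((Z (0, x + h *\<^sub>R b) - Z (0, x)) /\<^sub>R h - dir_deriv (%x. Z (0, x)) x b) <= e &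
    (\<forall>t\<in>{0..1}. norm ((X (t, x + h *\<^sub>R b, Z (t, x + h *\<^sub>R b)) - X (t, x, Z (t, x))) /\<^sub>R h
      - lin_part (sdirs B) X (t, x, Z (t, x)) (0, b, (Z (t, x + h *\<^sub>R b) - Z (t, x)) /\<^sub>R h)) <= e)"
proof -
 define \<Omega> where "\<Omega> = {0..1::real} \<times> V \<times> W"
 have VB: "V \<subseteq> span B" using V openin_imp_subset by blast
 note oV = open_along_openin[OF V]
 have o\<Omega>: "open_along (sdirs B) \<Omega>" unfolding \<Omega>_def by (rule open_along_sdirs[OF oV W])
 have bB: "b \<in> span B" using b by (rule span_base)
 have nb: "norm b = 1" using b B by auto
 obtain r where r: "r > 0" "!!v. v \<in> span B ==> norm v <= r ==> x0 + v \<in> V"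
  using open_along_radius_point[OF oV x0] by blast
 define K0 where "K0 = cball x0 r Int span B"
 define K where "K = cball x0 (r / 2) Int span B"
 have K0V: "K0 \<subseteq> V"
 proof
  fix x assume "x \<in> K0"
  then have "x0 + (x - x0) \<in> V"
   using VB x0 by (intro r) (auto simp: K0_def dist_norm norm_minus_commute intro: span_diff)
  then show "x \<in> V" by simp
 qed
 have compK: "compact K0" "compact K" unfolding K0_def K_def by (auto intro!: compact_Int_closed)
 have KK0: "K \<subseteq> K0" unfolding K_def K0_def using r(1) by auto
 have KV: "K \<subseteq> V" using KK0 K0V by blast
 have shift: "x + h *\<^sub>R b \<in> K0" if "x \<in> K" "\<bar>h\<bar> <= r / 2" for x h
 proof -
  have "norm (x0 - (x + h *\<^sub>R b)) <= norm (x0 - x) + norm (h *\<^sub>R b)"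
   by (metis diff_diff_eq norm_triangle_ineq4)
  then show ?thesis using that nb bB by (auto simp: K_def K0_def dist_norm intro: span_add span_scale)
 qed
 define tube where "tube = (%p. (fst p, snd p, Z p)) ` ({0..1} \<times> K)"
 have ct: "compact tube"
  unfolding tube_def using cont KV compK(2)
  by (intro compact_continuous_image compact_Times compact_Icc)
   (auto intro!: continuous_intros elim: continuous_on_subset)
 have tube\<Omega>: "tube \<subseteq> \<Omega>" unfolding tube_def \<Omega>_def using KV ZW by auto
 have tubeI: "(t, x, Z (t, x)) \<in> tube" if "t \<in> {0..1}" "x \<in> K" for t x
  unfolding tube_def using that by force
 have X': "Ck_on 1 (sdirs B) \<Omega> X" using X unfolding \<Omega>_def .
 obtain M where M: "M \<ge> 0" "!!p v. p \<in> tube ==> norm (lin_part (sdirs B) X p v) <= M * norm v"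
  using lin_part_bound[OF sdirs_Basis[OF B] X' ct tube\<Omega>] by blast
 \<comment> \<open>first-order expansion of X along the perturbation, uniformly in time\<close>
 have S: "\<exists>y>0. \<forall>x\<in>K. \<forall>h. \<bar>h\<bar> < y --> (\<forall>t\<in>{0..1}.
   norm (X (t, x + h *\<^sub>R b, Z (t, x + h *\<^sub>R b)) - X (t, x, Z (t, x))
    - lin_part (sdirs B) X (t, x, Z (t, x)) (0, h *\<^sub>R b, Z (t, x + h *\<^sub>R b) - Z (t, x)))
   <= e * (\<bar>h\<bar> + norm (Z (t, x + h *\<^sub>R b) - Z (t, x))))" if e: "e > 0" for e
 proof -
  obtain A where A: "A > 0" "!!p v. p \<in> tube ==> v \<in> span (sdirs B) ==> norm v <= A ==> p + v \<in> \<Omega> &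
    norm (X (p + v) - X p - (\<Sum>d\<in>sdirs B. (v \<bullet> d) *\<^sub>R dir_deriv X p d)) <= e * norm v"
   by (rule uniform_taylor[OF sdirs_Basis[OF B] o\<Omega> X' ct tube\<Omega> e]) blast
  have "uniformly_continuous_on ({0..1} \<times> K0) Z"
   using cont K0V compK(1)
   by (intro compact_uniformly_continuous compact_Times compact_Icc) (auto elim: continuous_on_subset)
  then obtain d where d: "d > 0" "!!p q. p \<in> {0..1} \<times> K0 ==> q \<in> {0..1} \<times> K0 ==> dist q p < d ==> dist (Z q) (Z p) < A / 2"
   unfolding uniformly_continuous_on_def using A(1) by (meson half_gt_zero)
  define y where "y = min (r / 2) (min d (A / 2))"
  show ?thesis
  proof (intro exI[of _ y] conjI ballI allI impI)
   show "y > 0" using r(1) d(1) A(1) by (simp add: y_def)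
   fix x h t assume x: "x \<in> K" and h: "\<bar>h\<bar> < y" and t: "t \<in> {0..1::real}"
   define E where "E = Z (t, x + h *\<^sub>R b) - Z (t, x)"
   have "norm E < A / 2"
    using d(2)[of "(t, x)" "(t, x + h *\<^sub>R b)"] t x KK0 shift[OF x, of h] h nb
    by (auto simp: E_def dist_norm y_def norm_Pair)
   moreover have nv: "norm (0::real, h *\<^sub>R b, E) <= \<bar>h\<bar> + norm E"
    using norm_Pair_le[of "0::real" "(h *\<^sub>R b, E)"] norm_Pair_le[of "h *\<^sub>R b" E] nb by auto
   ultimately have "norm (0::real, h *\<^sub>R b, E) <= A" using h by (simp add: y_def)
   moreover have "(0, h *\<^sub>R b, E) \<in> span (sdirs B)" using bB by (simp add: span_sdirs span_scale)
   ultimately have "norm (X ((t, x, Z (t, x)) + (0, h *\<^sub>R b, E)) - X (t, x, Z (t, x))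
     - lin_part (sdirs B) X (t, x, Z (t, x)) (0, h *\<^sub>R b, E)) <= e * norm (0::real, h *\<^sub>R b, E)"
    using A(2)[OF tubeI[OF t x]] unfolding lin_part_def by blast
   also have "... <= e * (\<bar>h\<bar> + norm E)" using nv e by (intro mult_left_mono) auto
   finally show "norm (X (t, x + h *\<^sub>R b, Z (t, x + h *\<^sub>R b)) - X (t, x, Z (t, x))
    - lin_part (sdirs B) X (t, x, Z (t, x)) (0, h *\<^sub>R b, Z (t, x + h *\<^sub>R b) - Z (t, x)))
   <= e * (\<bar>h\<bar> + norm (Z (t, x + h *\<^sub>R b) - Z (t, x)))"
    by (simp add: E_def)
  qed
 qed
 have S0: "\<exists>y>0. \<forall>x\<in>K. \<forall>h. \<bar>h\<bar> < y -->
   norm (Z (0, x + h *\<^sub>R b) - Z (0, x) - h *\<^sub>R dir_deriv (%x. Z (0, x)) x b) <= e * \<bar>h\<bar>" if e: "e > 0" for e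
 proof -
  obtain A where A: "A > 0" "!!p v. p \<in> K ==> v \<in> span B ==> norm v <= A ==> p + v \<in> V &
    norm (Z (0, p + v) - Z (0, p) - (\<Sum>d\<in>B. (v \<bullet> d) *\<^sub>R dir_deriv (%x. Z (0, x)) p d)) <= e * norm v"
   by (rule uniform_taylor[OF B oV init compK(2) KV e]) blast
  show ?thesis
  proof (intro exI[of _ A] conjI ballI allI impI)
   fix x h assume x: "x \<in> K" and h: "\<bar>h\<bar> < A"
   have "(\<Sum>d\<in>B. ((h *\<^sub>R b) \<bullet> d) *\<^sub>R dir_deriv (%x. Z (0, x)) x d) = h *\<^sub>R lin_part B (%x. Z (0, x)) x b"
    by (simp add: lin_part_def scaleR_sum_right)
   then show "norm (Z (0, x + h *\<^sub>R b) - Z (0, x) - h *\<^sub>R dir_deriv (%x. Z (0, x)) x b) <= e * \<bar>h\<bar>"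
    using A(2)[OF x span_scale[OF bB], of h] h nb lin_part_base[OF B b, of "%x. Z (0, x)" x] by auto
  qed (use A in auto)
 qed
 have "continuous_on K (%x. dir_deriv (%x. Z (0, x)) x b)"
  using init b KV by (auto intro: continuous_on_subset)
 then obtain N where N: "N \<ge> 0" "!!x. x \<in> K ==> norm (dir_deriv (%x. Z (0, x)) x b) <= N"
  using compact_bounded_norm[OF compK(2)] by blast
 define C where "C = (N + 1 + (M + 1)) * exp (M + 1 + 1)"
 have C: "C \<ge> 0" unfolding C_def using N M by simp
 obtain y1 where y1: "y1 > 0" "!!x h t. x \<in> K ==> \<bar>h\<bar> < y1 ==> t \<in> {0..1} ==>
   norm (X (t, x + h *\<^sub>R b, Z (t, x + h *\<^sub>R b)) - X (t, x, Z (t, x))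
    - lin_part (sdirs B) X (t, x, Z (t, x)) (0, h *\<^sub>R b, Z (t, x + h *\<^sub>R b) - Z (t, x)))
   <= 1 * (\<bar>h\<bar> + norm (Z (t, x + h *\<^sub>R b) - Z (t, x)))"
  using S[of 1] zero_less_one by blast
 obtain y0 where y0: "y0 > 0" "!!x h. x \<in> K ==> \<bar>h\<bar> < y0 ==>
   norm (Z (0, x + h *\<^sub>R b) - Z (0, x) - h *\<^sub>R dir_deriv (%x. Z (0, x)) x b) <= 1 * \<bar>h\<bar>"
  using S0[of 1] zero_less_one by blast
 have Lip: "norm (Z (t, x + h *\<^sub>R b) - Z (t, x)) <= C * \<bar>h\<bar>"
  if x: "x \<in> K" and h: "\<bar>h\<bar> < y1" "\<bar>h\<bar> < y0" "\<bar>h\<bar> <= r / 2" and t: "t \<in> {0..1}" for x h t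
 proof -
  let ?u = "%t. Z (t, x + h *\<^sub>R b) - Z (t, x)"
  have xV: "x \<in> V" "x + h *\<^sub>R b \<in> V" using x KV shift[OF x h(3)] K0V by auto
  have "norm (?u t) <= (norm (?u 0) + (M + 1) * \<bar>h\<bar>) * exp ((M + 1) + 1)"
  proof (rule gronwall[OF _ _ _ _ t])
   fix s assume s: "s \<in> {0..1::real}"
   show "(?u has_vector_derivative X (s, x + h *\<^sub>R b, Z (s, x + h *\<^sub>R b)) - X (s, x, Z (s, x))) (at s within {0..1})"
    by (intro has_vector_derivative_diff ode s xV)
   have n: "norm (0::real, h *\<^sub>R b, ?u s) <= \<bar>h\<bar> + norm (?u s)"
    using norm_Pair_le[of "0::real" "(h *\<^sub>R b, ?u s)"] norm_Pair_le[of "h *\<^sub>R b" "?u s"] nb by auto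
   have "norm (lin_part (sdirs B) X (s, x, Z (s, x)) (0, h *\<^sub>R b, ?u s)) <= M * (\<bar>h\<bar> + norm (?u s))"
    using M(2)[OF tubeI[OF s x], of "(0, h *\<^sub>R b, ?u s)"] mult_left_mono[OF n M(1)] by linarith
   then have "norm (X (s, x + h *\<^sub>R b, Z (s, x + h *\<^sub>R b)) - X (s, x, Z (s, x)))
     <= M * (\<bar>h\<bar> + norm (?u s)) + (\<bar>h\<bar> + norm (?u s))"
    using y1(2)[OF x h(1) s] norm_triangle_sub by (smt (verit))
   then show "norm (X (s, x + h *\<^sub>R b, Z (s, x + h *\<^sub>R b)) - X (s, x, Z (s, x)))
    <= (M + 1) * norm (?u s) + (M + 1) * \<bar>h\<bar>" by (simp add: algebra_simps)
  qed (use M in auto)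
  also have "... <= (((N + 1) * \<bar>h\<bar>) + (M + 1) * \<bar>h\<bar>) * exp ((M + 1) + 1)"
  proof (intro mult_right_mono add_right_mono)
   have "norm (h *\<^sub>R dir_deriv (%x. Z (0, x)) x b) <= N * \<bar>h\<bar>"
    using mult_left_mono[OF N(2)[OF x], of "\<bar>h\<bar>"] by (simp add: mult.commute)
   then show "norm (?u 0) <= (N + 1) * \<bar>h\<bar>"
    using y0(2)[OF x h(2)] norm_triangle_sub[of "?u 0" "h *\<^sub>R dir_deriv (%x. Z (0, x)) x b"]
    by (simp add: algebra_simps)
  qed auto
  also have "... = C * \<bar>h\<bar>" unfolding C_def by (simp add: algebra_simps)
  finally show ?thesis .
 qed
 show ?thesis
 proof (rule that[of "r / 2" M])
  show "0 < r / 2" "0 <= M" using r(1) M(1) by auto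
  show "cball x0 (r / 2) Int span B \<subseteq> V" using KV unfolding K_def .
  show "norm (lin_part (sdirs B) X (t, x, Z (t, x)) v) <= M * norm v"
   if "t \<in> {0..1}" "x \<in> cball x0 (r / 2) Int span B" for t x v
   using M(2)[OF tubeI] that unfolding K_def by blast
  fix e :: real assume e: "e > 0"
  have e': "e / (1 + C) > 0" using e C by simp
  obtain y2 where y2: "y2 > 0" "!!x h t. x \<in> K ==> \<bar>h\<bar> < y2 ==> t \<in> {0..1} ==>
   norm (X (t, x + h *\<^sub>R b, Z (t, x + h *\<^sub>R b)) - X (t, x, Z (t, x))
    - lin_part (sdirs B) X (t, x, Z (t, x)) (0, h *\<^sub>R b, Z (t, x + h *\<^sub>R b) - Z (t, x)))
   <= (e / (1 + C)) * (\<bar>h\<bar> + norm (Z (t, x + h *\<^sub>R b) - Z (t, x)))"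
   using S[OF e'] by blast
  obtain y3 where y3: "y3 > 0" "!!x h. x \<in> K ==> \<bar>h\<bar> < y3 ==>
   norm (Z (0, x + h *\<^sub>R b) - Z (0, x) - h *\<^sub>R dir_deriv (%x. Z (0, x)) x b) <= e * \<bar>h\<bar>"
   using S0[OF e] by blast
  define y where "y = Min {y0, y1, y2, y3, r / 2}"
  show "\<exists>y>0. \<forall>x\<in>cball x0 (r / 2) Int span B. \<forall>h. 0 < \<bar>h\<bar> & \<bar>h\<bar> < y -->
    x + h *\<^sub>R b \<in> V &
    norm ((Z (0, x + h *\<^sub>R b) - Z (0, x)) /\<^sub>R h - dir_deriv (%x. Z (0, x)) x b) <= e &
    (\<forall>t\<in>{0..1}. norm ((X (t, x + h *\<^sub>R b, Z (t, x + h *\<^sub>R b)) - X (t, x, Z (t, x))) /\<^sub>R h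
      - lin_part (sdirs B) X (t, x, Z (t, x)) (0, b, (Z (t, x + h *\<^sub>R b) - Z (t, x)) /\<^sub>R h)) <= e)"
  proof (intro exI[of _ y] conjI ballI allI impI; (elim conjE)?)
   show "y > 0" using y0 y1 y2 y3 r by (simp add: y_def)
   fix x h assume x: "x \<in> cball x0 (r / 2) Int span B" and h: "0 < \<bar>h\<bar>" "\<bar>h\<bar> < y"
   have xK: "x \<in> K" using x unfolding K_def .
   have hs: "\<bar>h\<bar> < y0" "\<bar>h\<bar> < y1" "\<bar>h\<bar> < y2" "\<bar>h\<bar> < y3" "\<bar>h\<bar> <= r / 2" using h(2) by (auto simp: y_def)
   show "x + h *\<^sub>R b \<in> V" using shift[OF xK hs(5)] K0V by blast
   have nz: "h ~= 0" using h by auto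
   have scale: "norm (w /\<^sub>R h) <= c" if "norm w <= c * \<bar>h\<bar>" for w :: 'b and c
    using that h(1) by (simp add: field_simps)
   have "(Z (0, x + h *\<^sub>R b) - Z (0, x)) /\<^sub>R h - dir_deriv (%x. Z (0, x)) x b
     = (Z (0, x + h *\<^sub>R b) - Z (0, x) - h *\<^sub>R dir_deriv (%x. Z (0, x)) x b) /\<^sub>R h"
    using nz by (simp add: scaleR_diff_right)
   then show "norm ((Z (0, x + h *\<^sub>R b) - Z (0, x)) /\<^sub>R h - dir_deriv (%x. Z (0, x)) x b) <= e"
    using scale[OF y3(2)[OF xK hs(4)]] by simp
   fix t assume t: "t \<in> {0..1::real}"
   define E where "E = Z (t, x + h *\<^sub>R b) - Z (t, x)"
   let ?L = "lin_part (sdirs B) X (t, x, Z (t, x))"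
   have "(e / (1 + C)) * (\<bar>h\<bar> + norm E) <= (e / (1 + C)) * (\<bar>h\<bar> + C * \<bar>h\<bar>)"
    using Lip[OF xK hs(2,1,5) t] e' unfolding E_def by (intro mult_left_mono) auto
   also have "... = e * \<bar>h\<bar>" using C by (simp add: field_simps)
   finally have "norm (X (t, x + h *\<^sub>R b, Z (t, x + h *\<^sub>R b)) - X (t, x, Z (t, x)) - ?L (0, h *\<^sub>R b, E)) <= e * \<bar>h\<bar>"
    using y2(2)[OF xK hs(3) t] unfolding E_def by linarith
   from scale[OF this]
   have "norm ((X (t, x + h *\<^sub>R b, Z (t, x + h *\<^sub>R b)) - X (t, x, Z (t, x)) - ?L (0, h *\<^sub>R b, E)) /\<^sub>R h) <= e" .
   moreover have "?L (0, h *\<^sub>R b, E) /\<^sub>R h = ?L (0, b, E /\<^sub>R h)"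
    using nz by (simp flip: linear_cmul[OF linear_lin_part])
   ultimately show "norm ((X (t, x + h *\<^sub>R b, Z (t, x + h *\<^sub>R b)) - X (t, x, Z (t, x))) /\<^sub>R h
      - ?L (0, b, (Z (t, x + h *\<^sub>R b) - Z (t, x)) /\<^sub>R h)) <= e"
    unfolding E_def by (simp add: scaleR_diff_right)
  qed
 qed
qed

text \<open>Approximate solutions of the same linear equation are close, so the difference quotients form a uniform Cauchy
family. Their limit is the derivative, and it solves the variational equation; no existence theorem
for linear equations is used.\<close>

lemma ODE_variation:
 fixes X :: "real \<times> 'a::euclidean_space \<times> 'b::euclidean_space => 'b" and Z :: "real \<times> 'a => 'b"
 assumes B: "B \<subseteq> Basis" and V: "open_in B V" and W: "open W"
  and X: "Ck_on 1 (sdirs B) ({0..1} \<times> V \<times> W) X"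
  and cont: "continuous_on ({0..1} \<times> V) Z"
  and ZW: "!!t x. t \<in> {0..1} ==> x \<in> V ==> Z (t, x) \<in> W"
  and ode: "!!t x. t \<in> {0..1} ==> x \<in> V ==>
   ((%t. Z (t, x)) has_vector_derivative X (t, x, Z (t, x))) (at t within {0..1})"
  and init: "Ck_on 1 B V (%x. Z (0, x))"
  and b: "b \<in> B" 
 defines "Q \<equiv> %p. dir_deriv Z p (0, b)"
 shows "!!t x. t \<in> {0..1} ==> x \<in> V ==>
    ((%h. Z ((t, x) + h *\<^sub>R (0, b))) has_vector_derivative Q (t, x)) (at 0)"
  and "continuous_on ({0..1} \<times> V) Q"
  and "!!t x. t \<in> {0..1} ==> x \<in> V ==> ((%t. Q (t, x)) has_vector_derivative
    lin_part (sdirs B) X (t, x, Z (t, x)) (0, b, Q (t, x))) (at t within {0..1})"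
proof -
 have VB: "V \<subseteq> span B" using V openin_imp_subset by blast
 have near: "\<exists>r>0. (\<forall>t\<in>{0..1}. \<forall>x\<in>cball x0 r Int span B.
    ((%h. Z ((t, x) + h *\<^sub>R (0, b))) has_vector_derivative Q (t, x)) (at 0) &
    ((%t. Q (t, x)) has_vector_derivative
    lin_part (sdirs B) X (t, x, Z (t, x)) (0, b, Q (t, x))) (at t within {0..1})) &
   continuous_on ({0..1} \<times> (cball x0 r Int span B)) Q" if x0: "x0 \<in> V" for x0
 proof -
  obtain r M where r: "r > 0" "cball x0 r Int span B \<subseteq> V" and M: "M \<ge> 0"
   "!!t x v. t \<in> {0..1} ==> x \<in> cball x0 r Int span B ==>
    norm (lin_part (sdirs B) X (t, x, Z (t, x)) v) <= M * norm v" and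
  est: "!!e. e > 0 ==> \<exists>y>0. \<forall>x\<in>cball x0 r Int span B. \<forall>h. 0 < \<bar>h\<bar> & \<bar>h\<bar> < y -->
    x + h *\<^sub>R b \<in> V &
    norm ((Z (0, x + h *\<^sub>R b) - Z (0, x)) /\<^sub>R h - dir_deriv (%x. Z (0, x)) x b) <= e &
    (\<forall>t\<in>{0..1}. norm ((X (t, x + h *\<^sub>R b, Z (t, x + h *\<^sub>R b)) - X (t, x, Z (t, x))) /\<^sub>R h
      - lin_part (sdirs B) X (t, x, Z (t, x)) (0, b, (Z (t, x + h *\<^sub>R b) - Z (t, x)) /\<^sub>R h)) <= e)"
   by (rule variation_estimates[OF B V W X cont ZW ode init b x0]) blast+
  define K where "K = cball x0 r Int span B"
  have KV: "K \<subseteq> V" using r(2) by (simp add: K_def)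
  define L where "L t x = lin_part (sdirs B) X (t, x, Z (t, x))" for t x
  have linL: "linear (L t x)" for t x unfolding L_def by (rule linear_lin_part)
  have LM: "norm (L t x v) <= M * norm v" if "t \<in> {0..1}" "x \<in> K" for t x v
   using M(2)[OF that(1)] that(2) unfolding L_def K_def by blast
  have Ldiff: "norm (L t x (0, b, v) - L t x (0, b, w)) <= M * norm (v - w)" if "t \<in> {0..1}" "x \<in> K" for t x v w
  proof -
   have "L t x (0, b, v) - L t x (0, b, w) = L t x (0, 0, v - w)"
    by (simp flip: linear_diff[OF linL])
   then show ?thesis using LM[OF that, of "(0, 0, v - w)"] by (simp add: norm_Pair)
  qed
  define D where "D h x t = (Z (t, x + h *\<^sub>R b) - Z (t, x)) /\<^sub>R h" for h x t
  define DX where "DX h x t = (X (t, x + h *\<^sub>R b, Z (t, x + h *\<^sub>R b)) - X (t, x, Z (t, x))) /\<^sub>R h" for h x t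
  have est': "\<exists>y>0. \<forall>x\<in>K. \<forall>h. 0 < \<bar>h\<bar> & \<bar>h\<bar> < y --> x + h *\<^sub>R b \<in> V &
    norm (D h x 0 - dir_deriv (%x. Z (0, x)) x b) <= e &
    (\<forall>t\<in>{0..1}. norm (DX h x t - L t x (0, b, D h x t)) <= e)" if "e > 0" for e
   using est[OF that] unfolding D_def DX_def L_def K_def .
  have est_V: "\<exists>y>0. \<forall>x\<in>K. \<forall>h. 0 < \<bar>h\<bar> & \<bar>h\<bar> < y --> x + h *\<^sub>R b \<in> V"
  proof -
   from est'[OF zero_less_one] obtain y where y: "y > 0"
    and all: "\<forall>x\<in>K. \<forall>h. 0 < \<bar>h\<bar> & \<bar>h\<bar> < y --> x + h *\<^sub>R b \<in> V &
     norm (D h x 0 - dir_deriv (%x. Z (0, x)) x b) <= 1 &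
     (\<forall>t\<in>{0..1}. norm (DX h x t - L t x (0, b, D h x t)) <= 1)"
    by (elim exE conjE)
   show ?thesis using all by (intro exI[of _ y] conjI ballI allI impI y) simp
  qed
  have derD: "(D h x has_vector_derivative DX h x t) (at t within {0..1})"
   if "x \<in> K" "x + h *\<^sub>R b \<in> V" "t \<in> {0..1}" for h x t
  proof -
   have "((%t. Z (t, x + h *\<^sub>R b) - Z (t, x)) has_vector_derivative
     X (t, x + h *\<^sub>R b, Z (t, x + h *\<^sub>R b)) - X (t, x, Z (t, x))) (at t within {0..1})"
    using that KV by (intro has_vector_derivative_diff ode) auto
   from bounded_linear.has_vector_derivative[OF bounded_linear_scaleR_right this, of "inverse h"]
   show ?thesis unfolding D_def DX_def .
  qed
  have Cauchy: "\<exists>y>0. \<forall>x\<in>K. \<forall>h k. 0 < \<bar>h\<bar> & \<bar>h\<bar> < y & 0 < \<bar>k\<bar> & \<bar>k\<bar> < y -->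
    (\<forall>t\<in>{0..1}. norm (D h x t - D k x t) <= e)" if e: "e > 0" for e
  proof -
   define e' where "e' = e / (4 * exp (M + 1))"
   have e': "e' > 0" using e by (simp add: e'_def)
   obtain y where y: "y > 0" "!!x h. x \<in> K ==> 0 < \<bar>h\<bar> ==> \<bar>h\<bar> < y ==> x + h *\<^sub>R b \<in> V"
    "!!x h. x \<in> K ==> 0 < \<bar>h\<bar> ==> \<bar>h\<bar> < y ==> norm (D h x 0 - dir_deriv (%x. Z (0, x)) x b) <= e'"
    "!!x h t. x \<in> K ==> 0 < \<bar>h\<bar> ==> \<bar>h\<bar> < y ==> t \<in> {0..1} ==> norm (DX h x t - L t x (0, b, D h x t)) <= e'"
    using est'[OF e'] by blast
   show ?thesis
   proof (intro exI[of _ y] conjI ballI allI impI y(1); elim conjE)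
    fix x h k t assume x: "x \<in> K" and h: "0 < \<bar>h\<bar>" "\<bar>h\<bar> < y" and k: "0 < \<bar>k\<bar>" "\<bar>k\<bar> < y" and t: "t \<in> {0..1::real}"
    have "norm (D h x t - D k x t) <= (norm (D h x 0 - D k x 0) + 2 * e') * exp (M + 1)"
    proof (rule gronwall[OF _ _ M(1) _ t])
     fix s assume s: "s \<in> {0..1::real}"
     show "((%t. D h x t - D k x t) has_vector_derivative DX h x s - DX k x s) (at s within {0..1})"
      using y(2) x h k s by (intro has_vector_derivative_diff derD) auto
     have "DX h x s - DX k x s = (DX h x s - L s x (0, b, D h x s)) - (DX k x s - L s x (0, b, D k x s))
      + (L s x (0, b, D h x s) - L s x (0, b, D k x s))" by simp
     also have "norm ... <= (e' + e') + M * norm (D h x s - D k x s)"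
      using y(4)[OF x h s] y(4)[OF x k s] Ldiff[OF s x]
      by (intro order_trans[OF norm_triangle_ineq add_mono] order_trans[OF norm_triangle_ineq4 add_mono])
     finally show "norm (DX h x s - DX k x s) <= M * norm (D h x s - D k x s) + 2 * e'" by simp
    qed (use e' in auto)
    also have "... <= (2 * e' + 2 * e') * exp (M + 1)"
    proof (intro mult_right_mono add_right_mono)
     show "norm (D h x 0 - D k x 0) <= 2 * e'"
      using y(3)[OF x h] y(3)[OF x k]
       norm_triangle_ineq4[of "D h x 0 - dir_deriv (%x. Z (0, x)) x b" "D k x 0 - dir_deriv (%x. Z (0, x)) x b"]
      by simp
    qed auto
    also have "... = e" by (simp add: e'_def)
    finally show "norm (D h x t - D k x t) <= e" .
   qed
  qed
  define q where "q t x = lim (%n. D (inverse (real (Suc n))) x t)" for t x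
  have small: "\<forall>\<^sub>F n in sequentially. \<bar>inverse (real (Suc n))\<bar> < y" if "y > 0" for y :: real
   using order_tendstoD(2)[OF LIMSEQ_inverse_real_of_nat that] by (auto elim: eventually_mono)
  have conv: "(%n. D (inverse (real (Suc n))) x t) \<longlonglongrightarrow> q t x" if "x \<in> K" "t \<in> {0..1}" for x t
  proof -
   have "Cauchy (%n. D (inverse (real (Suc n))) x t)"
   proof (rule metric_CauchyI)
    fix e :: real assume "e > 0"
    then have "e / 2 > 0" by simp
    from Cauchy[OF this] obtain y where y: "y > 0"
     and *: "\<forall>x\<in>K. \<forall>h k. 0 < \<bar>h\<bar> & \<bar>h\<bar> < y & 0 < \<bar>k\<bar> & \<bar>k\<bar> < y -->
      (\<forall>t\<in>{0..1}. norm (D h x t - D k x t) <= e / 2)"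
     by (elim exE conjE)
    obtain N where N: "!!n. n \<ge> N ==> \<bar>inverse (real (Suc n))\<bar> < y"
     using small[OF y] unfolding eventually_sequentially by blast
    show "\<exists>M. \<forall>m\<ge>M. \<forall>n\<ge>M. dist (D (inverse (real (Suc m))) x t) (D (inverse (real (Suc n))) x t) < e"
    proof (intro exI[of _ N] allI impI)
     fix m n assume "m \<ge> N" "n \<ge> N"
     then have "norm (D (inverse (real (Suc m))) x t - D (inverse (real (Suc n))) x t) <= e / 2"
      using * \<open>x \<in> K\<close> \<open>t \<in> {0..1}\<close> N[of m] N[of n] by simp
     then show "dist (D (inverse (real (Suc m))) x t) (D (inverse (real (Suc n))) x t) < e"
      using \<open>e > 0\<close> by (simp add: dist_norm)
    qed
   qed
   then show ?thesis unfolding q_def by (simp add: Cauchy_convergent convergent_LIMSEQ_iff[symmetric])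
  qed
  have unif: "\<exists>y>0. \<forall>x\<in>K. \<forall>h. 0 < \<bar>h\<bar> & \<bar>h\<bar> < y --> (\<forall>t\<in>{0..1}. norm (D h x t - q t x) <= e)" if e: "e > 0" for e
  proof -
   from Cauchy[OF e] obtain y where y1: "y > 0"
    and *: "\<forall>x\<in>K. \<forall>h k. 0 < \<bar>h\<bar> & \<bar>h\<bar> < y & 0 < \<bar>k\<bar> & \<bar>k\<bar> < y -->
      (\<forall>t\<in>{0..1}. norm (D h x t - D k x t) <= e)"
    by (elim exE conjE)
   have y2: "norm (D h x t - D k x t) <= e"
    if "x \<in> K" "0 < \<bar>h\<bar>" "\<bar>h\<bar> < y" "0 < \<bar>k\<bar>" "\<bar>k\<bar> < y" "t \<in> {0..1}" for x h k t
    using * that by simp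
   note y = y1 y2
   show ?thesis
   proof (intro exI[of _ y] conjI ballI allI impI y(1); elim conjE)
    fix x h t assume *: "x \<in> K" "0 < \<bar>h\<bar>" "\<bar>h\<bar> < y" "t \<in> {0..1::real}"
    have "(%n. norm (D h x t - D (inverse (real (Suc n))) x t)) \<longlonglongrightarrow> norm (D h x t - q t x)"
     by (intro tendsto_intros conv *)
    then show "norm (D h x t - q t x) <= e"
     by (rule tendsto_upperbound)
      (use small[OF y(1)] in \<open>auto elim!: eventually_mono intro!: y(2) *\<close>)
   qed
  qed
  have der: "((%h. Z ((t, x) + h *\<^sub>R (0, b))) has_vector_derivative q t x) (at 0)" if "x \<in> K" "t \<in> {0..1}" for x t
   unfolding has_vector_derivative_at_0_iff
  proof (rule tendstoI)
   fix e :: real assume "e > 0"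
   then have "e / 2 > 0" by simp
   from unif[OF this] obtain y where y: "y > 0"
    and all: "\<forall>x\<in>K. \<forall>h. 0 < \<bar>h\<bar> & \<bar>h\<bar> < y --> (\<forall>t\<in>{0..1}. norm (D h x t - q t x) <= e / 2)"
    by (elim exE conjE)
   have "dist ((Z ((t, x) + h *\<^sub>R (0, b)) - Z ((t, x) + 0 *\<^sub>R (0, b))) /\<^sub>R h) (q t x) < e"
    if "h ~= 0" "dist h 0 < y" for h
    using all[rule_format, OF \<open>x \<in> K\<close> _ \<open>t \<in> {0..1}\<close>, of h] that \<open>e > 0\<close> by (simp add: D_def dist_norm)
   then show "\<forall>\<^sub>F h in at 0. dist ((Z ((t, x) + h *\<^sub>R (0, b)) - Z ((t, x) + 0 *\<^sub>R (0, b))) /\<^sub>R h) (q t x) < e"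
    unfolding eventually_at using y by blast
  qed
  have Qq: "Q (t, x) = q t x" if "x \<in> K" "t \<in> {0..1}" for x t
   unfolding Q_def using der[OF that] by (rule dir_deriv_eqI)
  have ode': "((%t. Q (t, x)) has_vector_derivative L t x (0, b, Q (t, x))) (at t within {0..1})"
   if x: "x \<in> K" and t: "t \<in> {0..1}" for x t
  proof -
   obtain y1 where y1: "y1 > 0" "!!h. 0 < \<bar>h\<bar> ==> \<bar>h\<bar> < y1 ==> x + h *\<^sub>R b \<in> V"
    using est_V x by metis
   obtain N where N: "!!n. n \<ge> N ==> \<bar>inverse (real (Suc n))\<bar> < y1"
    using small[OF y1(1)] unfolding eventually_sequentially by blast
   define hn where "hn n = inverse (real (Suc (n + N)))" for n
   have hn: "0 < \<bar>hn n\<bar>" "x + hn n *\<^sub>R b \<in> V" for n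
   proof -
    show "0 < \<bar>hn n\<bar>" by (simp add: hn_def)
    then show "x + hn n *\<^sub>R b \<in> V" using N[of "n + N"] by (intro y1(2)) (simp_all add: hn_def)
   qed
   have small': "\<forall>\<^sub>F n in sequentially. \<bar>hn n\<bar> < y" if "y > 0" for y
    using small[OF that] unfolding hn_def
    by (subst eventually_sequentially_seg[where P = "%n. \<bar>inverse (real (Suc n))\<bar> < y"])
   have "\<exists>g. \<forall>t\<in>{0..1}. (%n. D (hn n) x t) \<longlonglongrightarrow> g t &
     (g has_derivative (%h. h *\<^sub>R L t x (0, b, q t x))) (at t within {0..1})"
   proof (rule has_derivative_sequence[where f' = "%n t h. h *\<^sub>R DX (hn n) x t"])
    show "(D (hn n) x has_derivative (%h. h *\<^sub>R DX (hn n) x t)) (at t within {0..1})" if "t \<in> {0..1}" for n t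
     using derD[OF x hn(2) that] unfolding has_vector_derivative_def .
    show "(%n. D (hn n) x 0) \<longlonglongrightarrow> q 0 x"
     unfolding hn_def by (rule LIMSEQ_ignore_initial_segment[OF conv[OF x], of 0 N]) simp
    fix e :: real assume e: "e > 0"
    define e' where "e' = e / (1 + M)"
    have e': "e' > 0" using e M(1) by (simp add: e'_def)
    have "e' * (1 + M) = e" using M(1) by (simp add: e'_def)
    then have e'2: "e' + M * e' = e" by (simp add: algebra_simps)
    note e' = e' e'2
    from est'[OF e'(1)] obtain y2 where y2: "y2 > 0"
     and all2: "\<forall>x\<in>K. \<forall>h. 0 < \<bar>h\<bar> & \<bar>h\<bar> < y2 --> x + h *\<^sub>R b \<in> V &
      norm (D h x 0 - dir_deriv (%x. Z (0, x)) x b) <= e' &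
      (\<forall>t\<in>{0..1}. norm (DX h x t - L t x (0, b, D h x t)) <= e')"
     by (elim exE conjE)
    from unif[OF e'(1)] obtain y3 where y3: "y3 > 0"
     and all3: "\<forall>x\<in>K. \<forall>h. 0 < \<bar>h\<bar> & \<bar>h\<bar> < y3 --> (\<forall>t\<in>{0..1}. norm (D h x t - q t x) <= e')"
     by (elim exE conjE)
    show "\<forall>\<^sub>F n in sequentially. \<forall>t\<in>{0..1}. \<forall>h. norm (h *\<^sub>R DX (hn n) x t - h *\<^sub>R L t x (0, b, q t x)) <= e * norm h"
     using small'[OF y2] small'[OF y3]
    proof eventually_elim
     case (elim n)
     show ?case
     proof (intro ballI allI)
      fix t h :: real assume t: "t \<in> {0..1}"
      have "norm (L t x (0, b, D (hn n) x t) - L t x (0, b, q t x)) <= M * e'"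
       using Ldiff[OF t x, of "D (hn n) x t" "q t x"] M(1) all3[rule_format, OF x _ t, of "hn n"] hn(1) elim(2)
       by (meson mult_left_mono order_trans)
      moreover have "norm (DX (hn n) x t - L t x (0, b, D (hn n) x t)) <= e'"
       using all2[rule_format, OF x, of "hn n"] hn(1)[of n] elim(1) t by blast
      ultimately have "norm (DX (hn n) x t - L t x (0, b, q t x)) <= e"
       using e'(2)
        norm_triangle_ineq[of "DX (hn n) x t - L t x (0, b, D (hn n) x t)" "L t x (0, b, D (hn n) x t) - L t x (0, b, q t x)"]
       by simp
      then have "norm (h *\<^sub>R (DX (hn n) x t - L t x (0, b, q t x))) <= e * norm h"
       using mult_left_mono[of "norm (DX (hn n) x t - L t x (0, b, q t x))" e "norm h"]
       by (simp add: mult.commute)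
      then show "norm (h *\<^sub>R DX (hn n) x t - h *\<^sub>R L t x (0, b, q t x)) <= e * norm h"
       by (simp add: scaleR_diff_right)
     qed
    qed
   qed auto
   then obtain g where g: "!!t. t \<in> {0..1} ==> (%n. D (hn n) x t) \<longlonglongrightarrow> g t"
    "!!t. t \<in> {0..1} ==> (g has_derivative (%h. h *\<^sub>R L t x (0, b, q t x))) (at t within {0..1})" by blast
   have gQ: "Q (t, x) = g t" if "t \<in> {0..1}" for t
   proof -
    have "(%n. D (hn n) x t) \<longlonglongrightarrow> q t x"
     unfolding hn_def by (rule LIMSEQ_ignore_initial_segment[OF conv[OF x that]])
    then show ?thesis using g(1)[OF that] LIMSEQ_unique Qq[OF x that] by metis
   qed
   show ?thesis
    unfolding has_vector_derivative_def
    by (rule has_derivative_transform[OF t gQ]) (use g(2)[OF t] Qq[OF x t] in auto)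
  qed
  have contQ: "continuous_on ({0..1} \<times> K) Q"
  proof -
   obtain y1 where y1: "y1 > 0" "!!x h. x \<in> K ==> 0 < \<bar>h\<bar> ==> \<bar>h\<bar> < y1 ==> x + h *\<^sub>R b \<in> V"
    using est_V by metis
   have "continuous_on ({0..1} \<times> K) (%p. q (fst p) (snd p))"
   proof (rule uniform_limit_theorem[where F = sequentially and f = "%n p. D (inverse (real (Suc n))) (snd p) (fst p)"])
    show "\<forall>\<^sub>F n in sequentially. continuous_on ({0..1} \<times> K) (%p. D (inverse (real (Suc n))) (snd p) (fst p))"
     using small[OF y1(1)]
    proof eventually_elim
     case (elim n)
     have "continuous_on ({0..1} \<times> K) (%p. Z (fst p, snd p + inverse (real (Suc n)) *\<^sub>R b))"
      by (rule continuous_on_compose2[OF cont])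
       (use y1(2) elim in \<open>auto intro!: continuous_intros\<close>)
     moreover have "continuous_on ({0..1} \<times> K) (%p. Z (fst p, snd p))"
      by (rule continuous_on_compose2[OF cont]) (use KV in \<open>auto intro!: continuous_intros\<close>)
     ultimately show ?case unfolding D_def by (intro continuous_intros)
    qed
    show "uniform_limit ({0..1} \<times> K) (%n p. D (inverse (real (Suc n))) (snd p) (fst p)) (%p. q (fst p) (snd p)) sequentially"
    proof (rule uniform_limitI)
     fix e :: real assume "e > 0"
     then have "e / 2 > 0" by simp
     from unif[OF this] obtain y where y: "y > 0"
      and all: "\<forall>x\<in>K. \<forall>h. 0 < \<bar>h\<bar> & \<bar>h\<bar> < y --> (\<forall>t\<in>{0..1}. norm (D h x t - q t x) <= e / 2)"
      by (elim exE conjE)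
     show "\<forall>\<^sub>F n in sequentially. \<forall>p\<in>{0..1} \<times> K. dist (D (inverse (real (Suc n))) (snd p) (fst p)) (q (fst p) (snd p)) < e"
      using small[OF y]
     proof eventually_elim
      case (elim n)
      show ?case
      proof
       fix p assume "p \<in> {0..1::real} \<times> K"
       then have "norm (D (inverse (real (Suc n))) (snd p) (fst p) - q (fst p) (snd p)) <= e / 2"
        using all elim by (auto simp: mem_Times_iff)
       then show "dist (D (inverse (real (Suc n))) (snd p) (fst p)) (q (fst p) (snd p)) < e"
        using \<open>e > 0\<close> by (simp add: dist_norm)
      qed
     qed
    qed
   qed auto
   then show ?thesis by (rule continuous_on_eq) (use Qq in auto)
  qed
  show ?thesis
   using r(1) der ode' contQ Qq unfolding L_def K_def by (intro exI[of _ r] conjI ballI) auto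
 qed
 have in_ball: "x \<in> cball x r Int span B" if "x \<in> V" "r > 0" for x r using that VB by auto
 show "((%h. Z ((t, x) + h *\<^sub>R (0, b))) has_vector_derivative Q (t, x)) (at 0)"
  "((%t. Q (t, x)) has_vector_derivative
    lin_part (sdirs B) X (t, x, Z (t, x)) (0, b, Q (t, x))) (at t within {0..1})"
  if "t \<in> {0..1}" "x \<in> V" for t x
  using near[OF that(2)] that in_ball by blast+
 show "continuous_on ({0..1} \<times> V) Q"
 proof (rule continuous_on_local)
  fix p assume "p \<in> {0..1::real} \<times> V"
  then obtain t x0 where p: "p = (t, x0)" "x0 \<in> V" by auto
  obtain r where r: "r > 0" "continuous_on ({0..1} \<times> (cball x0 r Int span B)) Q" using near[OF p(2)] by blast
  have "continuous_on (({0..1} \<times> V) Int (UNIV \<times> ball x0 r)) Q"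
   by (rule continuous_on_subset[OF r(2)]) (use VB in auto)
  then show "\<exists>G. open G & p \<in> G & continuous_on (({0..1} \<times> V) Int G) Q"
   using r(1) p by (intro exI[of _ "UNIV \<times> ball x0 r"]) (auto simp: open_Times)
 qed
qed

text \<open>By induction: the derivative in a parameter, together with the solution itself, solves a system with one
derivative less.\<close>

theorem ODE_solution_Ck:
 fixes X :: "real \<times> 'a::euclidean_space \<times> 'b::euclidean_space => 'b" and Z :: "real \<times> 'a => 'b"
 assumes B: "B \<subseteq> Basis" and V: "open_in B V" and W: "open W"
  and X: "Ck_on k (sdirs B) ({0..1} \<times> V \<times> W) X"
  and cont: "continuous_on ({0..1} \<times> V) Z"
  and ZW: "!!t x. t \<in> {0..1} ==> x \<in> V ==> Z (t, x) \<in> W"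
  and ode: "!!t x. t \<in> {0..1} ==> x \<in> V ==>
   ((%t. Z (t, x)) has_vector_derivative X (t, x, Z (t, x))) (at t within {0..1})"
  and init: "Ck_on k B V (%x. Z (0, x))"
 shows "Ck_on k (pdirs B) ({0..1} \<times> V) Z"
 using W X cont ZW ode init
proof (induction k arbitrary: W X Z)
 case 0
 then show ?case by simp
next
 case (Suc k)
 note oV = open_along_openin[OF V]
 note oP = open_along_pdirs[OF oV]
 have Zk: "Ck_on k (pdirs B) ({0..1} \<times> V) Z"
  by (rule Suc.IH[OF Suc.prems(1) Ck_on_Suc_le[OF Suc.prems(2)] Suc.prems(3-5) Ck_on_Suc_le[OF Suc.prems(6)]])
 have X1: "Ck_on 1 (sdirs B) ({0..1} \<times> V \<times> W) X" by (rule Ck_on_le[OF Suc.prems(2)]) simp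
 have i1: "Ck_on 1 B V (%x. Z (0, x))" by (rule Ck_on_le[OF Suc.prems(6)]) simp
 have var1: "((%h. Z ((t, x) + h *\<^sub>R (0, b))) has_vector_derivative dir_deriv Z (t, x) (0, b)) (at 0)"
  if "b \<in> B" "t \<in> {0..1}" "x \<in> V" for b t x
  by (rule ODE_variation(1)[OF B V Suc.prems(1) X1 Suc.prems(3) _ _ i1 that]) (simp_all add: Suc.prems(4,5))
 have var2: "continuous_on ({0..1} \<times> V) (%p. dir_deriv Z p (0, b))" if "b \<in> B" for b
  by (rule ODE_variation(2)[OF B V Suc.prems(1) X1 Suc.prems(3) _ _ i1 that]) (simp_all add: Suc.prems(4,5))
 have var3: "((%t. dir_deriv Z (t, x) (0, b)) has_vector_derivative
    lin_part (sdirs B) X (t, x, Z (t, x)) (0, b, dir_deriv Z (t, x) (0, b))) (at t within {0..1})"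
  if "b \<in> B" "t \<in> {0..1}" "x \<in> V" for b t x
  by (rule ODE_variation(3)[OF B V Suc.prems(1) X1 Suc.prems(3) _ _ i1 that]) (simp_all add: Suc.prems(4,5))
 show ?case
 proof (rule Ck_on_SucI[OF Suc.prems(3)])
  fix d assume "d \<in> pdirs B"
  then obtain b where b: "b \<in> B" "d = (0, b)" by (auto simp: pdirs_def)
  show "((%t. Z (p + t *\<^sub>R d)) has_vector_derivative dir_deriv Z p d) (at 0)" if "p \<in> {0..1} \<times> V" for p
   using var1[OF b(1), of "fst p" "snd p"] that unfolding b(2) by (simp add: mem_Times_iff)
  let ?U = "{0..1::real} \<times> V \<times> (UNIV :: 'b set)"
  have oU: "open_along (sdirs B) ?U" by (rule open_along_sdirs[OF oV]) simp
  define j where "j p = (fst p, fst (snd p), Z (fst p, fst (snd p)))" for p :: "real \<times> 'a \<times> 'b"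
  have jk: "Ck_on k (sdirs B) ?U j"
   unfolding j_def
  proof (intro Ck_on_Pair oU)
   show "Ck_on k (sdirs B) ?U (%p. Z (fst p, fst (snd p)))"
    by (rule Ck_on_compose[OF sdirs_Basis[OF B] pdirs_Basis[OF B] oU oP, where f = "%p. (fst p, fst (snd p))" and g = Z])
     (auto simp: span_sdirs span_pdirs Zk intro!: Ck_on_bounded_linear[OF oU] bounded_linear_Pair bounded_linear_fst
      bounded_linear_compose[OF bounded_linear_fst bounded_linear_snd])
  qed (auto intro!: Ck_on_bounded_linear[OF oU] bounded_linear_fst bounded_linear_compose[OF bounded_linear_fst bounded_linear_snd])
  define Y where "Y p = lin_part (sdirs B) X (j p) (0, b, snd (snd p))" for p
  have Yk: "Ck_on k (sdirs B) ?U Y"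
   unfolding Y_def lin_part_def
  proof (rule Ck_on_sum[OF oU], rule Ck_on_bilinear[OF bounded_bilinear_scaleR oU])
   fix d :: "real \<times> 'a \<times> 'b" assume d: "d \<in> sdirs B"
   have "Ck_on k (sdirs B) ?U (%p. (0, b, snd (snd p)))"
    by (intro Ck_on_Pair oU Ck_on_const Ck_on_bounded_linear[OF oU] bounded_linear_compose[OF bounded_linear_snd bounded_linear_snd])
   then show "Ck_on k (sdirs B) ?U (%p. (0, b, snd (snd p)) \<bullet> d)"
    by (intro Ck_on_bilinear[OF bounded_bilinear_inner oU]) auto
   show "Ck_on k (sdirs B) ?U (%p. dir_deriv X (j p) d)"
   proof (rule Ck_on_compose[OF sdirs_Basis[OF B] sdirs_Basis[OF B] oU open_along_sdirs[OF oV Suc.prems(1)],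
      where f = j and g = "%p. dir_deriv X p d"])
    show "Ck_on k (sdirs B) ({0..1} \<times> V \<times> W) (%p. dir_deriv X p d)"
     using Suc.prems(2) d by simp
    show "j p \<in> {0..1} \<times> V \<times> W" if "p \<in> ?U" for p
     using that Suc.prems(4) by (auto simp: j_def)
   qed (use jk in \<open>auto simp: j_def span_sdirs\<close>)
  qed
  show "Ck_on k (pdirs B) ({0..1} \<times> V) (%p. dir_deriv Z p d)"
   unfolding b(2)
  proof (rule Suc.IH[OF open_UNIV Yk var2[OF b(1)]])
   fix t x assume tx: "t \<in> {0..1::real}" "x \<in> V"
   show "((%t. dir_deriv Z (t, x) (0, b)) has_vector_derivative Y (t, x, dir_deriv Z (t, x) (0, b))) (at t within {0..1})"
    using var3[OF b(1) tx] by (simp add: Y_def j_def)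
  next
   have "dir_deriv Z (0, x) (0, b) = dir_deriv (%x. Z (0, x)) x b" for x
    unfolding dir_deriv_def by simp
   then show "Ck_on k B V (%x. dir_deriv Z (0, x) (0, b))"
    using Suc.prems(6) b(1) by simp
  qed auto
 qed
qed

section \<open>Differential equations with parameters: smoothness\<close>

lemma cball_span_subset:
 assumes "open_in B V" "x0 \<in> V"
 obtains r where "r > 0" "cball x0 r Int span B \<subseteq> V"
proof -
 obtain G where G: "open G" "V = span B Int G" using assms(1) unfolding openin_open by blast
 then obtain r where "r > 0" "cball x0 r \<subseteq> G" using assms(2) open_contains_cball by blast
 then show ?thesis using that G by blast
qed

lemma ODE_solution_continuous:
 fixes X :: "real \<times> 'a::euclidean_space \<times> 'b::euclidean_space => 'b" and Z :: "real \<times> 'a => 'b"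
 assumes B: "B \<subseteq> Basis" and V: "open_in B V" and W: "open W"
  and X: "Ck_on 1 (sdirs B) ({0..1} \<times> V \<times> W) X"
  and K: "compact K" "convex K" "K \<subseteq> W"
  and ZK: "!!t x. t \<in> {0..1} ==> x \<in> V ==> Z (t, x) \<in> K"
  and ode: "!!t x. t \<in> {0..1} ==> x \<in> V ==>
   ((%t. Z (t, x)) has_vector_derivative X (t, x, Z (t, x))) (at t within {0..1})"
  and init: "continuous_on V (%x. Z (0, x))"
 shows "continuous_on ({0..1} \<times> V) Z"
 unfolding continuous_on_iff
proof (intro ballI allI impI)
 fix p and e :: real assume "p \<in> {0..1::real} \<times> V" and e: "e > 0"
 then obtain t0 x0 where p: "p = (t0, x0)" "t0 \<in> {0..1}" "x0 \<in> V" by auto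
 obtain r where r: "r > 0" "cball x0 r Int span B \<subseteq> V" using cball_span_subset[OF V p(3)] by blast
 have VB: "V \<subseteq> span B" using V openin_imp_subset by blast
 define K0 where "K0 = cball x0 r Int span B"
 define T where "T = {0..1::real} \<times> K0 \<times> K"
 have cT: "compact T" unfolding T_def K0_def by (intro compact_Times K compact_Icc compact_Int_closed) auto
 have T\<Omega>: "T \<subseteq> {0..1} \<times> V \<times> W" using r(2) K(3) unfolding T_def K0_def by auto
 have x0K: "x0 \<in> K0" unfolding K0_def using p VB r(1) by auto
 note o\<Omega> = open_along_sdirs[OF open_along_openin[OF V] W]
 obtain M where M: "M \<ge> 0" "!!q v. q \<in> T ==> norm (lin_part (sdirs B) X q v) <= M * norm v"
  using lin_part_bound[OF sdirs_Basis[OF B] X cT T\<Omega>] by blast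
 have Lip: "norm (X (t, x0, y) - X (t, x0, z)) <= M * norm (y - z)" if "t \<in> {0..1}" "y \<in> K" "z \<in> K" for t y z
 proof -
  let ?c = "%s::real. (t, x0, z + s *\<^sub>R (y - z))"
  have cK: "z + s *\<^sub>R (y - z) \<in> K" if "s \<in> {0..1}" for s
  proof -
   have "z + s *\<^sub>R (y - z) = (1 - s) *\<^sub>R z + s *\<^sub>R y" by (simp add: algebra_simps)
   then show ?thesis using K(2) \<open>y \<in> K\<close> \<open>z \<in> K\<close> that by (auto intro: convexD)
  qed
  have "norm (X (?c 1) - X (?c 0)) <= (M * norm (y - z)) * \<bar>1 - 0\<bar>"
  proof (rule vector_derivative_bound[where S = "{0..1}" and f = "%s. X (?c s)" and f' = "%s. lin_part (sdirs B) X (?c s) (0, 0, y - z)"])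
   fix s assume s: "s \<in> {0..1::real}"
   have cT: "?c s \<in> T" using that(1) x0K cK[OF s] by (simp add: T_def)
   have "(?c has_vector_derivative (0, 0, y - z)) (at s within {0..1})"
    by (auto intro!: derivative_eq_intros has_vector_derivative_Pair)
   from C1_chain_curve[OF sdirs_Basis[OF B] o\<Omega> X _ this]
   show "((%s. X (?c s)) has_vector_derivative lin_part (sdirs B) X (?c s) (0, 0, y - z)) (at s within {0..1})"
    using cT T\<Omega> by (auto simp: lin_part_def span_sdirs span_zero)
   show "norm (lin_part (sdirs B) X (?c s) (0, 0, y - z)) <= M * norm (y - z)"
    using M(2)[OF cT, of "(0, 0, y - z)"] by (simp add: norm_Pair)
  qed auto
  then show ?thesis by simp
 qed
 define e' where "e' = e / (8 * exp (M + 1))"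
 have e': "e' > 0" using e by (simp add: e'_def)
 have "uniformly_continuous_on T X"
  using Ck_on_continuous[OF X] T\<Omega> cT continuous_on_subset compact_uniformly_continuous by blast
 then obtain d1 where d1: "d1 > 0" "!!q q'. q \<in> T ==> q' \<in> T ==> dist q' q < d1 ==> dist (X q') (X q) < e'"
  unfolding uniformly_continuous_on_def using e' by meson
 obtain d2 where d2: "d2 > 0" "!!x. x \<in> V ==> dist x x0 < d2 ==> dist (Z (0, x)) (Z (0, x0)) < e'"
  using init p(3) e' unfolding continuous_on_iff by meson
 have "continuous_on {0..1} (%t. Z (t, x0))"
  using ode[OF _ p(3)] has_vector_derivative_continuous continuous_on_eq_continuous_within by blast
 then obtain d3 where d3: "d3 > 0" "!!t. t \<in> {0..1} ==> dist t t0 < d3 ==> dist (Z (t, x0)) (Z (t0, x0)) < e / 2"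
  using p(2) e half_gt_zero unfolding continuous_on_iff by meson
 define d where "d = Min {r, d1, d2, d3}"
 have d: "d > 0" "d <= r" "d <= d1" "d <= d2" "d <= d3" using r d1 d2 d3 by (auto simp: d_def)
 have "dist (Z q) (Z p) < e" if q: "q \<in> {0..1} \<times> V" "dist q p < d" for q
 proof -
  obtain t x where tx: "q = (t, x)" "t \<in> {0..1}" "x \<in> V" using q(1) by auto
  have dx: "dist x x0 < d" and dt: "dist t t0 < d"
   using q(2) dist_snd_le[of q p] dist_fst_le[of q p] unfolding tx p by auto
  have xK: "x \<in> K0" using dx d(2) tx(3) VB by (auto simp: K0_def dist_commute)
  have "norm (Z (t, x) - Z (t, x0)) <= (norm (Z (0, x) - Z (0, x0)) + e') * exp (M + 1)"
  proof (rule gronwall[OF _ _ M(1) _ tx(2)])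
   fix s assume s: "s \<in> {0..1::real}"
   show "((%t. Z (t, x) - Z (t, x0)) has_vector_derivative X (s, x, Z (s, x)) - X (s, x0, Z (s, x0))) (at s within {0..1})"
    by (intro has_vector_derivative_diff ode s tx p)
   have "dist (X (s, x, Z (s, x))) (X (s, x0, Z (s, x))) < e'"
    using dx d(3) s xK x0K ZK[OF s tx(3)] by (intro d1(2)) (auto simp: T_def dist_Pair_Pair)
   moreover have "norm (X (s, x0, Z (s, x)) - X (s, x0, Z (s, x0))) <= M * norm (Z (s, x) - Z (s, x0))"
    by (intro Lip ZK s tx p)
   ultimately show "norm (X (s, x, Z (s, x)) - X (s, x0, Z (s, x0))) <= M * norm (Z (s, x) - Z (s, x0)) + e'"
    using norm_triangle_ineq[of "X (s, x, Z (s, x)) - X (s, x0, Z (s, x))" "X (s, x0, Z (s, x)) - X (s, x0, Z (s, x0))"]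
    by (simp add: dist_norm)
  qed (use e' in auto)
  also have "... <= (e' + e') * exp (M + 1)"
   using d2(2)[OF tx(3)] dx d(4) by (intro mult_right_mono add_right_mono) (auto simp: dist_norm)
  also have "... = e / 4" by (simp add: e'_def)
  finally have "dist (Z (t, x)) (Z (t, x0)) < e / 2" using e by (simp add: dist_norm)
  moreover have "dist (Z (t, x0)) (Z (t0, x0)) < e / 2" using d3(2)[OF tx(2)] dt d(5) by simp
  ultimately show ?thesis unfolding tx p using dist_triangle_half_l by (metis dist_commute)
 qed
 then show "\<exists>d>0. \<forall>q\<in>{0..1} \<times> V. dist q p < d --> dist (Z q) (Z p) < e" using d(1) by blast
qed

theorem ODE_solution_smooth:
 fixes X :: "real \<times> 'a::euclidean_space \<times> 'b::euclidean_space => 'b" and Z :: "real \<times> 'a => 'b"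
 assumes B: "B \<subseteq> Basis" and V: "open_in B V" and W: "open W"
  and X: "smooth_on (sdirs B) ({0..1} \<times> V \<times> W) X"
  and K: "compact K" "convex K" "K \<subseteq> W"
  and ZK: "!!t x. t \<in> {0..1} ==> x \<in> V ==> Z (t, x) \<in> K"
  and ode: "!!t x. t \<in> {0..1} ==> x \<in> V ==>
   ((%t. Z (t, x)) has_vector_derivative X (t, x, Z (t, x))) (at t within {0..1})"
  and init: "smooth_on B V (%x. Z (0, x))"
 shows "smooth_on (pdirs B) ({0..1} \<times> V) Z"
 unfolding smooth_on_def
proof
 fix k
 have "continuous_on ({0..1} \<times> V) Z"
  by (rule ODE_solution_continuous[OF B V W smooth_on_Ck[OF X] K ZK ode Ck_on_continuous[OF smooth_on_Ck[OF init]]])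
 from ODE_solution_Ck[OF B V W smooth_on_Ck[OF X] this _ ode smooth_on_Ck[OF init]] 
 show "Ck_on k (pdirs B) ({0..1} \<times> V) Z" using ZK K(3) by blast
qed

lemma smooth_on_slice:
 assumes "B \<subseteq> Basis" "open_along B V" "smooth_on (pdirs B) ({0..1} \<times> V) Z" "t \<in> {0..1}"
 shows "smooth_on B V (%x. Z (t, x))"
 by (rule smooth_on_compose[OF assms(1) pdirs_Basis[OF assms(1)] assms(2) open_along_pdirs[OF assms(2)],
   where f = "%x. (t, x)" and g = Z])
  (use assms in \<open>auto simp: span_pdirs intro!: smooth_on_Pair smooth_on_id\<close>)

lemma smooth_parametric_integral:
 fixes q :: "real \<times> 'a::euclidean_space => 'b::euclidean_space"
 assumes B: "B \<subseteq> Basis" and V: "open_in B V"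
  and q: "smooth_on (pdirs B) ({0..1} \<times> V) q"
 shows "smooth_on B V (%x. integral {0..1} (%t. q (t, x)))"
proof -
 note oV = open_along_openin[OF V]
 define Z where "Z p = integral {0..fst p} (%s. q (s, snd p))" for p
 have cq: "continuous_on ({0..1} \<times> V) q" using Ck_on_continuous[OF smooth_on_Ck[OF q]] .
 have cqx: "continuous_on {0..1} (%s. q (s, x))" if "x \<in> V" for x
  by (rule continuous_on_compose2[OF cq]) (use that in \<open>auto intro!: continuous_intros\<close>)
 have cont: "continuous_on ({0..1} \<times> V) Z"
 proof (rule continuous_on_eq)
  have "continuous_on (({0..1} \<times> V) \<times> cbox 0 1) (%(p, s). fst p *\<^sub>R q (fst p * s, snd p))"
   unfolding case_prod_unfold
   by (intro continuous_intros continuous_on_compose2[OF cq]) (auto simp: mult_le_one)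
  then show "continuous_on ({0..1} \<times> V) (%p. integral (cbox 0 1) (%s. fst p *\<^sub>R q (fst p * s, snd p)))"
   by (rule integral_continuous_on_param)
  fix p assume "p \<in> {0..1::real} \<times> V"
  then obtain t x where p: "p = (t, x)" "0 <= t" "t <= 1" "x \<in> V" by auto
  show "integral (cbox 0 1) (%s. fst p *\<^sub>R q (fst p * s, snd p)) = Z p"
  proof (cases "t = 0")
   case False
   have "continuous_on {0..t} (%s. q (s, x))"
    using cqx[OF p(4)] p(3) continuous_on_subset by fastforce
   then have "((%s. q (s, x)) has_integral integral {0..t} (%s. q (s, x))) {0..t}"
    using integrable_continuous_interval by (blast intro: integrable_integral)
   from has_integral_stretch_real[OF this False]
   have "((%s. q (t * s, x)) has_integral (1 / \<bar>t\<bar>) *\<^sub>R integral {0..t} (%s. q (s, x))) ((%s. s / t) ` {0..t})" .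
   moreover have "(%s. s / t) ` {0..t} = {0..1}"
    using False p(2) by (auto simp: image_iff field_simps intro!: bexI[of _ "_ * t"])
   ultimately have "((%s. q (t * s, x)) has_integral (1 / \<bar>t\<bar>) *\<^sub>R integral {0..t} (%s. q (s, x))) {0..1}"
    by simp
   from has_integral_cmul[OF this, of t]
   have "((%s. t *\<^sub>R q (t * s, x)) has_integral integral {0..t} (%s. q (s, x))) {0..1}"
    using False p(2) by simp
   from integral_unique[OF this] show ?thesis by (simp add: p Z_def)
  qed (simp add: p Z_def)
 qed
 have "Ck_on k (pdirs B) ({0..1} \<times> V) Z" for k
 proof (rule ODE_solution_Ck[OF B V open_UNIV _ cont, where X = "%p. q (fst p, fst (snd p))"])
  show "Ck_on k (sdirs B) ({0..1} \<times> V \<times> (UNIV :: 'b set)) (%p. q (fst p, fst (snd p)))"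
   using open_along_sdirs[OF oV, of "UNIV :: 'b set"]
   by (intro Ck_on_compose[OF sdirs_Basis[OF B] pdirs_Basis[OF B] _ open_along_pdirs[OF oV],
      where f = "%p. (fst p, fst (snd p))" and g = q])
    (auto simp: span_sdirs span_pdirs smooth_on_Ck[OF q] intro!: Ck_on_bounded_linear bounded_linear_Pair bounded_linear_fst
      bounded_linear_compose[OF bounded_linear_fst bounded_linear_snd])
  show "((%t. Z (t, x)) has_vector_derivative q (fst (t, x, Z (t, x)), fst (snd (t, x, Z (t, x))))) (at t within {0..1})"
   if "t \<in> {0..1}" "x \<in> V" for t x
   unfolding Z_def using integral_has_vector_derivative[OF cqx[OF that(2)] that(1)] by simp
 qed (simp_all add: Z_def)
 then have "smooth_on (pdirs B) ({0..1} \<times> V) Z" by (simp add: smooth_on_def)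
 from smooth_on_slice[OF B oV this, of 1] show ?thesis by (simp add: Z_def)
qed

text \<open>\<open>G w - G 0\<close> is the integral over \<open>t\<close> of the derivative of \<open>G (t w)\<close>, from which the coordinates of \<open>w\<close> factor.\<close>

lemma hadamard:
 fixes G :: "'e::euclidean_space => 'f::euclidean_space"
 assumes B: "B \<subseteq> Basis" and G: "smooth_on B (ball 0 \<rho> Int span B) G" and \<rho>: "\<rho> > 0"
 obtains H where "!!b. b \<in> B ==> smooth_on B (ball 0 \<rho> Int span B) (H b)"
  "!!w. w \<in> ball 0 \<rho> Int span B ==> G w = G 0 + (\<Sum>b\<in>B. (w \<bullet> b) *\<^sub>R H b w)"
  "!!b. b \<in> B ==> H b 0 = dir_deriv G 0 b"
proof -
 define V where "V = ball (0::'e) \<rho> Int span B"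
 have V: "open_in B V" unfolding V_def by (auto simp: openin_open)
 note oV = open_along_openin[OF V]
 note oP = open_along_pdirs[OF oV]
 have star: "t *\<^sub>R w \<in> V" if "t \<in> {0..1}" "w \<in> V" for t w
 proof -
  have "\<bar>t\<bar> * norm w <= 1 * norm w" using that by (intro mult_right_mono) auto
  then show ?thesis using that unfolding V_def by (auto intro: span_scale)
 qed
 define H where "H b w = integral {0..1} (%t. dir_deriv G (t *\<^sub>R w) b)" for b w
 have mult: "smooth_on (pdirs B) ({0..1} \<times> V) (%p. fst p *\<^sub>R snd p)"
  by (intro smooth_on_scaleR oP smooth_on_bounded_linear bounded_linear_fst bounded_linear_snd)
 have sm: "smooth_on (pdirs B) ({0..1} \<times> V) (%p. dir_deriv G (fst p *\<^sub>R snd p) b)" if b: "b \<in> B" for b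
  by (rule smooth_on_compose_span[OF pdirs_Basis[OF B] B oP V _ mult, where g = "%w. dir_deriv G w b"])
   (use smooth_on_dir_deriv[OF G b] star in \<open>auto simp: V_def\<close>)
 show ?thesis
 proof (rule that[of H])
  show "smooth_on B (ball 0 \<rho> Int span B) (H b)" if "b \<in> B" for b
   using smooth_parametric_integral[OF B V sm[OF that]] by (simp add: V_def H_def[abs_def])
  show "H b 0 = dir_deriv G 0 b" for b by (simp add: H_def)
  fix w assume "w \<in> ball 0 \<rho> Int span B"
  then have w: "w \<in> V" by (simp add: V_def)
  have "((%t. \<Sum>b\<in>B. (w \<bullet> b) *\<^sub>R dir_deriv G (t *\<^sub>R w) b) has_integral G (1 *\<^sub>R w) - G (0 *\<^sub>R w)) {0..1}"
  proof (rule fundamental_theorem_of_calculus)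
   fix t assume t: "t \<in> {0..1::real}"
   have "((%t. t *\<^sub>R w) has_vector_derivative w) (at t within {0..1})"
    by (auto intro!: derivative_eq_intros)
   from C1_chain_curve[OF B oV smooth_on_Ck[OF G[folded V_def]] star[OF t w] this]
   show "((%t. G (t *\<^sub>R w)) has_vector_derivative (\<Sum>b\<in>B. (w \<bullet> b) *\<^sub>R dir_deriv G (t *\<^sub>R w) b)) (at t within {0..1})"
    using w by (auto simp: V_def span_scale span_diff)
  qed auto
  moreover have "((%t. \<Sum>b\<in>B. (w \<bullet> b) *\<^sub>R dir_deriv G (t *\<^sub>R w) b) has_integral (\<Sum>b\<in>B. (w \<bullet> b) *\<^sub>R H b w)) {0..1}"
  proof (intro has_integral_sum has_integral_cmul)
   fix b assume b: "b \<in> B"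
   have c: "continuous_on {0..1::real} (%t. (t, w))" "(%t. (t, w)) ` {0..1} \<subseteq> {0..1} \<times> V"
    using w by (auto intro!: continuous_intros)
   have "continuous_on {0..1} (%t. dir_deriv G (t *\<^sub>R w) b)"
    using continuous_on_compose2[OF Ck_on_continuous[OF smooth_on_Ck[OF sm[OF b]]] c] by simp
   then show "((%t. dir_deriv G (t *\<^sub>R w) b) has_integral H b w) {0..1}"
    unfolding H_def using integrable_continuous_interval by (blast intro: integrable_integral)
  qed (use B finite_Basis_subset in auto)
  ultimately have "G (1 *\<^sub>R w) - G (0 *\<^sub>R w) = (\<Sum>b\<in>B. (w \<bullet> b) *\<^sub>R H b w)" by (rule has_integral_unique)
  then show "G w = G 0 + (\<Sum>b\<in>B. (w \<bullet> b) *\<^sub>R H b w)" by (simp add: algebra_simps)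
 qed
qed

section \<open>Plots into a manifold\<close>

locale manifold_ctx =
 fixes M :: "('a, 'e::euclidean_space) manifold"
 assumes mfd: "smooth_manifold M"
begin

abbreviation "B \<equiv> coords M"

lemma B_Basis: "B \<subseteq> Basis"
 using mfd unfolding smooth_manifold_def by blast

lemma atlas_cover: "p \<in> points M ==> \<exists>c\<in>atlas M. p \<in> fst c"
 using mfd unfolding smooth_manifold_def by blast

lemma chart_open: "c \<in> atlas M ==> openin (mtop M) (fst c)"
 and chart_image_open: "c \<in> atlas M ==> open_in B (snd c ` fst c)"
 and chart_homeo: "c \<in> atlas M ==>
  homeomorphic_map (subtopology (mtop M) (fst c)) (top_of_set (snd c ` fst c)) (snd c)"
 using mfd unfolding smooth_manifold_def by (auto simp: case_prod_beta)

lemma transition_smooth: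
 "c \<in> atlas M ==> d \<in> atlas M ==> smooth_on B (snd c ` (fst c Int fst d)) (snd d o chart_inv c)"
 using mfd unfolding smooth_manifold_def by blast

lemma chart_sub: "c \<in> atlas M ==> fst c \<subseteq> points M"
 by (rule openin_subset[OF chart_open])

lemma topspace_chart: "c \<in> atlas M ==> topspace (subtopology (mtop M) (fst c)) = fst c"
 using chart_sub[of c] by (simp add: topspace_subtopology inf.absorb2)

lemma chart_inj: "c \<in> atlas M ==> inj_on (snd c) (fst c)"
 using homeomorphic_imp_injective_map[OF chart_homeo] topspace_chart by metis

lemma chart_inv_left [simp]: "c \<in> atlas M ==> p \<in> fst c ==> chart_inv c (snd c p) = p"
 unfolding chart_inv_def using chart_inj by simp

lemma chart_inv_in: "x \<in> snd c ` fst c ==> chart_inv c x \<in> fst c"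
 unfolding chart_inv_def by (rule inv_into_into)

lemma chart_inv_right [simp]: "x \<in> snd c ` fst c ==> snd c (chart_inv c x) = x"
 unfolding chart_inv_def by (rule f_inv_into_f)

lemma chart_image_span: "c \<in> atlas M ==> snd c ` fst c \<subseteq> span B"
 using chart_image_open openin_imp_subset by blast

lemma chart_continuous:
 "c \<in> atlas M ==> continuous_map (subtopology (mtop M) (fst c)) (top_of_set (snd c ` fst c)) (snd c)"
 using chart_homeo homeomorphic_imp_continuous_map by blast

lemma chart_inv_continuous:
 assumes "c \<in> atlas M"
 shows "continuous_map (top_of_set (snd c ` fst c)) (mtop M) (chart_inv c)"
proof -
 obtain h where h: "homeomorphic_maps (subtopology (mtop M) (fst c)) (top_of_set (snd c ` fst c)) (snd c) h"
  using chart_homeo[OF assms] homeomorphic_map_maps by blast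
 then have "continuous_map (top_of_set (snd c ` fst c)) (subtopology (mtop M) (fst c)) h"
  by (simp add: homeomorphic_maps_def)
 then have "continuous_map (top_of_set (snd c ` fst c)) (mtop M) h"
  using continuous_map_into_fulltopology by blast
 moreover have "h x = chart_inv c x" if "x \<in> topspace (top_of_set (snd c ` fst c))" for x
 proof -
  obtain p where p: "p \<in> fst c" "x = snd c p" using \<open>x \<in> _\<close> by auto
  then have "h x = p" using h topspace_chart[OF assms] by (simp add: homeomorphic_maps_def)
  then show ?thesis using p assms by simp
 qed
 ultimately show ?thesis by (rule continuous_map_eq)
qed

lemma open_chart_image:
 assumes "c \<in> atlas M" "openin (mtop M) W"
 shows "open_in B (snd c ` (fst c Int W))"
proof -
 have "openin (subtopology (mtop M) (fst c)) (fst c Int W)"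
  using assms(2) by (simp add: openin_subtopology_Int2)
 then have "openin (top_of_set (snd c ` fst c)) (snd c ` (fst c Int W))"
  using homeomorphic_map_openness_eq[OF chart_homeo[OF assms(1)]] by blast
 then show ?thesis by (rule openin_trans[OF _ chart_image_open[OF assms(1)]])
qed

lemma open_chart_preimage:
 assumes "c \<in> atlas M" "open_in B V"
 shows "openin (mtop M) {p \<in> fst c. snd c p \<in> V}"
proof -
 have "openin (top_of_set (snd c ` fst c)) (V Int snd c ` fst c)"
 proof -
  obtain G where G: "open G" "V = span B Int G" using assms(2) unfolding openin_open by blast
  then have "V Int snd c ` fst c = snd c ` fst c Int G" using chart_image_span[OF assms(1)] by blast
  then show ?thesis using G(1) by (metis openin_open_Int)
 qed
 then have "openin (subtopology (mtop M) (fst c)) {p \<in> topspace (subtopology (mtop M) (fst c)). snd c p \<in> V Int snd c ` fst c}"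
  using chart_continuous[OF assms(1)] openin_continuous_map_preimage by blast
 moreover have "{p \<in> topspace (subtopology (mtop M) (fst c)). snd c p \<in> V Int snd c ` fst c} = {p \<in> fst c. snd c p \<in> V}"
  using topspace_chart[OF assms(1)] by auto
 ultimately show ?thesis using openin_trans_full[OF _ chart_open[OF assms(1)]] by simp
qed

end

text \<open>Smooth maps from an open subset of a coordinate space, of any dimension, into \<open>M\<close>.\<close>

definition plot :: "('a, 'e::euclidean_space) manifold => 'd::euclidean_space set => 'd set => ('d => 'a) => bool" where
 "plot M C S F \<longleftrightarrow> C \<subseteq> Basis & open_in C S & continuous_map (top_of_set S) (mtop M) F &
   (\<forall>d\<in>atlas M. smooth_on C {x \<in> S. F x \<in> fst d} (snd d o F))"

lemma plotD:
 assumes "plot M C S F"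
 shows "C \<subseteq> Basis" "open_in C S" "continuous_map (top_of_set S) (mtop M) F"
  "!!d. d \<in> atlas M ==> smooth_on C {x \<in> S. F x \<in> fst d} (snd d o F)"
  "!!x. x \<in> S ==> F x \<in> points M" "S \<subseteq> span C"
 using assms continuous_map_image_subset_topspace[of "top_of_set S" "mtop M" F] openin_imp_subset[of euclidean "span C" S]
 unfolding plot_def by (simp_all add: image_subset_iff)

lemma plot_preimage_open:
 assumes "plot M C S F" "openin (mtop M) W"
 shows "open_in C {x \<in> S. F x \<in> W}"
proof -
 have "openin (top_of_set S) {x \<in> topspace (top_of_set S). F x \<in> W}"
  using openin_continuous_map_preimage plotD(3)[OF assms(1)] assms(2) by blast
 then show ?thesis using openin_trans[OF _ plotD(2)[OF assms(1)]] by simp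
qed

lemma smooth_map_if_plots:
 assumes "continuous_map (mtop M) (mtop N) F"
  and "!!c. c \<in> atlas M ==> inj_on (snd c) (fst c)"
  and "!!c. c \<in> atlas M ==> plot N (coords M) (snd c ` fst c) (F o chart_inv c)"
 shows "smooth_map M N F"
 unfolding smooth_map_def
proof (intro conjI ballI assms(1))
 fix c d assume c: "c \<in> atlas M" and d: "d \<in> atlas N"
 have "{x \<in> snd c ` fst c. (F o chart_inv c) x \<in> fst d} = snd c ` {x \<in> fst c. F x \<in> fst d}"
  using assms(2)[OF c] by (auto simp: chart_inv_def)
 then show "smooth_on (coords M) (snd c ` {x \<in> fst c. F x \<in> fst d}) (snd d o F o chart_inv c)"
  using plotD(4)[OF assms(3)[OF c] d] by (simp add: o_assoc)
qed

context manifold_ctx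
begin

lemma plot_localI:
 assumes C: "C \<subseteq> Basis" and S: "open_in C S"
  and loc: "!!x. x \<in> S ==> \<exists>S' d. open_in C S' & x \<in> S' & S' \<subseteq> S & d \<in> atlas M &
   F ` S' \<subseteq> fst d & smooth_on C S' (snd d o F)"
 shows "plot M C S F"
 unfolding plot_def
proof (intro conjI C S ballI)
 show cont: "continuous_map (top_of_set S) (mtop M) F"
  unfolding continuous_map_def
 proof (intro conjI allI impI)
  show "F \<in> topspace (top_of_set S) \<rightarrow> points M"
  proof
   fix x assume "x \<in> topspace (top_of_set S)"
   then have "x \<in> S" by simp
   from loc[OF this] obtain S' d where "x \<in> S'" "d \<in> atlas M" "F ` S' \<subseteq> fst d" by (elim exE conjE)
   then show "F x \<in> points M" using chart_sub[of d] by blast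
  qed
  fix W assume W: "openin (mtop M) W"
  show "openin (top_of_set S) {x \<in> topspace (top_of_set S). F x \<in> W}"
  proof (subst openin_subopen, intro ballI)
   fix x assume "x \<in> {x \<in> topspace (top_of_set S). F x \<in> W}"
   then have x: "x \<in> S" "F x \<in> W" by auto
   from loc[OF x(1)] obtain S' d where S': "open_in C S'" "x \<in> S'" "S' \<subseteq> S" "d \<in> atlas M"
    "F ` S' \<subseteq> fst d" "smooth_on C S' (snd d o F)" by (elim exE conjE)
   have "continuous_on S' (snd d o F)" using Ck_on_continuous[OF smooth_on_Ck[OF S'(6)]] .
   moreover have "snd d o F \<in> S' \<rightarrow> span B"
    using S'(5) chart_image_span[OF S'(4)] unfolding Pi_iff o_def by blast
   ultimately have "openin (top_of_set S') (S' Int (snd d o F) -` (snd d ` (fst d Int W)))"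
    by (rule continuous_openin_preimage[OF _ _ open_chart_image[OF S'(4) W]])
   then have "open_in C (S' Int (snd d o F) -` (snd d ` (fst d Int W)))"
    by (rule openin_trans[OF _ S'(1)])
   then have "openin (top_of_set S) (S' Int (snd d o F) -` (snd d ` (fst d Int W)))"
    by (rule openin_subset_trans) (use S'(3) openin_imp_subset[OF S] in blast)+
   moreover have "S' Int (snd d o F) -` (snd d ` (fst d Int W)) \<subseteq> {x \<in> topspace (top_of_set S). F x \<in> W}"
   proof
    fix y assume y: "y \<in> S' Int (snd d o F) -` (snd d ` (fst d Int W))"
    then obtain p where "p \<in> fst d" "p \<in> W" "snd d (F y) = snd d p" by auto
    then have "F y = p" using y S'(5) chart_inj[OF S'(4)] by (auto dest: inj_onD)
    then show "y \<in> {x \<in> topspace (top_of_set S). F x \<in> W}" using y S'(3) \<open>p \<in> W\<close> by auto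
   qed
   moreover have "x \<in> S' Int (snd d o F) -` (snd d ` (fst d Int W))" using x S' by auto
   ultimately show "\<exists>T. openin (top_of_set S) T & x \<in> T & T \<subseteq> {x \<in> topspace (top_of_set S). F x \<in> W}"
    by blast
  qed
 qed
 fix d' assume d': "d' \<in> atlas M"
 show "smooth_on C {x \<in> S. F x \<in> fst d'} (snd d' o F)"
 proof (rule smooth_on_local)
  fix x assume "x \<in> {x \<in> S. F x \<in> fst d'}"
  then have x: "x \<in> S" "F x \<in> fst d'" by auto
  from loc[OF x(1)] obtain S' d where S': "open_in C S'" "x \<in> S'" "S' \<subseteq> S" "d \<in> atlas M"
    "F ` S' \<subseteq> fst d" "smooth_on C S' (snd d o F)" by (elim exE conjE)
  obtain G where G: "open G" "S' = span C Int G" using S'(1) unfolding openin_open by blast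
  have "S \<subseteq> span C" using S openin_imp_subset by blast
  then have eq: "{x \<in> S. F x \<in> fst d'} Int G = {x \<in> S'. F x \<in> fst d'}" using G(2) S'(3) by blast
  have op: "open_in C {x \<in> S'. F x \<in> fst d'}"
  proof -
   have "openin (top_of_set S) {x \<in> topspace (top_of_set S). F x \<in> fst d'}"
    using openin_continuous_map_preimage[OF cont chart_open[OF d']] .
   then have "open_in C {x \<in> S. F x \<in> fst d'}" using openin_trans[OF _ S] by simp
   then have "open_in C ({x \<in> S. F x \<in> fst d'} Int G)" using G(1) by (simp add: openin_Int_open)
   then show ?thesis using eq by simp
  qed
  have sm: "smooth_on C {x \<in> S'. F x \<in> fst d'} (%x. (snd d' o chart_inv d) ((snd d o F) x))"
  proof (rule smooth_on_compose_span[OF C B_Basis open_along_openin[OF op] open_chart_image[OF S'(4) chart_open[OF d']],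
     where f = "snd d o F" and g = "snd d' o chart_inv d"])
   show "smooth_on C {x \<in> S'. F x \<in> fst d'} (snd d o F)" by (rule smooth_on_subset[OF S'(6)]) blast
   show "smooth_on B (snd d ` (fst d Int fst d')) (snd d' o chart_inv d)" using transition_smooth[OF S'(4) d'] .
   show "(snd d o F) y \<in> snd d ` (fst d Int fst d')" if "y \<in> {x \<in> S'. F x \<in> fst d'}" for y
    using that S'(5) by (simp add: image_subset_iff)
  qed
  have "(snd d' o chart_inv d) ((snd d o F) y) = (snd d' o F) y" if "y \<in> {x \<in> S'. F x \<in> fst d'}" for y
   using that S'(5) chart_inv_left[OF S'(4), of "F y"] by (simp add: image_subset_iff)
  from smooth_on_cong[OF open_along_openin[OF op] this sm]
  have "smooth_on C {x \<in> S'. F x \<in> fst d'} (snd d' o F)" .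
  then show "\<exists>G. open G & x \<in> G & smooth_on C ({x \<in> S. F x \<in> fst d'} Int G) (snd d' o F)"
   unfolding eq[symmetric] using G S'(2) by (intro exI[of _ G] conjI) simp_all
 qed
qed

lemma plot_at:
 assumes "plot M C S F" "x \<in> S"
 obtains S' d where "open_in C S'" "x \<in> S'" "S' \<subseteq> S" "d \<in> atlas M"
   "F ` S' \<subseteq> fst d" "smooth_on C S' (snd d o F)"
proof -
 obtain d where d: "d \<in> atlas M" "F x \<in> fst d" using atlas_cover plotD(5)[OF assms] by blast
 show ?thesis
  by (rule that[OF plot_preimage_open[OF assms(1) chart_open[OF d(1)]] _ _ d(1) _ plotD(4)[OF assms(1) d(1)]])
   (use d assms in auto)
qed

lemma plot_local:
 assumes "C \<subseteq> Basis" "open_in C S"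
  and "!!x. x \<in> S ==> \<exists>S'. x \<in> S' & S' \<subseteq> S & plot M C S' F"
 shows "plot M C S F"
proof (rule plot_localI[OF assms(1,2)])
 fix x assume "x \<in> S"
 from assms(3)[OF this] obtain S' where S': "x \<in> S'" "S' \<subseteq> S" "plot M C S' F" by (elim exE conjE)
 show "\<exists>S' d. open_in C S' & x \<in> S' & S' \<subseteq> S & d \<in> atlas M &
   F ` S' \<subseteq> fst d & smooth_on C S' (snd d o F)"
 proof -
  obtain T d where "open_in C T" "x \<in> T" "T \<subseteq> S'" "d \<in> atlas M"
   "F ` T \<subseteq> fst d" "smooth_on C T (snd d o F)" by (rule plot_at[OF S'(3,1)])
  moreover from this have "T \<subseteq> S" using S'(2) by blast
  ultimately show ?thesis by (intro exI[of _ T] exI[of _ d] conjI)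
 qed
qed

lemma plot_compose:
 assumes F: "plot M C S F" and D: "D \<subseteq> Basis" "open_in D T"
  and j: "smooth_on D T j" "j ` T \<subseteq> S"
 shows "plot M D T (%y. F (j y))"
proof (rule plot_localI[OF D])
 fix y assume y: "y \<in> T"
 then have "j y \<in> S" using j(2) by blast
 then obtain S' d where S': "open_in C S'" "j y \<in> S'" "S' \<subseteq> S" "d \<in> atlas M"
   "F ` S' \<subseteq> fst d" "smooth_on C S' (snd d o F)" by (rule plot_at[OF F])
 have "openin (top_of_set T) (T Int j -` S')"
  by (rule continuous_openin_preimage[OF Ck_on_continuous[OF smooth_on_Ck[OF j(1)]] _ S'(1)])
   (use j(2) plotD(6)[OF F] in auto)
 then have op: "open_in D (T Int j -` S')" by (rule openin_trans[OF _ D(2)])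
 have "smooth_on D (T Int j -` S') (%y. (snd d o F) (j y))"
  by (rule smooth_on_compose_span[OF D(1) plotD(1)[OF F] open_along_openin[OF op] S'(1) _ smooth_on_subset[OF j(1)] S'(6)])
   auto
 then have sm: "smooth_on D (T Int j -` S') (snd d o (%y. F (j y)))" by (simp add: o_def)
 have sub: "(%y. F (j y)) ` (T Int j -` S') \<subseteq> fst d" using S'(5) by blast
 show "\<exists>S' d. open_in D S' & y \<in> S' & S' \<subseteq> T & d \<in> atlas M &
   (%y. F (j y)) ` S' \<subseteq> fst d & smooth_on D S' (snd d o (%y. F (j y)))"
  using y S'(2) by (intro exI[of _ "T Int j -` S'"] exI[of _ d] conjI op sub sm S'(4)) simp_all
qed

lemma plot_subset:
 assumes "plot M C S F" "open_in C T" "T \<subseteq> S"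
 shows "plot M C T F"
 by (rule plot_compose[OF assms(1) plotD(1)[OF assms(1)] assms(2) smooth_on_id[OF open_along_openin[OF assms(2)]]])
  (use assms(3) in simp)

lemma plot_chart_inv:
 assumes "c \<in> atlas M"
 shows "plot M B (snd c ` fst c) (chart_inv c)"
proof (rule plot_localI[OF B_Basis chart_image_open[OF assms]])
 fix x assume x: "x \<in> snd c ` fst c"
 have sub: "chart_inv c ` (snd c ` fst c) \<subseteq> fst c"
  by (rule image_subsetI) (rule chart_inv_in)
 show "\<exists>S' d. open_in B S' & x \<in> S' & S' \<subseteq> snd c ` fst c & d \<in> atlas M &
   chart_inv c ` S' \<subseteq> fst d & smooth_on B S' (snd d o chart_inv c)"
  by (intro exI[of _ "snd c ` fst c"] exI[of _ c] conjI chart_image_open[OF assms] x assms subset_refl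
    sub transition_smooth[OF assms assms, unfolded Int_absorb])
qed

lemma continuous_from_charts:
 assumes "!!c. c \<in> atlas M ==> continuous_map (top_of_set (snd c ` fst c)) N (F o chart_inv c)"
 shows "continuous_map (mtop M) N F"
proof (subst continuous_map_openin_preimage_eq, intro conjI allI impI)
 show "F \<in> points M \<rightarrow> topspace N"
 proof
  fix p assume "p \<in> points M"
  then obtain c where c: "c \<in> atlas M" "p \<in> fst c" using atlas_cover by blast
  have "(F o chart_inv c) (snd c p) \<in> topspace N"
   using continuous_map_image_subset_topspace[OF assms[OF c(1)]] c(2) by (simp only: image_subset_iff) simp
  then show "F p \<in> topspace N" using c by simp
 qed
 fix W assume W: "openin N W"
 show "openin (mtop M) (points M Int F -` W)"
 proof (subst openin_subopen, intro ballI)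
  fix p assume p: "p \<in> points M Int F -` W"
  then obtain c where c: "c \<in> atlas M" "p \<in> fst c" using atlas_cover by blast
  have "openin (top_of_set (snd c ` fst c)) {x \<in> topspace (top_of_set (snd c ` fst c)). (F o chart_inv c) x \<in> W}"
   using openin_continuous_map_preimage[OF assms[OF c(1)] W] .
  then have "open_in B {x \<in> snd c ` fst c. (F o chart_inv c) x \<in> W}"
   using openin_trans[OF _ chart_image_open[OF c(1)]] by simp
  from open_chart_preimage[OF c(1) this]
  moreover have "{q \<in> fst c. snd c q \<in> {x \<in> snd c ` fst c. (F o chart_inv c) x \<in> W}} = {q \<in> fst c. F q \<in> W}"
   using c(1) by (auto dest: inj_onD[OF chart_inj[OF c(1)]])
  ultimately have "openin (mtop M) {q \<in> fst c. F q \<in> W}" by simp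
  then show "\<exists>T. openin (mtop M) T & p \<in> T & T \<subseteq> points M Int F -` W"
   using p c(2) chart_sub[OF c(1)] by (intro exI[of _ "{q \<in> fst c. F q \<in> W}"] conjI) (assumption | blast)+
 qed
qed

lemma smooth_map_from_plots:
 assumes "!!c. c \<in> atlas M ==> plot N B (snd c ` fst c) (F o chart_inv c)"
 shows "smooth_map M N F"
proof (rule smooth_map_if_plots[OF continuous_from_charts])
 show "continuous_map (top_of_set (snd c ` fst c)) (mtop N) (F o chart_inv c)" if "c \<in> atlas M" for c
  by (rule plotD(3)[OF assms[OF that]])
qed (use chart_inj assms in blast)+

end

text \<open>The image of the vector \<open>u\<close> at \<open>x\<close> under the derivative of \<open>F\<close>. Tangent maps are instances
(\<open>tangent_map_push\<close>), and vectors with given components in a chart are images under its inverse.\<close>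

definition push :: "('a, 'e::euclidean_space) manifold => ('d::euclidean_space => 'a) => 'd => 'd => ('a, 'e) tangent" where
 "push M F x u = (%d. if d \<in> charts_at M (F x) then dir_deriv (snd d o F) x u else 0)"

lemma tangent_map_push:
 "tangent_map M N F p V = push N (F o chart_inv (chart_at M p)) (snd (chart_at M p) p) (V (chart_at M p))"
 if "chart_inv (chart_at M p) (snd (chart_at M p) p) = p"
 using that unfolding tangent_map_def push_def Let_def comp_assoc by simp

context manifold_ctx
begin

lemma charts_at_iff: "c \<in> charts_at M p \<longleftrightarrow> c \<in> atlas M & p \<in> fst c"
 unfolding charts_at_def by simp

lemma chart_at: "p \<in> points M ==> chart_at M p \<in> atlas M & p \<in> fst (chart_at M p)"
proof -
 assume "p \<in> points M"
 then have "\<exists>c. c \<in> atlas M & p \<in> fst c" using atlas_cover by blast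
 from someI_ex[OF this] show ?thesis unfolding chart_at_def charts_at_def by simp
qed

lemma coord_vector_push:
 "c \<in> atlas M ==> p \<in> fst c ==> coord_vector M p c v = push M (chart_inv c) (snd c p) v"
 unfolding coord_vector_def push_def by simp

lemma plot_C1:
 assumes "plot M C S F" "d \<in> atlas M"
 shows "open_along C {x \<in> S. F x \<in> fst d}" "Ck_on k C {x \<in> S. F x \<in> fst d} (snd d o F)"
 by (rule open_along_openin[OF plot_preimage_open[OF assms(1) chart_open[OF assms(2)]]])
  (rule smooth_on_Ck[OF plotD(4)[OF assms]])

lemma push_derivative:
 assumes "plot M C S F" "x \<in> S" "u \<in> span C" "d \<in> charts_at M (F x)"
 shows "((%t. snd d (F (x + t *\<^sub>R u))) has_vector_derivative push M F x u d) (at 0)"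
  and "push M F x u d = dir_deriv (snd d o F) x u"
  and "push M F x u d \<in> span B"
proof -
 have d: "d \<in> atlas M" "F x \<in> fst d" using assms(4) by (auto simp: charts_at_iff)
 note C1 = plot_C1[OF assms(1) d(1)]
 have x: "x \<in> {x \<in> S. F x \<in> fst d}" using assms(2) d by simp
 show eq: "push M F x u d = dir_deriv (snd d o F) x u" using assms(4) by (simp add: push_def)
 have dsp: "(snd d o F) y \<in> span B" if "y \<in> {x \<in> S. F x \<in> fst d}" for y
  using that chart_image_span[OF d(1)] by auto
 have der: "((%t. (snd d o F) (x + t *\<^sub>R u)) has_vector_derivative dir_deriv (snd d o F) x u) (at 0)"
  by (rule C1_dir_deriv(1)[OF plotD(1)[OF assms(1)] C1(1) C1(2) x assms(3)])
 then show "((%t. snd d (F (x + t *\<^sub>R u))) has_vector_derivative push M F x u d) (at 0)"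
  by (simp add: eq)
 have "dir_deriv (snd d o F) x u \<in> span B"
  by (rule dir_deriv_in_span[OF B_Basis C1(1) x assms(3) der]) (intro span_diff dsp x)
 then show "push M F x u d \<in> span B" by (simp add: eq)
qed

lemma push_chain:
 assumes F: "plot M C S F" and D: "D \<subseteq> Basis" "open_in D T"
  and j: "smooth_on D T j" "j ` T \<subseteq> S" and y: "y \<in> T" "v \<in> span D"
 shows "dir_deriv j y v \<in> span C"
  and "push M (%y. F (j y)) y v = push M F (j y) (dir_deriv j y v)"
proof -
 have jy: "j y \<in> S" using j(2) y(1) by blast
 have der: "((%t. j (y + t *\<^sub>R v)) has_vector_derivative dir_deriv j y v) (at 0)"
  by (rule C1_dir_deriv(1)[OF D(1) open_along_openin[OF D(2)] smooth_on_Ck[OF j(1)] y])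
 have jsp: "j z \<in> span C" if "z \<in> T" for z using that j(2) plotD(6)[OF F] by blast
 show sp: "dir_deriv j y v \<in> span C"
  by (rule dir_deriv_in_span[OF plotD(1)[OF F] open_along_openin[OF D(2)] y der])
   (intro span_diff jsp y(1))
 show "push M (%y. F (j y)) y v = push M F (j y) (dir_deriv j y v)"
 proof
  fix d
  show "push M (%y. F (j y)) y v d = push M F (j y) (dir_deriv j y v) d"
  proof (cases "d \<in> charts_at M (F (j y))")
   case True
   then have d: "d \<in> atlas M" "F (j y) \<in> fst d" by (auto simp: charts_at_iff)
   note C1 = plot_C1[OF F d(1)]
   obtain r where r: "r > 0" "!!w. w \<in> span D ==> norm w <= r ==> y + w \<in> T"
    by (rule open_along_radius_point[OF open_along_openin[OF D(2)] y(1)]) blast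
   define T' where "T' = {t::real. norm (t *\<^sub>R v) < r}"
   have T': "open T'" "0 \<in> T'"
    unfolding T'_def using r(1) by (auto intro!: open_Collect_less continuous_intros)
   have "((%t. (snd d o F) (j (y + t *\<^sub>R v))) has_vector_derivative dir_deriv (snd d o F) (j (y + 0 *\<^sub>R v)) (dir_deriv j y v)) (at 0 within T')"
   proof (rule C1_chain[OF plotD(1)[OF F] C1(1) C1(2)])
    show "((%t. j (y + t *\<^sub>R v)) has_vector_derivative dir_deriv j y v) (at 0 within T')"
     using der by (rule has_vector_derivative_at_within)
    show "j (y + t *\<^sub>R v) - j (y + 0 *\<^sub>R v) \<in> span C" if "t \<in> T'" for t
    proof -
     have "y + t *\<^sub>R v \<in> T" using that span_scale[OF y(2)] by (intro r) (simp_all add: T'_def)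
     then have "j (y + t *\<^sub>R v) \<in> span C" using j(2) plotD(6)[OF F] by blast
     moreover have "j y \<in> span C" using jy plotD(6)[OF F] by blast
     ultimately show ?thesis by (simp add: span_diff)
    qed
   qed (use jy d sp in auto)
   then have "((%t. (snd d o F) (j (y + t *\<^sub>R v))) has_vector_derivative dir_deriv (snd d o F) (j y) (dir_deriv j y v)) (at 0)"
    using at_within_open[OF T'(2,1)] by simp
   from dir_deriv_eqI[of "%y. (snd d o F) (j y)", OF this] show ?thesis
    using True by (simp add: push_def o_def)
  qed (simp add: push_def)
 qed
qed

lemma push_cong:
 assumes "open_along C S" "x \<in> S" "u \<in> span C" "!!y. y \<in> S ==> F y = G y"
 shows "push M F x u = push M G x u"
proof
 fix d :: "('a, 'e) chart"
 have "dir_deriv (snd d o F) x u = dir_deriv (snd d o G) x u"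
  by (rule dir_deriv_cong[OF assms(1-3)]) (simp add: assms(4))
 then show "push M F x u d = push M G x u d"
  using assms(4)[OF assms(2)] by (simp add: push_def)
qed

lemma push_chart:
 assumes F: "plot M C S F" and x: "x \<in> S" "u \<in> span C" and c: "c \<in> charts_at M (F x)"
 shows "push M F x u = push M (chart_inv c) (snd c (F x)) (push M F x u c)"
proof -
 have c': "c \<in> atlas M" "F x \<in> fst c" using c by (auto simp: charts_at_iff)
 let ?T = "{x \<in> S. F x \<in> fst c}"
 have op: "open_in C ?T" by (rule plot_preimage_open[OF F chart_open[OF c'(1)]])
 have "push M F x u = push M (%y. chart_inv c ((snd c o F) y)) x u"
 proof (rule push_cong[OF open_along_openin[OF op] _ x(2)])
  show "x \<in> ?T" using x(1) c'(2) by blast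
  show "F y = chart_inv c ((snd c o F) y)" if "y \<in> ?T" for y
   using that chart_inv_left[OF c'(1), of "F y"] by simp
 qed
 also have "... = push M (chart_inv c) ((snd c o F) x) (dir_deriv (snd c o F) x u)"
 proof (rule push_chain(2)[OF plot_chart_inv[OF c'(1)] plotD(1)[OF F] op plotD(4)[OF F c'(1)] _ _ x(2)])
  show "(snd c o F) ` ?T \<subseteq> snd c ` fst c" by auto
  show "x \<in> ?T" using x(1) c'(2) by blast
 qed
 finally show ?thesis unfolding push_derivative(2)[OF F x c, symmetric] comp_apply .
qed

lemma push_in_tangent_space:
 assumes F: "plot M C S F" and x: "x \<in> S" "u \<in> span C"
 shows "push M F x u \<in> tangent_space M (F x)"
 unfolding tangent_space_def
proof (intro CollectI conjI ballI allI impI)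
 fix c assume c: "c \<in> charts_at M (F x)"
 show "push M F x u c \<in> span B" using push_derivative(3)[OF F x c] .
 fix d assume d: "d \<in> charts_at M (F x)"
 have "push M F x u d = push M (chart_inv c) (snd c (F x)) (push M F x u c) d"
  by (rule fun_cong[OF push_chart[OF F x c]])
 also have "... = dir_deriv (snd d o chart_inv c) (snd c (F x)) (push M F x u c)"
  using c d by (subst push_def) (simp only: charts_at_iff chart_inv_left simp_thms if_True)
 finally show "push M F x u d = dir_deriv (snd d o chart_inv c) (snd c (F x)) (push M F x u c)" .
qed (simp add: push_def)

lemma tangent_push:
 assumes "V \<in> tangent_space M p" "c \<in> charts_at M p"
 shows "V = push M (chart_inv c) (snd c p) (V c)" "V c \<in> span B"
proof -
 have c: "c \<in> atlas M" "p \<in> fst c" using assms(2) by (auto simp: charts_at_iff)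
 show "V = push M (chart_inv c) (snd c p) (V c)"
 proof
  fix d
  show "V d = push M (chart_inv c) (snd c p) (V c) d"
  proof (cases "d \<in> charts_at M p")
   case True
   then have "V d = dir_deriv (snd d o chart_inv c) (snd c p) (V c)"
    using assms unfolding tangent_space_def by blast
   then show ?thesis using True c by (simp add: push_def)
  next
   case False
   then have "V d = 0" using assms(1) unfolding tangent_space_def by blast
   then show ?thesis using False c by (simp add: push_def)
  qed
 qed
 show "V c \<in> span B" using assms unfolding tangent_space_def by blast
qed

lemma push_linear:
 assumes F: "plot M C S F" and x: "x \<in> S" and u: "u \<in> span C" "v \<in> span C"
 shows "push M F x (a *\<^sub>R u + b *\<^sub>R v) = (%d. a *\<^sub>R push M F x u d + b *\<^sub>R push M F x v d)"
proof
 fix d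
 show "push M F x (a *\<^sub>R u + b *\<^sub>R v) d = a *\<^sub>R push M F x u d + b *\<^sub>R push M F x v d"
 proof (cases "d \<in> charts_at M (F x)")
  case True
  then have d: "d \<in> atlas M" "F x \<in> fst d" by (auto simp: charts_at_iff)
  have lin: "dir_deriv (snd d o F) x w = lin_part C (snd d o F) x w" if "w \<in> span C" for w
   unfolding lin_part_def
   by (rule C1_dir_deriv(2)[OF plotD(1)[OF F] plot_C1(1)[OF F d(1)] plot_C1(2)[OF F d(1)] _ that])
    (use x d in simp)
  show ?thesis
   using True u lin[of u] lin[of v] lin[of "a *\<^sub>R u + b *\<^sub>R v"]
   by (simp add: push_def span_add span_scale linear_add[OF linear_lin_part] linear_cmul[OF linear_lin_part])
 qed (simp add: push_def)
qed

end

section \<open>Riemannian metrics and the function \<open>g(\<xi>, \<xi>)\<close>\<close>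

lemma dir_deriv_chain:
 fixes \<phi> :: "'c::euclidean_space => 'f::real_normed_vector" and j :: "'d::euclidean_space => 'c"
 assumes C: "C \<subseteq> Basis" "open_in C S" "Ck_on 1 C S \<phi>"
  and D: "D \<subseteq> Basis" "open_along D T" "Ck_on 1 D T j" "j ` T \<subseteq> S" and y: "y \<in> T" "v \<in> span D"
 shows "dir_deriv j y v \<in> span C"
  and "((%t. \<phi> (j (y + t *\<^sub>R v))) has_vector_derivative dir_deriv \<phi> (j y) (dir_deriv j y v)) (at 0)"
  and "dir_deriv (%y. \<phi> (j y)) y v = dir_deriv \<phi> (j y) (dir_deriv j y v)"
proof -
 have jS: "j z \<in> S" if "z \<in> T" for z using D(4) that by (rule image_subset_iff[THEN iffD1, THEN bspec])
 have jC: "j z \<in> span C" if "z \<in> T" for z using openin_imp_subset[OF C(2)] jS[OF that] by (rule subsetD)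
 have der: "((%t. j (y + t *\<^sub>R v)) has_vector_derivative dir_deriv j y v) (at 0)"
  by (rule C1_dir_deriv(1)[OF D(1-3) y])
 show sp: "dir_deriv j y v \<in> span C"
  by (rule dir_deriv_in_span[OF C(1) D(2) y der]) (intro span_diff jC y(1))
 obtain r where r: "r > 0" "!!w. w \<in> span D ==> norm w <= r ==> y + w \<in> T"
  by (rule open_along_radius_point[OF D(2) y(1)]) blast
 define T' where "T' = {t::real. norm (t *\<^sub>R v) < r}"
 have T': "open T'" "0 \<in> T'"
  unfolding T'_def using r(1) by (auto intro!: open_Collect_less continuous_intros)
 have "((%t. \<phi> (j (y + t *\<^sub>R v))) has_vector_derivative dir_deriv \<phi> (j (y + 0 *\<^sub>R v)) (dir_deriv j y v)) (at 0 within T')"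
 proof (rule C1_chain[OF C(1) open_along_openin[OF C(2)] C(3)])
  show "((%t. j (y + t *\<^sub>R v)) has_vector_derivative dir_deriv j y v) (at 0 within T')"
   using der by (rule has_vector_derivative_at_within)
  show "j (y + t *\<^sub>R v) - j (y + 0 *\<^sub>R v) \<in> span C" if "t \<in> T'" for t
  proof -
   have "y + t *\<^sub>R v \<in> T" using that span_scale[OF y(2)] by (intro r) (simp_all add: T'_def)
   from span_diff[OF jC[OF this] jC[OF y(1)]] show ?thesis by simp
  qed
 qed (use jS[OF y(1)] sp in simp_all)
 then show 1: "((%t. \<phi> (j (y + t *\<^sub>R v))) has_vector_derivative dir_deriv \<phi> (j y) (dir_deriv j y v)) (at 0)"
  using at_within_open[OF T'(2,1)] by simp
 show "dir_deriv (%y. \<phi> (j y)) y v = dir_deriv \<phi> (j y) (dir_deriv j y v)"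
  using dir_deriv_eqI[of "%y. \<phi> (j y)", OF 1] .
qed

locale riemannian_ctx = manifold_ctx M for M :: "('a, 'e::euclidean_space) manifold" +
 fixes g :: "('a, 'e) tensor2"
 assumes metric: "riemannian_metric M g"
begin

abbreviation gc :: "('a, 'e) chart => 'e => 'e => 'e => real" where
 "gc \<equiv> tensor_in_chart M g"

lemma gc_left:
 "c \<in> atlas M ==> x \<in> snd c ` fst c ==> u \<in> span B ==> v \<in> span B ==> w \<in> span B ==>
  gc c x (a *\<^sub>R u + b *\<^sub>R v) w = a * gc c x u w + b * gc c x v w"
 and gc_sym: "c \<in> atlas M ==> x \<in> snd c ` fst c ==> v \<in> span B ==> w \<in> span B ==> gc c x v w = gc c x w v"
 and gc_pos: "c \<in> atlas M ==> x \<in> snd c ` fst c ==> v \<in> span B ==> v ~= 0 ==> gc c x v v > 0"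
 and gc_smooth: "c \<in> atlas M ==> v \<in> span B ==> w \<in> span B ==> smooth_on B (snd c ` fst c) (%x. gc c x v w)"
 using metric unfolding riemannian_metric_def Let_def by meson+

lemma gc_right:
 assumes "c \<in> atlas M" "x \<in> snd c ` fst c" "u \<in> span B" "v \<in> span B" "w \<in> span B"
 shows "gc c x w (a *\<^sub>R u + b *\<^sub>R v) = a * gc c x w u + b * gc c x w v"
 using gc_left[OF assms] gc_sym[OF assms(1,2)] assms(3-5) span_add span_scale by metis

lemma gc_zero: "c \<in> atlas M ==> x \<in> snd c ` fst c ==> w \<in> span B ==> gc c x 0 w = 0"
 using gc_left[of c x 0 0 w 0 0] by (simp add: span_zero)

lemma gc_sum_left:
 assumes "c \<in> atlas M" "x \<in> snd c ` fst c" "w \<in> span B" "finite A" "A \<subseteq> B"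
 shows "gc c x (\<Sum>b\<in>A. a b *\<^sub>R b) w = (\<Sum>b\<in>A. a b * gc c x b w)"
 using assms(4,5)
proof (induction A rule: finite_induct)
 case empty
 then show ?case using gc_zero assms by simp
next
 case (insert b A)
 have sp: "(\<Sum>b\<in>A. a b *\<^sub>R b) \<in> span B" using insert.prems by (intro span_sum span_scale) (auto intro: span_base)
 have b: "b \<in> span B" using insert.prems by (auto intro: span_base)
 have "gc c x (\<Sum>b\<in>insert b A. a b *\<^sub>R b) w = gc c x (a b *\<^sub>R b + 1 *\<^sub>R (\<Sum>b\<in>A. a b *\<^sub>R b)) w"
  using insert.hyps by simp
 also have "... = a b * gc c x b w + 1 * gc c x (\<Sum>b\<in>A. a b *\<^sub>R b) w"
  by (rule gc_left[OF assms(1,2) b sp assms(3)])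
 finally show ?case using insert by simp
qed

lemma gc_expand:
 assumes "c \<in> atlas M" "x \<in> snd c ` fst c" "v \<in> span B" "w \<in> span B"
 shows "gc c x v w = (\<Sum>b\<in>B. \<Sum>d\<in>B. ((v \<bullet> b) * (w \<bullet> d)) * gc c x b d)"
proof -
 have fB: "finite B" by (rule finite_Basis_subset[OF B_Basis])
 have left: "gc c x u z = (\<Sum>b\<in>B. (u \<bullet> b) * gc c x b z)" if "u \<in> span B" "z \<in> span B" for u z
  using gc_sum_left[OF assms(1,2) that(2) fB subset_refl, of "%b. u \<bullet> b"]
  unfolding sum_Basis_inner[OF B_Basis that(1)] .
 have "gc c x v w = (\<Sum>b\<in>B. (v \<bullet> b) * gc c x b w)" by (rule left[OF assms(3,4)])
 also have "... = (\<Sum>b\<in>B. \<Sum>d\<in>B. ((v \<bullet> b) * (w \<bullet> d)) * gc c x b d)"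
 proof (rule sum.cong[OF refl])
  fix b assume b: "b \<in> B"
  have "gc c x b w = gc c x w b" by (rule gc_sym[OF assms(1,2) span_base[OF b] assms(4)])
  also have "... = (\<Sum>d\<in>B. (w \<bullet> d) * gc c x d b)" by (rule left[OF assms(4) span_base[OF b]])
  also have "... = (\<Sum>d\<in>B. (w \<bullet> d) * gc c x b d)"
   by (intro sum.cong refl arg_cong[where f = "(*) _"] gc_sym[OF assms(1,2)] span_base b)
  finally show "(v \<bullet> b) * gc c x b w = (\<Sum>d\<in>B. ((v \<bullet> b) * (w \<bullet> d)) * gc c x b d)"
   by (simp add: sum_distrib_left mult.assoc)
 qed
 finally show ?thesis .
qed

lemma tensor_push:
 assumes "c \<in> atlas M" "x \<in> snd c ` fst c"
 shows "gc c x v w = g (chart_inv c x) (push M (chart_inv c) x v) (push M (chart_inv c) x w)"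
 unfolding tensor_in_chart_def Let_def coord_vector_push[OF assms(1) chart_inv_in[OF assms(2)]]
  chart_inv_right[OF assms(2)] ..

lemma tangent_metric:
 assumes "V \<in> tangent_space M p" "W \<in> tangent_space M p" "c \<in> charts_at M p"
 shows "g p V W = gc c (snd c p) (V c) (W c)"
proof -
 have c: "c \<in> atlas M" "p \<in> fst c" using assms(3) by (auto simp: charts_at_iff)
 have "gc c (snd c p) (V c) (W c) = g p (push M (chart_inv c) (snd c p) (V c)) (push M (chart_inv c) (snd c p) (W c))"
  using tensor_push[OF c(1) imageI[OF c(2)]] chart_inv_left[OF c] by simp
 also have "... = g p V W"
  using tangent_push(1)[OF assms(1,3), symmetric] tangent_push(1)[OF assms(2,3), symmetric] by (simp only:)
 finally show ?thesis by simp
qed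

text \<open>The pullback of the metric by a plot; it reduces statements about tangent vectors to coordinate vectors.\<close>

definition pb :: "('d::euclidean_space => 'a) => 'd => 'd => 'd => real" where
 "pb F x u v = g (F x) (push M F x u) (push M F x v)"

lemma pb_chart:
 assumes F: "plot M C S F" and x: "x \<in> S" "u \<in> span C" "v \<in> span C" and c: "c \<in> charts_at M (F x)"
 shows "pb F x u v = gc c (snd c (F x)) (push M F x u c) (push M F x v c)"
 unfolding pb_def
 by (rule tangent_metric[OF push_in_tangent_space[OF F x(1,2)] push_in_tangent_space[OF F x(1,3)] c])

lemma gc_chart_inv:
 assumes "c \<in> atlas M" "x \<in> snd c ` fst c"
 shows "gc c x v w = pb (chart_inv c) x v w"
 using tensor_push[OF assms] by (simp add: pb_def)

lemma smooth_gc: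
 assumes c: "c \<in> atlas M" and C: "C \<subseteq> Basis" "open_in C S"
  and k: "smooth_on C S k" "!!x. x \<in> S ==> k x \<in> snd c ` fst c"
  and U: "smooth_on C S U" "!!x. x \<in> S ==> U x \<in> span B" and V: "smooth_on C S V" "!!x. x \<in> S ==> V x \<in> span B"
 shows "smooth_on C S (%x. gc c (k x) (U x) (V x))"
proof (rule smooth_on_cong[OF open_along_openin[OF C(2)]])
 show "smooth_on C S (%x. \<Sum>b\<in>B. \<Sum>d\<in>B. ((U x \<bullet> b) * (V x \<bullet> d)) * gc c (k x) b d)"
 proof (intro smooth_on_sum smooth_on_mult smooth_on_inner open_along_openin[OF C(2)] U(1) V(1) smooth_on_const)
  fix b d assume "b \<in> B" "d \<in> B"
  then have "smooth_on B (snd c ` fst c) (%x. gc c x b d)" using gc_smooth[OF c] span_base by metis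
  from smooth_on_compose_span[OF C(1) B_Basis open_along_openin[OF C(2)] chart_image_open[OF c] k(2) k(1) this]
  show "smooth_on C S (%x. gc c (k x) b d)" .
 qed
 show "(\<Sum>b\<in>B. \<Sum>d\<in>B. ((U x \<bullet> b) * (V x \<bullet> d)) * gc c (k x) b d) = gc c (k x) (U x) (V x)" if "x \<in> S" for x
  by (rule gc_expand[OF c k(2)[OF that] U(2)[OF that] V(2)[OF that], symmetric])
qed

text \<open>The product rule for \<open>g(U, V)\<close> along a curve; the metric is expanded in the basis to differentiate it.\<close>

lemma gc_derivative:
 assumes c: "c \<in> atlas M"
  and k: "(k has_vector_derivative k') (at t within T)" "k' \<in> span B" "!!s. s \<in> T ==> k s \<in> snd c ` fst c"
  and U: "(U has_vector_derivative U') (at t within T)" "U' \<in> span B" "!!s. s \<in> T ==> U s \<in> span B"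
  and V: "(V has_vector_derivative V') (at t within T)" "V' \<in> span B" "!!s. s \<in> T ==> V s \<in> span B"
  and t: "t \<in> T"
 shows "((%s. gc c (k s) (U s) (V s)) has_vector_derivative
   dir_deriv (%y. gc c y (U t) (V t)) (k t) k' + gc c (k t) U' (V t) + gc c (k t) (U t) V') (at t within T)"
proof -
 have fB: "finite B" by (rule finite_Basis_subset[OF B_Basis])
 let ?h = "%b d y. gc c y b d"
 have C1: "Ck_on 1 B (snd c ` fst c) (?h b d)" if "b \<in> B" "d \<in> B" for b d
  by (rule smooth_on_Ck[OF gc_smooth[OF c span_base[OF that(1)] span_base[OF that(2)]]])
 note op = open_along_openin[OF chart_image_open[OF c]]
 have ksp: "k s - k t \<in> span B" if "s \<in> T" for s
  using k(3)[OF that] k(3)[OF t] chart_image_span[OF c] by (intro span_diff) (auto dest: subsetD)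
 have h': "((%s. ?h b d (k s)) has_vector_derivative dir_deriv (?h b d) (k t) k') (at t within T)"
  if "b \<in> B" "d \<in> B" for b d
  by (rule C1_chain[OF B_Basis op C1[OF that] k(3)[OF t] k(1) ksp k(2)])
 have inn: "((%s. W s \<bullet> b) has_vector_derivative W' \<bullet> b) (at t within T)"
  if "(W has_vector_derivative W') (at t within T)" for W W' b
  by (rule bounded_linear.has_vector_derivative[OF bounded_linear_inner_left that])
 have "((%s. \<Sum>b\<in>B. \<Sum>d\<in>B. ((U s \<bullet> b) * (V s \<bullet> d)) * ?h b d (k s)) has_vector_derivative
   (\<Sum>b\<in>B. \<Sum>d\<in>B. ((U t \<bullet> b) * (V t \<bullet> d)) * dir_deriv (?h b d) (k t) k'
    + ((U t \<bullet> b) * (V' \<bullet> d) + (U' \<bullet> b) * (V t \<bullet> d)) * ?h b d (k t))) (at t within T)"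
  by (intro has_vector_derivative_sum has_vector_derivative_mult inn U V h')
 moreover have sum1: "(\<Sum>b\<in>B. \<Sum>d\<in>B. ((U t \<bullet> b) * (V t \<bullet> d)) * dir_deriv (?h b d) (k t) k')
   = dir_deriv (%y. gc c y (U t) (V t)) (k t) k'"
 proof -
  have "dir_deriv (%y. gc c y (U t) (V t)) (k t) k' =
   dir_deriv (%y. \<Sum>b\<in>B. \<Sum>d\<in>B. ((U t \<bullet> b) * (V t \<bullet> d)) *\<^sub>R ?h b d y) (k t) k'"
   by (rule dir_deriv_cong[OF op k(3)[OF t] k(2)]) (simp add: gc_expand[OF c _ U(3)[OF t] V(3)[OF t]])
  also have "... = (\<Sum>b\<in>B. \<Sum>d\<in>B. ((U t \<bullet> b) * (V t \<bullet> d)) *\<^sub>R dir_deriv (?h b d) (k t) k')"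
   by (intro dir_deriv_eqI has_vector_derivative_sum
     bounded_linear.has_vector_derivative[OF bounded_linear_scaleR_right]
     C1_dir_deriv(1)[OF B_Basis op C1 k(3)[OF t] k(2)])
  finally show ?thesis by simp
 qed
 moreover have "(\<Sum>b\<in>B. \<Sum>d\<in>B. ((U t \<bullet> b) * (V t \<bullet> d)) * dir_deriv (?h b d) (k t) k'
    + ((U t \<bullet> b) * (V' \<bullet> d) + (U' \<bullet> b) * (V t \<bullet> d)) * ?h b d (k t))
   = dir_deriv (%y. gc c y (U t) (V t)) (k t) k' + gc c (k t) U' (V t) + gc c (k t) (U t) V'"
  unfolding distrib_right sum.distrib sum1
   gc_expand[OF c k(3)[OF t] U(2) V(3)[OF t]] gc_expand[OF c k(3)[OF t] U(3)[OF t] V(2)]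
  by linarith
 ultimately have "((%s. \<Sum>b\<in>B. \<Sum>d\<in>B. ((U s \<bullet> b) * (V s \<bullet> d)) * ?h b d (k s)) has_vector_derivative
   dir_deriv (%y. gc c y (U t) (V t)) (k t) k' + gc c (k t) U' (V t) + gc c (k t) (U t) V') (at t within T)"
  by (simp only:)
 then show ?thesis
  by (rule has_vector_derivative_transform[OF t, rotated])
   (rule gc_expand[OF c k(3) U(3) V(3)])
qed

end

locale selfsimilar_ctx = riemannian_ctx M g for M :: "('a, 'e::euclidean_space) manifold" and g +
 fixes \<xi> :: "'a => ('a, 'e) tangent"
 assumes vf: "vector_field M \<xi>" and hom: "homothetic M g \<xi>"
  and complete: "complete_vector_field M \<xi>" and potential: "potential_field M g \<xi>"
begin

definition X :: "('a, 'e) chart => 'e => 'e" where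
 "X c x = \<xi> (chart_inv c x) c"

lemma \<xi>_tangent: "p \<in> points M ==> \<xi> p \<in> tangent_space M p"
 using vf unfolding vector_field_def by blast

lemma X_smooth: "c \<in> atlas M ==> smooth_on B (snd c ` fst c) (X c)"
 using vf unfolding vector_field_def X_def[abs_def] by blast

lemma X_at: "c \<in> charts_at M p ==> X c (snd c p) = \<xi> p c"
 unfolding X_def by (simp add: charts_at_iff)

lemma chart_inv_topspace: "c \<in> atlas M ==> x \<in> snd c ` fst c ==> chart_inv c x \<in> points M"
 using chart_sub[of c] chart_inv_in[of x c] by (simp add: subset_iff)

lemma chart_inv_charts_at: "c \<in> atlas M ==> x \<in> snd c ` fst c ==> c \<in> charts_at M (chart_inv c x)"
 using chart_inv_in[of x c] by (simp add: charts_at_iff)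

lemma X_span:
 assumes "c \<in> atlas M" "x \<in> snd c ` fst c"
 shows "X c x \<in> span B"
 unfolding X_def
 by (rule tangent_push(2)[OF \<xi>_tangent[OF chart_inv_topspace[OF assms]] chart_inv_charts_at[OF assms]])

lemma \<xi>_push:
 assumes "c \<in> atlas M" "x \<in> snd c ` fst c"
 shows "\<xi> (chart_inv c x) = push M (chart_inv c) x (X c x)"
 using tangent_push(1)[OF \<xi>_tangent[OF chart_inv_topspace[OF assms]] chart_inv_charts_at[OF assms]]
 unfolding X_def chart_inv_right[OF assms(2)] .

definition f :: "'a => real" where
 "f p = g p (\<xi> p) (\<xi> p)"

lemma f_chart: "c \<in> atlas M ==> x \<in> snd c ` fst c ==> f (chart_inv c x) = gc c x (X c x) (X c x)"
 unfolding f_def by (simp add: tensor_push \<xi>_push)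

lemma f_smooth_chart:
 assumes "c \<in> atlas M"
 shows "smooth_on B (snd c ` fst c) (%x. gc c x (X c x) (X c x))"
 by (rule smooth_gc[OF assms B_Basis chart_image_open[OF assms]
    smooth_on_id[OF open_along_openin[OF chart_image_open[OF assms]]] _ X_smooth[OF assms] _ X_smooth[OF assms]])
  (use X_span[OF assms] in auto)

lemma dX:
 assumes "c \<in> atlas M" "x \<in> snd c ` fst c" "v \<in> span B"
 shows "((%t. X c (x + t *\<^sub>R v)) has_vector_derivative dir_deriv (X c) x v) (at 0)"
  and "dir_deriv (X c) x v \<in> span B"
proof -
 note op = open_along_openin[OF chart_image_open[OF assms(1)]]
 show 1: "((%t. X c (x + t *\<^sub>R v)) has_vector_derivative dir_deriv (X c) x v) (at 0)"
  by (rule C1_dir_deriv(1)[OF B_Basis op smooth_on_Ck[OF X_smooth[OF assms(1)]] assms(2,3)])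
 show "dir_deriv (X c) x v \<in> span B"
  by (rule dir_deriv_in_span[OF B_Basis op assms(2,3) 1]) (intro span_diff X_span assms)
qed

lemma gc_dir_deriv:
 assumes c: "c \<in> atlas M" and x: "x \<in> snd c ` fst c" and v: "v \<in> span B"
  and U: "((%t. U (x + t *\<^sub>R v)) has_vector_derivative U') (at 0)" "U' \<in> span B" "!!y. y \<in> snd c ` fst c ==> U y \<in> span B"
  and V: "((%t. V (x + t *\<^sub>R v)) has_vector_derivative V') (at 0)" "V' \<in> span B" "!!y. y \<in> snd c ` fst c ==> V y \<in> span B"
 shows "dir_deriv (%y. gc c y (U y) (V y)) x v =
   dir_deriv (%y. gc c y (U x) (V x)) x v + gc c x U' (V x) + gc c x (U x) V'"
proof -
 obtain r where r: "r > 0" "!!w. w \<in> span B ==> norm w <= r ==> x + w \<in> snd c ` fst c"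
  by (rule open_along_radius_point[OF open_along_openin[OF chart_image_open[OF c]] x]) blast
 define T' where "T' = {t::real. norm (t *\<^sub>R v) < r}"
 have T': "open T'" "0 \<in> T'"
  unfolding T'_def using r(1) by (auto intro!: open_Collect_less continuous_intros)
 have inT: "x + t *\<^sub>R v \<in> snd c ` fst c" if "t \<in> T'" for t
  using that span_scale[OF v] by (intro r) (simp_all add: T'_def)
 have line: "((%t. x + t *\<^sub>R v) has_vector_derivative v) (at 0 within T')"
  by (auto intro!: derivative_eq_intros)
 have "((%t. gc c (x + t *\<^sub>R v) (U (x + t *\<^sub>R v)) (V (x + t *\<^sub>R v))) has_vector_derivative
   dir_deriv (%y. gc c y (U (x + 0 *\<^sub>R v)) (V (x + 0 *\<^sub>R v))) (x + 0 *\<^sub>R v) v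
   + gc c (x + 0 *\<^sub>R v) U' (V (x + 0 *\<^sub>R v)) + gc c (x + 0 *\<^sub>R v) (U (x + 0 *\<^sub>R v)) V') (at 0 within T')"
  by (rule gc_derivative[OF c line v _ has_vector_derivative_at_within[OF U(1)] U(2) _ has_vector_derivative_at_within[OF V(1)] V(2)])
   (intro U(3) V(3) inT T'(2); assumption)+
 then show ?thesis
  using at_within_open[OF T'(2,1)] by (intro dir_deriv_eqI) simp
qed

text \<open>Locally \<open>g(\<xi>, _) = du\<close>, and second derivatives of \<open>u\<close> commute.\<close>

lemma closed_form:
 assumes c: "c \<in> atlas M" and x: "x \<in> snd c ` fst c" and v: "v \<in> span B" and w: "w \<in> span B"
 shows "dir_deriv (%y. gc c y (X c y) w) x v = dir_deriv (%y. gc c y (X c y) v) x w"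
proof -
 have p: "chart_inv c x \<in> points M" by (rule chart_inv_topspace[OF c x])
 from potential[unfolded potential_field_def, rule_format, OF p]
 obtain W h where W: "openin (mtop M) W" "chart_inv c x \<in> W" "smooth_function_on M W h" "is_gradient_on M g W h \<xi>"
  by (elim exE conjE)
 define V where "V = snd c ` (fst c Int W)"
 have V: "open_in B V" unfolding V_def by (rule open_chart_image[OF c W(1)])
 note opV = open_along_openin[OF V]
 have xV: "x \<in> V" unfolding V_def using W(2) x chart_inv_in[OF x] chart_inv_right[OF x] by (metis IntI imageI)
 have Vsub: "V \<subseteq> snd c ` fst c" unfolding V_def by auto
 have sh: "smooth_on B (snd d ` (fst d Int W)) (h o chart_inv d)" if "d \<in> atlas M" for d
  using W(3) that unfolding smooth_function_on_def by blast
 have grad: "gc c y (X c y) u = dir_deriv (h o chart_inv c) y u" if y: "y \<in> V" and u: "u \<in> span B" for y u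
 proof -
  define q where "q = chart_inv c y"
  have yc: "y \<in> snd c ` fst c" using y Vsub by (rule subsetD[rotated])
  have qW: "q \<in> W" using y c unfolding q_def V_def by auto
  have qt: "q \<in> points M" unfolding q_def by (rule chart_inv_topspace[OF c yc])
  define Z where "Z = push M (chart_inv c) y u"
  have Z: "Z \<in> tangent_space M q" unfolding Z_def q_def by (rule push_in_tangent_space[OF plot_chart_inv[OF c] yc u])
  define c' where "c' = chart_at M q"
  have c': "c' \<in> atlas M" "q \<in> fst c'" using chart_at[OF qt] by (auto simp: c'_def)
  have "gc c y (X c y) u = g q (\<xi> q) Z"
   unfolding tensor_push[OF c yc] q_def Z_def \<xi>_push[OF c yc] ..
  also have "... = differential M h q Z" using W(4) qW Z unfolding is_gradient_on_def by blast
  also have "... = dir_deriv (h o chart_inv c') (snd c' q) (Z c')"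
   unfolding differential_def Let_def c'_def ..
  also have "Z c' = dir_deriv (snd c' o chart_inv c) y u"
   using c' unfolding Z_def push_def q_def[symmetric] by (simp add: charts_at_iff)
  also have "dir_deriv (h o chart_inv c') (snd c' q) (dir_deriv (snd c' o chart_inv c) y u) = dir_deriv (h o chart_inv c) y u"
  proof -
   let ?T = "snd c ` (fst c Int (fst c' Int W))"
   have opT: "open_along B ?T"
    by (rule open_along_openin[OF open_chart_image[OF c openin_Int[OF chart_open[OF c'(1)] W(1)]]])
   have yT: "y \<in> ?T" using y c c' qW chart_inv_in[OF yc] chart_inv_right[OF yc] unfolding q_def
    by (metis IntI imageI)
   have sm: "smooth_on B ?T (snd c' o chart_inv c)"
    by (rule smooth_on_subset[OF transition_smooth[OF c c'(1)]]) blast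
   have "dir_deriv (%y. (h o chart_inv c') ((snd c' o chart_inv c) y)) y u =
     dir_deriv (h o chart_inv c') ((snd c' o chart_inv c) y) (dir_deriv (snd c' o chart_inv c) y u)"
    by (rule dir_deriv_chain(3)[OF B_Basis open_chart_image[OF c'(1) W(1)] smooth_on_Ck[OF sh[OF c'(1)]] B_Basis opT smooth_on_Ck[OF sm] _ yT u])
     (use c in auto)
   moreover have "dir_deriv (%y. (h o chart_inv c') ((snd c' o chart_inv c) y)) y u = dir_deriv (h o chart_inv c) y u"
    by (rule dir_deriv_cong[OF opT yT u]) (use c c' in auto)
   ultimately show ?thesis by (simp add: q_def)
  qed
  finally show ?thesis .
 qed
 have "dir_deriv (%y. gc c y (X c y) w) x v = dir_deriv (%y. dir_deriv (h o chart_inv c) y w) x v"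
  by (rule dir_deriv_cong[OF opV xV v grad[OF _ w]])
 also have "... = dir_deriv (%y. dir_deriv (h o chart_inv c) y v) x w"
  by (rule symmetric_second_derivative[OF B_Basis opV _ xV w v])
   (use smooth_on_Ck[OF sh[OF c]] in \<open>simp add: V_def\<close>)
 also have "... = dir_deriv (%y. gc c y (X c y) v) x w"
  by (rule dir_deriv_cong[OF opV xV w grad[OF _ v], symmetric])
 finally show ?thesis .
qed

lemma constant_field: "((%t. (%y. w) (x + t *\<^sub>R v)) has_vector_derivative 0) (at 0)"
 by simp

lemma lie_chart:
 assumes "c \<in> atlas M" "x \<in> snd c ` fst c" "v \<in> span B" "w \<in> span B"
 shows "dir_deriv (%y. gc c y v w) x (X c x) + gc c x (dir_deriv (X c) x v) w + gc c x v (dir_deriv (X c) x w) = 2 * gc c x v w"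
proof -
 have "lie_derivative_in_chart M \<xi> g c x v w = 2 * gc c x v w"
  using hom assms unfolding homothetic_def by blast
 then show ?thesis unfolding lie_derivative_in_chart_def Let_def X_def[abs_def] .
qed

text \<open>The Lie derivative evaluated at \<open>(\<xi>, w)\<close> together with closedness of \<open>g(\<xi>, _)\<close>.\<close>

lemma df_chart:
 assumes c: "c \<in> atlas M" and x: "x \<in> snd c ` fst c" and w: "w \<in> span B"
 shows "dir_deriv (%y. gc c y (X c y) (X c y)) x w = 2 * gc c x (X c x) w"
proof -
 have Xx: "X c x \<in> span B" by (rule X_span[OF c x])
 note Xs = X_span[OF c]
 note D = dX[OF c x]
 have 1: "dir_deriv (%y. gc c y (X c y) w) x (X c x) =
   dir_deriv (%y. gc c y (X c x) w) x (X c x) + gc c x (dir_deriv (X c) x (X c x)) w + gc c x (X c x) 0"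
  by (rule gc_dir_deriv[OF c x Xx D(1)[OF Xx] D(2)[OF Xx] Xs constant_field span_zero w])
 have 2: "dir_deriv (%y. gc c y (X c y) (X c x)) x w =
   dir_deriv (%y. gc c y (X c x) (X c x)) x w + gc c x (dir_deriv (X c) x w) (X c x) + gc c x (X c x) 0"
  by (rule gc_dir_deriv[OF c x w D(1)[OF w] D(2)[OF w] Xs constant_field span_zero Xx])
 have 3: "dir_deriv (%y. gc c y (X c y) (X c y)) x w =
   dir_deriv (%y. gc c y (X c x) (X c x)) x w + gc c x (dir_deriv (X c) x w) (X c x) + gc c x (X c x) (dir_deriv (X c) x w)"
  by (rule gc_dir_deriv[OF c x w D(1)[OF w] D(2)[OF w] Xs D(1)[OF w] D(2)[OF w] Xs])
 show ?thesis
  using 1 2 3 closed_form[OF c x Xx w] lie_chart[OF c x Xx w] by linarith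
qed

end

section \<open>The flow: short times\<close>

lemma C1_lipschitz:
 fixes \<phi> :: "'c::euclidean_space => 'f::real_normed_vector"
 assumes C: "C \<subseteq> Basis" "open_along C S" "Ck_on 1 C S \<phi>"
  and K: "compact K" "convex K" "K \<subseteq> S" "K \<subseteq> span C"
 obtains L where "L \<ge> 0" "!!y z. y \<in> K ==> z \<in> K ==> norm (\<phi> y - \<phi> z) <= L * norm (y - z)"
proof -
 obtain L where L: "L \<ge> 0" "!!x v. x \<in> K ==> norm (lin_part C \<phi> x v) <= L * norm v"
  by (rule lin_part_bound[OF C(1,3) K(1,3)]) blast
 show ?thesis
 proof (rule that[OF L(1)])
  fix y z assume yz: "y \<in> K" "z \<in> K"
  define j where "j s = z + s *\<^sub>R (y - z)" for s :: real
  have jK: "j s \<in> K" if "s \<in> {0..1}" for s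
  proof -
   have "j s = (1 - s) *\<^sub>R z + s *\<^sub>R y" by (simp add: j_def algebra_simps)
   then show ?thesis using convexD[OF K(2) yz(2,1), of "1 - s" s] that by simp
  qed
  have "norm (\<phi> (j 1) - \<phi> (j 0)) <= (L * norm (y - z)) * \<bar>1 - 0\<bar>"
  proof (rule vector_derivative_bound[where S = "{0..1}" and f' = "%s. lin_part C \<phi> (j s) (y - z)"])
   fix s assume s: "s \<in> {0..1::real}"
   have d: "(j has_vector_derivative (y - z)) (at s within {0..1})"
    unfolding j_def by (auto intro!: derivative_eq_intros)
   show "((%s. \<phi> (j s)) has_vector_derivative lin_part C \<phi> (j s) (y - z)) (at s within {0..1})"
    unfolding lin_part_def
   proof (rule C1_chain_curve[OF C subsetD[OF K(3) jK[OF s]] d])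
    show "j s' - j s \<in> span C" if "s' \<in> {0..1}" for s'
     by (intro span_diff subsetD[OF K(4)] jK that s)
   qed
   show "norm (lin_part C \<phi> (j s) (y - z)) <= L * norm (y - z)" by (rule L(2)[OF jK[OF s]])
  qed auto
  then show "norm (\<phi> y - \<phi> z) <= L * norm (y - z)" by (simp add: j_def)
 qed
qed

text \<open>The set of times up to which the curve lies in \<open>U\<close> is open, and closed by \<open>step\<close>.\<close>

lemma time_interval_induct:
 fixes j :: "real => 'a"
 assumes j: "continuous_map euclideanreal Y j" and U: "openin Y U"
  and step: "!!s. 0 <= s ==> s <= T ==> (!!r. 0 <= r ==> r < s ==> j r \<in> U) ==> j s \<in> U"
  and s: "0 <= s" "s <= T"
 shows "j s \<in> U"
proof (rule ccontr)
 assume neg: "j s \<notin> U"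
 define Z where "Z = {r \<in> {0..s}. j r \<notin> U}"
 have "openin euclideanreal {r \<in> topspace euclideanreal. j r \<in> U}"
  by (rule openin_continuous_map_preimage[OF j U])
 then have "closed (- {r. j r \<in> U})" by (simp add: closed_Compl)
 moreover have "Z = {0..s} Int - {r. j r \<in> U}" by (auto simp: Z_def)
 ultimately have "compact Z" by (simp add: compact_Int_closed)
 moreover have "Z ~= {}" using neg s by (auto simp: Z_def)
 ultimately obtain r where r: "r \<in> Z" "!!r'. r' \<in> Z ==> r <= r'"
  using compact_attains_inf by metis
 have "j r \<in> U"
 proof (rule step)
  show "j r' \<in> U" if "0 <= r'" "r' < r" for r'
   using r(2)[of r'] that r(1) by (force simp: Z_def)
 qed (use r(1) s in \<open>auto simp: Z_def\<close>)
 then show False using r(1) by (simp add: Z_def)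
qed

definition tdirs :: "'a::euclidean_space set => (real \<times> 'a) set" where
 "tdirs C = insert (1, 0) ((%b. (0, b)) ` C)"

lemma tdirs_Basis: "C \<subseteq> Basis ==> tdirs C \<subseteq> Basis"
 unfolding tdirs_def Basis_prod_def by auto

lemma span_tdirs: "v \<in> span (tdirs C) \<longleftrightarrow> snd v \<in> span C"
proof
 assume "v \<in> span (tdirs C)"
 then show "snd v \<in> span C"
 proof (induction rule: span_induct)
  case base
  show ?case by (auto simp: subspace_def span_add span_scale span_zero)
 next
  case (step x)
  then show ?case by (auto simp: tdirs_def span_base span_zero)
 qed
next
 assume *: "snd v \<in> span C"
 have "(0::real, snd v) \<in> span (pdirs C)" using * by (simp add: span_pdirs)
 moreover have "pdirs C \<subseteq> tdirs C" by (auto simp: pdirs_def tdirs_def)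
 ultimately have 1: "(0, snd v) \<in> span (tdirs C)" using span_mono by blast
 have "fst v *\<^sub>R (1::real, 0::'a) \<in> span (tdirs C)"
  by (intro span_scale span_base) (simp add: tdirs_def)
 from span_add[OF this 1] show "v \<in> span (tdirs C)" by (cases v) simp
qed

lemma openin_tdirs:
 assumes "open T" "open_in C S"
 shows "open_in (tdirs C) (T \<times> S)"
proof -
 obtain G where G: "open G" "S = span C Int G" using assms(2) unfolding openin_open by blast
 have "T \<times> S = span (tdirs C) Int (T \<times> G)" using G(2) by (auto simp: span_tdirs)
 then show ?thesis unfolding openin_open using open_Times[OF assms(1) G(1)] by blast
qed

lemma exp_growth:
 fixes h :: "real => real"
 assumes "!!t. (h has_vector_derivative k * h t) (at t)"
 shows "h t = exp (k * t) * h 0"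
proof -
 have "((%t. h t * exp (- k * t)) has_real_derivative 0) (at t)" for t
 proof -
  have "(h has_real_derivative k * h t) (at t)"
   using assms by (simp add: has_real_derivative_iff_has_vector_derivative)
  then show ?thesis by (auto intro!: derivative_eq_intros)
 qed
 then have "h t * exp (- k * t) = h 0 * exp (- k * 0)"
  using DERIV_isconst_all by blast
 then show ?thesis by (simp add: exp_minus field_simps)
qed

context manifold_ctx
begin

lemma Hausdorff: "Hausdorff_space (mtop M)"
 using mfd unfolding smooth_manifold_def by blast

lemma closedin_chart_compact:
 assumes "c \<in> atlas M" "compact K" "K \<subseteq> snd c ` fst c"
 shows "closedin (mtop M) (chart_inv c ` K)"
proof -
 have "compactin (top_of_set (snd c ` fst c)) K"
  using assms(2,3) by (simp add: compactin_subtopology)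
 then have "compactin (mtop M) (chart_inv c ` K)"
  by (rule image_compactin[OF _ chart_inv_continuous[OF assms(1)]])
 then show ?thesis by (rule compactin_imp_closedin[OF Hausdorff])
qed

end

context selfsimilar_ctx
begin

lemma integral_curve_chart:
 assumes "integral_curve M \<xi> j" "c \<in> atlas M" "j t \<in> fst c"
 shows "((%t. snd c (j t)) has_vector_derivative X c (snd c (j t))) (at t)"
proof -
 have c: "c \<in> charts_at M (j t)" using assms by (simp add: charts_at_iff)
 then have "((snd c o j) has_vector_derivative \<xi> (j t) c) (at t)"
  using assms(1) unfolding integral_curve_def by blast
 then show ?thesis using X_at[OF c] by (simp add: o_def)
qed

lemma integral_curve_continuous: "integral_curve M \<xi> j ==> continuous_map euclideanreal (mtop M) j"
 unfolding integral_curve_def by blast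

lemma integral_curve_topspace: "integral_curve M \<xi> j ==> j t \<in> points M"
 using continuous_map_image_subset_topspace[OF integral_curve_continuous[of j]] by (auto simp: image_subset_iff)

lemma integral_curve_open:
 assumes "integral_curve M \<xi> j" "openin (mtop M) W"
 shows "open {t. j t \<in> W}"
 using openin_continuous_map_preimage[OF integral_curve_continuous[OF assms(1)] assms(2)] by simp

lemma integral_curve_shift:
 assumes "integral_curve M \<xi> j"
 shows "integral_curve M \<xi> (%s. j (s + a))"
 unfolding integral_curve_def
proof (intro conjI allI ballI)
 have "continuous_map euclideanreal euclideanreal (%s::real. s + a)"
  by (auto intro!: continuous_intros)
 from continuous_map_compose[OF this integral_curve_continuous[OF assms]]
 show "continuous_map euclideanreal (mtop M) (%s. j (s + a))" by (simp add: o_def)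
 fix t c assume "c \<in> charts_at M (j (t + a))"
 then have d: "((snd c o j) has_vector_derivative \<xi> (j (t + a)) c) (at (t + a))"
  using assms unfolding integral_curve_def by blast
 have "((%s::real. s + a) has_vector_derivative 1) (at t)" by (auto intro!: derivative_eq_intros)
 from vector_diff_chain_at[OF this d]
 show "((snd c o (%s. j (s + a))) has_vector_derivative \<xi> (j (t + a)) c) (at t)"
  by (simp add: o_def)
qed

lemma chart_ball:
 assumes "p \<in> fst c" "c \<in> atlas M"
 obtains r where "r > 0" "cball (snd c p) r Int span B \<subseteq> snd c ` fst c"
 using cball_span_subset[OF chart_image_open[OF assms(2)] imageI[OF assms(1)]] by blast

lemma chart_nbhd_open:
 assumes "c \<in> atlas M"
 shows "openin (mtop M) {p \<in> fst c. norm (snd c p - x) < r}"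
proof -
 have "open_in B (span B Int ball x r)" by (auto simp: openin_open)
 from open_chart_preimage[OF assms this]
 have "openin (mtop M) {p \<in> fst c. snd c p \<in> span B Int ball x r}" .
 moreover have "{p \<in> fst c. snd c p \<in> span B Int ball x r} = {p \<in> fst c. norm (snd c p - x) < r}"
  using chart_image_span[OF assms] by (auto simp: dist_norm norm_minus_commute)
 ultimately show ?thesis by simp
qed

text \<open>The set where two curves agree is closed, as \<open>M\<close> is Hausdorff, and open by a Lipschitz estimate in a chart.\<close>

lemma integral_curve_unique:
 assumes j: "integral_curve M \<xi> j" and n: "integral_curve M \<xi> n" and eq: "j t0 = n t0"
 shows "j t = n t"
proof -
 define E where "E = {t. j t = n t}"
 have "closedin euclideanreal {t \<in> topspace euclideanreal. j t = n t}"
  by (rule closedin_continuous_maps_eq[OF Hausdorff integral_curve_continuous[OF j] integral_curve_continuous[OF n]])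
 then have cl: "closed E" by (simp add: E_def)
 have op: "open E"
  unfolding open_dist
 proof
  fix t1 assume "t1 \<in> E"
  then have t1: "j t1 = n t1" by (simp add: E_def)
  obtain c where c: "c \<in> atlas M" "j t1 \<in> fst c"
   using atlas_cover[OF integral_curve_topspace[OF j, of t1]] by blast
  obtain r where r: "r > 0" "cball (snd c (j t1)) r Int span B \<subseteq> snd c ` fst c"
   by (rule chart_ball[OF c(2,1)])
  define K where "K = cball (snd c (j t1)) r Int span B"
  have K: "compact K" "convex K" "K \<subseteq> snd c ` fst c" "K \<subseteq> span B"
   using r(2) unfolding K_def
   using convex_Int[OF convex_cball subspace_imp_convex[OF subspace_span]] by (auto intro!: compact_Int_closed)
  obtain L where L: "L \<ge> 0" "!!y z. y \<in> K ==> z \<in> K ==> norm (X c y - X c z) <= L * norm (y - z)"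
   by (rule C1_lipschitz[OF B_Basis open_along_openin[OF chart_image_open[OF c(1)]] smooth_on_Ck[OF X_smooth[OF c(1)]] K]) blast
  define W where "W = {p \<in> fst c. norm (snd c p - snd c (j t1)) < r}"
  have W: "openin (mtop M) W" unfolding W_def by (rule chart_nbhd_open[OF c(1)])
  have "open ({t. j t \<in> W} Int {t. n t \<in> W})"
   by (intro open_Int integral_curve_open[OF j W] integral_curve_open[OF n W])
  moreover have "t1 \<in> {t. j t \<in> W} Int {t. n t \<in> W}" using c(2) r(1) t1 by (simp add: W_def)
  ultimately obtain e where e: "e > 0" "!!t. dist t t1 < e ==> j t \<in> W & n t \<in> W"
   unfolding open_dist by (metis (no_types, lifting) IntE mem_Collect_eq)
  have WK: "snd c p \<in> K" if "p \<in> W" for p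
   using that chart_image_span[OF c(1)] by (auto simp: W_def K_def dist_norm norm_minus_commute)
  have "t2 \<in> E" if "dist t2 t1 < e" for t2
  proof -
   define a where "a = t2 - t1"
   define u where "u s = snd c (j (t1 + s * a)) - snd c (n (t1 + s * a))" for s
   have in_W: "j (t1 + s * a) \<in> W" "n (t1 + s * a) \<in> W" if "s \<in> {0..1}" for s
   proof -
    have "\<bar>s * a\<bar> <= 1 * \<bar>a\<bar>" unfolding abs_mult using that by (intro mult_right_mono) auto
    then have "dist (t1 + s * a) t1 < e" using \<open>dist t2 t1 < e\<close> by (simp add: dist_real_def a_def)
    then show "j (t1 + s * a) \<in> W" "n (t1 + s * a) \<in> W" using e(2) by blast+
   qed
   have der: "((%s. snd c (\<beta> (t1 + s * a))) has_vector_derivative a *\<^sub>R X c (snd c (\<beta> (t1 + s * a)))) (at s within {0..1})"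
    if \<beta>: "integral_curve M \<xi> \<beta>" "\<beta> (t1 + s * a) \<in> W" for \<beta> s
   proof -
    have 1: "((%s. t1 + s * a) has_vector_derivative a) (at s)" by (auto intro!: derivative_eq_intros)
    have 2: "((%t. snd c (\<beta> t)) has_vector_derivative X c (snd c (\<beta> (t1 + s * a)))) (at (t1 + s * a))"
     by (rule integral_curve_chart[OF \<beta>(1) c(1)]) (use \<beta>(2) in \<open>simp add: W_def\<close>)
    from vector_diff_chain_at[OF 1 2] show ?thesis
     by - (rule has_vector_derivative_at_within, simp add: o_def)
   qed
   have "norm (u 1) <= (norm (u 0) + 0) * exp (\<bar>a\<bar> * L + 1)"
   proof (rule gronwall[where u' = "%s. a *\<^sub>R X c (snd c (j (t1 + s * a))) - a *\<^sub>R X c (snd c (n (t1 + s * a)))"])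
    fix s assume s: "s \<in> {0..1::real}"
    show "(u has_vector_derivative a *\<^sub>R X c (snd c (j (t1 + s * a))) - a *\<^sub>R X c (snd c (n (t1 + s * a)))) (at s within {0..1})"
     unfolding u_def by (intro has_vector_derivative_diff der j n in_W s)
    have "norm (X c (snd c (j (t1 + s * a))) - X c (snd c (n (t1 + s * a)))) <= L * norm (u s)"
     unfolding u_def by (intro L(2) WK in_W s)
    then have "\<bar>a\<bar> * norm (X c (snd c (j (t1 + s * a))) - X c (snd c (n (t1 + s * a)))) <= \<bar>a\<bar> * (L * norm (u s))"
     by (rule mult_left_mono) simp
    then show "norm (a *\<^sub>R X c (snd c (j (t1 + s * a))) - a *\<^sub>R X c (snd c (n (t1 + s * a)))) <= \<bar>a\<bar> * L * norm (u s) + 0"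
     by (simp add: mult.assoc flip: scaleR_diff_right)
   qed (use L(1) in auto)
   moreover have "u 0 = 0" by (simp add: u_def t1)
   ultimately have "snd c (j t2) = snd c (n t2)" by (simp add: u_def a_def)
   moreover have "j t2 \<in> fst c" "n t2 \<in> fst c" using e(2)[OF that] by (simp_all add: W_def)
   ultimately show ?thesis using inj_onD[OF chart_inj[OF c(1)]] by (simp add: E_def)
  qed
  then show "\<exists>e>0. \<forall>t. dist t t1 < e --> t \<in> E" using e(1) by blast
 qed
 have "E = UNIV" using cl op clopen[of E] eq by (auto simp: E_def)
 then show ?thesis by (auto simp: E_def)
qed

definition flow :: "real => 'a => 'a" where
 "flow t p = (SOME j. j 0 = p & integral_curve M \<xi> j) t"

lemma flow_curve:
 assumes "p \<in> points M"
 shows "integral_curve M \<xi> (%t. flow t p)" and "flow 0 p = p"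
proof -
 have "\<exists>j. j 0 = p & integral_curve M \<xi> j"
  using complete assms unfolding complete_vector_field_def by blast
 from someI_ex[OF this] show "integral_curve M \<xi> (%t. flow t p)" "flow 0 p = p"
  unfolding flow_def by auto
qed

lemma flow_topspace [simp]: "p \<in> points M ==> flow t p \<in> points M"
 by (rule integral_curve_topspace[OF flow_curve(1)])

lemma flow_add:
 assumes "p \<in> points M"
 shows "flow s (flow t p) = flow (s + t) p"
proof -
 have 1: "integral_curve M \<xi> (%s. flow s (flow t p))" by (rule flow_curve(1)[OF flow_topspace[OF assms]])
 have 2: "integral_curve M \<xi> (%s. flow (s + t) p)" by (rule integral_curve_shift[OF flow_curve(1)[OF assms]])
 have 3: "flow 0 (flow t p) = flow (0 + t) p" by (simp add: flow_curve(2)[OF flow_topspace[OF assms]])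
 from integral_curve_unique[OF 1 2, of 0 s, OF 3] show ?thesis .
qed

lemma flow_inverse: "p \<in> points M ==> flow (- t) (flow t p) = p"
 by (simp add: flow_add flow_curve(2))

lemma flow_chart_derivative:
 assumes "p \<in> points M" "c \<in> atlas M" "flow t p \<in> fst c"
 shows "((%t. snd c (flow t p)) has_vector_derivative X c (snd c (flow t p))) (at t)"
 using integral_curve_chart[OF flow_curve(1)[OF assms(1)] assms(2,3)] .

text \<open>The speed is bounded on a compact ball, so points cannot leave it in a short time.\<close>

lemma flow_local_ball:
 assumes c: "c \<in> atlas M" and q: "q \<in> fst c"
 obtains w r R where "w > 0" "0 < r" "cball (snd c q) R Int span B \<subseteq> snd c ` fst c"
  "!!p t. p \<in> fst c ==> norm (snd c p - snd c q) < r ==> \<bar>t\<bar> <= w ==>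
    flow t p \<in> fst c & norm (snd c (flow t p) - snd c q) <= R"
proof -
 define x where "x = snd c q"
 obtain R where R: "R > 0" "cball x R Int span B \<subseteq> snd c ` fst c"
  unfolding x_def by (rule chart_ball[OF q c])
 define K where "K = cball x R Int span B"
 have K: "compact K" "K \<subseteq> snd c ` fst c" using R(2) unfolding K_def by (auto intro!: compact_Int_closed)
 have "continuous_on K (X c)"
  using Ck_on_continuous[OF smooth_on_Ck[OF X_smooth[OF c]]] K(2) by (rule continuous_on_subset)
 then obtain b where b: "b \<ge> 0" "!!y. y \<in> K ==> norm (X c y) <= b"
  using compact_bounded_norm[OF K(1)] by blast
 define w where "w = R / (4 * (b + 1))"
 have w: "w > 0" "w * b <= R / 4"
 proof -
  show "w > 0" using R(1) b(1) by (simp add: w_def)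
  have "w * b <= w * (b + 1)" using \<open>w > 0\<close> by (intro mult_left_mono) auto
  also have "... = R / 4" unfolding w_def times_divide_eq_left
   by (rule nonzero_mult_divide_mult_cancel_right) (use b(1) in simp)
  finally show "w * b <= R / 4" .
 qed
 define U where "U = {p \<in> fst c. norm (snd c p - x) < R}"
 define C where "C = chart_inv c ` (cball x (3 * R / 4) Int span B)"
 have sub: "cball x (3 * R / 4) Int span B \<subseteq> snd c ` fst c"
  using R by (intro subset_trans[OF _ R(2)]) auto
 have clC: "closedin (mtop M) C"
  unfolding C_def by (rule closedin_chart_compact[OF c _ sub]) (auto intro!: compact_Int_closed)
 have CU: "C \<subseteq> U"
 proof
  fix p assume "p \<in> C"
  then obtain y where y: "y \<in> cball x (3 * R / 4)" "y \<in> span B" "p = chart_inv c y" by (auto simp: C_def)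
  have yc: "y \<in> snd c ` fst c" using sub y by blast
  show "p \<in> U" using y(1) R(1) chart_inv_in[OF yc] chart_inv_right[OF yc] y(3)
   by (simp add: U_def dist_norm norm_minus_commute)
 qed
 have inC: "p \<in> C" if "p \<in> fst c" "norm (snd c p - x) <= 3 * R / 4" for p
 proof -
  have "snd c p \<in> cball x (3 * R / 4) Int span B"
   using that chart_image_span[OF c] by (auto simp: dist_norm norm_minus_commute)
  then have "chart_inv c (snd c p) \<in> C" unfolding C_def by (rule imageI)
  then show ?thesis using that(1) c by simp
 qed
 have opU: "openin (mtop M) U" unfolding U_def by (rule chart_nbhd_open[OF c])
 have main: "flow t p \<in> U" if p: "p \<in> fst c" "norm (snd c p - x) < R / 2" and t: "\<bar>t\<bar> <= w" for p t
 proof -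
  have pt: "p \<in> points M" using chart_sub[OF c] p(1) by (rule subsetD)
  have j: "continuous_map euclideanreal (mtop M) (%s. flow (s * t) p)"
  proof -
   have "continuous_map euclideanreal euclideanreal (%s::real. s * t)" by (auto intro!: continuous_intros)
   from continuous_map_compose[OF this integral_curve_continuous[OF flow_curve(1)[OF pt]]]
   show ?thesis by (simp add: o_def)
  qed
  have "(%s. flow (s * t) p) 1 \<in> U"
  proof (rule time_interval_induct[OF j opU, where T = 1])
   fix s :: real assume s: "0 <= s" "s <= 1" and IH: "!!r. 0 <= r ==> r < s ==> flow (r * t) p \<in> U"
   show "flow (s * t) p \<in> U"
   proof (cases "s = 0")
    case True
    then show ?thesis using p R(1) pt by (simp add: U_def flow_curve(2))
   next
    case False
    then have s0: "s > 0" using s by simp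
    have inC': "flow (r * t) p \<in> C" if r: "0 <= r" "r < s" for r
    proof -
     have U': "flow (r' * t) p \<in> U" if "r' \<in> {0..r}" for r' using IH[of r'] that r by simp
     have "norm (snd c (flow (r * t) p) - snd c (flow (0 * t) p)) <= (w * b) * \<bar>r - 0\<bar>"
     proof (rule vector_derivative_bound[where S = "{0..r}" and f' = "%r'. t *\<^sub>R X c (snd c (flow (r' * t) p))"])
      fix r' assume r': "r' \<in> {0..r}"
      have 1: "((%r. r * t) has_vector_derivative t) (at r')" by (auto intro!: derivative_eq_intros)
      have 2: "((%t. snd c (flow t p)) has_vector_derivative X c (snd c (flow (r' * t) p))) (at (r' * t))"
       by (rule flow_chart_derivative[OF pt c]) (use U'[OF r'] in \<open>simp add: U_def\<close>)
      from vector_diff_chain_at[OF 1 2]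
      show "((%r. snd c (flow (r * t) p)) has_vector_derivative t *\<^sub>R X c (snd c (flow (r' * t) p))) (at r' within {0..r})"
       by - (rule has_vector_derivative_at_within, simp add: o_def)
      have "snd c (flow (r' * t) p) \<in> K"
       using U'[OF r'] chart_image_span[OF c] by (auto simp: U_def K_def dist_norm norm_minus_commute)
      then show "norm (t *\<^sub>R X c (snd c (flow (r' * t) p))) <= w * b"
       using t b w(1) by (auto intro!: mult_mono)
     qed (use r in auto)
     also have "... <= (w * b) * 1" using r s w(1) b(1) by (intro mult_left_mono) auto
     finally have "norm (snd c (flow (r * t) p) - snd c p) <= R / 4"
      using w(2) pt by (simp add: flow_curve(2))
     then have "norm (snd c (flow (r * t) p) - x) <= 3 * R / 4"
      using p(2) norm_triangle_ineq[of "snd c (flow (r * t) p) - snd c p" "snd c p - x"] by simp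
     then show ?thesis using IH[OF r] by (intro inC) (simp add: U_def)
    qed
    have cl: "closed {r. flow (r * t) p \<in> C}"
     using closedin_continuous_map_preimage[OF j clC] by simp
    have "{0..<s} \<subseteq> {r. flow (r * t) p \<in> C}" using inC' by auto
    then have "closure {0..<s} \<subseteq> {r. flow (r * t) p \<in> C}" using cl by (rule closure_minimal)
    moreover have "s \<in> closure {0..<s}" using s0 by simp
    ultimately have "s \<in> {r. flow (r * t) p \<in> C}" by (rule subsetD)
    then have "flow (s * t) p \<in> C" by simp
    then show ?thesis using CU by (rule subsetD[rotated])
   qed
  qed auto
  then show ?thesis by simp
 qed
 show ?thesis
 proof (rule that[of w "R / 2" R])
  show "w > 0" "0 < R / 2" using w R by auto
  show "cball (snd c q) R Int span B \<subseteq> snd c ` fst c" using R(2) by (simp add: x_def)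
  show "flow t p \<in> fst c & norm (snd c (flow t p) - snd c q) <= R"
   if "p \<in> fst c" "norm (snd c p - snd c q) < R / 2" "\<bar>t\<bar> <= w" for p t
   using main[of p t] that by (simp add: U_def x_def)
 qed
qed

text \<open>For short times everything happens inside one chart, where smooth dependence on parameters applies; scaling the
field by the time, which may depend on \<open>x\<close>, brings all solutions to the interval \<open>{0..1}\<close>.\<close>

lemma flow_plot_short_time:
 assumes q: "q \<in> points M"
 obtains w W where "w > 0" "openin (mtop M) W" "q \<in> W"
  "!!(C::'d::euclidean_space set) S F i. plot M C S F ==> F ` S \<subseteq> W ==> smooth_on C S i ==>
    (!!x. x \<in> S ==> \<bar>i x\<bar> <= w) ==> plot M C S (%x. flow (i x) (F x))"
proof -
 obtain c where c: "c \<in> atlas M" "q \<in> fst c" using atlas_cover[OF q] by blast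
 obtain w r R where *: "w > 0" "0 < r" "cball (snd c q) R Int span B \<subseteq> snd c ` fst c"
  "!!p t. p \<in> fst c ==> norm (snd c p - snd c q) < r ==> \<bar>t\<bar> <= w ==>
    flow t p \<in> fst c & norm (snd c (flow t p) - snd c q) <= R"
  by (rule flow_local_ball[OF c]) blast
 define W where "W = {p \<in> fst c. norm (snd c p - snd c q) < r}"
 define K where "K = cball (snd c q) R Int span B"
 define D where "D = proj_span B -` (snd c ` fst c)"
 have D: "open D" unfolding D_def by (rule open_vimage_proj_span[OF chart_image_open[OF c(1)]])
 have KD: "K \<subseteq> D" using *(3) proj_span_id[OF B_Basis] by (auto simp: K_def D_def)
 have K: "compact K" "convex K" unfolding K_def
  using convex_Int[OF convex_cball subspace_imp_convex[OF subspace_span]] by (auto intro!: compact_Int_closed)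
 show ?thesis
 proof (rule that[OF *(1), of W])
  show "openin (mtop M) W" unfolding W_def by (rule chart_nbhd_open[OF c(1)])
  show "q \<in> W" using c(2) *(2) by (simp add: W_def)
  fix C :: "'d set" and S F i
  assume F: "plot M C S F" "F ` S \<subseteq> W" and i: "smooth_on C S i" "!!x. x \<in> S ==> \<bar>i x\<bar> <= w"
  note C = plotD(1)[OF F(1)] and S = plotD(2)[OF F(1)]
  note oS = open_along_openin[OF S]
  have FW: "F x \<in> fst c" "norm (snd c (F x) - snd c q) < r" "F x \<in> points M" if "x \<in> S" for x
   using F(2) that plotD(5)[OF F(1) that] by (auto simp: W_def)
  have flowK: "flow (t * i x) (F x) \<in> fst c & snd c (flow (t * i x) (F x)) \<in> K" if "t \<in> {0..1}" "x \<in> S" for t x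
  proof -
   have "\<bar>t * i x\<bar> <= 1 * w" unfolding abs_mult using that i(2)[OF that(2)] by (intro mult_mono) auto
   then have "flow (t * i x) (F x) \<in> fst c & norm (snd c (flow (t * i x) (F x)) - snd c q) <= R"
    by (intro *(4) FW that) simp
   then show ?thesis using chart_image_span[OF c(1)] by (auto simp: K_def dist_norm norm_minus_commute)
  qed
  define \<Gamma> where "\<Gamma> p = snd c (flow (fst p * i (snd p)) (F (snd p)))" for p
  have "smooth_on (pdirs C) ({0..1} \<times> S) \<Gamma>"
  proof (rule ODE_solution_smooth[OF C S D _ K KD, where X = "%p. i (fst (snd p)) *\<^sub>R X c (proj_span B (snd (snd p)))"])
   let ?U = "{0..1::real} \<times> S \<times> D"
   have oU: "open_along (sdirs C) ?U" by (rule open_along_sdirs[OF oS D])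
   show "smooth_on (sdirs C) ?U (%p. i (fst (snd p)) *\<^sub>R X c (proj_span B (snd (snd p))))"
   proof (rule smooth_on_scaleR[OF oU])
    have l1: "smooth_on (sdirs C) ?U (%p. fst (snd p))"
     by (rule smooth_on_bounded_linear[OF oU bounded_linear_compose[OF bounded_linear_fst bounded_linear_snd]])
    show "smooth_on (sdirs C) ?U (%p. i (fst (snd p)))"
     by (rule smooth_on_compose_span[OF sdirs_Basis[OF C] C oU S _ l1 i(1)]) auto
    have l2: "smooth_on (sdirs C) ?U (%p. proj_span B (snd (snd p)))"
     by (rule smooth_on_bounded_linear[OF oU bounded_linear_compose[OF bounded_linear_proj_span bounded_linear_compose[OF bounded_linear_snd bounded_linear_snd]]])
    show "smooth_on (sdirs C) ?U (%p. X c (proj_span B (snd (snd p))))"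
     by (rule smooth_on_compose_span[OF sdirs_Basis[OF C] B_Basis oU chart_image_open[OF c(1)] _ l2 X_smooth[OF c(1)]])
      (auto simp: D_def)
   qed
   show "\<Gamma> (t, x) \<in> K" if "t \<in> {0..1}" "x \<in> S" for t x using flowK[OF that] by (simp add: \<Gamma>_def)
   show "((%t. \<Gamma> (t, x)) has_vector_derivative i (fst (snd (t, x, \<Gamma> (t, x)))) *\<^sub>R X c (proj_span B (snd (snd (t, x, \<Gamma> (t, x)))))) (at t within {0..1})"
    if t: "t \<in> {0..1}" and x: "x \<in> S" for t x
   proof -
    have 1: "((%t. t * i x) has_vector_derivative i x) (at t)" by (auto intro!: derivative_eq_intros)
    have 2: "((%t. snd c (flow t (F x))) has_vector_derivative X c (snd c (flow (t * i x) (F x)))) (at (t * i x))"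
     by (rule flow_chart_derivative[OF FW(3)[OF x] c(1)]) (use flowK[OF t x] in simp)
    have "proj_span B (\<Gamma> (t, x)) = \<Gamma> (t, x)"
     using flowK[OF t x] by (intro proj_span_id[OF B_Basis]) (simp add: \<Gamma>_def K_def)
    then show ?thesis using has_vector_derivative_at_within[OF vector_diff_chain_at[OF 1 2]]
     by (simp add: \<Gamma>_def o_def)
   qed
   have "smooth_on C {x \<in> S. F x \<in> fst c} (snd c o F)" by (rule plotD(4)[OF F(1) c(1)])
   then have "smooth_on C S (snd c o F)" by (rule smooth_on_subset) (use FW(1) in auto)
   then show "smooth_on C S (%x. \<Gamma> (0, x))"
    by (rule smooth_on_cong[OF oS, rotated]) (simp add: \<Gamma>_def flow_curve(2) FW(3))
  qed
  from smooth_on_slice[OF C oS this, of 1]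
  have sm: "smooth_on C S (snd c o (%x. flow (i x) (F x)))" by (simp add: \<Gamma>_def o_def)
  have sub: "(%x. flow (i x) (F x)) ` S \<subseteq> fst c" using flowK[of 1] by auto
  show "plot M C S (%x. flow (i x) (F x))"
   by (rule plot_localI[OF C S]) (intro exI[of _ S] exI[of _ c] conjI S subset_refl c(1) sub sm; assumption)
 qed
qed

end

section \<open>The flow acts by homotheties\<close>

context manifold_ctx
begin

lemma plot_cong:
 assumes "plot M C S F" "!!x. x \<in> S ==> F x = G x"
 shows "plot M C S G"
 unfolding plot_def
proof (intro conjI ballI plotD(1,2)[OF assms(1)])
 show "continuous_map (top_of_set S) (mtop M) G"
  by (rule continuous_map_eq[OF plotD(3)[OF assms(1)]]) (simp add: assms(2))
 fix d assume d: "d \<in> atlas M"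
 have eq: "{x \<in> S. G x \<in> fst d} = {x \<in> S. F x \<in> fst d}" using assms(2) by auto
 show "smooth_on C {x \<in> S. G x \<in> fst d} (snd d o G)"
  unfolding eq
  by (rule smooth_on_cong[OF plot_C1(1)[OF assms(1) d] _ plotD(4)[OF assms(1) d]]) (simp add: assms(2))
qed

end

context selfsimilar_ctx
begin

text \<open>The times with this property form an open and closed set; it contains \<open>0\<close>.\<close>

lemma flow_plot_constant_time:
 fixes F :: "'d::euclidean_space => 'a"
 assumes F: "plot M C S F" and x0: "x0 \<in> S"
 shows "\<exists>S'. open_in C S' & x0 \<in> S' & S' \<subseteq> S & plot M C S' (%x. flow t (F x))"
proof -
 define G where "G = {t. \<exists>S'. open_in C S' & x0 \<in> S' & S' \<subseteq> S & plot M C S' (%x. flow t (F x))}"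
 have p0: "F x0 \<in> points M" by (rule plotD(5)[OF F x0])
 have near: "\<exists>e>0. \<forall>t t'. \<bar>t - t1\<bar> < e --> \<bar>t' - t1\<bar> < e --> t \<in> G --> t' \<in> G" for t1
 proof -
  obtain \<epsilon> W where W: "\<epsilon> > 0" "openin (mtop M) W" "flow t1 (F x0) \<in> W"
   "!!(C::'d set) S F i. plot M C S F ==> F ` S \<subseteq> W ==> smooth_on C S i ==>
    (!!x. x \<in> S ==> \<bar>i x\<bar> <= \<epsilon>) ==> plot M C S (%x. flow (i x) (F x))"
   by (rule flow_plot_short_time[OF flow_topspace[OF p0, of t1], where 'd = 'd]) blast
  have "open {t. flow t (F x0) \<in> W}" by (rule integral_curve_open[OF flow_curve(1)[OF p0] W(2)])
  then obtain e1 where e1: "e1 > 0" "!!t. dist t t1 < e1 ==> flow t (F x0) \<in> W"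
   unfolding open_dist using W(3) by (metis mem_Collect_eq)
  show ?thesis
  proof (intro exI[of _ "min e1 (\<epsilon> / 2)"] conjI allI impI)
   show "min e1 (\<epsilon> / 2) > 0" using e1(1) W(1) by simp
   fix t t' assume t: "\<bar>t - t1\<bar> < min e1 (\<epsilon> / 2)" and t': "\<bar>t' - t1\<bar> < min e1 (\<epsilon> / 2)" and "t \<in> G"
   then obtain S' where S': "open_in C S'" "x0 \<in> S'" "S' \<subseteq> S" "plot M C S' (%x. flow t (F x))"
    unfolding G_def by blast
   define S'' where "S'' = {x \<in> S'. flow t (F x) \<in> W}"
   have S'': "open_in C S''"
    unfolding S''_def by (rule plot_preimage_open[OF S'(4) W(2)])
   have pl0: "plot M C S'' (%x. flow t (F x))"
    by (rule plot_subset[OF S'(4) S'']) (auto simp: S''_def)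
   have "\<bar>t' - t\<bar> <= \<epsilon>" using t t' by arith
   then have "plot M C S'' (%x. flow (t' - t) (flow t (F x)))"
    by (intro W(4)[OF pl0 _ smooth_on_const]) (auto simp: S''_def)
   moreover have "flow (t' - t) (flow t (F x)) = flow t' (F x)" if "x \<in> S''" for x
    using plotD(5)[OF F, of x] that S'(3) by (subst flow_add) (auto simp: S''_def)
   ultimately have pl: "plot M C S'' (%x. flow t' (F x))" by (rule plot_cong)
   have "x0 \<in> S''" using S'(2) e1(2)[of t] t by (simp add: S''_def dist_real_def)
   then show "t' \<in> G" unfolding G_def using S'' pl S'(3) by (auto simp: S''_def)
  qed
 qed
 have "open G" unfolding open_dist
 proof
  fix t1 assume t1: "t1 \<in> G"
  obtain e where e: "e > 0" "\<forall>t t'. \<bar>t - t1\<bar> < e --> \<bar>t' - t1\<bar> < e --> t \<in> G --> t' \<in> G"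
   using near[of t1] by (elim exE conjE)
  have "y \<in> G" if "dist y t1 < e" for y
  proof -
   have "\<bar>y - t1\<bar> < e" "\<bar>t1 - t1\<bar> < e" using that e(1) by (simp_all add: dist_real_def)
   then show ?thesis using e(2) t1 by blast
  qed
  then show "\<exists>e>0. \<forall>y. dist y t1 < e --> y \<in> G" using e(1) by blast
 qed
 moreover have "open (- G)" unfolding open_dist
 proof
  fix t1 assume t1: "t1 \<in> - G"
  obtain e where e: "e > 0" "\<forall>t t'. \<bar>t - t1\<bar> < e --> \<bar>t' - t1\<bar> < e --> t \<in> G --> t' \<in> G"
   using near[of t1] by (elim exE conjE)
  have "y \<in> - G" if "dist y t1 < e" for y
  proof -
   have "\<bar>y - t1\<bar> < e" "\<bar>t1 - t1\<bar> < e" using that e(1) by (simp_all add: dist_real_def)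
   then show ?thesis using e(2) t1 by blast
  qed
  then show "\<exists>e>0. \<forall>y. dist y t1 < e --> y \<in> - G" using e(1) by blast
 qed
 moreover have "0 \<in> G"
 proof -
  have "plot M C S (%x. flow 0 (F x))"
   by (rule plot_cong[OF F]) (simp add: flow_curve(2) plotD(5)[OF F])
  then show ?thesis unfolding G_def using plotD(2)[OF F] x0 by blast
 qed
 ultimately have "G = UNIV" using clopen[of G] by (auto simp: closed_def)
 then have "t \<in> G" by simp
 then show ?thesis by (simp add: G_def)
qed

text \<open>The time is split into its value at a point and a short time that depends on the parameter.\<close>

theorem flow_plot:
 fixes F :: "'d::euclidean_space => 'a"
 assumes F: "plot M C S F" and i: "smooth_on C S i"
 shows "plot M C S (%x. flow (i x) (F x))"
proof (rule plot_local[OF plotD(1,2)[OF F]])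
 fix x0 assume x0: "x0 \<in> S"
 define t0 where "t0 = i x0"
 have p0: "F x0 \<in> points M" by (rule plotD(5)[OF F x0])
 obtain \<epsilon> W where W: "\<epsilon> > 0" "openin (mtop M) W" "flow t0 (F x0) \<in> W"
  "!!(C::'d set) S F i. plot M C S F ==> F ` S \<subseteq> W ==> smooth_on C S i ==>
   (!!x. x \<in> S ==> \<bar>i x\<bar> <= \<epsilon>) ==> plot M C S (%x. flow (i x) (F x))"
  by (rule flow_plot_short_time[OF flow_topspace[OF p0, of t0], where 'd = 'd]) blast
 from flow_plot_constant_time[OF F x0, of t0]
 obtain S' where S': "open_in C S'" "x0 \<in> S'" "S' \<subseteq> S" "plot M C S' (%x. flow t0 (F x))"
  by (elim exE conjE)
 have i': "smooth_on C S' i" by (rule smooth_on_subset[OF i S'(3)])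
 have "openin (top_of_set S') (S' Int i -` ball t0 \<epsilon>)"
  by (rule continuous_openin_preimage_gen[OF Ck_on_continuous[OF smooth_on_Ck[OF i']]]) simp
 then have o1: "open_in C (S' Int i -` ball t0 \<epsilon>)" by (rule openin_trans[OF _ S'(1)])
 define S'' where "S'' = (S' Int i -` ball t0 \<epsilon>) Int {x \<in> S'. flow t0 (F x) \<in> W}"
 have S'': "open_in C S''"
  unfolding S''_def by (rule openin_Int[OF o1 plot_preimage_open[OF S'(4) W(2)]])
 have pl: "plot M C S'' (%x. flow t0 (F x))"
  by (rule plot_subset[OF S'(4) S'']) (auto simp: S''_def)
 have "smooth_on C S'' i" by (rule smooth_on_subset[OF i']) (auto simp: S''_def)
 then have "smooth_on C S'' (%x. i x - t0)"
  by (intro smooth_on_diff open_along_openin[OF S''] smooth_on_const)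
 note i0 = this
 have "plot M C S'' (%x. flow (i x - t0) (flow t0 (F x)))"
 proof (rule W(4)[OF pl _ i0])
  show "(%x. flow t0 (F x)) ` S'' \<subseteq> W" by (auto simp: S''_def)
  show "\<bar>i x - t0\<bar> <= \<epsilon>" if "x \<in> S''" for x
   using that by (simp add: S''_def dist_real_def abs_minus_commute)
 qed
 moreover have "flow (i x - t0) (flow t0 (F x)) = flow (i x) (F x)" if "x \<in> S''" for x
  using plotD(5)[OF F, of x] that S'(3) by (subst flow_add) (auto simp: S''_def)
 ultimately have "plot M C S'' (%x. flow (i x) (F x))" by (rule plot_cong)
 moreover have "x0 \<in> S''" using S'(2) W(1,3) by (simp add: S''_def t0_def)
 moreover have "S'' \<subseteq> S" using S'(3) by (auto simp: S''_def)
 ultimately show "\<exists>S'. x0 \<in> S' & S' \<subseteq> S & plot M C S' (%x. flow (i x) (F x))" by blast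
qed

lemma flow_plot_fixed:
 assumes F: "plot M C S F"
 shows "plot M C S (%x. flow t (F x))"
 by (rule flow_plot[OF F smooth_on_const])

lemma flow_joint_plot:
 assumes F: "plot M C S F"
 shows "plot M (tdirs C) (UNIV \<times> S) (%p. flow (fst p) (F (snd p)))"
proof -
 note D = tdirs_Basis[OF plotD(1)[OF F]] openin_tdirs[OF open_UNIV plotD(2)[OF F]]
 have "plot M (tdirs C) (UNIV \<times> S) (%p. F (snd p))"
  by (rule plot_compose[OF F D smooth_on_bounded_linear[OF open_along_openin[OF D(2)] bounded_linear_snd]]) auto
 from flow_plot[OF this smooth_on_bounded_linear[OF open_along_openin[OF D(2)] bounded_linear_fst]]
 show ?thesis .
qed

lemma push_flow_time:
 assumes F: "plot M C S F" and x: "x \<in> S"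
 shows "push M (%p. flow (fst p) (F (snd p))) (t, x) (1, 0) = \<xi> (flow t (F x))"
proof
 fix d :: "('a, 'e) chart"
 have p: "F x \<in> points M" by (rule plotD(5)[OF F x])
 show "push M (%p. flow (fst p) (F (snd p))) (t, x) (1, 0) d = \<xi> (flow t (F x)) d"
 proof (cases "d \<in> charts_at M (flow t (F x))")
  case True
  then have d: "d \<in> atlas M" "flow t (F x) \<in> fst d" by (auto simp: charts_at_iff)
  have 1: "((%s. t + s) has_vector_derivative 1) (at 0)" by (auto intro!: derivative_eq_intros)
  have 2: "((%s. snd d (flow s (F x))) has_vector_derivative X d (snd d (flow t (F x)))) (at (t + 0))"
   using flow_chart_derivative[OF p d] by simp
  from vector_diff_chain_at[OF 1 2]
  have "((%s. snd d (flow (t + s) (F x))) has_vector_derivative X d (snd d (flow t (F x)))) (at 0)"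
   by (simp add: o_def)
  then have "dir_deriv (snd d o (%p. flow (fst p) (F (snd p)))) (t, x) (1, 0) = X d (snd d (flow t (F x)))"
   by (intro dir_deriv_eqI) simp
  then show ?thesis using True X_at[OF True] by (simp add: push_def)
 next
  case False
  moreover have "\<xi> (flow t (F x)) \<in> tangent_space M (flow t (F x))" by (rule \<xi>_tangent[OF flow_topspace[OF p]])
  ultimately have "\<xi> (flow t (F x)) d = 0" unfolding tangent_space_def by blast
  then show ?thesis using False by (simp add: push_def)
 qed
qed

lemma push_flow_space:
 "push M (%p. flow (fst p) (F (snd p))) (t, x) (0, u) = push M (%x. flow t (F x)) x u"
 unfolding push_def dir_deriv_def by (simp cong: if_cong)

lemma push_flow:
 assumes F: "plot M C S F" and i: "smooth_on C S i" and x: "x \<in> S" "u \<in> span C"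
 shows "push M (%x. flow (i x) (F x)) x u =
  (%d. push M (%y. flow (i x) (F y)) x u d + dir_deriv i x u *\<^sub>R \<xi> (flow (i x) (F x)) d)"
proof -
 note C = plotD(1,2)[OF F]
 note oS = open_along_openin[OF C(2)]
 let ?\<Psi> = "%p. flow (fst p) (F (snd p))"
 let ?\<theta> = "%x. (i x, x)"
 have \<theta>: "smooth_on C S ?\<theta>" by (rule smooth_on_Pair[OF oS i smooth_on_id[OF oS]])
 have "((%t. i (x + t *\<^sub>R u)) has_vector_derivative dir_deriv i x u) (at 0)"
  by (rule C1_dir_deriv(1)[OF C(1) oS smooth_on_Ck[OF i] x])
 moreover have "((%t. x + t *\<^sub>R u) has_vector_derivative u) (at 0)" by (auto intro!: derivative_eq_intros)
 ultimately have "((%t. ?\<theta> (x + t *\<^sub>R u)) has_vector_derivative (dir_deriv i x u, u)) (at 0)"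
  by (rule has_vector_derivative_Pair)
 then have d\<theta>: "dir_deriv ?\<theta> x u = (dir_deriv i x u, u)" by (rule dir_deriv_eqI)
 have "push M (%x. flow (i x) (F x)) x u = push M (%x. ?\<Psi> (?\<theta> x)) x u" by simp
 also have "... = push M ?\<Psi> (?\<theta> x) (dir_deriv ?\<theta> x u)"
  by (rule push_chain(2)[OF flow_joint_plot[OF F] C \<theta> _ x]) auto
 also have "dir_deriv ?\<theta> x u = dir_deriv i x u *\<^sub>R (1, 0) + 1 *\<^sub>R (0, u)" by (simp add: d\<theta>)
 also have "push M ?\<Psi> (?\<theta> x) (dir_deriv i x u *\<^sub>R (1, 0) + 1 *\<^sub>R (0, u)) =
   (%d. dir_deriv i x u *\<^sub>R push M ?\<Psi> (?\<theta> x) (1, 0) d + 1 *\<^sub>R push M ?\<Psi> (?\<theta> x) (0, u) d)"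
  by (rule push_linear[OF flow_joint_plot[OF F]]) (use x in \<open>auto simp: span_tdirs span_zero\<close>)
 finally show ?thesis by (simp add: push_flow_time[OF F x(1)] push_flow_space add.commute)
qed

text \<open>The variational equation: derivatives in time and in the parameters commute.\<close>

lemma push_flow_derivative:
 assumes F: "plot M C S F" and x: "x \<in> S" and u: "u \<in> span C" and c: "c \<in> atlas M" "flow t (F x) \<in> fst c"
 shows "((%s. push M (%y. flow s (F y)) x u c) has_vector_derivative
  dir_deriv (X c) (snd c (flow t (F x))) (push M (%y. flow t (F y)) x u c)) (at t)"
proof -
 let ?\<Psi> = "%p. flow (fst p) (F (snd p))"
 note \<Psi> = flow_joint_plot[OF F]
 have p: "F x \<in> points M" by (rule plotD(5)[OF F x])
 define O' where "O' = {p \<in> UNIV \<times> S. ?\<Psi> p \<in> fst c}"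
 define \<psi> where "\<psi> = snd c o ?\<Psi>"
 have O': "open_in (tdirs C) O'"
  unfolding O'_def by (rule plot_preimage_open[OF \<Psi> chart_open[OF c(1)]])
 have \<psi>: "smooth_on (tdirs C) O' \<psi>" unfolding O'_def \<psi>_def by (rule plotD(4)[OF \<Psi> c(1)])
 note D = plotD(1)[OF \<Psi>] and oO = open_along_openin[OF O']
 have px: "(t, x) \<in> O'" using c(2) x by (simp add: O'_def)
 have dirs: "(1, 0) \<in> span (tdirs C)" "(0, u) \<in> span (tdirs C)" using u by (auto simp: span_tdirs span_zero)
 define G where "G p = dir_deriv \<psi> p (0, u)" for p
 have sG: "smooth_on (tdirs C) O' G"
  unfolding G_def[abs_def] by (rule smooth_on_dir_deriv_span[OF D oO \<psi> dirs(2)])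
 have "((%s. G ((t, x) + s *\<^sub>R (1, 0))) has_vector_derivative dir_deriv G (t, x) (1, 0)) (at 0)"
  by (rule C1_dir_deriv(1)[OF D oO smooth_on_Ck[OF sG] px dirs(1)])
 then have "((%s. G (((0, x) + t *\<^sub>R (1, 0)) + s *\<^sub>R (1, 0))) has_vector_derivative dir_deriv G (t, x) (1, 0)) (at 0)" by simp
 from shift_line_derivative[of G, OF this]
 have der: "((%s. G (s, x)) has_vector_derivative dir_deriv G (t, x) (1, 0)) (at t)" by simp
 have time: "dir_deriv \<psi> p (1, 0) = X c (\<psi> p)" if p': "p \<in> O'" for p
 proof -
  obtain s y where sy: "p = (s, y)" "y \<in> S" "flow s (F y) \<in> fst c" using p' by (auto simp: O'_def)
  have ch: "c \<in> charts_at M (flow s (F y))" using sy c(1) by (simp add: charts_at_iff)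
  have "dir_deriv \<psi> p (1, 0) = push M ?\<Psi> (s, y) (1, 0) c" using ch by (simp add: push_def \<psi>_def sy)
  also have "... = X c (\<psi> p)" unfolding push_flow_time[OF F sy(2)] using X_at[OF ch] by (simp add: \<psi>_def sy)
  finally show ?thesis .
 qed
 have img: "\<psi> ` O' \<subseteq> snd c ` fst c" by (auto simp: \<psi>_def O'_def)
 have "dir_deriv G (t, x) (1, 0) = dir_deriv (%p. dir_deriv \<psi> p (1, 0)) (t, x) (0, u)"
  unfolding G_def[abs_def] by (rule symmetric_second_derivative[OF D oO smooth_on_Ck[OF \<psi>] px dirs(2,1)])
 also have "... = dir_deriv (%p. X c (\<psi> p)) (t, x) (0, u)"
  by (rule dir_deriv_cong[OF oO px dirs(2) time])
 also have "... = dir_deriv (X c) (\<psi> (t, x)) (dir_deriv \<psi> (t, x) (0, u))"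
  by (rule dir_deriv_chain(3)[OF B_Basis chart_image_open[OF c(1)] smooth_on_Ck[OF X_smooth[OF c(1)]] D oO smooth_on_Ck[OF \<psi>] img px dirs(2)])
 finally have eq: "dir_deriv G (t, x) (1, 0) = dir_deriv (X c) (\<psi> (t, x)) (dir_deriv \<psi> (t, x) (0, u))" .
 have pushG: "push M (%y. flow s (F y)) x u c = G (s, x)" if "flow s (F x) \<in> fst c" for s
  using that c(1) unfolding push_flow_space[symmetric] by (simp add: push_def G_def \<psi>_def charts_at_iff)
 have "open {s. flow s (F x) \<in> fst c}" by (rule integral_curve_open[OF flow_curve(1)[OF p] chart_open[OF c(1)]])
 from has_vector_derivative_transform_within_open[OF der this]
 have "((%s. push M (%y. flow s (F y)) x u c) has_vector_derivative dir_deriv G (t, x) (1, 0)) (at t)"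
  using c(2) pushG by simp
 then show ?thesis unfolding eq using pushG[OF c(2)] by (simp add: G_def \<psi>_def)
qed

text \<open>In a chart the derivative of the pullback in time is the Lie derivative of \<open>g\<close>, which is \<open>2 g\<close>; so the pullback
grows like \<open>exp (2 t)\<close>.\<close>

theorem pb_flow:
 assumes F: "plot M C S F" and x: "x \<in> S" and u: "u \<in> span C" and v: "v \<in> span C"
 shows "pb (%y. flow t (F y)) x u v = exp (2 * t) * pb F x u v"
proof -
 define h where "h t = pb (%y. flow t (F y)) x u v" for t
 have p: "F x \<in> points M" by (rule plotD(5)[OF F x])
 have "(h has_vector_derivative 2 * h t) (at t)" for t
 proof -
  obtain c where c: "c \<in> atlas M" "flow t (F x) \<in> fst c"
   using atlas_cover[OF flow_topspace[OF p, of t]] by blast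
  define T where "T = {s. flow s (F x) \<in> fst c}"
  have T: "open T" "t \<in> T"
   unfolding T_def using integral_curve_open[OF flow_curve(1)[OF p] chart_open[OF c(1)]] c(2) by auto
  define j where "j s = snd c (flow s (F x))" for s
  define Q where "Q u s = push M (%y. flow s (F y)) x u c" for u s
  have ch: "c \<in> charts_at M (flow s (F x))" if "s \<in> T" for s using that c(1) by (simp add: T_def charts_at_iff)
  have Qs: "Q u s \<in> span B" if "u \<in> span C" "s \<in> T" for u s
   unfolding Q_def by (rule push_derivative(3)[OF flow_plot_fixed[OF F] x that(1) ch[OF that(2)]])
  have jin: "j s \<in> snd c ` fst c" if "s \<in> T" for s using that by (simp add: T_def j_def)
  have hT: "h s = gc c (j s) (Q u s) (Q v s)" if "s \<in> T" for s
   unfolding h_def j_def Q_def by (rule pb_chart[OF flow_plot_fixed[OF F] x u v ch[OF that]])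
  have dj: "(j has_vector_derivative X c (j t)) (at t within T)"
   unfolding j_def[abs_def] by (rule has_vector_derivative_at_within[OF flow_chart_derivative[OF p c]])
  have dQ: "(Q u has_vector_derivative dir_deriv (X c) (j t) (Q u t)) (at t within T)" if "u \<in> span C" for u
   unfolding Q_def[abs_def] j_def by (rule has_vector_derivative_at_within[OF push_flow_derivative[OF F x that c]])
  have "((%s. gc c (j s) (Q u s) (Q v s)) has_vector_derivative
   dir_deriv (%y. gc c y (Q u t) (Q v t)) (j t) (X c (j t)) + gc c (j t) (dir_deriv (X c) (j t) (Q u t)) (Q v t)
    + gc c (j t) (Q u t) (dir_deriv (X c) (j t) (Q v t))) (at t within T)"
   by (rule gc_derivative[OF c(1) dj X_span[OF c(1) jin[OF T(2)]] jin
      dQ[OF u] dX(2)[OF c(1) jin[OF T(2)] Qs[OF u T(2)]] Qs[OF u]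
      dQ[OF v] dX(2)[OF c(1) jin[OF T(2)] Qs[OF v T(2)]] Qs[OF v] T(2)])
  then have "((%s. gc c (j s) (Q u s) (Q v s)) has_vector_derivative 2 * gc c (j t) (Q u t) (Q v t)) (at t within T)"
   unfolding lie_chart[OF c(1) jin[OF T(2)] Qs[OF u T(2)] Qs[OF v T(2)]] .
  from has_vector_derivative_transform[OF T(2) hT this]
  have "(h has_vector_derivative 2 * h t) (at t within T)" unfolding hT[OF T(2)] .
  then show ?thesis using at_within_open[OF T(2,1)] by simp
 qed
 from exp_growth[OF this, of t] have "h t = exp (2 * t) * h 0" .
 moreover have "h 0 = pb F x u v"
 proof -
  have "push M (%y. flow 0 (F y)) x w = push M F x w" if "w \<in> span C" for w
   by (rule push_cong[OF open_along_openin[OF plotD(2)[OF F]] x that]) (simp add: flow_curve(2) plotD(5)[OF F])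
  then show ?thesis using u v p by (simp add: h_def pb_def flow_curve(2))
 qed
 ultimately show ?thesis by (simp add: h_def)
qed

lemma f_flow:
 assumes p: "p \<in> points M"
 shows "f (flow t p) = exp (2 * t) * f p"
proof -
 have "((%t. f (flow t p)) has_vector_derivative 2 * f (flow t p)) (at t)" for t
 proof -
  obtain c where c: "c \<in> atlas M" "flow t p \<in> fst c"
   using atlas_cover[OF flow_topspace[OF p, of t]] by blast
  define T where "T = {s. flow s p \<in> fst c}"
  have T: "open T" "t \<in> T"
   unfolding T_def using integral_curve_open[OF flow_curve(1)[OF p] chart_open[OF c(1)]] c(2) by auto
  define j where "j s = snd c (flow s p)" for s
  have jin: "j s \<in> snd c ` fst c" if "s \<in> T" for s using that by (simp add: T_def j_def)
  have jB: "j s \<in> span B" if "s \<in> T" for s using chart_image_span[OF c(1)] jin[OF that] by (rule subsetD)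
  let ?h = "%x. gc c x (X c x) (X c x)"
  have fT: "f (flow s p) = ?h (j s)" if "s \<in> T" for s
   using f_chart[OF c(1) jin[OF that]] that chart_inv_left[OF c(1)] by (simp add: j_def T_def)
  have dj: "(j has_vector_derivative X c (j t)) (at t within T)"
   unfolding j_def[abs_def] by (rule has_vector_derivative_at_within[OF flow_chart_derivative[OF p c]])
  have "((%s. ?h (j s)) has_vector_derivative dir_deriv ?h (j t) (X c (j t))) (at t within T)"
   by (rule C1_chain[OF B_Basis open_along_openin[OF chart_image_open[OF c(1)]] smooth_on_Ck[OF f_smooth_chart[OF c(1)]]
     jin[OF T(2)] dj span_diff[OF jB jB[OF T(2)]] X_span[OF c(1) jin[OF T(2)]]])
  then have "((%s. ?h (j s)) has_vector_derivative 2 * ?h (j t)) (at t within T)"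
   unfolding df_chart[OF c(1) jin[OF T(2)] X_span[OF c(1) jin[OF T(2)]]] .
  from has_vector_derivative_transform[OF T(2) fT this]
  have "((%s. f (flow s p)) has_vector_derivative 2 * f (flow t p)) (at t within T)" unfolding fT[OF T(2)] .
  then show ?thesis using at_within_open[OF T(2,1)] by simp
 qed
 from exp_growth[of "%t. f (flow t p)" 2, OF this] show ?thesis using p by (simp add: flow_curve(2))
qed

lemma f_plot:
 assumes F: "plot M C S F"
 shows "smooth_on C S (%x. f (F x))"
  and "x \<in> S ==> u \<in> span C ==> dir_deriv (%x. f (F x)) x u = 2 * g (F x) (\<xi> (F x)) (push M F x u)"
proof -
 have loc: "open_along C {x \<in> S. F x \<in> fst c}"
  "smooth_on C {x \<in> S. F x \<in> fst c} (snd c o F)"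
  "(snd c o F) ` {x \<in> S. F x \<in> fst c} \<subseteq> snd c ` fst c"
  "!!x. x \<in> {x \<in> S. F x \<in> fst c} ==> gc c ((snd c o F) x) (X c ((snd c o F) x)) (X c ((snd c o F) x)) = f (F x)"
  if c: "c \<in> atlas M" for c
 proof -
  show "open_along C {x \<in> S. F x \<in> fst c}" by (rule plot_C1(1)[OF F c])
  show "smooth_on C {x \<in> S. F x \<in> fst c} (snd c o F)" by (rule plotD(4)[OF F c])
  show "(snd c o F) ` {x \<in> S. F x \<in> fst c} \<subseteq> snd c ` fst c" by auto
  show "gc c ((snd c o F) x) (X c ((snd c o F) x)) (X c ((snd c o F) x)) = f (F x)"
   if "x \<in> {x \<in> S. F x \<in> fst c}" for x
   using f_chart[OF c, of "snd c (F x)"] chart_inv_left[OF c, of "F x"] that by simp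
 qed
 show "smooth_on C S (%x. f (F x))"
 proof (rule smooth_on_local)
  fix x assume x: "x \<in> S"
  obtain c where c: "c \<in> atlas M" "F x \<in> fst c" using atlas_cover[OF plotD(5)[OF F x]] by blast
  obtain G where G: "open G" "{x \<in> S. F x \<in> fst c} = span C Int G"
   using plot_preimage_open[OF F chart_open[OF c(1)]] unfolding openin_open by blast
  have "S Int G = {x \<in> S. F x \<in> fst c}" using G(2) plotD(6)[OF F] by blast
  moreover have sm: "smooth_on C {x \<in> S. F x \<in> fst c} (%x. gc c ((snd c o F) x) (X c ((snd c o F) x)) (X c ((snd c o F) x)))"
   by (rule smooth_on_compose_span[OF plotD(1)[OF F] B_Basis loc(1)[OF c(1)] chart_image_open[OF c(1)] _ loc(2)[OF c(1)] f_smooth_chart[OF c(1)]])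
    auto
  have "smooth_on C {x \<in> S. F x \<in> fst c} (%x. f (F x))"
   by (rule smooth_on_cong[OF loc(1)[OF c(1)] loc(4)[OF c(1)] sm])
  ultimately show "\<exists>G. open G & x \<in> G & smooth_on C (S Int G) (%x. f (F x))"
   using G x c(2) by (intro exI[of _ G]) auto
 qed
 assume x: "x \<in> S" and u: "u \<in> span C"
 obtain c where c: "c \<in> atlas M" "F x \<in> fst c" using atlas_cover[OF plotD(5)[OF F x]] by blast
 have ch: "c \<in> charts_at M (F x)" using c by (simp add: charts_at_iff)
 have xT: "x \<in> {x \<in> S. F x \<in> fst c}" using x c by simp
 have y: "snd c (F x) \<in> snd c ` fst c" using c(2) by simp
 have "dir_deriv (%x. f (F x)) x u = dir_deriv (%x. gc c ((snd c o F) x) (X c ((snd c o F) x)) (X c ((snd c o F) x))) x u"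
  by (rule dir_deriv_cong[OF loc(1)[OF c(1)] xT u loc(4)[OF c(1), symmetric]])
 also have "... = dir_deriv (%y. gc c y (X c y) (X c y)) ((snd c o F) x) (dir_deriv (snd c o F) x u)"
  by (rule dir_deriv_chain(3)[OF B_Basis chart_image_open[OF c(1)] smooth_on_Ck[OF f_smooth_chart[OF c(1)]]
     plotD(1)[OF F] loc(1)[OF c(1)] smooth_on_Ck[OF loc(2)[OF c(1)]] loc(3)[OF c(1)] xT u])
 also have "... = 2 * gc c (snd c (F x)) (X c (snd c (F x))) (push M F x u c)"
  using df_chart[OF c(1) y push_derivative(3)[OF F x u ch]] push_derivative(2)[OF F x u ch] by simp
 also have "gc c (snd c (F x)) (X c (snd c (F x))) (push M F x u c) = g (F x) (\<xi> (F x)) (push M F x u)"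
  unfolding X_at[OF ch]
  by (rule tangent_metric[OF \<xi>_tangent[OF plotD(5)[OF F x]] push_in_tangent_space[OF F x u] ch, symmetric])
 finally show "dir_deriv (%x. f (F x)) x u = 2 * g (F x) (\<xi> (F x)) (push M F x u)" .
qed

end

section \<open>The level set \<open>g(\<xi>, \<xi>) = 1\<close>\<close>

context manifold_ctx
begin

lemma push_zero:
 assumes "plot M C S F" "x \<in> S"
 shows "push M F x 0 = (%d. 0)"
 using push_linear[OF assms span_zero span_zero, of 0 0] by simp

end

context riemannian_ctx
begin

lemma smooth_pb:
 assumes F: "plot M C S F" and u: "u \<in> span C" and v: "v \<in> span C"
 shows "smooth_on C S (%x. pb F x u v)"
proof (rule smooth_on_local)
 fix x assume x: "x \<in> S"
 obtain c where c: "c \<in> atlas M" "F x \<in> fst c" using atlas_cover[OF plotD(5)[OF F x]] by blast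
 let ?T = "{x \<in> S. F x \<in> fst c}"
 have T: "open_in C ?T" by (rule plot_preimage_open[OF F chart_open[OF c(1)]])
 obtain G where G: "open G" "?T = span C Int G" using T unfolding openin_open by blast
 have SG: "S Int G = ?T" using G(2) plotD(6)[OF F] by blast
 have ch: "c \<in> charts_at M (F y)" if "y \<in> ?T" for y using that c(1) by (simp add: charts_at_iff)
 have yS: "y \<in> S" if "y \<in> ?T" for y using that by simp
 note sm = plotD(4)[OF F c(1)]
 have "smooth_on C ?T (%y. gc c ((snd c o F) y) (dir_deriv (snd c o F) y u) (dir_deriv (snd c o F) y v))"
 proof (rule smooth_gc[OF c(1) plotD(1)[OF F] T sm])
  show "smooth_on C ?T (%y. dir_deriv (snd c o F) y u)" "smooth_on C ?T (%y. dir_deriv (snd c o F) y v)"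
   by (rule smooth_on_dir_deriv_span[OF plotD(1)[OF F] open_along_openin[OF T] sm], fact)+
  show "dir_deriv (snd c o F) y u \<in> span B" if "y \<in> ?T" for y
   using push_derivative(2,3)[OF F yS[OF that] u ch[OF that]] by simp
  show "dir_deriv (snd c o F) y v \<in> span B" if "y \<in> ?T" for y
   using push_derivative(2,3)[OF F yS[OF that] v ch[OF that]] by simp
 qed auto
 moreover have "gc c ((snd c o F) y) (dir_deriv (snd c o F) y u) (dir_deriv (snd c o F) y v) = pb F y u v" if "y \<in> ?T" for y
  unfolding pb_chart[OF F yS[OF that] u v ch[OF that]] push_derivative(2)[OF F yS[OF that] u ch[OF that]]
   push_derivative(2)[OF F yS[OF that] v ch[OF that]] comp_apply ..
 ultimately have "smooth_on C ?T (%y. pb F y u v)"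
  by - (rule smooth_on_cong[OF open_along_openin[OF T]])
 then show "\<exists>G. open G & x \<in> G & smooth_on C (S Int G) (%x. pb F x u v)"
  unfolding SG[symmetric] using G x c(2) by (intro exI[of _ G]) auto
qed

lemma pb_left:
 assumes F: "plot M C S F" and x: "x \<in> S" and u: "u \<in> span C" and v: "v \<in> span C" and w: "w \<in> span C"
 shows "pb F x (a *\<^sub>R u + b *\<^sub>R v) w = a * pb F x u w + b * pb F x v w"
  and "pb F x u w = pb F x w u"
proof -
 obtain c where c: "c \<in> atlas M" "F x \<in> fst c" using atlas_cover[OF plotD(5)[OF F x]] by blast
 have ch: "c \<in> charts_at M (F x)" using c by (simp add: charts_at_iff)
 have y: "snd c (F x) \<in> snd c ` fst c" using c by simp
 note P = pb_chart[OF F x _ _ ch]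
 note sp = push_derivative(3)[OF F x _ ch]
 have "pb F x (a *\<^sub>R u + b *\<^sub>R v) w = gc c (snd c (F x)) (push M F x (a *\<^sub>R u + b *\<^sub>R v) c) (push M F x w c)"
  by (rule P) (intro span_add span_scale u v w)+
 also have "... = a * gc c (snd c (F x)) (push M F x u c) (push M F x w c) + b * gc c (snd c (F x)) (push M F x v c) (push M F x w c)"
  unfolding push_linear[OF F x u v] by (rule gc_left[OF c(1) y sp[OF u] sp[OF v] sp[OF w]])
 finally show "pb F x (a *\<^sub>R u + b *\<^sub>R v) w = a * pb F x u w + b * pb F x v w"
  unfolding P[OF u w] P[OF v w] .
 show "pb F x u w = pb F x w u"
  unfolding P[OF u w] P[OF w u] by (rule gc_sym[OF c(1) y sp[OF u] sp[OF w]])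
qed

end

locale nonvanishing_ctx = selfsimilar_ctx M g \<xi> for M :: "('a, 'e::euclidean_space) manifold" and g \<xi> +
 assumes nonvanishing: "!!p. p \<in> points M ==> \<not> vanishes_at \<xi> p"
begin

lemma X_nonzero:
 assumes "c \<in> atlas M" "x \<in> snd c ` fst c"
 shows "X c x ~= 0"
proof
 assume "X c x = 0"
 then have "\<xi> (chart_inv c x) = (%d. 0)"
  using \<xi>_push[OF assms] push_zero[OF plot_chart_inv[OF assms(1)] assms(2)] by simp
 then show False
  using nonvanishing[OF chart_inv_topspace[OF assms]] by (simp add: vanishes_at_def)
qed

lemma f_pos:
 assumes "p \<in> points M"
 shows "f p > 0"
proof -
 obtain c where c: "c \<in> atlas M" "p \<in> fst c" using atlas_cover[OF assms] by blast
 have x: "snd c p \<in> snd c ` fst c" using c by simp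
 have "f (chart_inv c (snd c p)) > 0"
  unfolding f_chart[OF c(1) x] by (rule gc_pos[OF c(1) x X_span[OF c(1) x] X_nonzero[OF c(1) x]])
 then show ?thesis using c by simp
qed

definition radius :: "'a => real" where "radius p = sqrt (f p)"

definition retr :: "'a => 'a" where "retr p = flow (- ln (radius p)) p"

definition Nset :: "'a set" where "Nset = {p \<in> points M. f p = 1}"

lemma radius_pos: "p \<in> points M ==> radius p > 0"
 using f_pos by (simp add: radius_def)

lemma radius_flow: "p \<in> points M ==> radius (flow t p) = exp t * radius p"
proof -
 assume p: "p \<in> points M"
 have "exp (2 * t) = (exp t)\<^sup>2" by (rule exp_double)
 then show ?thesis unfolding radius_def f_flow[OF p] by (simp add: real_sqrt_mult)
qed

lemma f_radius: "p \<in> points M ==> f p = (radius p)\<^sup>2"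
 using f_pos[of p] by (simp add: radius_def)

lemma retr_in: "p \<in> points M ==> retr p \<in> Nset"
proof -
 assume p: "p \<in> points M"
 have "radius (retr p) = 1"
  unfolding retr_def radius_flow[OF p] using radius_pos[OF p] by (simp add: exp_minus)
 then show ?thesis using p f_radius[of "retr p"] by (simp add: Nset_def retr_def)
qed

lemma Nset_topspace: "p \<in> Nset ==> p \<in> points M"
 and Nset_radius: "p \<in> Nset ==> radius p = 1"
 by (auto simp: Nset_def radius_def)

lemma retr_Nset: "p \<in> Nset ==> retr p = p"
 by (simp add: retr_def Nset_radius flow_curve(2) Nset_topspace)

lemma flow_retr: "p \<in> points M ==> flow (ln (radius p)) (retr p) = p"
 unfolding retr_def by (simp add: flow_add flow_curve(2))

lemma radius_plot:
 assumes F: "plot M C S F"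
 shows "smooth_on C S (%x. radius (F x))" "smooth_on C S (%x. ln (radius (F x)))"
proof -
 note oS = open_along_openin[OF plotD(2)[OF F]]
 have sf: "Ck_on k C S (%x. f (F x))" for k by (rule smooth_on_Ck[OF f_plot(1)[OF F]])
 have r: "Ck_on k C S (%x. radius (F x))" for k
  unfolding radius_def by (rule Ck_on_sqrt[OF oS f_pos[OF plotD(5)[OF F]] sf])
 then show "smooth_on C S (%x. radius (F x))" by (simp add: smooth_on_def)
 have "Ck_on k C S (%x. ln (radius (F x)))" for k
  by (rule Ck_on_ln[OF oS radius_pos[OF plotD(5)[OF F]] r])
 then show "smooth_on C S (%x. ln (radius (F x)))" by (simp add: smooth_on_def)
qed

lemma retr_plot:
 assumes F: "plot M C S F"
 shows "plot M C S (%x. retr (F x))"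
 unfolding retr_def
 by (rule flow_plot[OF F smooth_on_minus[OF open_along_openin[OF plotD(2)[OF F]] radius_plot(2)[OF F]]])

lemma retr_continuous: "continuous_map (mtop M) (mtop M) retr"
proof (rule continuous_from_charts)
 fix c assume "c \<in> atlas M"
 from plotD(3)[OF retr_plot[OF plot_chart_inv[OF this]]]
 show "continuous_map (top_of_set (snd c ` fst c)) (mtop M) (retr o chart_inv c)" by (simp add: o_def)
qed

lemma B_nonempty: "B ~= {}"
proof
 assume "B = {}"
 obtain p where "p \<in> points M" using mfd unfolding smooth_manifold_def by blast
 then obtain c where c: "c \<in> atlas M" "p \<in> fst c" using atlas_cover by blast
 then have x: "snd c p \<in> snd c ` fst c" by simp
 show False using X_span[OF c(1) x] X_nonzero[OF c(1) x] \<open>B = {}\<close> by simp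
qed

definition b0 :: 'e where "b0 = (SOME b. b \<in> B)"

lemma b0: "b0 \<in> B"
 unfolding b0_def using B_nonempty some_in_eq by blast

text \<open>The hypersurface has one coordinate less. Which coordinate is dropped is immaterial, but it has to be the same
for all charts.\<close>

definition CN :: "'e set" where "CN = B - {b0}"

text \<open>The hypersurface has one coordinate less. Which coordinate is dropped is immaterial, but it has to be the same
for all charts.\<close>

lemma CN: "CN \<subseteq> B" "CN \<subseteq> Basis" "b0 \<notin> CN" "B = insert b0 CN"
 using b0 B_Basis by (auto simp: CN_def)

text \<open>The coordinates on the level set are linear functions of the coordinates of a chart \<open>c\<close> of \<open>M\<close>. The last clause, that
the inverse is smooth as a map into \<open>M\<close>, makes the inclusion smooth and transition maps easy.\<close>

definition slice_chart :: "('a, 'e) chart => ('a, 'e) chart => ('e => 'e) => bool" where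
 "slice_chart d c l \<longleftrightarrow> c \<in> atlas M & bounded_linear l & fst d \<subseteq> fst c Int Nset &
   snd d = (%p. l (snd c p)) & openin (subtopology (mtop M) Nset) (fst d) &
   open_in CN (snd d ` fst d) & inj_on (snd d) (fst d) &
   plot M CN (snd d ` fst d) (chart_inv d)"

definition N :: "('a, 'e) manifold" where
 "N = \<lparr>mtop = subtopology (mtop M) Nset, coords = CN, atlas = {d. \<exists>c l. slice_chart d c l}\<rparr>"

lemma N_simps [simp]: "mtop N = subtopology (mtop M) Nset" "coords N = CN"
 "d \<in> atlas N \<longleftrightarrow> (\<exists>c l. slice_chart d c l)"
 by (simp_all add: N_def)

lemma topspace_N: "points N = Nset"
 by (auto simp: Nset_def)

text \<open>Since \<open>df \<noteq> 0\<close>, some partial derivative of \<open>f\<close> is nonzero. Replacing that coordinate by \<open>f\<close> is a local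
diffeomorphism, in which the level set is an affine subspace.\<close>

lemma slice_chart_exists:
 assumes q: "q \<in> Nset"
 shows "\<exists>d\<in>atlas N. q \<in> fst d"
proof -
 obtain c where c: "c \<in> atlas M" "q \<in> fst c" using atlas_cover[OF Nset_topspace[OF q]] by blast
 define x0 where "x0 = snd c q"
 have x0: "x0 \<in> snd c ` fst c" using c by (simp add: x0_def)
 define h where "h x = f (chart_inv c x)" for x
 have hs: "smooth_on B (snd c ` fst c) h"
  unfolding h_def[abs_def] by (rule f_plot(1)[OF plot_chart_inv[OF c(1)]])
 note img = chart_image_open[OF c(1)] and oi = open_along_openin[OF chart_image_open[OF c(1)]]
 have hq: "h x0 = 1" using q c by (simp add: h_def x0_def Nset_def)
 have dhX: "dir_deriv h x0 (X c x0) ~= 0"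
 proof -
  have "dir_deriv (%x. gc c x (X c x) (X c x)) x0 (X c x0) = dir_deriv h x0 (X c x0)"
   by (rule dir_deriv_cong[OF oi x0 X_span[OF c(1) x0]]) (simp add: h_def f_chart[OF c(1)])
  then have "dir_deriv h x0 (X c x0) = 2 * gc c x0 (X c x0) (X c x0)"
   using df_chart[OF c(1) x0 X_span[OF c(1) x0]] by simp
  also have "... > 0" using gc_pos[OF c(1) x0 X_span[OF c(1) x0] X_nonzero[OF c(1) x0]] by simp
  finally show ?thesis by simp
 qed
 have dh: "dir_deriv h x0 v = (\<Sum>b\<in>B. (v \<bullet> b) *\<^sub>R dir_deriv h x0 b)" if "v \<in> span B" for v
  by (rule C1_dir_deriv(2)[OF B_Basis oi smooth_on_Ck[OF hs] x0 that])
 obtain b1 where b1: "b1 \<in> B" "dir_deriv h x0 b1 ~= 0"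
  using dhX dh[OF X_span[OF c(1) x0]] by (metis (no_types, lifting) scaleR_zero_right sum.neutral)
 have nb: "b0 \<bullet> b0 = 1" "b1 \<bullet> b1 = 1" using b0 b1 B_Basis by (auto simp: inner_Basis subset_iff)
 have fB: "finite B" by (rule finite_Basis_subset[OF B_Basis])
 \<comment> \<open>drop the coordinate b1 and rename the coordinate b0 to b1\<close>
 define w0 where "w0 v = v - (v \<bullet> b1) *\<^sub>R b1" for v :: 'e
 define l where "l v = w0 v + (w0 v \<bullet> b0) *\<^sub>R (b1 - b0)" for v :: 'e
 have blw: "bounded_linear w0"
  unfolding w0_def
  by (intro bounded_linear_sub bounded_linear_ident bounded_linear_scaleR_const bounded_linear_inner_left)
 have bl: "bounded_linear l"
  unfolding l_def
  by (intro bounded_linear_add blw bounded_linear_scaleR_const bounded_linear_compose[OF bounded_linear_inner_left blw])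
 have b01: "b0 \<bullet> b1 = (if b0 = b1 then 1 else 0)" using b0 b1 B_Basis by (auto simp: inner_Basis subset_iff)
 have w0b1: "w0 v \<bullet> b1 = 0" for v by (simp add: w0_def inner_diff_left nb)
 have lb0: "l v \<bullet> b0 = 0" for v
 proof -
  have eq: "l v \<bullet> b0 = w0 v \<bullet> b0 + (w0 v \<bullet> b0) * (b1 \<bullet> b0 - b0 \<bullet> b0)"
   by (simp add: l_def inner_add_left inner_diff_left)
  show ?thesis
  proof (cases "b0 = b1")
   case True
   then show ?thesis using eq w0b1[of v] by simp
  next
   case False
   then have "b1 \<bullet> b0 = 0" using b01 inner_commute[of b0 b1] by simp
   then show ?thesis using eq nb(1) by simp
  qed
 qed
 have lB: "l v \<in> span B" if "v \<in> span B" for v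
  unfolding l_def w0_def using that b0 b1 by (intro span_add span_diff span_scale) (auto intro: span_base)
 have lCN: "l v \<in> span CN" if "v \<in> span B" for v
  using lB[OF that] lb0[of v] unfolding in_span_iff_inner[OF B_Basis] in_span_iff_inner[OF CN(2)] by (auto simp: CN_def)
 have lker: "v = (v \<bullet> b1) *\<^sub>R b1" if "l v = 0" for v
 proof -
  have "l v \<bullet> b1 = 0" using that by simp
  then have "w0 v \<bullet> b0 = 0"
   using b01 w0b1[of v] by (auto simp: l_def inner_add_left inner_diff_left nb split: if_splits)
  then have "w0 v = 0" using that by (simp add: l_def)
  then show ?thesis by (simp add: w0_def)
 qed
 define G where "G x = l x + h x *\<^sub>R b0" for x
 have sG: "smooth_on B (snd c ` fst c) G"
  unfolding G_def by (intro smooth_on_add smooth_on_scaleR smooth_on_bounded_linear oi bl hs smooth_on_const)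
 have imgB: "x \<in> span B" if "x \<in> snd c ` fst c" for x using chart_image_span[OF c(1)] that by (rule subsetD)
 have GB: "G x \<in> span B" if "x \<in> snd c ` fst c" for x
  unfolding G_def by (intro span_add span_scale lB[OF imgB[OF that]] span_base b0)
 have dG: "dir_deriv G x0 v = l v + dir_deriv h x0 v *\<^sub>R b0" if "v \<in> span B" for v
 proof (rule dir_deriv_eqI)
  have 1: "((%t. x0 + t *\<^sub>R v) has_vector_derivative v) (at 0)" by (auto intro!: derivative_eq_intros)
  have 2: "((%t. h (x0 + t *\<^sub>R v)) has_vector_derivative dir_deriv h x0 v) (at 0)"
   by (rule C1_dir_deriv(1)[OF B_Basis oi smooth_on_Ck[OF hs] x0 that])
  show "((%t. G (x0 + t *\<^sub>R v)) has_vector_derivative l v + dir_deriv h x0 v *\<^sub>R b0) (at 0)"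
   unfolding G_def
   by (intro has_vector_derivative_add bounded_linear.has_vector_derivative[OF bl 1]
     bounded_linear.has_vector_derivative[OF bounded_linear_scaleR_left 2])
 qed
 have inj: "v = 0" if v: "v \<in> span B" and 0: "dir_deriv G x0 v = 0" for v
 proof -
  have eq: "l v + dir_deriv h x0 v *\<^sub>R b0 = 0" using 0 dG[OF v] by simp
  then have "(l v + dir_deriv h x0 v *\<^sub>R b0) \<bullet> b0 = 0" by simp
  then have dh0: "dir_deriv h x0 v = 0" using lb0[of v] nb by (simp add: inner_add_left)
  then have "l v = 0" using eq by simp
  from lker[OF this] have v1: "v = (v \<bullet> b1) *\<^sub>R b1" .
  have "dir_deriv h x0 v = (v \<bullet> b1) *\<^sub>R dir_deriv h x0 b1"
  proof -
   have "dir_deriv h x0 v = (\<Sum>b\<in>B. if b = b1 then (v \<bullet> b1) *\<^sub>R dir_deriv h x0 b1 else 0)"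
    unfolding dh[OF v]
   proof (rule sum.cong[OF refl])
    fix b assume b: "b \<in> B"
    have "v \<bullet> b = (v \<bullet> b1) * (b1 \<bullet> b)" by (subst v1) simp
    then show "(v \<bullet> b) *\<^sub>R dir_deriv h x0 b = (if b = b1 then (v \<bullet> b1) *\<^sub>R dir_deriv h x0 b1 else 0)"
     using b b1(1) B_Basis by (auto simp: inner_Basis subset_iff)
   qed
   then show ?thesis using fB b1(1) by simp
  qed
  then have "v \<bullet> b1 = 0" using dh0 b1(2) by simp
  then show ?thesis using v1 by simp
 qed
 obtain U' V H where H: "open_in B U'" "U' \<subseteq> snd c ` fst c" "x0 \<in> U'"
  "open_in B V" "G x0 \<in> V" "homeomorphism U' V G H" "smooth_on B V H"
  by (rule smooth_inverse_function[OF B_Basis img sG GB x0 inj])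
 have HG: "H (G x) = x" "G x \<in> V" if "x \<in> U'" for x using H(6) that unfolding homeomorphism_def by auto
 have GH: "G (H y) = y" "H y \<in> U'" if "y \<in> V" for y using H(6) that unfolding homeomorphism_def by auto
 define O' where "O' = {p \<in> fst c. snd c p \<in> U'} Int Nset"
 define d where "d = (O', %p. l (snd c p))"
 have hN: "h (snd c p) = 1" if "p \<in> O'" for p using that c by (simp add: O'_def h_def Nset_def)
 have imd: "snd d ` fst d = {y \<in> span CN. y + b0 \<in> V}"
 proof (intro set_eqI iffI)
  fix y assume "y \<in> snd d ` fst d"
  then obtain p where p: "p \<in> O'" "y = l (snd c p)" by (auto simp: d_def)
  have pU: "snd c p \<in> U'" using p by (simp add: O'_def)
  have "y + b0 = G (snd c p)" using hN[OF p(1)] p(2) by (simp add: G_def)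
  then show "y \<in> {y \<in> span CN. y + b0 \<in> V}"
   using HG(2)[OF pU] lCN[OF imgB[OF subsetD[OF H(2) pU]]] p(2) by simp
 next
  fix y assume "y \<in> {y \<in> span CN. y + b0 \<in> V}"
  then have y: "y \<in> span CN" "y + b0 \<in> V" by auto
  define x where "x = H (y + b0)"
  have x: "x \<in> U'" "G x = y + b0" using GH[OF y(2)] by (auto simp: x_def)
  have xc: "x \<in> snd c ` fst c" using H(2) x(1) by (rule subsetD)
  have y0: "y \<bullet> b0 = 0" using y(1) CN(3) b0 B_Basis unfolding in_span_iff_inner[OF CN(2)] by blast
  have "G x \<bullet> b0 = 1" using x(2) y0 nb by (simp add: inner_add_left)
  then have "h x = 1" using lb0[of x] nb by (simp add: G_def inner_add_left)
  then have lx: "l x = y" using x(2) by (simp add: G_def)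
  have "chart_inv c x \<in> O'"
   using x(1) xc chart_inv_in[OF xc] chart_inv_topspace[OF c(1) xc] \<open>h x = 1\<close>
   by (simp add: O'_def Nset_def h_def)
  moreover have "l (snd c (chart_inv c x)) = y" using lx xc by simp
  ultimately show "y \<in> snd d ` fst d" unfolding d_def by force
 qed
 have injd: "inj_on (snd d) (fst d)"
 proof (rule inj_onI)
  fix p p' assume "p \<in> fst d" "p' \<in> fst d" and eq: "snd d p = snd d p'"
  then have p: "p \<in> O'" "p' \<in> O'" by (auto simp: d_def)
  have "G (snd c p) = G (snd c p')" using eq hN p by (simp add: G_def d_def)
  then have "snd c p = snd c p'" using HG(1) p by (metis (no_types, lifting) IntD1 O'_def mem_Collect_eq)
  then show "p = p'" using inj_onD[OF chart_inj[OF c(1)]] p by (simp add: O'_def)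
 qed
 have sub: "(%y. y + b0) ` (snd d ` fst d) \<subseteq> V" unfolding imd by auto
 have opd: "open_in CN (snd d ` fst d)"
 proof -
  have "open_in CN (span CN Int (%y. y + b0) -` V)"
  proof (rule continuous_openin_preimage[OF _ _ H(4)])
   show "(%y. y + b0) \<in> span CN \<rightarrow> span B"
    by (intro funcsetI span_add span_base[OF b0] subsetD[OF span_mono[OF CN(1)]])
  qed (intro continuous_intros)
  then show ?thesis unfolding imd by (simp add: Int_def vimage_def)
 qed
 have pl: "plot M CN (snd d ` fst d) (%y. chart_inv c (H (y + b0)))"
 proof (rule plot_compose[OF plot_chart_inv[OF c(1)] CN(2) opd])
  have sh: "smooth_on CN (snd d ` fst d) (%y. y + b0)"
   by (intro smooth_on_add smooth_on_id smooth_on_const open_along_openin[OF opd])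
  show "smooth_on CN (snd d ` fst d) (%y. H (y + b0))"
   by (rule smooth_on_compose_span[OF CN(2) B_Basis open_along_openin[OF opd] H(4) _ sh H(7)]) (use sub in blast)
  show "(%y. H (y + b0)) ` (snd d ` fst d) \<subseteq> snd c ` fst c"
  proof (rule image_subsetI)
   fix y assume "y \<in> snd d ` fst d"
   then have "y + b0 \<in> V" using sub by blast
   from subsetD[OF H(2) GH(2)[OF this]] show "H (y + b0) \<in> snd c ` fst c" .
  qed
 qed
 have inv: "chart_inv c (H (y + b0)) = chart_inv d y" if yd: "y \<in> snd d ` fst d" for y
 proof -
  obtain p where p: "p \<in> O'" "y = l (snd c p)" using yd by (auto simp: d_def)
  have "y + b0 = G (snd c p)" using hN[OF p(1)] p(2) by (simp add: G_def)
  then have "H (y + b0) = snd c p" using HG(1) p(1) by (simp add: O'_def)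
  then have "chart_inv c (H (y + b0)) = p" using p(1) c(1) by (simp add: O'_def)
  moreover have "chart_inv d (snd d p) = p"
   unfolding chart_inv_def by (rule inv_into_f_f[OF injd]) (simp add: d_def p(1))
  ultimately show ?thesis using p(2) by (simp add: d_def)
 qed
 have "slice_chart d c l"
  unfolding slice_chart_def
 proof (intro conjI c(1) bl opd injd plot_cong[OF pl inv])
  show "fst d \<subseteq> fst c Int Nset" by (auto simp: d_def O'_def)
  show "snd d = (%p. l (snd c p))" by (simp add: d_def)
  have "openin (mtop M) {p \<in> fst c. snd c p \<in> U'}" by (rule open_chart_preimage[OF c(1) H(1)])
  then show "openin (subtopology (mtop M) Nset) (fst d)"
   by (auto simp: d_def O'_def openin_subtopology)
 qed
 moreover have "q \<in> fst d" using c(2) H(3) q by (simp add: d_def O'_def x0_def)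
 ultimately show ?thesis unfolding N_def manifold.simps by (intro bexI[of _ d] CollectI exI)
qed

lemma slice_chart_inv:
 assumes "slice_chart d c l"
 shows "p \<in> fst d ==> chart_inv d (snd d p) = p"
  and "y \<in> snd d ` fst d ==> chart_inv d y \<in> fst d"
  and "y \<in> snd d ` fst d ==> snd d (chart_inv d y) = y"
proof -
 have inj: "inj_on (snd d) (fst d)" using assms unfolding slice_chart_def by blast
 show "p \<in> fst d ==> chart_inv d (snd d p) = p" unfolding chart_inv_def by (rule inv_into_f_f[OF inj])
 show "y \<in> snd d ` fst d ==> chart_inv d y \<in> fst d" unfolding chart_inv_def by (rule inv_into_into)
 show "y \<in> snd d ` fst d ==> snd d (chart_inv d y) = y" unfolding chart_inv_def by (rule f_inv_into_f)
qed

lemma slice_chart_smooth: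
 assumes d: "slice_chart d c l" and F: "plot M C S F"
 shows "smooth_on C {x \<in> S. F x \<in> fst d} (snd d o F)"
proof -
 have c: "c \<in> atlas M" "bounded_linear l" "fst d \<subseteq> fst c" "snd d = (%p. l (snd c p))"
  using d unfolding slice_chart_def by auto
 have "smooth_on C {x \<in> S. F x \<in> fst c} (%x. l ((snd c o F) x))"
  by (rule smooth_on_linear_compose[OF plot_C1(1)[OF F c(1)] c(2) plotD(4)[OF F c(1)]])
 then have "smooth_on C {x \<in> S. F x \<in> fst d} (%x. l ((snd c o F) x))"
  by (rule smooth_on_subset) (use c(3) in auto)
 then show ?thesis by (simp add: c(4) o_def)
qed

lemma N_manifold: "smooth_manifold N"
 unfolding smooth_manifold_def
proof (intro conjI)
 show "coords N \<subseteq> Basis" using CN(2) by simp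
 obtain p where p: "p \<in> points M" using mfd unfolding smooth_manifold_def by blast
 show "points N ~= {}" unfolding topspace_N using retr_in[OF p] by blast
 have "connected_space (mtop M)" using mfd unfolding smooth_manifold_def by blast
 then have "connectedin (mtop M) (retr ` points M)"
  by (intro connectedin_continuous_map_image[OF retr_continuous]) (simp add: connectedin_topspace)
 moreover have "retr ` points M = Nset"
 proof
  show "retr ` points M \<subseteq> Nset" using retr_in by blast
  show "Nset \<subseteq> retr ` points M"
  proof
   fix q assume q: "q \<in> Nset"
   show "q \<in> retr ` points M"
    using imageI[OF Nset_topspace[OF q], of retr] unfolding retr_Nset[OF q] .
  qed
 qed
 ultimately show "connected_space (mtop N)" by (simp add: connectedin_def)
 show "Hausdorff_space (mtop N)" using Hausdorff_space_subtopology[OF Hausdorff] by simp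
 have "second_countable (mtop M)" using mfd unfolding smooth_manifold_def by blast
 then show "second_countable (mtop N)" using second_countable_subtopology by simp
 show "(\<Union>c\<in>atlas N. fst c) = points N"
 proof
  show "(\<Union>c\<in>atlas N. fst c) \<subseteq> points N"
   unfolding topspace_N by (auto simp: slice_chart_def)
  show "points N \<subseteq> (\<Union>c\<in>atlas N. fst c)"
   unfolding topspace_N using slice_chart_exists by blast
 qed
 show "\<forall>(U, \<phi>)\<in>atlas N.
    openin (mtop N) U & open_in (coords N) (\<phi> ` U) &
    homeomorphic_map (subtopology (mtop N) U) (top_of_set (\<phi> ` U)) \<phi>"
 proof (rule ballI, clarify)
  fix U \<phi> assume "(U, \<phi>) \<in> atlas N"
  then obtain c l where d: "slice_chart (U, \<phi>) c l" by auto
  then have c: "c \<in> atlas M" "bounded_linear l" "U \<subseteq> fst c" "U \<subseteq> Nset" "\<phi> = (%p. l (snd c p))"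
   "openin (subtopology (mtop M) Nset) U" "open_in CN (\<phi> ` U)"
   "plot M CN (\<phi> ` U) (chart_inv (U, \<phi>))" unfolding slice_chart_def by auto
  have sub: "subtopology (mtop N) U = subtopology (mtop M) U"
   using c(4) by (simp add: subtopology_subtopology Int_absorb1)
  have tU: "topspace (subtopology (mtop M) U) = U" using c(3) chart_sub[OF c(1)] by auto
  have "continuous_map (subtopology (mtop M) (fst c)) euclidean (snd c)"
   using chart_continuous[OF c(1)] continuous_map_into_fulltopology by blast
  then have "continuous_map (subtopology (mtop M) U) euclidean (snd c)"
   using c(3) continuous_map_from_subtopology_mono by blast
  moreover have "continuous_map euclidean euclidean l"
   using linear_continuous_on[OF c(2), of UNIV] by simp
  ultimately have "continuous_map (subtopology (mtop M) U) euclidean (l o snd c)"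
   by (rule continuous_map_compose)
  then have c1: "continuous_map (subtopology (mtop M) U) (top_of_set (\<phi> ` U)) \<phi>"
   using tU by (simp add: c(5) continuous_map_in_subtopology o_def image_subset_iff_funcset)
  have c2: "continuous_map (top_of_set (\<phi> ` U)) (subtopology (mtop M) U) (chart_inv (U, \<phi>))"
   using plotD(3)[OF c(8)] slice_chart_inv(2)[OF d]
   by (intro continuous_map_into_subtopology) (auto simp: image_subset_iff_funcset)
  have "homeomorphic_maps (subtopology (mtop M) U) (top_of_set (\<phi> ` U)) \<phi> (chart_inv (U, \<phi>))"
   unfolding homeomorphic_maps_def using c1 c2 slice_chart_inv(1)[OF d] tU by auto
  then show "openin (mtop N) U & open_in (coords N) (\<phi> ` U) &
    homeomorphic_map (subtopology (mtop N) U) (top_of_set (\<phi> ` U)) \<phi>"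
   unfolding sub using c(6,7) homeomorphic_map_maps by (metis N_simps(1,2))
 qed
 show "\<forall>c\<in>atlas N. \<forall>d\<in>atlas N. smooth_on (coords N) (snd c ` (fst c Int fst d)) (snd d o chart_inv c)"
 proof (intro ballI)
  fix d d' assume "d \<in> atlas N" "d' \<in> atlas N"
  then obtain c l c' l' where d: "slice_chart d c l" and d': "slice_chart d' c' l'" by auto
  have "plot M CN (snd d ` fst d) (chart_inv d)" using d unfolding slice_chart_def by blast
  from slice_chart_smooth[OF d' this]
  show "smooth_on (coords N) (snd d ` (fst d Int fst d')) (snd d' o chart_inv d)"
   unfolding N_simps(2) by (rule smooth_on_subset) (use slice_chart_inv(1)[OF d] in auto)
 qed
qed

sublocale N: manifold_ctx N
 by unfold_locales (rule N_manifold)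

lemma plot_into_N:
 assumes F: "plot M C S F" and N: "F ` S \<subseteq> Nset"
 shows "plot N C S F"
 unfolding plot_def
proof (intro conjI ballI plotD(1,2)[OF F])
 show "continuous_map (top_of_set S) (mtop N) F"
  using plotD(3)[OF F] N by (simp add: continuous_map_in_subtopology image_subset_iff_funcset)
 fix d assume "d \<in> atlas N"
 then obtain c l where "slice_chart d c l" by auto
 from slice_chart_smooth[OF this F] show "smooth_on C {x \<in> S. F x \<in> fst d} (snd d o F)" .
qed

lemma N_chart_plot: "d \<in> atlas N ==> plot M CN (snd d ` fst d) (chart_inv d)"
 by (auto simp: slice_chart_def)

text \<open>A tangent vector of the level set is evaluated by \<open>g\<close> after applying the derivative of the inclusion.\<close>

definition gN :: "('a, 'e) tensor2" where
 "gN q V W = g q (tangent_map N M (%x. x) q V) (tangent_map N M (%x. x) q W)"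

lemma inclusion_push:
 assumes F: "plot M C S F" and N: "F ` S \<subseteq> Nset" and x: "x \<in> S" and u: "u \<in> span C"
 shows "tangent_map N M (%x. x) (F x) (push N F x u) = push M F x u"
proof -
 define d where "d = chart_at N (F x)"
 have FN: "plot N C S F" by (rule plot_into_N[OF F N])
 have d: "d \<in> atlas N" "F x \<in> fst d" using N.chart_at[OF plotD(5)[OF FN x]] by (auto simp: d_def)
 let ?T = "{y \<in> S. F y \<in> fst d}"
 have T: "open_in C ?T" by (rule plot_preimage_open[OF FN N.chart_open[OF d(1)]])
 have xT: "x \<in> ?T" using x d by simp
 have "tangent_map N M (%x. x) (F x) (push N F x u) = push M ((%x. x) o chart_inv d) (snd d (F x)) (push N F x u d)"
  unfolding d_def by (rule tangent_map_push) (use d N.chart_inv_left[of d "F x"] in \<open>simp only: d_def\<close>)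
 also have "push N F x u d = dir_deriv (snd d o F) x u"
  using d by (simp only: push_def N.charts_at_iff simp_thms if_True)
 also have "(%x. x) o chart_inv d = chart_inv d" by (simp add: o_def)
 also have "push M (chart_inv d) (snd d (F x)) (dir_deriv (snd d o F) x u) = push M (%y. chart_inv d ((snd d o F) y)) x u"
  using push_chain(2)[OF N_chart_plot[OF d(1)] plotD(1)[OF F] T plotD(4)[OF FN d(1)] _ xT u] by force
 also have "... = push M F x u"
  by (rule push_cong[OF open_along_openin[OF T] xT u]) (use N.chart_inv_left[OF d(1)] in simp)
 finally show ?thesis .
qed

lemma gN_push:
 assumes F: "plot M C S F" and N: "F ` S \<subseteq> Nset" and x: "x \<in> S" and u: "u \<in> span C" and v: "v \<in> span C"
 shows "gN (F x) (push N F x u) (push N F x v) = pb F x u v"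
 unfolding gN_def inclusion_push[OF F N x u] inclusion_push[OF F N x v] pb_def ..

lemma N_metric: "riemannian_metric N gN"
 unfolding riemannian_metric_def Let_def
proof (intro ballI conjI allI)
 fix d assume d: "d \<in> atlas N"
 then obtain c l where sl: "slice_chart d c l" by auto
 let ?P = "chart_inv d" and ?D = "snd d ` fst d"
 have P: "plot M CN ?D ?P" by (rule N_chart_plot[OF d])
 have PN: "?P ` ?D \<subseteq> Nset" using slice_chart_inv(2)[OF sl] sl by (auto simp: slice_chart_def)
 have tens: "tensor_in_chart N gN d y v w = pb ?P y v w"
  if y: "y \<in> ?D" and v: "v \<in> span CN" and w: "w \<in> span CN" for y v w
 proof -
  have "tensor_in_chart N gN d y v w = gN (?P y) (push N ?P y v) (push N ?P y w)"
   unfolding tensor_in_chart_def Let_def N.coord_vector_push[OF d N.chart_inv_in[OF y]] N.chart_inv_right[OF y] ..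
  also have "... = pb ?P y v w" by (rule gN_push[OF P PN y v w])
  finally show ?thesis .
 qed
 show "smooth_on (coords N) ?D (%y. tensor_in_chart N gN d y v w)"
  if "v \<in> span (coords N)" "w \<in> span (coords N)" for v w
 proof -
  have v: "v \<in> span CN" and w: "w \<in> span CN" using that by simp_all
  have "smooth_on CN ?D (%y. tensor_in_chart N gN d y v w)"
   by (rule smooth_on_cong[OF open_along_openin[OF plotD(2)[OF P]] tens[OF _ v w, symmetric] smooth_pb[OF P v w]])
  then show ?thesis by simp
 qed
 fix y assume y: "y \<in> ?D"
 show "tensor_in_chart N gN d y (a *\<^sub>R u + b *\<^sub>R v) w = a * tensor_in_chart N gN d y u w + b * tensor_in_chart N gN d y v w"
  if "u \<in> span (coords N)" "v \<in> span (coords N)" "w \<in> span (coords N)" for u v w a b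
 proof -
  have u: "u \<in> span CN" and v: "v \<in> span CN" and w: "w \<in> span CN" using that by simp_all
  show ?thesis
   unfolding tens[OF y u w] tens[OF y v w] tens[OF y span_add[OF span_scale[OF u] span_scale[OF v]] w]
   by (rule pb_left(1)[OF P y u v w])
 qed
 show "tensor_in_chart N gN d y v w = tensor_in_chart N gN d y w v"
  if "v \<in> span (coords N)" "w \<in> span (coords N)" for v w
 proof -
  have v: "v \<in> span CN" and w: "w \<in> span CN" using that by simp_all
  show ?thesis unfolding tens[OF y v w] tens[OF y w v] by (rule pb_left(2)[OF P y v v w])
 qed
 show "v ~= 0 --> tensor_in_chart N gN d y v v > 0" if "v \<in> span (coords N)" for v
 proof
  assume nz: "v ~= 0"
  have v: "v \<in> span CN" using that by simp
  have c: "c \<in> atlas M" "bounded_linear l" "fst d \<subseteq> fst c" "snd d = (%p. l (snd c p))"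
   using sl unfolding slice_chart_def by auto
  have pc: "?P y \<in> fst c" using slice_chart_inv(2)[OF sl y] c(3) by blast
  have ch: "c \<in> charts_at M (?P y)" using pc c(1) by (simp add: charts_at_iff)
  have lp: "l (push M ?P y v c) = v"
  proof -
   have "((%t. l (snd c (?P (y + t *\<^sub>R v)))) has_vector_derivative l (push M ?P y v c)) (at 0)"
    by (rule bounded_linear.has_vector_derivative[OF c(2) push_derivative(1)[OF P y v ch]])
   moreover have "((%t. (%z. l (snd c (?P z))) (y + t *\<^sub>R v)) has_vector_derivative v) (at 0)
    \<longleftrightarrow> ((%t. (%z. z) (y + t *\<^sub>R v)) has_vector_derivative v) (at 0)"
    by (rule has_vector_derivative_line_cong[OF open_along_openin[OF plotD(2)[OF P]] y v])
     (use slice_chart_inv(3)[OF sl] in \<open>simp add: c(4)\<close>)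
   moreover have "((%t. (%z. z) (y + t *\<^sub>R v)) has_vector_derivative v) (at 0)"
    by (auto intro!: derivative_eq_intros)
   ultimately show ?thesis using vector_derivative_unique_at by blast
  qed
  then have "push M ?P y v c ~= 0" using nz bounded_linear.linear[OF c(2)] linear_0 by metis
  then show "tensor_in_chart N gN d y v v > 0"
   unfolding tens[OF y v v] pb_chart[OF P y v v ch]
   using gc_pos[OF c(1) imageI[OF pc] push_derivative(3)[OF P y v ch]] by simp
 qed
qed

end

section \<open>The cone over the level set\<close>

context nonvanishing_ctx
begin

abbreviation "K \<equiv> riemannian_cone N"

definition cone_map :: "'a => 'a \<times> real" where
 "cone_map p = (retr p, radius p)"

definition cone_inv :: "'a \<times> real => 'a" where
 "cone_inv z = flow (ln (snd z)) (fst z)"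

definition cone_chart :: "('a, 'e) chart => ('a \<times> real, 'e \<times> real) chart" where
 "cone_chart d = (fst d \<times> {0<..}, %(x, s). (snd d x, s))"

definition CC :: "('e \<times> real) set" where
 "CC = insert (0, 1) ((%b. (b, 0)) ` CN)"

lemma K_simps: "mtop K = prod_topology (mtop N) (top_of_set {0<..})" "coords K = CC"
 "d' \<in> atlas K \<longleftrightarrow> (\<exists>d\<in>atlas N. d' = cone_chart d)"
proof -
 show "mtop K = prod_topology (mtop N) (top_of_set {0<..})" "coords K = CC"
  unfolding riemannian_cone_def CC_def by simp_all
 have "(%(U, \<phi>). (U \<times> {0<..}, %(x, s). (\<phi> x, s))) = cone_chart"
  unfolding cone_chart_def by (auto simp: fun_eq_iff)
 then show "d' \<in> atlas K \<longleftrightarrow> (\<exists>d\<in>atlas N. d' = cone_chart d)"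
  unfolding riemannian_cone_def manifold.simps image_iff by simp
qed

lemma topspace_K: "points K = Nset \<times> {0<..}"
 unfolding K_simps topspace_prod_topology topspace_N by simp

lemma cone_map_inv:
 assumes "p \<in> points M"
 shows "cone_map p \<in> points K" "cone_inv (cone_map p) = p"
 using retr_in[OF assms] radius_pos[OF assms] flow_retr[OF assms]
 unfolding topspace_K cone_map_def cone_inv_def by simp_all

lemma cone_inv_map:
 assumes "z \<in> points K"
 shows "cone_inv z \<in> points M" "cone_map (cone_inv z) = z"
proof -
 have z: "fst z \<in> Nset" "snd z > 0" using assms unfolding topspace_K by auto
 note q = Nset_topspace[OF z(1)]
 show 1: "cone_inv z \<in> points M" unfolding cone_inv_def by (rule flow_topspace[OF q])
 have r: "radius (cone_inv z) = snd z"
  unfolding cone_inv_def radius_flow[OF q] Nset_radius[OF z(1)] using z(2) by simp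
 have "retr (cone_inv z) = fst z"
  unfolding retr_def r unfolding cone_inv_def using flow_inverse[OF q] by simp
 then show "cone_map (cone_inv z) = z" by (simp add: cone_map_def r)
qed

lemma cone_chart_image: "snd (cone_chart d) ` fst (cone_chart d) = snd d ` fst d \<times> {0<..}"
 unfolding cone_chart_def by force

lemma cone_chart_inj:
 assumes "d \<in> atlas N"
 shows "inj_on (snd (cone_chart d)) (fst (cone_chart d))"
 using N.chart_inj[OF assms] unfolding cone_chart_def inj_on_def by auto

lemma cone_chart_inv:
 assumes d: "d \<in> atlas N" and y: "y \<in> snd d ` fst d" and s: "s > 0"
 shows "chart_inv (cone_chart d) (y, s) = (chart_inv d y, s)"
proof -
 have "(chart_inv d y, s) \<in> fst (cone_chart d)" using N.chart_inv_in[OF y] s by (simp add: cone_chart_def)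
 moreover have "snd (cone_chart d) (chart_inv d y, s) = (y, s)"
  using N.chart_inv_right[OF y] by (simp add: cone_chart_def)
 ultimately show ?thesis
  unfolding chart_inv_def using inv_into_f_f[OF cone_chart_inj[OF d]] by metis
qed

lemma CC_Basis: "CC \<subseteq> Basis"
 using CN(2) unfolding CC_def Basis_prod_def by auto

lemma span_CC: "v \<in> span CC \<longleftrightarrow> fst v \<in> span CN"
proof
 assume "v \<in> span CC"
 then show "fst v \<in> span CN"
 proof (induction rule: span_induct)
  case base
  show ?case by (auto simp: subspace_def span_add span_scale span_zero)
 next
  case (step x)
  then show ?case by (auto simp: CC_def span_base span_zero)
 qed
next
 assume *: "fst v \<in> span CN"
 have l: "linear (%b::'e. (b, 0::real))" by (auto intro!: linearI)
 have "(fst v, 0::real) \<in> span ((%b. (b, 0)) ` CN)"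
  unfolding span_linear_image[OF l] using * by (rule imageI)
 moreover have "(%b. (b, 0)) ` CN \<subseteq> CC" by (auto simp: CC_def)
 ultimately have 1: "(fst v, 0) \<in> span CC" using span_mono by blast
 have "snd v *\<^sub>R (0::'e, 1::real) \<in> span CC" by (intro span_scale span_base) (simp add: CC_def)
 from span_add[OF 1 this] show "v \<in> span CC" by (cases v) simp
qed

lemma cone_image_open:
 assumes "d \<in> atlas N"
 shows "open_in CC (snd d ` fst d \<times> {0<..})"
proof -
 obtain G where G: "open G" "snd d ` fst d = span CN Int G"
  using N.chart_image_open[OF assms] unfolding N_simps openin_open by blast
 have "snd d ` fst d \<times> {0<..} = span CC Int (G \<times> {0<..})" unfolding G(2) by (auto simp: span_CC)
 moreover have "open (G \<times> {0::real<..})" using G(1) by (intro open_Times) auto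
 ultimately show ?thesis unfolding openin_open by blast
qed

lemma plot_cone:
 assumes F: "plot N C S F" and s: "smooth_on C S s" "!!x. x \<in> S ==> s x > 0"
 shows "plot K C S (%x. (F x, s x))"
 unfolding plot_def
proof (intro conjI ballI plotD(1,2)[OF F])
 have "continuous_map (top_of_set S) (top_of_set {0<..}) s"
  using Ck_on_continuous[OF smooth_on_Ck[OF s(1)]] s(2) by (auto simp: continuous_map_in_subtopology)
 then show "continuous_map (top_of_set S) (mtop K) (%x. (F x, s x))"
  unfolding K_simps using plotD(3)[OF F] by (simp add: continuous_map_pairedI)
 fix d' assume "d' \<in> atlas K"
 then obtain d where d: "d \<in> atlas N" "d' = cone_chart d" unfolding K_simps by blast
 let ?T = "{x \<in> S. F x \<in> fst d}"
 have eq: "{x \<in> S. (F x, s x) \<in> fst d'} = ?T" using s(2) by (auto simp: d(2) cone_chart_def)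
 have oT: "open_along C ?T" by (rule open_along_openin[OF plot_preimage_open[OF F N.chart_open[OF d(1)]]])
 have "smooth_on C ?T (%x. ((snd d o F) x, s x))"
  by (rule smooth_on_Pair[OF oT plotD(4)[OF F d(1)] smooth_on_subset[OF s(1)]]) auto
 then show "smooth_on C {x \<in> S. (F x, s x) \<in> fst d'} (snd d' o (%x. (F x, s x)))"
  unfolding eq by (simp add: d(2) cone_chart_def o_def)
qed

lemma cone_map_plot:
 assumes F: "plot M C S F"
 shows "plot K C S (%x. cone_map (F x))"
 unfolding cone_map_def
proof (rule plot_cone[OF plot_into_N[OF retr_plot[OF F]] radius_plot(1)[OF F] radius_pos[OF plotD(5)[OF F]]])
 show "(%x. retr (F x)) ` S \<subseteq> Nset" using retr_in[OF plotD(5)[OF F]] by blast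
qed

text \<open>The inverse of the cone map is the flow for time \<open>ln s\<close>.\<close>

lemma cone_inv_plot:
 assumes d: "d \<in> atlas N"
 shows "plot M CC (snd d ` fst d \<times> {0<..}) (%z. flow (ln (snd z)) (chart_inv d (fst z)))"
proof (rule flow_plot)
 note op = cone_image_open[OF d]
 note oa = open_along_openin[OF op]
 show "plot M CC (snd d ` fst d \<times> {0<..}) (%z. chart_inv d (fst z))"
  by (rule plot_compose[OF N_chart_plot[OF d] CC_Basis op smooth_on_bounded_linear[OF oa bounded_linear_fst]]) auto
 have "Ck_on k CC (snd d ` fst d \<times> {0<..}) (%z. ln (snd z))" for k
  by (rule Ck_on_ln[OF oa _ Ck_on_bounded_linear[OF oa bounded_linear_snd]]) auto
 then show "smooth_on CC (snd d ` fst d \<times> {0<..}) (%z. ln (snd z))" by (simp add: smooth_on_def)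
qed

lemma cone_inv_continuous: "continuous_map (mtop K) (mtop M) cone_inv"
proof (rule pasting_lemma[where I = "atlas N" and T = "%d. fst d \<times> {0<..}" and f = "%d. cone_inv"])
 fix d assume d: "d \<in> atlas N"
 show "openin (mtop K) (fst d \<times> {0<..})"
  unfolding K_simps openin_prod_Times_iff using N.chart_open[OF d] by simp
 have sub: "subtopology (mtop K) (fst d \<times> {0<..}) = prod_topology (subtopology (mtop N) (fst d)) (top_of_set {0<..})"
  unfolding K_simps subtopology_Times subtopology_subtopology by simp
 have 1: "continuous_map (subtopology (mtop K) (fst d \<times> {0<..})) euclidean (%z. snd d (fst z))"
 proof -
  have "continuous_map (subtopology (mtop N) (fst d)) euclidean (snd d)"
   using N.chart_continuous[OF d] continuous_map_into_fulltopology by blast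
  from continuous_map_compose[OF continuous_map_fst this, of "top_of_set {0<..}"]
  show ?thesis unfolding sub by (simp add: o_def)
 qed
 have 2: "continuous_map (subtopology (mtop K) (fst d \<times> {0<..})) euclidean (%z. snd z)"
  unfolding sub using continuous_map_into_fulltopology[OF continuous_map_snd] by blast
 have 3: "continuous_map (subtopology (mtop K) (fst d \<times> {0<..})) euclidean (%z. (snd d (fst z), snd z))"
  using continuous_map_pairedI[OF 1 2] by (simp add: euclidean_product_topology)
 have tops: "topspace (subtopology (mtop K) (fst d \<times> {0<..})) = fst d \<times> {0<..}"
  unfolding topspace_subtopology topspace_K using N.chart_sub[OF d] unfolding topspace_N by auto
 have "continuous_map (subtopology (mtop K) (fst d \<times> {0<..})) (top_of_set (snd d ` fst d \<times> {0<..})) (%z. (snd d (fst z), snd z))"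
  unfolding continuous_map_in_subtopology tops by (intro conjI 3) auto
 from continuous_map_compose[OF this plotD(3)[OF cone_inv_plot[OF d]]]
 show "continuous_map (subtopology (mtop K) (fst d \<times> {0<..})) (mtop M) cone_inv"
 proof (rule continuous_map_eq)
  fix z assume "z \<in> topspace (subtopology (mtop K) (fst d \<times> {0<..}))"
  then have "fst z \<in> fst d" unfolding tops by (simp add: mem_Times_iff)
  from N.chart_inv_left[OF d this]
  show "((%z. flow (ln (snd z)) (chart_inv d (fst z))) o (%z. (snd d (fst z), snd z))) z = cone_inv z"
   by (simp add: cone_inv_def)
 qed
next
 fix z assume "z \<in> points K"
 then have z: "fst z \<in> Nset" "snd z > 0" unfolding topspace_K by (simp_all add: mem_Times_iff)
 obtain d where d: "d \<in> atlas N" "fst z \<in> fst d" using slice_chart_exists[OF z(1)] by (elim bexE)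
 have "z \<in> fst d \<times> {0<..}" using d(2) z(2) by (simp add: mem_Times_iff)
 with d(1) show "\<exists>j. j \<in> atlas N & z \<in> fst j \<times> {0<..} & cone_inv z = cone_inv z"
  by (intro exI conjI refl)
qed auto

lemma cone_diffeomorphism: "diffeomorphism M K cone_map"
 unfolding diffeomorphism_def
proof (intro conjI)
 show bij: "bij_betw cone_map (points M) (points K)"
  by (rule bij_betw_byWitness[where f' = cone_inv]) (use cone_map_inv cone_inv_map in auto)
 show "smooth_map M K cone_map"
 proof (rule smooth_map_from_plots)
  fix c assume "c \<in> atlas M"
  from cone_map_plot[OF plot_chart_inv[OF this]]
  show "plot K B (snd c ` fst c) (cone_map o chart_inv c)" by (simp add: o_def)
 qed
 let ?G = "inv_into (points M) cone_map"
 have G: "?G z = cone_inv z" if "z \<in> points K" for z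
  using inv_into_f_f[OF bij_betw_imp_inj_on[OF bij] cone_inv_map(1)[OF that]] cone_inv_map(2)[OF that] by simp
 show "smooth_map K M ?G"
 proof (rule smooth_map_if_plots)
  show "continuous_map (mtop K) (mtop M) ?G"
   by (rule continuous_map_eq[OF cone_inv_continuous]) (simp add: G)
  fix c assume "c \<in> atlas K"
  then obtain d where d: "d \<in> atlas N" "c = cone_chart d" unfolding K_simps by blast
  show "inj_on (snd c) (fst c)" unfolding d(2) by (rule cone_chart_inj[OF d(1)])
  show "plot M (coords K) (snd c ` fst c) (?G o chart_inv c)"
   unfolding K_simps d(2) cone_chart_image
  proof (rule plot_cong[OF cone_inv_plot[OF d(1)]])
   fix z assume z: "z \<in> snd d ` fst d \<times> {0::real<..}"
   then have "chart_inv (cone_chart d) z = (chart_inv d (fst z), snd z)"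
    using cone_chart_inv[OF d(1), of "fst z" "snd z"] by (simp add: mem_Times_iff)
   moreover have "(chart_inv d (fst z), snd z) \<in> points K"
    using z N.chart_inv_in[of "fst z" d] N.chart_sub[OF d(1)]
    unfolding topspace_K topspace_N by (auto simp: mem_Times_iff subset_iff)
   ultimately show "flow (ln (snd z)) (chart_inv d (fst z)) = (?G o chart_inv (cone_chart d)) z"
    by (simp add: G cone_inv_def)
  qed
 qed
qed

lemma chart_at_K:
 assumes "z \<in> points K"
 obtains d where "d \<in> atlas N" "chart_at K z = cone_chart d" "fst z \<in> fst d" "snd z > 0"
proof -
 have z: "fst z \<in> Nset" "snd z > 0" using assms unfolding topspace_K by (simp_all add: mem_Times_iff)
 obtain d where d: "d \<in> atlas N" "fst z \<in> fst d" using slice_chart_exists[OF z(1)] by (elim bexE)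
 have "cone_chart d \<in> atlas K" by (rule K_simps(3)[THEN iffD2, OF bexI[OF refl d(1)]])
 moreover have "z \<in> fst (cone_chart d)" using d(2) z(2) by (simp add: cone_chart_def mem_Times_iff)
 ultimately have "cone_chart d \<in> charts_at K z" unfolding charts_at_def by (intro CollectI conjI)
 then have "chart_at K z \<in> charts_at K z" unfolding chart_at_def by (rule someI)
 then have c: "chart_at K z \<in> atlas K" "z \<in> fst (chart_at K z)" unfolding charts_at_def by simp_all
 obtain d' where d': "d' \<in> atlas N" "chart_at K z = cone_chart d'"
  using K_simps(3)[THEN iffD1, OF c(1)] by (elim bexE)
 have "fst z \<in> fst d'" using c(2) unfolding d'(2) by (simp add: cone_chart_def mem_Times_iff)
 then show ?thesis by (rule that[OF d' _ z(2)])
qed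

lemma cone_metric_push:
 assumes F: "plot N C S F" and FM: "plot M C S F" and FN: "F ` S \<subseteq> Nset"
  and s: "smooth_on C S s" "!!x. x \<in> S ==> s x > 0"
  and x: "x \<in> S" and u: "u \<in> span C" and v: "v \<in> span C"
 defines "G \<equiv> %x. (F x, s x)"
 shows "cone_metric N gN (G x) (push K G x u) (push K G x v) = (s x)\<^sup>2 * pb F x u v + dir_deriv s x u * dir_deriv s x v"
proof -
 have GK: "plot K C S G" unfolding G_def by (rule plot_cone[OF F s])
 have Gx: "G x \<in> points K" by (rule plotD(5)[OF GK x])
 obtain d where d: "d \<in> atlas N" "chart_at K (G x) = cone_chart d" "fst (G x) \<in> fst d" "snd (G x) > 0"
  by (rule chart_at_K[OF Gx])
 let ?c = "cone_chart d"
 have cK: "?c \<in> atlas K" unfolding K_simps using d(1) by blast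
 have Gc: "G x \<in> fst ?c" using d(3,4) by (simp add: cone_chart_def mem_Times_iff)
 let ?T = "{y \<in> S. F y \<in> fst d}"
 have T: "open_in C ?T" by (rule plot_preimage_open[OF F N.chart_open[OF d(1)]])
 note oT = open_along_openin[OF T]
 have xT: "x \<in> ?T" using x d(3) by (simp add: G_def)
 define m where "m y = (snd d (F y), s y)" for y
 have meq: "snd ?c (G y) = m y" for y by (simp add: m_def G_def cone_chart_def)
 have ms: "smooth_on C ?T m"
  unfolding m_def using smooth_on_Pair[OF oT plotD(4)[OF F d(1)] smooth_on_subset[OF s(1)]] by (simp add: o_def)
 have mim: "m ` ?T \<subseteq> snd d ` fst d \<times> {0<..}" using s(2) by (auto simp: m_def)
 have pushc: "push K G x w ?c = dir_deriv m x w" for w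
 proof -
  have "?c \<in> charts_at K (G x)" using cK Gc by (simp add: charts_at_def)
  then show ?thesis by (simp add: push_def meq o_def)
 qed
 have cinv: "chart_inv ?c (snd ?c (G x)) = G x"
  unfolding chart_inv_def by (rule inv_into_f_f[OF cone_chart_inj[OF d(1)] Gc])
 have plN: "plot N CN (snd d ` fst d) (chart_inv d)" using N.plot_chart_inv[OF d(1)] by simp
 have plfst: "plot N CC (snd d ` fst d \<times> {0<..}) (%z. fst (chart_inv ?c z))"
 proof (rule N.plot_cong)
  show "plot N CC (snd d ` fst d \<times> {0<..}) (%z. chart_inv d (fst z))"
   by (rule N.plot_compose[OF plN CC_Basis cone_image_open[OF d(1)]
      smooth_on_bounded_linear[OF open_along_openin[OF cone_image_open[OF d(1)]] bounded_linear_fst]]) auto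
  show "chart_inv d (fst z) = fst (chart_inv ?c z)" if "z \<in> snd d ` fst d \<times> {0<..}" for z
   using cone_chart_inv[OF d(1), of "fst z" "snd z"] that by (simp add: mem_Times_iff)
 qed
 have tan: "tangent_map K N fst (G x) (push K G x w) = push N F x w" if w: "w \<in> span C" for w
 proof -
  have "tangent_map K N fst (G x) (push K G x w) = push N (fst o chart_inv ?c) (snd ?c (G x)) (push K G x w ?c)"
   using tangent_map_push[of K "G x" N fst "push K G x w"] cinv unfolding d(2) by simp
  also have "... = push N (%z. fst (chart_inv ?c z)) (m x) (dir_deriv m x w)"
   unfolding pushc meq by (simp add: o_def)
  also have "... = push N (%y. fst (chart_inv ?c (m y))) x w"
   by (rule N.push_chain(2)[OF plfst plotD(1)[OF F] T ms mim xT w, symmetric])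
  also have "... = push N F x w"
  proof (rule N.push_cong[OF oT xT w])
   fix y assume y: "y \<in> ?T"
   have "m y \<in> snd d ` fst d \<times> {0<..}" using y mim by blast
   then have "chart_inv ?c (m y) = (chart_inv d (snd d (F y)), s y)"
    using cone_chart_inv[OF d(1), of "fst (m y)" "snd (m y)"] by (simp add: m_def)
   then show "fst (chart_inv ?c (m y)) = F y" using N.chart_inv_left[OF d(1), of "F y"] y by simp
  qed
  finally show ?thesis .
 qed
 have dif: "differential K snd (G x) (push K G x w) = dir_deriv s x w" if w: "w \<in> span C" for w
 proof -
  let ?\<phi> = "%z. snd (chart_inv ?c z)"
  have \<phi>: "?\<phi> z = snd z" if "z \<in> snd d ` fst d \<times> {0<..}" for z
   using cone_chart_inv[OF d(1), of "fst z" "snd z"] that by (simp add: mem_Times_iff)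
  have "Ck_on 1 CC (snd d ` fst d \<times> {0<..}) ?\<phi>"
   by (rule Ck_on_cong[OF open_along_openin[OF cone_image_open[OF d(1)]] \<phi>[symmetric]
      Ck_on_bounded_linear[OF open_along_openin[OF cone_image_open[OF d(1)]] bounded_linear_snd]])
  from dir_deriv_chain(3)[OF CC_Basis cone_image_open[OF d(1)] this plotD(1)[OF F] oT smooth_on_Ck[OF ms] mim xT w]
  have "dir_deriv ?\<phi> (m x) (dir_deriv m x w) = dir_deriv (%y. ?\<phi> (m y)) x w" by simp
  also have "... = dir_deriv s x w"
  proof (rule dir_deriv_cong[OF oT xT w])
   fix y assume "y \<in> ?T"
   then have "m y \<in> snd d ` fst d \<times> {0<..}" using mim by blast
   from \<phi>[OF this] show "?\<phi> (m y) = s y" by (simp add: m_def)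
  qed
  finally show ?thesis unfolding differential_def Let_def d(2) pushc meq by (simp add: o_def)
 qed
 show ?thesis
  unfolding cone_metric_def tan[OF u] tan[OF v] dif[OF u] dif[OF v]
  using gN_push[OF FM FN x u v] by (simp add: G_def)
qed

text \<open>The derivative of \<open>F\<close> splits into a part along \<open>\<xi>\<close>, of length given by the derivative of the radius, and a part
orthogonal to it, because \<open>f\<close> is constant on level sets; the latter is the flow image of the derivative of the
retraction, for which \<open>pb_flow\<close> gives the factor \<open>radius\<^sup>2\<close>.\<close>

lemma cone_isometry:
 assumes F: "plot M C S F" and x: "x \<in> S" and u: "u \<in> span C" and v: "v \<in> span C"
 shows "(radius (F x))\<^sup>2 * pb (%y. retr (F y)) x u v
  + dir_deriv (%y. radius (F y)) x u * dir_deriv (%y. radius (F y)) x v = pb F x u v"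
proof -
 let ?R = "%y. retr (F y)" and ?r = "%y. radius (F y)" and ?i = "%y. ln (radius (F y))"
 note C = plotD(1)[OF F] and oS = open_along_openin[OF plotD(2)[OF F]]
 have R: "plot M C S ?R" by (rule retr_plot[OF F])
 have p: "F y \<in> points M" if "y \<in> S" for y by (rule plotD(5)[OF F that])
 define i0 where "i0 = ?i x"
 define r0 where "r0 = radius (F x)"
 have r0: "r0 > 0" unfolding r0_def by (rule radius_pos[OF p[OF x]])
 have recover: "flow (?i y) (?R y) = F y" if "y \<in> S" for y by (rule flow_retr[OF p[OF that]])
 define W where "W y = flow i0 (?R y)" for y
 have Wp: "plot M C S W" unfolding W_def by (rule flow_plot_fixed[OF R])
 have Wx: "W x = F x" unfolding W_def i0_def by (rule recover[OF x])
 have di: "dir_deriv ?i x w = dir_deriv ?r x w / r0" if w: "w \<in> span C" for w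
 proof (rule dir_deriv_eqI)
  have "((%t. ?r (x + t *\<^sub>R w)) has_vector_derivative dir_deriv ?r x w) (at 0)"
   by (rule C1_dir_deriv(1)[OF C oS smooth_on_Ck[OF radius_plot(1)[OF F]] x w])
  then have "((%t. ?r (x + t *\<^sub>R w)) has_real_derivative dir_deriv ?r x w) (at 0)"
   by (simp add: has_real_derivative_iff_has_vector_derivative)
  then have "((%t. ln (?r (x + t *\<^sub>R w))) has_real_derivative dir_deriv ?r x w / r0) (at 0)"
   using r0 by (auto intro!: derivative_eq_intros simp: r0_def divide_inverse)
  then show "((%t. ?i (x + t *\<^sub>R w)) has_vector_derivative dir_deriv ?r x w / r0) (at 0)"
   by (simp add: has_real_derivative_iff_has_vector_derivative)
 qed
 have pushF: "push M F x w = (%d. push M W x w d + (dir_deriv ?r x w / r0) *\<^sub>R \<xi> (F x) d)" if w: "w \<in> span C" for w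
 proof -
  have "push M F x w = push M (%y. flow (?i y) (?R y)) x w"
   by (rule push_cong[OF oS x w]) (rule recover[symmetric])
  also have "... = (%d. push M (%y. flow (?i x) (?R y)) x w d + dir_deriv ?i x w *\<^sub>R \<xi> (flow (?i x) (?R x)) d)"
   by (rule push_flow[OF R radius_plot(2)[OF F] x w])
  finally show ?thesis unfolding recover[OF x] di[OF w] W_def[abs_def] i0_def .
 qed
 obtain c where c: "c \<in> atlas M" "F x \<in> fst c" using atlas_cover[OF p[OF x]] by blast
 have ch: "c \<in> charts_at M (F x)" and chW: "c \<in> charts_at M (W x)" using c Wx by (simp_all add: charts_at_iff)
 define y where "y = snd c (F x)"
 have y: "y \<in> snd c ` fst c" using c by (simp add: y_def)
 define Z where "Z = \<xi> (F x) c"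
 have ZX: "Z = X c y" unfolding Z_def y_def by (rule X_at[OF ch, symmetric])
 have Z: "Z \<in> span B" unfolding ZX by (rule X_span[OF c(1) y])
 define Q where "Q w = push M W x w c" for w
 have Q: "Q w \<in> span B" if "w \<in> span C" for w unfolding Q_def by (rule push_derivative(3)[OF Wp x that chW])
 have QQ: "gc c y (Q u) (Q v) = r0\<^sup>2 * pb ?R x u v"
 proof -
  have "gc c y (Q u) (Q v) = pb W x u v"
   unfolding Q_def y_def using pb_chart[OF Wp x u v chW] by (simp add: Wx)
  also have "... = exp (2 * i0) * pb ?R x u v" unfolding W_def[abs_def] by (rule pb_flow[OF R x u v])
  also have "exp (2 * i0) = r0\<^sup>2" unfolding exp_double using r0 by (simp add: i0_def r0_def)
  finally show ?thesis .
 qed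
 have ZQ: "gc c y Z (Q w) = 0" if w: "w \<in> span C" for w
 proof -
  have "g (W x) (\<xi> (W x)) (push M W x w) = gc c (snd c (W x)) (\<xi> (W x) c) (push M W x w c)"
   by (rule tangent_metric[OF \<xi>_tangent[OF plotD(5)[OF Wp x]] push_in_tangent_space[OF Wp x w] chW])
  then have "2 * gc c y Z (Q w) = dir_deriv (%y. f (W y)) x w"
   using f_plot(2)[OF Wp x w] by (simp add: Wx y_def Z_def Q_def)
  also have "... = dir_deriv (%y. exp (2 * i0)) x w"
  proof (rule dir_deriv_cong[OF oS x w])
   fix y assume "y \<in> S"
   then have "?R y \<in> Nset" by (rule retr_in[OF p])
   then show "f (W y) = exp (2 * i0)" unfolding W_def f_flow[OF Nset_topspace[OF \<open>?R y \<in> Nset\<close>]]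
    by (simp add: Nset_def)
  qed
  also have "... = 0" by (rule dir_deriv_eqI) simp
  finally show ?thesis by simp
 qed
 have ZZ: "gc c y Z Z = r0\<^sup>2"
  using f_chart[OF c(1) y] f_radius[OF p[OF x]] chart_inv_left[OF c] by (simp add: ZX r0_def y_def)
 let ?a = "dir_deriv ?r x u / r0" and ?b = "dir_deriv ?r x v / r0"
 have Fu: "push M F x u c = 1 *\<^sub>R Q u + ?a *\<^sub>R Z" and Fv: "push M F x v c = 1 *\<^sub>R Q v + ?b *\<^sub>R Z"
  unfolding pushF[OF u] pushF[OF v] by (simp_all add: Q_def Z_def)
 have sp: "1 *\<^sub>R Q v + ?b *\<^sub>R Z \<in> span B" by (intro span_add span_scale Q v Z)
 have "pb F x u v = gc c y (1 *\<^sub>R Q u + ?a *\<^sub>R Z) (1 *\<^sub>R Q v + ?b *\<^sub>R Z)"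
  unfolding y_def pb_chart[OF F x u v ch] Fu Fv ..
 also have "... = 1 * gc c y (Q u) (1 *\<^sub>R Q v + ?b *\<^sub>R Z) + ?a * gc c y Z (1 *\<^sub>R Q v + ?b *\<^sub>R Z)"
  by (rule gc_left[OF c(1) y Q[OF u] Z sp])
 also have "... = r0\<^sup>2 * pb ?R x u v + ?a * (?b * r0\<^sup>2)"
  unfolding gc_right[OF c(1) y Q[OF v] Z Q[OF u]] gc_right[OF c(1) y Q[OF v] Z Z]
  using QQ ZQ[OF v] ZQ[OF u] gc_sym[OF c(1) y Q[OF u] Z] ZZ by simp
 also have "?a * (?b * r0\<^sup>2) = dir_deriv ?r x u * dir_deriv ?r x v"
  using r0 by (simp add: power2_eq_square)
 finally show ?thesis by (simp add: r0_def)
qed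

lemma cone_tangent_map_field:
 assumes p: "p \<in> points M"
 shows "tangent_map M K cone_map p (\<xi> p) = cone_field N (cone_map p)"
proof -
 define c where "c = chart_at M p"
 have c: "c \<in> atlas M" "p \<in> fst c" using chart_at[OF p] by (auto simp: c_def)
 define x where "x = snd c p"
 have x: "x \<in> snd c ` fst c" using c by (simp add: x_def)
 have px: "chart_inv c x = p" using c by (simp add: x_def)
 let ?z = "cone_map p"
 have z: "?z \<in> points K" by (rule cone_map_inv(1)[OF p])
 obtain d0 where d0: "d0 \<in> atlas N" "chart_at K ?z = cone_chart d0" "fst ?z \<in> fst d0" "snd ?z > 0"
  by (rule chart_at_K[OF z])
 have tm: "tangent_map M K cone_map p (\<xi> p) = push K (%y. cone_map (chart_inv c y)) x (\<xi> p c)"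
  using tangent_map_push[of M p K cone_map "\<xi> p"] px unfolding c_def[symmetric] x_def by (simp add: o_def)
 have Xc: "\<xi> p c = X c x" unfolding X_def px ..
 have Xsp: "X c x \<in> span B" by (rule X_span[OF c(1) x])
 have cz0: "chart_inv (cone_chart d0) (snd (cone_chart d0) ?z) = ?z"
  unfolding chart_inv_def
  by (rule inv_into_f_f[OF cone_chart_inj[OF d0(1)]]) (use d0(3,4) in \<open>simp add: cone_chart_def mem_Times_iff\<close>)
 show ?thesis
 proof
  fix d' :: "('a \<times> real, 'e \<times> real) chart"
  show "tangent_map M K cone_map p (\<xi> p) d' = cone_field N ?z d'"
  proof (cases "d' \<in> charts_at K ?z")
   case True
   then obtain d where d: "d \<in> atlas N" "d' = cone_chart d" unfolding charts_at_def K_simps by auto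
   have zd: "retr p \<in> fst d" using True unfolding charts_at_def d(2) by (simp add: cone_chart_def cone_map_def)
   have snd': "snd d' (q, s) = (snd d q, s)" for q s by (simp add: d(2) cone_chart_def)
   \<comment> \<open>\<xi> is mapped to the velocity of the image of its flow line, on which only \<open>s\<close> moves\<close>
   let ?F = "%y. cone_map (chart_inv c y)"
   have Fp: "plot K B (snd c ` fst c) ?F" by (rule cone_map_plot[OF plot_chart_inv[OF c(1)]])
   define U where "U = {y \<in> snd c ` fst c. ?F y \<in> fst d'}"
   have dK: "d' \<in> atlas K" using True by (simp add: charts_at_def)
   have opd': "openin (mtop K) (fst d')"
    unfolding d(2) cone_chart_def fst_conv K_simps openin_prod_Times_iff
    using N.chart_open[OF d(1)] by simp
   have U: "open_in B U" unfolding U_def by (rule plot_preimage_open[OF Fp opd'])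
   have sU: "smooth_on B U (snd d' o ?F)" unfolding U_def by (rule plotD(4)[OF Fp dK])
   have xU: "x \<in> U" using x px True by (simp add: U_def charts_at_def)
   define h where "h t = snd c (flow t p)" for t
   define T where "T = {t. flow t p \<in> fst c}"
   have T: "open T" "0 \<in> T"
    unfolding T_def using integral_curve_open[OF flow_curve(1)[OF p] chart_open[OF c(1)]] c(2) p by (auto simp: flow_curve(2))
   have h0: "h 0 = x" using p by (simp add: h_def x_def flow_curve(2))
   have dh: "(h has_vector_derivative X c x) (at 0 within T)"
   proof (rule has_vector_derivative_at_within)
    have "flow 0 p = p" by (rule flow_curve(2)[OF p])
    then show "(h has_vector_derivative X c x) (at 0)"
     using flow_chart_derivative[OF p c(1), of 0] c(2) unfolding h_def x_def by simp
   qed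
   have hB: "h t \<in> span B" if "t \<in> T" for t
    using that chart_image_span[OF c(1)] by (auto simp: h_def T_def)
   have "((%t. (snd d' o ?F) (h t)) has_vector_derivative dir_deriv (snd d' o ?F) (h 0) (X c x)) (at 0 within T)"
    by (rule C1_chain[OF B_Basis open_along_openin[OF U] smooth_on_Ck[OF sU] _ dh _ Xsp])
     (use xU h0 in simp, intro span_diff hB T(2), assumption)
   then have D1: "((%t. (snd d' o ?F) (h t)) has_vector_derivative dir_deriv (snd d' o ?F) x (X c x)) (at 0)"
    using at_within_open[OF T(2,1)] h0 by simp
   have val: "(snd d' o ?F) (h t) = (snd d (retr p), exp t * radius p)" if "t \<in> T" for t
   proof -
    have "chart_inv c (h t) = flow t p" using that c(1) by (simp add: h_def T_def)
    moreover have "cone_map (flow t p) = (retr p, exp t * radius p)"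
    proof -
     have e: "cone_map (flow t p) = (retr (flow t p), exp t * radius p)"
      by (simp add: cone_map_def radius_flow[OF p])
     have "retr (flow t p) = flow (- ln (exp t * radius p)) (flow t p)"
      unfolding retr_def radius_flow[OF p] ..
     also have "... = flow (- ln (exp t * radius p) + t) p" by (rule flow_add[OF p])
     also have "- ln (exp t * radius p) + t = - ln (radius p)"
      using radius_pos[OF p] by (simp add: ln_mult)
     finally show ?thesis using e by (simp add: retr_def)
    qed
    ultimately show ?thesis by (simp add: snd')
   qed
   have "((%t. exp t * radius p) has_real_derivative radius p) (at 0)"
    by (auto intro!: derivative_eq_intros)
   then have "((%t. (snd d (retr p), exp t * radius p)) has_vector_derivative (0, radius p)) (at 0)"
    by (intro has_vector_derivative_Pair has_vector_derivative_const)
     (simp add: has_real_derivative_iff_has_vector_derivative)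
   from has_vector_derivative_transform_within_open[OF this T val[symmetric]]
   have "dir_deriv (snd d' o ?F) x (X c x) = (0, radius p)"
    using vector_derivative_unique_at[OF D1] by blast
   then have L: "tangent_map M K cone_map p (\<xi> p) d' = (0, radius p)"
    unfolding tm Xc using True px by (simp add: push_def)
   have "coord_vector K ?z (chart_at K ?z) (0, 1) d' = dir_deriv (snd d' o chart_inv (cone_chart d0)) (snd (cone_chart d0) ?z) (0, 1)"
    unfolding coord_vector_def d0(2) using True by simp
   also have "... = (0, 1)"
   proof (rule dir_deriv_eqI)
    let ?y0 = "snd d0 (retr p)"
    have y0: "?y0 \<in> snd d0 ` fst d0" using d0(3) by (simp add: cone_map_def)
    have inv0: "chart_inv d0 ?y0 = retr p" using N.chart_inv_left[OF d0(1)] d0(3) by (simp add: cone_map_def)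
    have "((%t. (snd d (retr p), radius p + t)) has_vector_derivative (0, 1)) (at 0)"
     by (intro has_vector_derivative_Pair) (auto intro!: derivative_eq_intros)
    then show "((%t. (snd d' o chart_inv (cone_chart d0)) (snd (cone_chart d0) ?z + t *\<^sub>R (0, 1))) has_vector_derivative (0, 1)) (at 0)"
    proof (rule has_vector_derivative_transform_within_open)
     show "open {t. radius p + t > 0}" by (intro open_Collect_less continuous_intros)
     show "0 \<in> {t. radius p + t > 0}" using radius_pos[OF p] by simp
     fix t assume t: "t \<in> {t. radius p + t > 0}"
     have "snd (cone_chart d0) ?z + t *\<^sub>R (0, 1) = (?y0, radius p + t)"
      by (simp add: cone_chart_def cone_map_def)
     moreover have "chart_inv (cone_chart d0) (?y0, radius p + t) = (retr p, radius p + t)"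
      using cone_chart_inv[OF d0(1) y0, of "radius p + t"] t inv0 by simp
     ultimately show "(snd d (retr p), radius p + t) = (snd d' o chart_inv (cone_chart d0)) (snd (cone_chart d0) ?z + t *\<^sub>R (0, 1))"
      by (simp add: snd')
    qed
   qed
   finally show ?thesis unfolding L cone_field_def Let_def by (simp add: cone_map_def)
  next
   case False
   then show ?thesis
    unfolding tm cone_field_def Let_def coord_vector_def using px by (simp add: push_def)
  qed
 qed
qed

theorem isomorphic_cone: "isomorphic (M, g, \<xi>) (riemannian_cone N, cone_metric N gN, cone_field N)"
 unfolding isomorphic_def prod.case
proof (intro exI[of _ cone_map] conjI ballI cone_diffeomorphism cone_tangent_map_field)
 fix p V W assume p: "p \<in> points M" and V: "V \<in> tangent_space M p" and W: "W \<in> tangent_space M p"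
 define c where "c = chart_at M p"
 have c: "c \<in> atlas M" "p \<in> fst c" using chart_at[OF p] by (auto simp: c_def)
 have ch: "c \<in> charts_at M p" using c by (simp add: charts_at_iff)
 define x where "x = snd c p"
 have x: "x \<in> snd c ` fst c" using c by (simp add: x_def)
 have px: "chart_inv c x = p" using c by (simp add: x_def)
 let ?P = "chart_inv c"
 have P: "plot M B (snd c ` fst c) ?P" by (rule plot_chart_inv[OF c(1)])
 have tm: "tangent_map M K cone_map p Z = push K (%y. (retr (?P y), radius (?P y))) x (Z c)" for Z
  using tangent_map_push[of M p K cone_map Z] px unfolding c_def[symmetric] x_def by (simp add: o_def cone_map_def)
 have v: "V c \<in> span B" and w: "W c \<in> span B" using tangent_push(2)[OF V ch] tangent_push(2)[OF W ch] .
 have sub: "(%y. retr (?P y)) ` (snd c ` fst c) \<subseteq> Nset" using retr_in[OF plotD(5)[OF P]] by blast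
 have "cone_metric N gN (cone_map p) (tangent_map M K cone_map p V) (tangent_map M K cone_map p W) =
   (radius (?P x))\<^sup>2 * pb (%y. retr (?P y)) x (V c) (W c)
   + dir_deriv (%y. radius (?P y)) x (V c) * dir_deriv (%y. radius (?P y)) x (W c)"
  unfolding tm
  using cone_metric_push[OF plot_into_N[OF retr_plot[OF P] sub] retr_plot[OF P] sub radius_plot(1)[OF P] radius_pos[OF plotD(5)[OF P]] x v w]
  by (simp add: px cone_map_def)
 also have "... = pb ?P x (V c) (W c)" by (rule cone_isometry[OF P x v w])
 also have "... = g p V W"
  unfolding pb_def px using tangent_push(1)[OF V ch, symmetric] tangent_push(1)[OF W ch, symmetric] by (simp add: x_def)
 finally show "cone_metric N gN (cone_map p) (tangent_map M K cone_map p V) (tangent_map M K cone_map p W) = g p V W" .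
qed

end

section \<open>Behaviour near a zero\<close>

text \<open>A solution with values in a compact set has bounded speed, so it converges at the end of the interval; the integral
equation shows that the extension is a solution there as well.\<close>

lemma ODE_extend_endpoint:
 fixes z :: "real => 'b::euclidean_space" and \<phi> :: "real \<times> 'b => 'b"
 assumes \<phi>: "continuous_on ({0..1} \<times> K) \<phi>" and K: "compact K"
  and zK: "!!t. t \<in> {0..<1} ==> z t \<in> K"
  and ode: "!!t. t \<in> {0..<1} ==> (z has_vector_derivative \<phi> (t, z t)) (at t within {0..<1})"
 obtains j where "!!t. t \<in> {0..<1} ==> j t = z t" "!!t. t \<in> {0..1} ==> j t \<in> K"
  "!!t. t \<in> {0..1} ==> (j has_vector_derivative \<phi> (t, j t)) (at t within {0..1})"
proof -
 have "compact ({0..1::real} \<times> K)" by (intro compact_Times K compact_Icc)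
 from compact_bounded_norm[OF this \<phi>]
 obtain M where M: "M \<ge> 0" "!!p. p \<in> {0..1} \<times> K ==> norm (\<phi> p) <= M" by metis
 have bd: "norm (\<phi> (t, z t)) <= M" if "t \<in> {0..<1}" for t
  by (rule M(2)) (use that zK[OF that] in simp)
 have cv: "convex {0..<1::real}" by (rule convex_real_interval)
 have lip: "norm (z t - z s) <= M * \<bar>t - s\<bar>" if "s \<in> {0..<1}" "t \<in> {0..<1}" for s t
  by (rule vector_derivative_bound[OF cv ode bd that])
 have uc: "uniformly_continuous_on {0..<1} z"
 proof (rule lipschitz_on_uniformly_continuous[of M])
  show "M-lipschitz_on {0..<1} z" by (rule lipschitz_onI) (use lip M(1) in \<open>simp_all add: dist_norm\<close>)
 qed
 have cl: "closure {0..<1::real} = {0..1}" by simp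
 have "1 \<in> closure {0..<1::real}" by simp
 then obtain l where l: "(z \<longlongrightarrow> l) (at 1 within {0..<1})"
  by (rule uniformly_continuous_on_extension_at_closure[OF uc])
 define j where "j t = (if t = 1 then l else z t)" for t
 have within: "at t within {0..<1} = at t within {0..1}" if "t \<in> {0..1}" for t :: real
 proof (cases "t = 1")
  case True
  have "{0..<1} - {1} = {0..1} - {1::real}" by auto
  then show ?thesis unfolding True at_within_def by simp
 next
  case False
  show ?thesis by (rule at_within_nhd[of t "{..<1}"]) (use that False in auto)
 qed
 have jK: "j t \<in> K" if "t \<in> {0..1}" for t
 proof (cases "t = 1")
  case True
  have "l \<in> K"
  proof (rule Lim_in_closed_set[OF compact_imp_closed[OF K] _ _ l])
   show "eventually (%t. z t \<in> K) (at 1 within {0..<1})"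
    unfolding eventually_at_filter using zK by (intro always_eventually) auto
   show "at (1::real) within {0..<1} ~= bot" by (simp add: at_within_eq_bot_iff)
  qed
  then show ?thesis by (simp add: j_def True)
 qed (use zK that in \<open>auto simp: j_def\<close>)
 have jc: "continuous_on {0..1} j"
  unfolding continuous_on_eq_continuous_within continuous_within
 proof
  fix t :: real assume t: "t \<in> {0..1}"
  show "(j \<longlongrightarrow> j t) (at t within {0..1})"
  proof (cases "t = 1")
   case True
   have "(j \<longlongrightarrow> l) (at 1 within {0..<1})"
    using l by (rule iffD1[OF Lim_cong_within, rotated -1]) (auto simp: j_def)
   then show ?thesis using within[OF t] by (simp add: True j_def)
  next
   case False
   then have t': "t \<in> {0..<1}" using t by auto
   have "(z \<longlongrightarrow> z t) (at t within {0..<1})"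
    using has_vector_derivative_continuous[OF ode[OF t']] unfolding continuous_within .
   then have "(j \<longlongrightarrow> z t) (at t within {0..<1})"
    by (rule iffD1[OF Lim_cong_within, rotated -1]) (auto simp: j_def)
   then show ?thesis using within[OF t] False by (simp add: j_def)
  qed
 qed
 have "continuous_on {0..1} (%s. \<phi> (s, j s))"
  by (rule continuous_on_compose2[OF \<phi> continuous_on_Pair[OF continuous_on_id jc]]) (use jK in auto)
 note der = integral_has_vector_derivative[OF this]
 define J where "J t = z 0 + integral {0..t} (%s. \<phi> (s, j s))" for t
 have J: "(J has_vector_derivative \<phi> (t, j t)) (at t within {0..1})" if "t \<in> {0..1}" for t
  unfolding J_def[abs_def] using has_vector_derivative_add[OF has_vector_derivative_const der[OF that]] by simp
 have const: "J t - j t = 0" if t: "t \<in> {0..<1}" for t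
 proof -
  have d0: "((%s. J s - z s) has_vector_derivative 0) (at s within {0..<1})" if s: "s \<in> {0..<1}" for s
  proof -
   have "j s = z s" using s by (auto simp: j_def)
   then have "(J has_vector_derivative \<phi> (s, z s)) (at s within {0..<1})"
    using J[of s] s within[of s] by simp
   from has_vector_derivative_diff[OF this ode[OF s]] show ?thesis by simp
  qed
  from has_vector_derivative_zero_constant[OF cv d0]
  obtain k where k: "!!s. s \<in> {0..<1} ==> J s - z s = k" by metis
  have "k = 0" using k[of 0] by (simp add: J_def)
  then show ?thesis using k[OF t] t by (simp add: j_def)
 qed
 have Jj: "J t = j t" if "t \<in> {0..1}" for t
 proof -
  have "continuous_on {0..1} J" by (rule continuous_on_vector_derivative[OF J])
  then have "continuous_on (closure {0..<1}) (%t. J t - j t)" unfolding cl by (intro continuous_on_diff jc)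
  from continuous_constant_on_closure[OF this, of 0 t] const that cl show ?thesis by simp
 qed
 show ?thesis
 proof (rule that)
  show "j t = z t" if "t \<in> {0..<1}" for t using that by (simp add: j_def)
  show "j t \<in> K" if "t \<in> {0..1}" for t by (rule jK[OF that])
  show "(j has_vector_derivative \<phi> (t, j t)) (at t within {0..1})" if "t \<in> {0..1}" for t
   by (rule has_vector_derivative_transform[OF that _ J[OF that]]) (simp add: Jj)
 qed
qed

text \<open>The Cholesky decomposition: a new basis vector is projected orthogonally to the span of the earlier ones, and its
orthogonal part is mapped to a multiple of itself.\<close>

lemma inner_product_isometry:
 fixes G :: "'e::euclidean_space => 'e => real"
 assumes G: "bilinear G" and "finite A" "A \<subseteq> Basis"
  and sym: "!!v w. G v w = G w v" and pos: "!!v. v \<in> span A ==> v ~= 0 ==> G v v > 0"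
 shows "\<exists>L. linear L & (\<forall>v\<in>span A. L v \<in> span A) & (\<forall>v\<in>span A. \<forall>w\<in>span A. L v \<bullet> L w = G v w)"
 using assms(2,3) pos
proof (induction A)
 case empty
 show ?case using G by (intro exI[of _ "%v. 0"]) (auto simp: linear_iff bilinear_lzero)
next
 case (insert a A)
 have A: "A \<subseteq> Basis" "a \<in> Basis" "a \<notin> A" "A \<subseteq> insert a A" using insert.hyps insert.prems by auto
 note sub = subsetD[OF span_mono[OF A(4)]]
 have aS: "a \<in> span (insert a A)" by (simp add: span_base)
 have "\<exists>L. linear L & (\<forall>v\<in>span A. L v \<in> span A) & (\<forall>v\<in>span A. \<forall>w\<in>span A. L v \<bullet> L w = G v w)"
  by (rule insert.IH[OF A(1)]) (rule insert.prems(2)[OF sub])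
 then obtain L where L: "linear L" "!!v. v \<in> span A ==> L v \<in> span A"
   "!!v w. v \<in> span A ==> w \<in> span A ==> L v \<bullet> L w = G v w" by metis
 have Gl: "G (u + v) w = G u w + G v w" "G (r *\<^sub>R u) w = r * G u w" "G (u - v) w = G u w - G v w"
  and Gr: "G w (u + v) = G w u + G w v" "G w (r *\<^sub>R u) = r * G w u" "G w (u - v) = G w u - G w v" for u v w r
  using bilinear_ladd[OF G] bilinear_lmul[OF G] bilinear_lsub[OF G]
   bilinear_radd[OF G] bilinear_rmul[OF G] bilinear_rsub[OF G] by simp_all
 \<comment> \<open>the \<open>G\<close>-orthogonal projection of \<open>a\<close> to the span of \<open>A\<close>\<close>
 define T where "T v = (\<Sum>b\<in>A. G (proj_span A v) b *\<^sub>R b) + (v - proj_span A v)" for v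
 have lp: "linear (proj_span A)" using bounded_linear_proj_span by (rule bounded_linear.linear)
 have lT: "linear T"
  unfolding T_def linear_iff linear_add[OF lp] linear_scale[OF lp]
  by (simp add: Gl algebra_simps sum.distrib scaleR_sum_right)
 have Tb: "T v \<bullet> b = G (proj_span A v) b" if b: "b \<in> A" for v b
 proof -
  have "(\<Sum>c\<in>A. G (proj_span A v) c *\<^sub>R c) \<bullet> b = (\<Sum>c\<in>A. if c = b then G (proj_span A v) b else 0)"
   unfolding inner_sum_left using A(1) b by (intro sum.cong refl) (auto simp: inner_Basis subset_iff)
  also have "... = G (proj_span A v) b" using b insert.hyps(1) by simp
  finally have 1: "(\<Sum>c\<in>A. G (proj_span A v) c *\<^sub>R c) \<bullet> b = G (proj_span A v) b" .
  have "proj_span A v \<bullet> b = (\<Sum>c\<in>A. if c = b then v \<bullet> b else 0)"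
   unfolding proj_span_def inner_sum_left using A(1) b by (intro sum.cong refl) (auto simp: inner_Basis subset_iff)
  also have "... = v \<bullet> b" using b insert.hyps(1) by simp
  finally show ?thesis unfolding T_def inner_add_left inner_diff_left 1 by simp
 qed
 have Gspan: "G u w = 0" if "w \<in> span A" "!!b. b \<in> A ==> G u b = 0" for u w
  using that(1)
 proof (induction rule: span_induct)
  case base
  show ?case unfolding subspace_def using Gr(2)[of u 0] by (auto simp: Gr)
 next
  case (step x)
  then show ?case by (rule that(2))
 qed
 have "T v = 0 ==> v = 0" for v
 proof -
  assume T0: "T v = 0"
  have "G (proj_span A v) (proj_span A v) = 0"
   by (rule Gspan) (use Tb[of _ v] T0 in auto)
  then have p0: "proj_span A v = 0"
   using insert.prems(2)[OF sub[OF proj_span_in[of A v]]] by force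
  then show "v = 0" using T0 Gl(2)[of 0 0] by (simp add: T_def)
 qed
 then have "inj T" using linear_injective_0[OF lT] by blast
 then have "surj T" by (rule linear_inj_imp_surj[OF lT])
 then obtain q where q: "T q = (\<Sum>b\<in>A. G a b *\<^sub>R b)" by (metis surjD)
 define p where "p = proj_span A q"
 have pA: "p \<in> span A" by (simp add: p_def)
 have pb: "G (a - p) b = 0" if b: "b \<in> A" for b
 proof -
  have "(\<Sum>c\<in>A. G a c *\<^sub>R c) \<bullet> b = (\<Sum>c\<in>A. if c = b then G a b else 0)"
   unfolding inner_sum_left using A(1) b by (intro sum.cong refl) (auto simp: inner_Basis subset_iff)
  also have "... = G a b" using b insert.hyps(1) by simp
  finally show ?thesis using Tb[OF b, of q] unfolding q Gl p_def by simp
 qed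
 have orth: "G (a - p) w = 0" if "w \<in> span A" for w using Gspan[OF that pb] .
 have ap: "a - p ~= 0"
 proof
  assume "a - p = 0"
  then have "a \<in> span A" using pA by simp
  then have "a \<bullet> a = 0" using A(2,3) unfolding in_span_iff_inner[OF A(1)] by blast
  then show False using A(2) by auto
 qed
 define \<beta> where "\<beta> = sqrt (G (a - p) (a - p))"
 have "G (a - p) (a - p) > 0" by (rule insert.prems(2)[OF span_diff[OF aS sub[OF pA]] ap])
 then have \<beta>: "\<beta> * \<beta> = G (a - p) (a - p)" by (simp add: \<beta>_def)
 define L' where "L' v = L (v - (v \<bullet> a) *\<^sub>R a) + (v \<bullet> a) *\<^sub>R (L p + \<beta> *\<^sub>R a)" for v
 have lL': "linear L'"
  unfolding L'_def linear_iff
  by (simp add: linear_add[OF L(1)] linear_diff[OF L(1)] linear_scale[OF L(1)] inner_add_left algebra_simps)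
 have split: "v - (v \<bullet> a) *\<^sub>R a \<in> span A" if "v \<in> span (insert a A)" for v
  using that A(2) unfolding in_span_iff_inner[OF A(1)] in_span_iff_inner[OF insert.prems(1)]
  by (auto simp: inner_diff_left inner_Basis)
 have La: "u \<bullet> a = 0" if "u \<in> span A" for u
  using that A(2,3) unfolding in_span_iff_inner[OF A(1)] by blast
 have form: "L' v = L (v - (v \<bullet> a) *\<^sub>R a + (v \<bullet> a) *\<^sub>R p) + ((v \<bullet> a) * \<beta>) *\<^sub>R a" for v
  unfolding L'_def linear_add[OF L(1)] linear_scale[OF L(1)] by (simp add: algebra_simps)
 have sp: "v - (v \<bullet> a) *\<^sub>R a + (v \<bullet> a) *\<^sub>R p \<in> span A" if "v \<in> span (insert a A)" for v
  by (intro span_add split that span_scale pA)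
 show ?case
 proof (intro exI conjI ballI)
  show "linear L'" by (rule lL')
  fix v assume v: "v \<in> span (insert a A)"
  show "L' v \<in> span (insert a A)" unfolding form
   by (intro span_add span_scale aS sub[OF L(2)[OF sp[OF v]]])
  fix w assume w: "w \<in> span (insert a A)"
  define v' where "v' = v - (v \<bullet> a) *\<^sub>R a + (v \<bullet> a) *\<^sub>R p"
  define w' where "w' = w - (w \<bullet> a) *\<^sub>R a + (w \<bullet> a) *\<^sub>R p"
  have v': "v' \<in> span A" and w': "w' \<in> span A" using sp[OF v] sp[OF w] by (simp_all add: v'_def w'_def)
  have "L' v \<bullet> L' w = L v' \<bullet> L w' + (v \<bullet> a) * (w \<bullet> a) * (\<beta> * \<beta>)"
   unfolding form v'_def[symmetric] w'_def[symmetric] using La[OF L(2)[OF v']] La[OF L(2)[OF w']] A(2)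
   by (simp add: inner_add_left inner_add_right inner_commute)
  also have "... = G v' w' + (v \<bullet> a) * (w \<bullet> a) * G (a - p) (a - p)" unfolding L(3)[OF v' w'] \<beta> ..
  also have "... = G (v' + (v \<bullet> a) *\<^sub>R (a - p)) (w' + (w \<bullet> a) *\<^sub>R (a - p))"
   unfolding Gl(1,2) Gr(1,2) using orth[OF v'] orth[OF w'] sym[of v' "a - p"] by simp
  also have "... = G v w" by (simp add: v'_def w'_def scaleR_diff_right)
  finally show "L' v \<bullet> L' w = G v w" .
 qed
qed

context selfsimilar_ctx
begin

text \<open>At a zero the derivative \<open>A\<close> of the field satisfies \<open>g(Av, w) + g(v, Aw) = 2 g(v, w)\<close>, and \<open>g(Av, w) = g(v, Aw)\<close>
because \<open>g(\<xi>, _)\<close> is closed.\<close>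

lemma X_derivative_at_zero:
 assumes c: "c \<in> atlas M" and x: "x \<in> snd c ` fst c" and X0: "X c x = 0" and v: "v \<in> span B"
 shows "dir_deriv (X c) x v = v"
proof -
 let ?A = "dir_deriv (X c) x"
 have A: "?A w \<in> span B" if "w \<in> span B" for w by (rule dX(2)[OF c x that])
 have sym: "gc c x (?A v) w = gc c x (?A w) v" if v: "v \<in> span B" and w: "w \<in> span B" for v w
 proof -
  have *: "dir_deriv (%y. gc c y (X c y) w) x v = gc c x (?A v) w" if v: "v \<in> span B" and w: "w \<in> span B" for v w
  proof -
   have "dir_deriv (%y. gc c y (X c y) w) x v =
     dir_deriv (%y. gc c y (X c x) w) x v + gc c x (?A v) w + gc c x (X c x) 0"
    by (rule gc_dir_deriv[OF c x v dX(1)[OF c x v] A[OF v] X_span[OF c] has_vector_derivative_const span_zero w])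
   also have "dir_deriv (%y. gc c y (X c x) w) x v = dir_deriv (%y. 0) x v"
    by (rule dir_deriv_cong[OF open_along_openin[OF chart_image_open[OF c]] x v])
     (simp add: X0 gc_zero[OF c _ w])
   also have "... = 0" by (rule dir_deriv_eqI) simp
   finally show ?thesis using gc_zero[OF c x span_zero] by (simp add: X0)
  qed
  show ?thesis using closed_form[OF c x v w] unfolding *[OF v w] *[OF w v] .
 qed
 have eq: "gc c x (?A v) w = gc c x v w" if w: "w \<in> span B" for w
 proof -
  have "dir_deriv (%y. gc c y v w) x 0 = 0" by (rule dir_deriv_eqI) simp
  then have "gc c x (?A v) w + gc c x v (?A w) = 2 * gc c x v w"
   using lie_chart[OF c x v w] by (simp add: X0)
  then show ?thesis using sym[OF v w] gc_sym[OF c x v A[OF w]] by simp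
 qed
 define u where "u = 1 *\<^sub>R ?A v + (- 1) *\<^sub>R v"
 have u: "u \<in> span B" unfolding u_def by (intro span_add span_scale A v)
 have "gc c x u u = 1 * gc c x (?A v) u + (- 1) * gc c x v u"
  using gc_left[OF c x A[OF v] v u, of 1 "- 1"] unfolding u_def[symmetric] .
 then have "gc c x u u = 0" using eq[OF u] by simp
 then have "u = 0" using gc_pos[OF c x u] by force
 then show ?thesis by (simp add: u_def)
qed

lemma gc_continuous:
 assumes c: "c \<in> atlas M"
  and "continuous_on T x" "!!t. t \<in> T ==> x t \<in> snd c ` fst c"
  and "continuous_on T v" "!!t. t \<in> T ==> v t \<in> span B"
  and "continuous_on T w" "!!t. t \<in> T ==> w t \<in> span B"
 shows "continuous_on T (%t. gc c (x t) (v t) (w t))"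
proof -
 have cg: "continuous_on T (%t. gc c (x t) b d)" if "b \<in> B" "d \<in> B" for b d
  by (rule continuous_on_compose2[OF Ck_on_continuous[OF smooth_on_Ck[OF gc_smooth[OF c span_base[OF that(1)] span_base[OF that(2)]]]] assms(2)])
   (use assms(3) in blast)
 have "continuous_on T (%t. \<Sum>b\<in>B. \<Sum>d\<in>B. ((v t \<bullet> b) * (w t \<bullet> d)) * gc c (x t) b d)"
  by (intro continuous_on_sum continuous_on_mult continuous_on_inner assms(4,6) continuous_on_const cg)
 then show ?thesis
  by (rule continuous_on_eq) (rule gc_expand[OF c assms(3,5,7), symmetric])
qed

text \<open>The field is at least half as long as the radial field, since its linear part is the identity.\<close>

lemma f_quadratic_bound:
 assumes c: "c \<in> atlas M" "p0 \<in> fst c" and X0: "X c (snd c p0) = 0"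
 obtains r \<rho> m where "0 < r" "r < \<rho>" "cball (snd c p0) \<rho> Int span B \<subseteq> snd c ` fst c" "0 < m"
  "!!x. x \<in> cball (snd c p0) r Int span B ==> m * (norm (x - snd c p0))\<^sup>2 <= gc c x (X c x) (X c x)"
proof -
 define x0 where "x0 = snd c p0"
 obtain R where R: "R > 0" "cball x0 R Int span B \<subseteq> snd c ` fst c"
  unfolding x0_def by (rule chart_ball[OF c(2,1)])
 have x0: "x0 \<in> snd c ` fst c" using c(2) by (simp add: x0_def)
 then have x0B: "x0 \<in> span B" using chart_image_span[OF c(1)] by (rule subsetD[rotated])
 have "{x0} \<subseteq> snd c ` fst c" using x0 by simp
 note taylor = uniform_taylor[OF B_Basis open_along_openin[OF chart_image_open[OF c(1)]]
   smooth_on_Ck[OF X_smooth[OF c(1)]] compact_sing this, of "1/2"]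
 obtain d where d: "d > 0" "!!p v. p \<in> {x0} ==> v \<in> span B ==> norm v <= d ==> p + v \<in> snd c ` fst c &
   norm (X c (p + v) - X c p - (\<Sum>b\<in>B. (v \<bullet> b) *\<^sub>R dir_deriv (X c) p b)) <= 1 / 2 * norm v"
  by (rule taylor[OF _ that]) simp_all
 define r where "r = min d (R / 2)"
 have r: "0 < r" "r < R" "r <= d" using R(1) d(1) by (auto simp: r_def)
 have Xlow: "norm (x - x0) / 2 <= norm (X c x)" if x: "x \<in> cball x0 r Int span B" for x
 proof -
  let ?v = "x - x0"
  have v: "?v \<in> span B" "norm ?v <= d" using x x0B r(3) by (auto intro: span_diff simp: dist_norm norm_minus_commute)
  have "(\<Sum>b\<in>B. (?v \<bullet> b) *\<^sub>R dir_deriv (X c) x0 b) = (\<Sum>b\<in>B. (?v \<bullet> b) *\<^sub>R b)"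
   by (intro sum.cong refl arg_cong2[where f = scaleR] X_derivative_at_zero[OF c(1) x0 X0[folded x0_def]] span_base)
  also have "... = ?v" by (rule sum_Basis_inner[OF B_Basis v(1)])
  finally have "norm (X c x - ?v) <= 1 / 2 * norm ?v" using d(2)[OF singletonI v] X0 by (simp add: x0_def)
  then show ?thesis using norm_triangle_ineq3[of "X c x" ?v] by linarith
 qed
 define K where "K = (cball x0 r Int span B) \<times> (sphere 0 1 Int span B)"
 have K: "compact K" unfolding K_def by (intro compact_Times compact_Int_closed compact_cball compact_sphere closed_span)
 have sub: "x \<in> snd c ` fst c" if "x \<in> cball x0 r Int span B" for x using that R(2) r(2) by auto
 have "continuous_on K (%p. gc c (fst p) (snd p) (snd p))"
  by (rule gc_continuous[OF c(1)]) (auto intro!: continuous_intros sub simp: K_def)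
 then obtain m where m: "m > 0" "!!x u. x \<in> cball x0 r Int span B ==> u \<in> sphere 0 1 Int span B ==> m <= gc c x u u"
 proof (cases "K = {}")
  case True
  show ?thesis
  proof (rule that[of 1])
   fix x u assume "x \<in> cball x0 r Int span B" "u \<in> sphere 0 1 Int span B"
   then have "(x, u) \<in> K" by (simp add: K_def)
   then show "1 <= gc c x u u" unfolding True by simp
  qed simp
 next
  case False
  assume ct: "continuous_on K (%p. gc c (fst p) (snd p) (snd p))"
  obtain p where p: "p \<in> K" "!!y. y \<in> K ==> gc c (fst p) (snd p) (snd p) <= gc c (fst y) (snd y) (snd y)"
   using continuous_attains_inf[OF K False ct] by blast
  have pK: "fst p \<in> cball x0 r Int span B" "snd p \<in> span B" "snd p ~= 0" using p(1) by (auto simp: K_def)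
  show ?thesis
  proof (rule that)
   show "0 < gc c (fst p) (snd p) (snd p)" by (rule gc_pos[OF c(1) sub[OF pK(1)] pK(2,3)])
   fix x u assume "x \<in> cball x0 r Int span B" "u \<in> sphere 0 1 Int span B"
   then have "(x, u) \<in> K" by (simp add: K_def)
   from p(2)[OF this] show "gc c (fst p) (snd p) (snd p) <= gc c x u u" by simp
  qed
 qed
 have low: "m * (norm u)\<^sup>2 <= gc c x u u" if x: "x \<in> cball x0 r Int span B" and u: "u \<in> span B" for x u
 proof (cases "u = 0")
  case True
  then show ?thesis using gc_zero[OF c(1) sub[OF x] span_zero] by simp
 next
  case False
  let ?e = "u /\<^sub>R norm u"
  have e: "?e \<in> span B" "?e \<in> sphere 0 1 Int span B" using u False by (auto intro: span_scale)
  have ue: "u = norm u *\<^sub>R ?e + 0 *\<^sub>R 0" using False by simp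
  have "gc c x u u = (norm u)\<^sup>2 * gc c x ?e ?e"
  proof -
   have "gc c x u u = norm u * gc c x ?e u"
    using gc_left[OF c(1) sub[OF x] e(1) span_zero u, of "norm u" 0] False by simp
   also have "gc c x ?e u = norm u * gc c x ?e ?e"
    using gc_right[OF c(1) sub[OF x] e(1) span_zero e(1), of "norm u" 0] False by simp
   finally show ?thesis by (simp add: power2_eq_square)
  qed
  then show ?thesis using mult_left_mono[OF m(2)[OF x e(2)], of "(norm u)\<^sup>2"] by (simp add: mult.commute)
 qed
 show ?thesis
 proof (rule that[of r R "m / 4"])
  show "0 < r" "r < R" "cball (snd c p0) R Int span B \<subseteq> snd c ` fst c" "0 < m / 4"
   using r R m(1) by (simp_all add: x0_def)
  fix x assume "x \<in> cball (snd c p0) r Int span B"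
  then have x: "x \<in> cball x0 r Int span B" by (simp add: x0_def)
  have "(norm (x - x0) / 2)\<^sup>2 <= (norm (X c x))\<^sup>2" by (rule power_mono[OF Xlow[OF x]]) simp
  then have "m * (norm (x - x0) / 2)\<^sup>2 <= m * (norm (X c x))\<^sup>2" using m(1) by simp
  also have "... <= gc c x (X c x) (X c x)" by (rule low[OF x X_span[OF c(1) sub[OF x]]])
  finally show "m / 4 * (norm (x - snd c p0))\<^sup>2 <= gc c x (X c x) (X c x)"
   by (simp add: x0_def power_divide)
 qed
qed

end

section \<open>The basin of a zero\<close>

context selfsimilar_ctx
begin

lemma f_nonneg: "p \<in> points M ==> f p \<ge> 0"
proof -
 assume p: "p \<in> points M"
 obtain c where c: "c \<in> atlas M" "p \<in> fst c" using atlas_cover[OF p] by blast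
 have x: "snd c p \<in> snd c ` fst c" using c(2) by simp
 have "f p = gc c (snd c p) (X c (snd c p)) (X c (snd c p))"
  using f_chart[OF c(1) x] c by simp
 also have "... \<ge> 0"
  using gc_pos[OF c(1) x X_span[OF c(1) x]] gc_zero[OF c(1) x span_zero]
  by (cases "X c (snd c p) = 0") (simp_all add: less_imp_le)
 finally show ?thesis .
qed

lemma f_sublevel_open: "openin (mtop M) {p \<in> points M. f p < a}"
proof -
 have "continuous_map (mtop M) euclideanreal f"
 proof (rule continuous_from_charts)
  fix c assume "c \<in> atlas M"
  from Ck_on_continuous[OF smooth_on_Ck[OF f_plot(1)[OF plot_chart_inv[OF this]]]]
  show "continuous_map (top_of_set (snd c ` fst c)) euclideanreal (f o chart_inv c)" by (simp add: o_def)
 qed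
 from openin_continuous_map_preimage[OF this, of "{..<a}"] show ?thesis by simp
qed

lemma flow_continuous: "continuous_map (mtop M) (mtop M) (flow t)"
proof (rule continuous_from_charts)
 fix c assume "c \<in> atlas M"
 from plotD(3)[OF flow_plot_fixed[OF plot_chart_inv[OF this]]]
 show "continuous_map (top_of_set (snd c ` fst c)) (mtop M) (flow t o chart_inv c)" by (simp add: o_def)
qed

end

text \<open>A chart around a zero of the field, with radii and a constant as in \<open>f_quadratic_bound\<close>.\<close>

locale vanishing_ctx = selfsimilar_ctx M g \<xi> for M :: "('a, 'e::euclidean_space) manifold" and g \<xi> +
 fixes p0 :: 'a and c :: "('a, 'e) chart" and r \<rho> m :: real
 assumes c: "c \<in> atlas M" "p0 \<in> fst c" and zero: "X c (snd c p0) = 0"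
  and r: "0 < r" "r < \<rho>" and ball_image: "cball (snd c p0) \<rho> Int span B \<subseteq> snd c ` fst c"
  and m: "0 < m"
  and quadratic: "!!x. x \<in> cball (snd c p0) r Int span B ==>
   m * (norm (x - snd c p0))\<^sup>2 <= gc c x (X c x) (X c x)"
begin

definition x0 :: 'e where
 "x0 = snd c p0"

definition U0 :: "'a set" where
 "U0 = {q \<in> fst c. norm (snd c q - x0) < r & f q < m * r\<^sup>2}"

lemma x0: "x0 \<in> snd c ` fst c" "x0 \<in> span B"
proof -
 show 1: "x0 \<in> snd c ` fst c" unfolding x0_def using c(2) by (rule imageI)
 show "x0 \<in> span B" by (rule subsetD[OF chart_image_span[OF c(1)] 1])
qed

lemma p0: "p0 \<in> points M" "chart_inv c x0 = p0" "f p0 = 0"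
proof -
 show "p0 \<in> points M" by (rule subsetD[OF chart_sub[OF c(1)] c(2)])
 show 1: "chart_inv c x0 = p0" using c by (simp add: x0_def)
 have "f p0 = gc c x0 0 0" using f_chart[OF c(1) x0(1)] zero unfolding 1 by (simp add: x0_def)
 then show "f p0 = 0" using gc_zero[OF c(1) x0(1) span_zero] by simp
qed

lemma f_lower:
 assumes "q \<in> fst c" "norm (snd c q - x0) <= r"
 shows "m * (norm (snd c q - x0))\<^sup>2 <= f q"
proof -
 have x: "snd c q \<in> snd c ` fst c" using assms(1) by simp
 have "snd c q \<in> cball (snd c p0) r Int span B"
  using assms(2) subsetD[OF chart_image_span[OF c(1)] x] by (simp add: x0_def dist_norm norm_minus_commute)
 from quadratic[OF this] show ?thesis using f_chart[OF c(1) x] c(1) assms(1) by (simp add: x0_def)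
qed

lemma ball_sub: "cball x0 r Int span B \<subseteq> snd c ` fst c"
 using ball_image r(2) by (intro subset_trans[OF _ ball_image]) (auto simp: x0_def)

lemma inverse_ball:
 assumes "R <= r"
 shows "chart_inv c ` (cball x0 R Int span B) = {q \<in> fst c. norm (snd c q - x0) <= R}"
  and "closedin (mtop M) (chart_inv c ` (cball x0 R Int span B))"
proof -
 have sub: "cball x0 R Int span B \<subseteq> snd c ` fst c" using ball_sub assms by auto
 show "closedin (mtop M) (chart_inv c ` (cball x0 R Int span B))"
  by (rule closedin_chart_compact[OF c(1) _ sub]) (intro compact_Int_closed compact_cball closed_span)
 show "chart_inv c ` (cball x0 R Int span B) = {q \<in> fst c. norm (snd c q - x0) <= R}" (is "?L = ?R")
 proof
  show "?L \<subseteq> ?R"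
  proof (rule image_subsetI)
   fix x assume x: "x \<in> cball x0 R Int span B"
   note xc = subsetD[OF sub x]
   show "chart_inv c x \<in> ?R" using x chart_inv_in[OF xc] chart_inv_right[OF xc]
    by (simp add: dist_norm norm_minus_commute)
  qed
  show "?R \<subseteq> ?L"
  proof
   fix q assume q: "q \<in> ?R"
   then have "snd c q \<in> span B" using subsetD[OF chart_image_span[OF c(1)], of "snd c q"] by simp
   then have "snd c q \<in> cball x0 R Int span B" using q by (simp add: dist_norm norm_minus_commute)
   then have "chart_inv c (snd c q) \<in> ?L" by (rule imageI)
   then show "q \<in> ?L" using q c(1) by simp
  qed
 qed
qed

lemma U0_open: "openin (mtop M) U0"
proof -
 have "U0 = {p \<in> fst c. norm (snd c p - x0) < r} Int {p \<in> points M. f p < m * r\<^sup>2}"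
  using chart_sub[OF c(1)] by (auto simp: U0_def)
 then show ?thesis using openin_Int[OF chart_nbhd_open[OF c(1)] f_sublevel_open] by simp
qed

lemma U0_topspace: "q \<in> U0 ==> q \<in> points M"
 using openin_subset[OF U0_open] by (rule subsetD)

lemma U0I:
 assumes "q \<in> fst c" "norm (snd c q - x0) <= r" "f q < m * r\<^sup>2"
 shows "q \<in> U0"
proof -
 have "m * (norm (snd c q - x0))\<^sup>2 < m * r\<^sup>2" using f_lower[OF assms(1,2)] assms(3) by linarith
 then have "(norm (snd c q - x0))\<^sup>2 < r\<^sup>2" using m by simp
 then have "norm (snd c q - x0) < r" by (rule power2_less_imp_less) (use r in simp)
 then show ?thesis using assms by (simp add: U0_def)
qed

text \<open>To leave \<open>U0\<close> a curve would have to cross the sphere of radius \<open>r\<close>, where \<open>f\<close> is at least \<open>m r\<^sup>2\<close>.\<close>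

lemma stay_in_U0:
 assumes \<gamma>: "continuous_map euclideanreal (mtop M) \<gamma>" and 0: "\<gamma> 0 \<in> U0"
  and small: "!!s. 0 <= s ==> s <= T ==> f (\<gamma> s) < m * r\<^sup>2" and s: "0 <= s" "s <= T"
 shows "\<gamma> s \<in> U0"
proof (rule time_interval_induct[OF \<gamma> U0_open _ s])
 fix s :: real assume s: "0 <= s" "s <= T" and IH: "!!r. 0 <= r ==> r < s ==> \<gamma> r \<in> U0"
 show "\<gamma> s \<in> U0"
 proof (cases "s = 0")
  case False
  define S where "S = {u. \<gamma> u \<in> chart_inv c ` (cball x0 r Int span B)}"
  have "closed S"
   using closedin_continuous_map_preimage[OF \<gamma> inverse_ball(2)[OF order_refl]] by (simp add: S_def)
  moreover have "{0..<s} \<subseteq> S"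
   unfolding S_def inverse_ball(1)[OF order_refl] using IH by (auto simp: U0_def intro: less_imp_le)
  ultimately have "closure {0..<s} \<subseteq> S" by (rule closure_minimal[rotated])
  moreover have "s \<in> closure {0..<s}" using s(1) False by simp
  ultimately have "s \<in> S" by (rule subsetD)
  then have "\<gamma> s \<in> fst c" "norm (snd c (\<gamma> s) - x0) <= r" unfolding S_def inverse_ball(1)[OF order_refl] by simp_all
  then show ?thesis using small[OF s] by (rule U0I)
 qed (use 0 in simp)
qed

lemma flow_line_continuous:
 assumes "p \<in> points M"
 shows "continuous_map euclideanreal (mtop M) (%s. flow (a * s) p)"
proof -
 have "continuous_map euclideanreal euclideanreal (%s::real. a * s)" by (auto intro!: continuous_intros)
 from continuous_map_compose[OF this integral_curve_continuous[OF flow_curve(1)[OF assms]]]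
 show ?thesis by (simp add: o_def)
qed

lemma U0_backward:
 assumes q: "q \<in> U0" and t: "t \<ge> 0"
 shows "flow (- t) q \<in> U0"
proof -
 note qt = U0_topspace[OF q]
 have "flow (- 1 * t) q \<in> U0"
 proof (rule stay_in_U0[OF flow_line_continuous[OF qt] _ _ t order_refl])
  show "flow (- 1 * 0) q \<in> U0" using q flow_curve(2)[OF qt] by simp
  fix s :: real assume "0 <= s"
  then have "exp (2 * (- 1 * s)) <= 1" by simp
  then have "f (flow (- 1 * s) q) <= f q"
   unfolding f_flow[OF qt] using mult_right_mono[OF _ f_nonneg[OF qt], of _ 1] by simp
  then show "f (flow (- 1 * s) q) < m * r\<^sup>2" using q by (simp add: U0_def)
 qed
 then show ?thesis by simp
qed

text \<open>Openness of the basin is clear. If \<open>q\<close> is in its closure, flow the neighbourhood where \<open>f < f q + 1\<close> back until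
\<open>f\<close> is small: its points in the basin end up in a compact ball in the chart, hence so does \<open>q\<close>.\<close>

lemma basin:
 assumes q: "q \<in> points M"
 obtains t where "t \<ge> 0" "flow (- t) q \<in> U0"
proof -
 define W where "W = {p \<in> points M. \<exists>t\<ge>0. flow (- t) p \<in> U0}"
 have opW: "openin (mtop M) W"
 proof -
  have "W = (\<Union>t\<in>{0..}. {p \<in> points M. flow (- t) p \<in> U0})" by (auto simp: W_def)
  then show ?thesis using openin_continuous_map_preimage[OF flow_continuous U0_open] by auto
 qed
 have "openin (mtop M) (points M - W)"
 proof (subst openin_subopen, intro ballI)
  fix q assume q: "q \<in> points M - W"
  define k where "k = m * (r / 2)\<^sup>2"
  have k: "k > 0" "k < m * r\<^sup>2" using m r by (simp_all add: k_def power_divide)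
  define a where "a = f q + 1"
  have a: "a > 0" using f_nonneg[of q] q by (simp add: a_def)
  define T where "T = a / k"
  have T: "T \<ge> 0" using a k by (simp add: T_def)
  have "a * exp (- 2 * T) < k"
  proof -
   have "T < exp (2 * T)" using exp_ge_add_one_self[of "2 * T"] T by linarith
   then have "a < k * exp (2 * T)" using k(1) by (simp add: T_def field_simps)
   then have "a * exp (- 2 * T) < k * exp (2 * T) * exp (- 2 * T)" by simp
   also have "... = k" by (simp add: exp_add[symmetric] mult.assoc)
   finally show ?thesis .
  qed
  then have drop: "f (flow (- T) p) < k" if "p \<in> points M" "f p < a" for p
  proof -
   have "f (flow (- T) p) = exp (- 2 * T) * f p" using f_flow[OF that(1), of "- T"] by simp
   also have "... <= exp (- 2 * T) * a" by (rule mult_left_mono) (use that(2) in simp_all)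
   also have "... < k" using \<open>a * exp (- 2 * T) < k\<close> by (subst mult.commute)
   finally show ?thesis .
  qed
  define C where "C = chart_inv c ` (cball x0 (r / 2) Int span B)"
  have Ceq: "C = {q \<in> fst c. norm (snd c q - x0) <= r / 2}" and clC: "closedin (mtop M) C"
   unfolding C_def using inverse_ball[of "r / 2"] r(1) by simp_all
  define N where "N = {p \<in> points M. f p < a} Int {p \<in> points M. flow (- T) p \<in> points M - C}"
  have opN: "openin (mtop M) N" unfolding N_def
   by (intro openin_Int f_sublevel_open openin_continuous_map_preimage[OF flow_continuous] openin_diff openin_topspace clC)
  have qN: "q \<in> N"
  proof (rule ccontr)
   assume "q \<notin> N"
   then have fC: "flow (- T) q \<in> C" using q by (simp add: N_def a_def)
   have "flow (- T) q \<in> U0"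
    by (rule U0I) (use fC r(1) drop[of q] k(2) q in \<open>auto simp: Ceq a_def\<close>)
   then show False using q T by (auto simp: W_def)
  qed
  have "N \<subseteq> points M - W"
  proof
   fix w assume w: "w \<in> N"
   then have wt: "w \<in> points M" and wa: "f w < a" and wC: "flow (- T) w \<notin> C" by (simp_all add: N_def)
   have "w \<notin> W"
   proof
    assume "w \<in> W"
    then obtain t where t: "t \<ge> 0" "flow (- t) w \<in> U0" by (auto simp: W_def)
    have u: "flow (- T) w \<in> U0"
    proof (cases "t <= T")
     case True
     have "flow (- (T - t)) (flow (- t) w) \<in> U0" by (rule U0_backward[OF t(2)]) (use True in simp)
     then show ?thesis by (simp add: flow_add[OF wt])
    next
     case False
     note vt = U0_topspace[OF t(2)]
     have "flow (1 * (t - T)) (flow (- t) w) \<in> U0"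
     proof (rule stay_in_U0[OF flow_line_continuous[OF vt] _ _ _ order_refl])
      show "flow (1 * 0) (flow (- t) w) \<in> U0" using t(2) flow_curve(2)[OF vt] by simp
      fix s :: real assume s: "0 <= s" "s <= t - T"
      have "flow (1 * s) (flow (- t) w) = flow (s - t) w" by (simp add: flow_add[OF wt])
      then have "f (flow (1 * s) (flow (- t) w)) = exp (2 * (s - t)) * f w" by (simp add: f_flow[OF wt])
      also have "... <= exp (2 * - T) * f w"
       using s(2) f_nonneg[OF wt] by (intro mult_right_mono) simp_all
      also have "... = f (flow (- T) w)" by (rule f_flow[OF wt, symmetric])
      also have "... < m * r\<^sup>2" using drop[OF wt wa] k(2) by simp
      finally show "f (flow (1 * s) (flow (- t) w)) < m * r\<^sup>2" .
     qed (use False in simp)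
     then show ?thesis by (simp add: flow_add[OF wt])
    qed
    then have uc: "flow (- T) w \<in> fst c" "norm (snd c (flow (- T) w) - x0) <= r" by (simp_all add: U0_def)
    have "m * (norm (snd c (flow (- T) w) - x0))\<^sup>2 <= m * (r / 2)\<^sup>2"
     using f_lower[OF uc] drop[OF wt wa] by (simp add: k_def)
    then have "(norm (snd c (flow (- T) w) - x0))\<^sup>2 <= (r / 2)\<^sup>2" using m by simp
    then have "norm (snd c (flow (- T) w) - x0) <= r / 2" by (rule power2_le_imp_le) (use r in simp)
    then show False using wC uc(1) by (simp add: Ceq)
   qed
   then show "w \<in> points M - W" using wt by simp
  qed
  then show "\<exists>T. openin (mtop M) T & q \<in> T & T \<subseteq> points M - W" using opN qN by (intro exI conjI)
 qed
 then have clW: "closedin (mtop M) W" using openin_subset[OF opW] by (simp add: closedin_def)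
 have "p0 \<in> U0" using c(2) p0(3) m r(1) by (simp add: U0_def x0_def)
 then have "p0 \<in> W" using p0(1) flow_curve(2)[OF p0(1)] by (auto simp: W_def intro!: exI[of _ 0])
 moreover have "connected_space (mtop M)" using mfd by (simp add: smooth_manifold_def)
 ultimately have "W = points M" using opW clW unfolding connected_space_clopen_in by blast
 then show ?thesis using q that by (auto simp: W_def)
qed

definition V :: "'e set" where
 "V = snd c ` (fst c Int U0)"

lemma V_open: "open_in B V"
 unfolding V_def by (rule open_chart_image[OF c(1) U0_open])

lemma V_in:
 assumes "x \<in> V"
 shows "x \<in> snd c ` fst c" "x \<in> span B" "chart_inv c x \<in> U0"
proof -
 obtain q where q: "q \<in> fst c" "q \<in> U0" "x = snd c q" using assms by (auto simp: V_def)
 show 1: "x \<in> snd c ` fst c" unfolding q(3) by (rule imageI[OF q(1)])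
 show "x \<in> span B" by (rule subsetD[OF chart_image_span[OF c(1)] 1])
 show "chart_inv c x \<in> U0" using q c(1) by simp
qed

lemma snd_U0: "q \<in> U0 ==> snd c q \<in> V" "q \<in> U0 ==> q \<in> fst c"
 by (auto simp: V_def U0_def)

definition W :: "'e set" where
 "W = proj_span B -` (ball 0 \<rho> Int span B)"

definition K :: "'e set" where
 "K = cball 0 r Int span B"

lemma W_open: "open W"
 unfolding W_def Int_commute[of "ball 0 \<rho>"] by (intro open_vimage_proj_span openin_open_Int open_ball)

lemma K: "compact K" "convex K" "K \<subseteq> W"
proof -
 show "compact K" unfolding K_def by (intro compact_Int_closed compact_cball closed_span)
 show "convex K" unfolding K_def by (intro convex_Int convex_cball subspace_imp_convex subspace_span)
 show "K \<subseteq> W" unfolding K_def W_def using r(2) by (auto simp: proj_span_id[OF B_Basis])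
qed

text \<open>In coordinates centred at the zero, \<open>X = w + \<Sum> w\<^sub>b w\<^sub>d h\<^sub>b\<^sub>d w\<close> by two applications of Hadamard's lemma. With
\<open>w = (1 - t) z\<close> a factor \<open>(1 - t)\<^sup>2\<close> splits off.\<close>

lemma blow_up_field:
 obtains \<phi> :: "real \<times> 'e \<times> 'e => 'e"
 where "smooth_on (sdirs B) ({0..1} \<times> V \<times> W) \<phi>"
  "!!t x z. t \<in> {0..1} ==> z \<in> K ==>
    X c (x0 + (1 - t) *\<^sub>R z) = (1 - t) *\<^sub>R z - ((1 - t) * (1 - t)) *\<^sub>R \<phi> (t, x, z)"
proof -
 define D where "D = ball 0 \<rho> Int span B"
 have D: "open_in B D"
  unfolding D_def Int_commute[of "ball 0 \<rho>"] by (intro openin_open_Int open_ball)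
 note oD = open_along_openin[OF D]
 have D0: "0 \<in> D" using r by (simp add: D_def span_zero)
 define R where "R w = X c (x0 + w) - w" for w
 have inD: "x0 + w \<in> snd c ` fst c" if "w \<in> D" for w
  by (rule subsetD[OF ball_image]) (use that x0(2) in \<open>auto simp: D_def x0_def dist_norm intro: span_add\<close>)
 have sh: "smooth_on B D (%w. x0 + w)" by (intro smooth_on_add smooth_on_id smooth_on_const oD)
 have R: "smooth_on B D R" unfolding R_def
  by (rule smooth_on_diff[OF oD smooth_on_compose_span[OF B_Basis B_Basis oD chart_image_open[OF c(1)] inD sh X_smooth[OF c(1)]] smooth_on_id[OF oD]])
 have R0: "R 0 = 0" using zero by (simp add: R_def x0_def)
 have dR: "dir_deriv R 0 b = 0" if b: "b \<in> B" for b
 proof (rule dir_deriv_eqI)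
  have "((%t. X c (x0 + t *\<^sub>R b)) has_vector_derivative b) (at 0)"
   using dX(1)[OF c(1) x0(1) span_base[OF b]] X_derivative_at_zero[OF c(1) x0(1) _ span_base[OF b]] zero
   by (simp add: x0_def)
  moreover have "((%t. t *\<^sub>R b) has_vector_derivative b) (at (0::real))"
   by (auto intro!: derivative_eq_intros)
  ultimately have "((%t. X c (x0 + t *\<^sub>R b) - t *\<^sub>R b) has_vector_derivative b - b) (at 0)"
   by (rule has_vector_derivative_diff)
  then show "((%t. R (0 + t *\<^sub>R b)) has_vector_derivative 0) (at 0)" by (simp add: R_def)
 qed
 have \<rho>: "\<rho> > 0" using r by simp
 have factor: "\<exists>h. (\<forall>d\<in>B. smooth_on B D (h d)) & (\<forall>w\<in>D. G w = (\<Sum>d\<in>B. (w \<bullet> d) *\<^sub>R h d w)) &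
   (\<forall>d\<in>B. h d 0 = dir_deriv G 0 d)" if G: "smooth_on B D G" "G 0 = 0" for G :: "'e => 'e"
 proof (rule hadamard[OF B_Basis G(1)[unfolded D_def] \<rho>, folded D_def])
  fix h assume "!!d. d \<in> B ==> smooth_on B D (h d)"
   "!!w. w \<in> D ==> G w = G 0 + (\<Sum>d\<in>B. (w \<bullet> d) *\<^sub>R h d w)" "!!d. d \<in> B ==> h d 0 = dir_deriv G 0 d"
  then show ?thesis using G(2) by (intro exI[of _ h] conjI ballI) simp_all
 qed
 from factor[OF R R0] obtain H where H: "!!b. b \<in> B ==> smooth_on B D (H b)"
   "!!w. w \<in> D ==> R w = (\<Sum>b\<in>B. (w \<bullet> b) *\<^sub>R H b w)" "!!b. b \<in> B ==> H b 0 = dir_deriv R 0 b"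
  by metis
 have "\<forall>b\<in>B. \<exists>h. (\<forall>d\<in>B. smooth_on B D (h d)) & (\<forall>w\<in>D. H b w = (\<Sum>d\<in>B. (w \<bullet> d) *\<^sub>R h d w)) &
   (\<forall>d\<in>B. h d 0 = dir_deriv (H b) 0 d)"
  using factor H(1,3) dR by simp
 from bchoice[OF this] obtain h where h: "!!b d. b \<in> B ==> d \<in> B ==> smooth_on B D (h b d)"
   "!!b w. b \<in> B ==> w \<in> D ==> H b w = (\<Sum>d\<in>B. (w \<bullet> d) *\<^sub>R h b d w)" by metis
 define \<phi> :: "real \<times> 'e \<times> 'e => 'e" where
  "\<phi> p = - (\<Sum>b\<in>B. \<Sum>d\<in>B. ((snd (snd p) \<bullet> b) * (snd (snd p) \<bullet> d)) *\<^sub>R h b d ((1 - fst p) *\<^sub>R proj_span B (snd (snd p))))" for p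
 let ?S = "{0..1::real} \<times> V \<times> W"
 have oS: "open_along (sdirs B) ?S" by (rule open_along_sdirs[OF open_along_openin[OF V_open] W_open])
 have lin: "bounded_linear (%p::real \<times> 'e \<times> 'e. snd (snd p))"
  by (intro bounded_linear_compose[OF bounded_linear_snd bounded_linear_snd, unfolded o_def])
 have \<theta>: "smooth_on (sdirs B) ?S (%p. (1 - fst p) *\<^sub>R proj_span B (snd (snd p)))"
  by (intro smooth_on_bilinear[OF bounded_bilinear_scaleR] smooth_on_diff smooth_on_const oS
    smooth_on_bounded_linear[OF oS] bounded_linear_fst bounded_linear_compose[OF bounded_linear_proj_span] lin)
 have \<theta>D: "(1 - t) *\<^sub>R z \<in> D" if "t \<in> {0..1}" "z \<in> ball 0 \<rho> Int span B" for t z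
 proof -
  have "\<bar>1 - t\<bar> * norm z <= 1 * norm z" using that(1) by (intro mult_right_mono) auto
  then show ?thesis using that(2) by (simp add: D_def span_scale)
 qed
 have co: "smooth_on (sdirs B) ?S (%p. snd (snd p) \<bullet> b)" for b
  by (intro smooth_on_bounded_linear[OF oS] bounded_linear_compose[OF bounded_linear_inner_left] lin)
 show ?thesis
 proof (rule that)
  show "smooth_on (sdirs B) ?S \<phi>"
   unfolding \<phi>_def
  proof (intro smooth_on_minus smooth_on_sum oS smooth_on_bilinear[OF bounded_bilinear_scaleR]
    smooth_on_bilinear[OF bounded_bilinear_mult] co)
   fix b d assume "b \<in> B" "d \<in> B"
   show "smooth_on (sdirs B) ?S (%p. h b d ((1 - fst p) *\<^sub>R proj_span B (snd (snd p))))"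
    by (rule smooth_on_compose_span[OF sdirs_Basis[OF B_Basis] B_Basis oS D _ \<theta> h(1)[OF \<open>b \<in> B\<close> \<open>d \<in> B\<close>]])
     (use \<theta>D in \<open>auto simp: W_def\<close>)
  qed
  fix t :: real and x z assume t: "t \<in> {0..1}" and z: "z \<in> K"
  then have zB: "z \<in> ball 0 \<rho> Int span B" using r(2) by (auto simp: K_def)
  let ?w = "(1 - t) *\<^sub>R z"
  note w = \<theta>D[OF t zB]
  have "R ?w = (\<Sum>b\<in>B. (?w \<bullet> b) *\<^sub>R (\<Sum>d\<in>B. (?w \<bullet> d) *\<^sub>R h b d ?w))"
   unfolding H(2)[OF w] using h(2)[OF _ w] by simp
  also have "... = ((1 - t) * (1 - t)) *\<^sub>R (\<Sum>b\<in>B. \<Sum>d\<in>B. ((z \<bullet> b) * (z \<bullet> d)) *\<^sub>R h b d ?w)"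
   by (simp add: scaleR_sum_right mult.assoc mult.left_commute)
  also have "... = - (((1 - t) * (1 - t)) *\<^sub>R \<phi> (t, x, z))"
   using zB by (simp add: \<phi>_def proj_span_id[OF B_Basis])
  finally show "X c (x0 + ?w) = ?w - ((1 - t) * (1 - t)) *\<^sub>R \<phi> (t, x, z)" by (simp add: R_def algebra_simps)
 qed
qed

end

section \<open>Linearization at a zero\<close>

lemma smooth_dir_deriv_in_span:
 fixes j :: "'d::euclidean_space => 'c::euclidean_space"
 assumes "D \<subseteq> Basis" "open_along D T" "smooth_on D T j" "C \<subseteq> Basis" "!!y. y \<in> T ==> j y \<in> span C"
  and "y \<in> T" "v \<in> span D"
 shows "dir_deriv j y v \<in> span C"
proof -
 have 1: "Ck_on 1 C (span C) (%x. 0::real)" by simp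
 have 2: "open_in C (span C)" by simp
 have 3: "j ` T \<subseteq> span C" using assms(5) by (rule image_subsetI)
 show ?thesis by (rule dir_deriv_chain(1)[OF assms(4) 2 1 assms(1,2) smooth_on_Ck[OF assms(3)] 3 assms(6,7)])
qed

context vanishing_ctx
begin

text \<open>The time is \<open>t = 1 - s\<close>, so that the equation runs over \<open>{0..1}\<close> towards the singular end \<open>s = 0\<close>. The bound on \<open>f\<close>,
which scales like \<open>s\<^sup>2\<close>, keeps the rescaled curve in \<open>K\<close>.\<close>

lemma blow_up_curve_ode:
 fixes \<phi> :: "real \<times> 'e \<times> 'e => 'e"
 assumes \<phi>: "!!t x z. t \<in> {0..1} ==> z \<in> K ==>
    X c (x0 + (1 - t) *\<^sub>R z) = (1 - t) *\<^sub>R z - ((1 - t) * (1 - t)) *\<^sub>R \<phi> (t, x, z)"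
  and x: "x \<in> V" and t: "t \<in> {0..<1}"
 defines "k \<equiv> %t. (snd c (flow (ln (1 - t)) (chart_inv c x)) - x0) /\<^sub>R (1 - t)"
 shows "k t \<in> K" and "(k has_vector_derivative \<phi> (t, x, k t)) (at t)"
proof -
 define q where "q = chart_inv c x"
 have "q \<in> U0" unfolding q_def by (rule V_in(3)[OF x])
 then have q: "q \<in> U0" "q \<in> points M" by (assumption, rule U0_topspace)
 define a where "a = 1 - t"
 define i where "i = inverse a"
 have a: "a > 0" "a <= 1" and ia: "i * a = 1" using t by (auto simp: a_def i_def)
 define P where "P = flow (ln a) q"
 have "flow (- (- ln a)) q \<in> U0" by (rule U0_backward[OF q(1)]) (use a in simp)
 then have P: "P \<in> U0" by (simp add: P_def)
 have Pc: "P \<in> fst c" "norm (snd c P - x0) <= r" using P by (simp_all add: U0_def)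
 have kt: "k t = i *\<^sub>R (snd c P - x0)" by (simp add: k_def P_def a_def i_def q_def)
 have dP: "snd c P - x0 = a *\<^sub>R k t" using ia by (simp add: kt mult.commute)
 show kK: "k t \<in> K"
 proof -
  have e: "exp (2 * ln a) = a * a" using a(1) by (simp add: exp_double power2_eq_square)
  have "m * (norm (snd c P - x0))\<^sup>2 <= f P" by (rule f_lower[OF Pc])
  also have "... = (a * a) * f q" unfolding P_def e[symmetric] by (rule f_flow[OF q(2)])
  also have "... <= (a * a) * (m * r\<^sup>2)" using q(1) by (intro mult_left_mono) (simp_all add: U0_def)
  finally have "m * (norm (snd c P - x0))\<^sup>2 <= m * (a * r)\<^sup>2" by (simp add: power2_eq_square algebra_simps)
  then have "(norm (snd c P - x0))\<^sup>2 <= (a * r)\<^sup>2" using m by simp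
  then have "norm (snd c P - x0) <= a * r" by (rule power2_le_imp_le) (use a r in simp)
  then have "norm (k t) <= r" unfolding dP using a(1) by simp
  moreover have "snd c P \<in> span B" by (rule subsetD[OF chart_image_span[OF c(1)] imageI[OF Pc(1)]])
  ultimately show ?thesis unfolding K_def using span_scale[OF span_diff[OF _ x0(2)]] by (simp add: kt)
 qed
 have XP: "X c (snd c P) = a *\<^sub>R k t - (a * a) *\<^sub>R \<phi> (t, x, k t)"
 proof -
  have "snd c P = x0 + a *\<^sub>R k t" using dP by (simp add: algebra_simps)
  then show ?thesis using \<phi>[of t "k t" x] kK t by (simp add: a_def)
 qed
 have 1: "((%t. ln (1 - t)) has_vector_derivative - i) (at t)"
  unfolding has_real_derivative_iff_has_vector_derivative[symmetric]
  using a(1) by (auto intro!: derivative_eq_intros simp: a_def i_def divide_inverse)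
 have "((%\<tau>. snd c (flow \<tau> q)) has_vector_derivative X c (snd c P)) (at (ln (1 - t)))"
  using flow_chart_derivative[OF q(2) c(1), of "ln (1 - t)"] Pc(1) by (simp add: P_def a_def)
 from has_vector_derivative_diff[OF vector_diff_chain_at[OF 1 this] has_vector_derivative_const[of x0]]
 have 2: "((%t. snd c (flow (ln (1 - t)) q) - x0) has_vector_derivative (- i) *\<^sub>R X c (snd c P)) (at t)"
  by (simp add: o_def)
 have 3: "((%t. inverse (1 - t)) has_real_derivative i * i) (at t)"
  using a(1) by (auto intro!: derivative_eq_intros simp: a_def i_def)
 have "(k has_vector_derivative i *\<^sub>R ((- i) *\<^sub>R X c (snd c P)) + (i * i) *\<^sub>R (snd c P - x0)) (at t)"
  using has_vector_derivative_scaleR[OF 3 2] unfolding k_def P_def a_def i_def q_def by simp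
 also have "i *\<^sub>R ((- i) *\<^sub>R X c (snd c P)) + (i * i) *\<^sub>R (snd c P - x0) = (i * a * (i * a)) *\<^sub>R \<phi> (t, x, k t)"
  unfolding XP dP by (simp add: algebra_simps)
 finally show "(k has_vector_derivative \<phi> (t, x, k t)) (at t)" unfolding ia by simp
qed

lemma blow_up:
 obtains Z :: "real \<times> 'e => 'e"
 where "smooth_on (pdirs B) ({0..1} \<times> V) Z" "!!t x. t \<in> {0..1} ==> x \<in> V ==> Z (t, x) \<in> K"
  "!!t x. t \<in> {0..<1} ==> x \<in> V ==> snd c (flow (ln (1 - t)) (chart_inv c x)) = x0 + (1 - t) *\<^sub>R Z (t, x)"
proof -
 obtain \<phi> :: "real \<times> 'e \<times> 'e => 'e" where \<phi>: "smooth_on (sdirs B) ({0..1} \<times> V \<times> W) \<phi>"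
  "!!t x z. t \<in> {0..1} ==> z \<in> K ==>
    X c (x0 + (1 - t) *\<^sub>R z) = (1 - t) *\<^sub>R z - ((1 - t) * (1 - t)) *\<^sub>R \<phi> (t, x, z)"
  by (rule blow_up_field[OF that]) blast+
 define k where "k x t = (snd c (flow (ln (1 - t)) (chart_inv c x)) - x0) /\<^sub>R (1 - t)" for x t
 have ode: "k x t \<in> K" "(k x has_vector_derivative \<phi> (t, x, k x t)) (at t)"
  if "x \<in> V" "t \<in> {0..<1}" for x t
  unfolding k_def
  by (rule blow_up_curve_ode(1)[where \<phi> = \<phi>, OF _ that] blow_up_curve_ode(2)[where \<phi> = \<phi>, OF _ that], rule \<phi>(2), assumption+)+
 have "\<forall>x\<in>V. \<exists>n. (\<forall>t\<in>{0..<1}. n t = k x t) & (\<forall>t\<in>{0..1}. n t \<in> K) &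
   (\<forall>t\<in>{0..1}. (n has_vector_derivative \<phi> (t, x, n t)) (at t within {0..1}))"
 proof
  fix x assume x: "x \<in> V"
  have cont: "continuous_on ({0..1} \<times> K) (%p. \<phi> (fst p, x, snd p))"
   by (rule continuous_on_compose2[OF Ck_on_continuous[OF smooth_on_Ck[OF \<phi>(1)]]])
    (use K(3) x in \<open>auto intro!: continuous_intros\<close>)
  have od: "(k x has_vector_derivative (%p. \<phi> (fst p, x, snd p)) (t, k x t)) (at t within {0..<1})"
   if "t \<in> {0..<1}" for t
   unfolding fst_conv snd_conv by (rule has_vector_derivative_at_within[OF ode(2)[OF x that]])
  show "\<exists>n. (\<forall>t\<in>{0..<1}. n t = k x t) & (\<forall>t\<in>{0..1}. n t \<in> K) &
   (\<forall>t\<in>{0..1}. (n has_vector_derivative \<phi> (t, x, n t)) (at t within {0..1}))"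
  proof (rule ODE_extend_endpoint[OF cont K(1) ode(1)[OF x] od])
   fix n assume "!!t. t \<in> {0..<1} ==> n t = k x t" "!!t. t \<in> {0..1} ==> n t \<in> K"
    "!!t. t \<in> {0..1} ==> (n has_vector_derivative (%p. \<phi> (fst p, x, snd p)) (t, n t)) (at t within {0..1})"
   then show ?thesis unfolding fst_conv snd_conv by (intro exI[of _ n] conjI ballI)
  qed
 qed
 from bchoice[OF this] obtain n where n: "!!x t. x \<in> V ==> t \<in> {0..<1} ==> n x t = k x t"
   "!!x t. x \<in> V ==> t \<in> {0..1} ==> n x t \<in> K"
   "!!x t. x \<in> V ==> t \<in> {0..1} ==> (n x has_vector_derivative \<phi> (t, x, n x t)) (at t within {0..1})"
  by metis
 define Z where "Z p = n (snd p) (fst p)" for p :: "real \<times> 'e"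
 note oV = open_along_openin[OF V_open]
 show ?thesis
 proof (rule that)
  show ZK: "Z (t, x) \<in> K" if "t \<in> {0..1}" "x \<in> V" for t x using n(2)[OF that(2,1)] by (simp add: Z_def)
  have ode': "((%t. Z (t, x)) has_vector_derivative \<phi> (t, x, Z (t, x))) (at t within {0..1})"
   if "t \<in> {0..1}" "x \<in> V" for t x using n(3)[OF that(2,1)] by (simp add: Z_def)
  have init: "smooth_on B V (%x. Z (0, x))"
  proof (rule smooth_on_cong[OF oV])
   show "smooth_on B V (%x. x - x0)" by (intro smooth_on_diff smooth_on_id smooth_on_const oV)
   fix x assume x: "x \<in> V"
   have "Z (0, x) = k x 0" using n(1)[OF x, of 0] by (simp add: Z_def)
   also have "... = x - x0"
    using flow_curve(2)[OF U0_topspace[OF V_in(3)[OF x]]] V_in(1)[OF x] by (simp add: k_def)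
   finally show "x - x0 = Z (0, x)" ..
  qed
  show "smooth_on (pdirs B) ({0..1} \<times> V) Z"
   by (rule ODE_solution_smooth[OF B_Basis V_open W_open \<phi>(1) K ZK ode' init])
  fix t :: real and x assume "t \<in> {0..<1}" "x \<in> V"
  then have "Z (t, x) = k x t" "1 - t ~= 0" using n(1) by (auto simp: Z_def)
  then show "snd c (flow (ln (1 - t)) (chart_inv c x)) = x0 + (1 - t) *\<^sub>R Z (t, x)" by (simp add: k_def)
 qed
qed

text \<open>The linearization of the flow at the zero, \<open>lim exp t *\<^sub>R (flow (- t) q - p0)\<close> in the chart.\<close>

definition H :: "'a => 'e" where
 "H q = Lim at_top (%t. exp t *\<^sub>R (snd c (flow (- t) q) - x0))"

lemma H_eq:
 assumes "((%t. exp t *\<^sub>R (snd c (flow (- t) q) - x0)) \<longlongrightarrow> l) at_top"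
 shows "H q = l"
 unfolding H_def by (rule tendsto_Lim[OF _ assms]) simp

lemma H_linearizes:
 shows "smooth_on B V (%x. H (chart_inv c x))"
  and "x \<in> V ==> H (chart_inv c x) \<in> span B"
  and "x \<in> V ==> ((%t. exp t *\<^sub>R (snd c (flow (- t) (chart_inv c x)) - x0)) \<longlongrightarrow> H (chart_inv c x)) at_top"
  and "x \<in> V ==> v \<in> span B ==> w \<in> span B ==>
   gc c x0 (dir_deriv (%x. H (chart_inv c x)) x v) (dir_deriv (%x. H (chart_inv c x)) x w) = gc c x v w"
proof -
 obtain Z :: "real \<times> 'e => 'e" where Z: "smooth_on (pdirs B) ({0..1} \<times> V) Z"
  "!!t x. t \<in> {0..1} ==> x \<in> V ==> Z (t, x) \<in> K"
  "!!t x. t \<in> {0..<1} ==> x \<in> V ==> snd c (flow (ln (1 - t)) (chart_inv c x)) = x0 + (1 - t) *\<^sub>R Z (t, x)"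
  by (rule blow_up[OF that]) blast+
 note oV = open_along_openin[OF V_open]
 note oP = open_along_pdirs[OF oV]
 have at: "continuous_on {0..1} (%t. F (t, x))" if "continuous_on ({0..1} \<times> V) F" "x \<in> V"
  for F :: "real \<times> 'e => 'e" and x
  by (rule continuous_on_compose2[OF that(1)]) (use that(2) in \<open>auto intro!: continuous_intros\<close>)
 have cont: "continuous_on {0..1} (%t. Z (t, x))" if "x \<in> V" for x
  by (rule at[OF Ck_on_continuous[OF smooth_on_Ck[OF Z(1)]] that])
 have lim: "((%t. exp t *\<^sub>R (snd c (flow (- t) (chart_inv c x)) - x0)) \<longlongrightarrow> Z (1, x)) at_top" if x: "x \<in> V" for x
 proof -
  have "((%t::real. exp (- t)) \<longlongrightarrow> (0::real)) at_top"
   by (rule filterlim_compose[OF exp_at_bot filterlim_uminus_at_bot_at_top])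
  from tendsto_diff[OF tendsto_const this, of 1] have g: "((%t::real. 1 - exp (- t)) \<longlongrightarrow> 1) at_top" by simp
  have "((%t. Z (1 - exp (- t), x)) \<longlongrightarrow> Z (1, x)) at_top"
  proof (rule continuous_on_tendsto_compose[OF cont[OF x] g])
   show "eventually (%t::real. 1 - exp (- t) \<in> {0..1}) at_top"
    using eventually_ge_at_top[of 0] by eventually_elim simp
  qed simp
  then show ?thesis
  proof (rule Lim_transform_eventually)
   show "eventually (%t. Z (1 - exp (- t), x) = exp t *\<^sub>R (snd c (flow (- t) (chart_inv c x)) - x0)) at_top"
    using eventually_ge_at_top[of 0]
   proof eventually_elim
    case (elim t)
    have "1 - exp (- t) \<in> {0..<1}" using elim by simp
    from Z(3)[OF this x]
    have e: "snd c (flow (- t) (chart_inv c x)) = x0 + exp (- t) *\<^sub>R Z (1 - exp (- t), x)" by simp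
    show ?case unfolding e by (simp add: mult_exp_exp)
   qed
  qed
 qed
 have h: "H (chart_inv c x) = Z (1, x)" if "x \<in> V" for x by (rule H_eq[OF lim[OF that]])
 have sm: "smooth_on B V (%x. Z (t, x))" if "t \<in> {0..1}" for t by (rule smooth_on_slice[OF B_Basis oV Z(1) that])
 show "smooth_on B V (%x. H (chart_inv c x))"
  by (rule smooth_on_cong[OF oV h[symmetric] sm]) simp_all
 assume x: "x \<in> V"
 show "((%t. exp t *\<^sub>R (snd c (flow (- t) (chart_inv c x)) - x0)) \<longlongrightarrow> H (chart_inv c x)) at_top"
  unfolding h[OF x] by (rule lim[OF x])
 show "H (chart_inv c x) \<in> span B" using Z(2)[of 1 x] x unfolding h[OF x] K_def by simp
 assume v: "v \<in> span B" and w: "w \<in> span B"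
 define D where "D v t = dir_deriv Z (t, x) (0, v)" for v t
 have D: "D v t = dir_deriv (%y. Z (t, y)) x v" for v t by (simp add: D_def dir_deriv_def)
 have ZB: "Z (t, y) \<in> span B" if "t \<in> {0..1}" "y \<in> V" for t y using Z(2)[OF that] by (simp add: K_def)
 have DB: "D v t \<in> span B" if "v \<in> span B" "t \<in> {0..1}" for v t
  unfolding D by (rule smooth_dir_deriv_in_span[OF B_Basis oV sm[OF that(2)] B_Basis ZB[OF that(2)] x that(1)])
 have Dc: "continuous_on {0..1} (D v)" if "v \<in> span B" for v
  unfolding D_def[abs_def]
  by (rule at[OF Ck_on_continuous[OF smooth_on_Ck[OF smooth_on_dir_deriv_span[OF pdirs_Basis[OF B_Basis] oP Z(1)]]] x])
   (simp add: span_pdirs that)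
 have inc: "x0 + (1 - t) *\<^sub>R Z (t, x) \<in> snd c ` fst c" if t: "t \<in> {0..1}" for t
 proof (rule subsetD[OF ball_sub])
  have "\<bar>1 - t\<bar> * norm (Z (t, x)) <= 1 * r"
   using t Z(2)[OF t x] by (intro mult_mono) (auto simp: K_def)
  then show "x0 + (1 - t) *\<^sub>R Z (t, x) \<in> cball x0 r Int span B"
   using x0(2) ZB[OF t x] by (auto simp: dist_norm intro: span_add span_scale)
 qed
 define E where "E t = gc c (x0 + (1 - t) *\<^sub>R Z (t, x)) (D v t) (D w t)" for t
 have Ec: "continuous_on {0..1} E"
  unfolding E_def[abs_def]
  by (rule gc_continuous[OF c(1) _ inc Dc[OF v] DB[OF v] Dc[OF w] DB[OF w]])
   (intro continuous_intros cont[OF x])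
 have E: "E t = gc c x v w" if t: "t \<in> {0..<1}" for t
 proof -
  define a where "a = 1 - t"
  have a: "a > 0" and t': "t \<in> {0..1}" using t by (auto simp: a_def)
  have e: "exp (2 * ln a) = a * a" using a by (simp add: exp_double power2_eq_square)
  let ?F = "%y. flow (ln a) (chart_inv c y)"
  have P: "plot M B V (chart_inv c)"
   by (rule plot_subset[OF plot_chart_inv[OF c(1)] V_open]) (use V_in(1) in auto)
  have F: "plot M B V ?F" by (rule flow_plot_fixed[OF P])
  have Fx: "snd c (?F y) = x0 + a *\<^sub>R Z (t, y)" if "y \<in> V" for y using Z(3)[OF t that] by (simp add: a_def)
  have "flow (- (- ln a)) (chart_inv c x) \<in> U0" by (rule U0_backward[OF V_in(3)[OF x]]) (use a t in \<open>simp add: a_def\<close>)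
  then have "c \<in> charts_at M (?F x)" using c(1) by (simp add: charts_at_iff U0_def)
  note ch = this
  have pu: "push M ?F x u c = a *\<^sub>R D u t" if u: "u \<in> span B" for u
  proof -
   have "push M ?F x u c = dir_deriv (snd c o ?F) x u" by (rule push_derivative(2)[OF F x u ch])
   also have "... = dir_deriv (%y. x0 + a *\<^sub>R Z (t, y)) x u"
    by (rule dir_deriv_cong[OF oV x u]) (simp add: Fx)
   also have "... = a *\<^sub>R D u t"
   proof (rule dir_deriv_eqI)
    have "((%h. Z (t, x + h *\<^sub>R u)) has_vector_derivative D u t) (at 0)"
     unfolding D by (rule C1_dir_deriv(1)[OF B_Basis oV smooth_on_Ck[OF sm[OF t']] x u])
    from has_vector_derivative_add[OF has_vector_derivative_const bounded_linear.has_vector_derivative[OF bounded_linear_scaleR_right this]]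
    show "((%h. x0 + a *\<^sub>R Z (t, x + h *\<^sub>R u)) has_vector_derivative a *\<^sub>R D u t) (at 0)" by simp
   qed
   finally show ?thesis .
  qed
  let ?y = "x0 + a *\<^sub>R Z (t, x)"
  have y: "?y \<in> snd c ` fst c" using inc[OF t'] by (simp add: a_def)
  have "gc c ?y (a *\<^sub>R D v t) (a *\<^sub>R D w t) = pb ?F x v w"
   unfolding pb_chart[OF F x v w ch] pu[OF v] pu[OF w] Fx[OF x] ..
  also have "... = exp (2 * ln a) * pb (chart_inv c) x v w" by (rule pb_flow[OF P x v w])
  also have "... = a * a * gc c x v w"
   unfolding gc_chart_inv[OF c(1) V_in(1)[OF x], symmetric] e ..
  finally have 1: "gc c ?y (a *\<^sub>R D v t) (a *\<^sub>R D w t) = a * a * gc c x v w" .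
  have "gc c ?y (a *\<^sub>R D v t) (a *\<^sub>R D w t) = a * a * gc c ?y (D v t) (D w t)"
   using gc_left[OF c(1) y DB[OF v t'] span_zero span_scale[OF DB[OF w t']], of a 0 a]
    gc_right[OF c(1) y DB[OF w t'] span_zero DB[OF v t'], of a 0] by simp
  then show ?thesis using 1 a by (simp add: E_def a_def)
 qed
 have "continuous_on (closure {0..<1}) E" using Ec by simp
 from continuous_constant_on_closure[OF this E, of 1]
 have "gc c x0 (D v 1) (D w 1) = gc c x v w" by (simp add: E_def)
 moreover have "dir_deriv (%x. H (chart_inv c x)) x u = D u 1" if "u \<in> span B" for u
  unfolding D by (rule dir_deriv_cong[OF oV x that h])
 ultimately show "gc c x0 (dir_deriv (%x. H (chart_inv c x)) x v) (dir_deriv (%x. H (chart_inv c x)) x w) = gc c x v w"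
  using v w by simp
qed

lemma H_limit_flow:
 assumes q: "q \<in> points M" and l: "((%t. exp t *\<^sub>R (snd c (flow (- t) q) - x0)) \<longlongrightarrow> l) at_top"
 shows "((%t. exp t *\<^sub>R (snd c (flow (- t) (flow \<tau> q)) - x0)) \<longlongrightarrow> exp \<tau> *\<^sub>R l) at_top"
proof -
 have "filterlim (%t. - \<tau> + t) at_top at_top"
  by (rule filterlim_tendsto_add_at_top[OF tendsto_const filterlim_ident])
 from tendsto_scaleR[OF tendsto_const filterlim_compose[OF l this], of "exp \<tau>"]
 show ?thesis by (simp add: flow_add[OF q] exp_add[symmetric] algebra_simps)
qed

lemma H_limit:
 assumes q: "q \<in> points M"
 shows "((%t. exp t *\<^sub>R (snd c (flow (- t) q) - x0)) \<longlongrightarrow> H q) at_top" and "H q \<in> span B"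
proof -
 obtain T where T: "flow (- T) q \<in> U0" by (rule basin[OF q])
 define x where "x = snd c (flow (- T) q)"
 have x: "x \<in> V" "chart_inv c x = flow (- T) q" using snd_U0[OF T] c(1) by (simp_all add: x_def)
 have qq: "flow T (flow (- T) q) = q" using flow_inverse[OF q, of "- T"] by simp
 note lim = H_limit_flow[OF U0_topspace[OF T] H_linearizes(3)[OF x(1), unfolded x(2)], of T, unfolded qq]
 then have "H q = exp T *\<^sub>R H (flow (- T) q)" by (rule H_eq)
 with lim show "((%t. exp t *\<^sub>R (snd c (flow (- t) q) - x0)) \<longlongrightarrow> H q) at_top" by simp
 show "H q \<in> span B" unfolding \<open>H q = _\<close> using span_scale[OF H_linearizes(2)[OF x(1)]] x(2) by simp
qed

lemma H_flow:
 assumes "q \<in> points M"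
 shows "H (flow \<tau> q) = exp \<tau> *\<^sub>R H q"
 by (rule H_eq[OF H_limit_flow[OF assms H_limit(1)[OF assms]]])

definition L :: "'e => 'e" where
 "L = (SOME L. linear L & (\<forall>v\<in>span B. L v \<in> span B) & (\<forall>v\<in>span B. \<forall>w\<in>span B. L v \<bullet> L w = gc c x0 v w))"

lemma L: "linear L" "v \<in> span B ==> L v \<in> span B" "v \<in> span B ==> w \<in> span B ==> L v \<bullet> L w = gc c x0 v w"
proof -
 define G where "G v w = gc c x0 (proj_span B v) (proj_span B w)" for v w
 have lp: "linear (proj_span B)" using bounded_linear_proj_span by (rule bounded_linear.linear)
 note gl = gc_left[OF c(1) x0(1) proj_span_in proj_span_in proj_span_in]
 note gr = gc_right[OF c(1) x0(1) proj_span_in proj_span_in proj_span_in]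
 have "G (u + v) w = G u w + G v w" "G w (u + v) = G w u + G w v" for u v w
  using gl[of 1 u 1 v w] gr[of w 1 u 1 v] unfolding G_def linear_add[OF lp] scaleR_one mult_1 .
 moreover have "G (a *\<^sub>R u) w = a * G u w" "G w (a *\<^sub>R u) = a * G w u" for a u w
  using gl[of a u 0 0 w] gr[of w a u 0 0]
  unfolding G_def linear_scale[OF lp] scaleR_zero_left mult_zero_left add_0_right .
 ultimately have "bilinear G"
  unfolding bilinear_def linear_iff real_scaleR_def by (intro allI conjI)
 moreover have "G v w = G w v" for v w unfolding G_def by (rule gc_sym[OF c(1) x0(1)]) (rule proj_span_in)+
 moreover have "G v v > 0" if "v \<in> span B" "v ~= 0" for v
  unfolding G_def proj_span_id[OF B_Basis that(1)] by (rule gc_pos[OF c(1) x0(1) that])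
 ultimately have "\<exists>L. linear L & (\<forall>v\<in>span B. L v \<in> span B) & (\<forall>v\<in>span B. \<forall>w\<in>span B. L v \<bullet> L w = G v w)"
  by (intro inner_product_isometry finite_Basis_subset[OF B_Basis] B_Basis)
 then have "\<exists>L. linear L & (\<forall>v\<in>span B. L v \<in> span B) & (\<forall>v\<in>span B. \<forall>w\<in>span B. L v \<bullet> L w = gc c x0 v w)"
  unfolding G_def by (simp add: proj_span_id[OF B_Basis])
 from someI_ex[OF this, folded L_def]
 show "linear L" "v \<in> span B ==> L v \<in> span B" "v \<in> span B ==> w \<in> span B ==> L v \<bullet> L w = gc c x0 v w"
  by simp_all
qed

definition \<Phi> :: "'a => 'e" where
 "\<Phi> q = L (H q)"

lemma \<Phi>_span: "q \<in> points M ==> \<Phi> q \<in> span B"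
 unfolding \<Phi>_def by (intro L H_limit)

lemma \<Phi>_flow: "q \<in> points M ==> \<Phi> (flow \<tau> q) = exp \<tau> *\<^sub>R \<Phi> q"
 unfolding \<Phi>_def by (simp add: H_flow linear_scale[OF L(1)])

text \<open>Flow back to the neighbourhood \<open>U0\<close>, where \<open>H\<close> is known; the factor \<open>exp T\<close> cancels against \<open>pb_flow\<close>.\<close>

lemma \<Phi>_local:
 fixes C :: "'d::euclidean_space set"
 assumes F: "plot M C S F" and x: "x \<in> S"
 shows "\<exists>S'. open_in C S' & x \<in> S' & S' \<subseteq> S & smooth_on C S' (%y. \<Phi> (F y)) &
  (\<forall>u\<in>span C. \<forall>v\<in>span C. dir_deriv (%y. \<Phi> (F y)) x u \<bullet> dir_deriv (%y. \<Phi> (F y)) x v = pb F x u v)"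
proof -
 obtain T where T: "flow (- T) (F x) \<in> U0" by (rule basin[OF plotD(5)[OF F x]])
 let ?G = "%y. flow (- T) (F y)" and ?h = "%x. H (chart_inv c x)"
 have G: "plot M C S ?G" by (rule flow_plot_fixed[OF F])
 define S' where "S' = {y \<in> S. ?G y \<in> U0}"
 have S': "open_in C S'" unfolding S'_def by (rule plot_preimage_open[OF G U0_open])
 note oS = open_along_openin[OF S'] and C = plotD(1)[OF F]
 have xS: "x \<in> S'" using x T by (simp add: S'_def)
 define j where "j y = snd c (?G y)" for y
 have jV: "j y \<in> V" and inv: "chart_inv c (j y) = ?G y" if "y \<in> S'" for y
  using that snd_U0 c(1) by (simp_all add: S'_def j_def)
 have j: "smooth_on C S' j"
  using smooth_on_subset[OF plotD(4)[OF G c(1)], of S'] snd_U0(2) by (auto simp: S'_def j_def[abs_def] o_def)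
 have sh: "smooth_on C S' (%y. ?h (j y))"
  by (rule smooth_on_compose_span[OF C B_Basis oS V_open jV j H_linearizes(1)])
 have bl: "bounded_linear (%v. exp T *\<^sub>R L v)"
  by (intro bounded_linear_compose[OF bounded_linear_scaleR_right] linear_conv_bounded_linear[THEN iffD1] L(1))
 have eq: "exp T *\<^sub>R L (?h (j y)) = \<Phi> (F y)" if y: "y \<in> S'" for y
 proof -
  have Fy: "F y \<in> points M" using plotD(5)[OF F] y by (simp add: S'_def)
  show ?thesis unfolding inv[OF y] H_flow[OF Fy] linear_scale[OF L(1)] \<Phi>_def by (simp add: exp_add[symmetric])
 qed
 have sm: "smooth_on C S' (%y. \<Phi> (F y))"
  by (rule smooth_on_cong[OF oS eq smooth_on_linear_compose[OF oS bl sh]])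
 have img: "j ` S' \<subseteq> V" using jV by (rule image_subsetI)
 note ch = dir_deriv_chain[OF B_Basis V_open smooth_on_Ck[OF H_linearizes(1)] C oS smooth_on_Ck[OF j] img xS]
 have der: "dir_deriv (%y. \<Phi> (F y)) x u = exp T *\<^sub>R L (dir_deriv ?h (j x) (dir_deriv j x u))"
  if u: "u \<in> span C" for u
 proof -
  have "dir_deriv (%y. \<Phi> (F y)) x u = dir_deriv (%y. exp T *\<^sub>R L (?h (j y))) x u"
   by (rule dir_deriv_cong[OF oS xS u eq[symmetric]])
  also have "... = exp T *\<^sub>R L (dir_deriv ?h (j x) (dir_deriv j x u))"
   by (rule dir_deriv_eqI) (rule bounded_linear.has_vector_derivative[OF bl ch(2)[OF u]])
  finally show ?thesis .
 qed
 have cc: "c \<in> charts_at M (?G x)" using snd_U0(2)[OF T] c(1) by (simp add: charts_at_iff)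
 have pu: "push M ?G x u c = dir_deriv j x u" if "u \<in> span C" for u
  using push_derivative(2)[OF G x that cc] by (simp add: j_def[abs_def] o_def)
 have "dir_deriv (%y. \<Phi> (F y)) x u \<bullet> dir_deriv (%y. \<Phi> (F y)) x v = pb F x u v"
  if u: "u \<in> span C" and v: "v \<in> span C" for u v
 proof -
  have B: "dir_deriv ?h (j x) w \<in> span B" if "w \<in> span B" for w
   by (rule smooth_dir_deriv_in_span[OF B_Basis open_along_openin[OF V_open] H_linearizes(1) B_Basis H_linearizes(2) jV[OF xS] that])
  have "dir_deriv (%y. \<Phi> (F y)) x u \<bullet> dir_deriv (%y. \<Phi> (F y)) x v
    = exp T * exp T * gc c x0 (dir_deriv ?h (j x) (dir_deriv j x u)) (dir_deriv ?h (j x) (dir_deriv j x v))"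
   unfolding der[OF u] der[OF v] using L(3)[OF B[OF ch(1)[OF u]] B[OF ch(1)[OF v]]] by simp
  also have "... = exp T * exp T * pb ?G x u v"
   unfolding H_linearizes(4)[OF jV[OF xS] ch(1)[OF u] ch(1)[OF v]] pb_chart[OF G x u v cc] pu[OF u] pu[OF v]
   by (simp add: j_def)
  also have "... = pb F x u v" unfolding pb_flow[OF F x u v] by (simp add: exp_add[symmetric] mult.assoc[symmetric])
  finally show ?thesis .
 qed
 moreover have "S' \<subseteq> S" by (auto simp: S'_def)
 ultimately show ?thesis using S' xS sm by (intro exI[of _ S'] conjI ballI)
qed

lemma \<Phi>_plot:
 assumes F: "plot M C S F"
 shows "smooth_on C S (%y. \<Phi> (F y))"
  and "x \<in> S ==> u \<in> span C ==> v \<in> span C ==>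
   dir_deriv (%y. \<Phi> (F y)) x u \<bullet> dir_deriv (%y. \<Phi> (F y)) x v = pb F x u v"
proof -
 show "smooth_on C S (%y. \<Phi> (F y))"
 proof (rule smooth_on_local)
  fix x assume x: "x \<in> S"
  obtain S' where S': "open_in C S'" "x \<in> S'" "S' \<subseteq> S" "smooth_on C S' (%y. \<Phi> (F y))"
   using \<Phi>_local[OF F x] by (elim exE conjE)
  obtain G where G: "open G" "S' = span C Int G" using S'(1) unfolding openin_open by (elim exE conjE)
  have "S Int G \<subseteq> S'" using plotD(6)[OF F] unfolding G(2) by blast
  then show "\<exists>G. open G & x \<in> G & smooth_on C (S Int G) (%y. \<Phi> (F y))"
   using G S'(2) smooth_on_subset[OF S'(4)] by (intro exI[of _ G]) auto
 qed
 assume x: "x \<in> S" and u: "u \<in> span C" and v: "v \<in> span C"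
 have "\<forall>u\<in>span C. \<forall>v\<in>span C. dir_deriv (%y. \<Phi> (F y)) x u \<bullet> dir_deriv (%y. \<Phi> (F y)) x v = pb F x u v"
  using \<Phi>_local[OF F x] by (elim exE conjE)
 from bspec[OF bspec[OF this u] v]
 show "dir_deriv (%y. \<Phi> (F y)) x u \<bullet> dir_deriv (%y. \<Phi> (F y)) x v = pb F x u v" .
qed

end

section \<open>The isometry with Euclidean space\<close>

lemma euclid_simps [simp]:
 "mtop (euclid B) = top_of_set (span B)" "coords (euclid B) = B" "atlas (euclid B) = {(span B, %x. x)}"
 by (simp_all add: euclid_def)

lemma euclid_chart_inv: "x \<in> span B ==> chart_inv (span B, %x. x) x = x"
 unfolding chart_inv_def fst_conv snd_conv by (rule inv_into_f_f) simp

lemma charts_at_euclid: "y \<in> span B ==> charts_at (euclid B) y = {(span B, %x. x)}"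
 by (auto simp: charts_at_def)

lemma chart_at_euclid: "y \<in> span B ==> chart_at (euclid B) y = (span B, %x. x)"
 by (simp add: chart_at_def charts_at_euclid)

lemma plot_euclid:
 assumes "C \<subseteq> Basis" "open_in C S" "smooth_on C S G" "!!x. x \<in> S ==> G x \<in> span B"
 shows "plot (euclid B) C S G"
proof -
 have "{x \<in> S. G x \<in> span B} = S" using assms(4) by auto
 moreover have "continuous_map (top_of_set S) (top_of_set (span B)) G"
  using Ck_on_continuous[OF smooth_on_Ck[OF assms(3)]] assms(4) by (auto simp: continuous_map_in_subtopology)
 ultimately show ?thesis using assms(1-3) by (simp add: plot_def o_def)
qed

lemma euclid_dir_deriv:
 fixes l :: "'e::euclidean_space => 'f::real_normed_vector"
 assumes "bounded_linear l" "y \<in> span B" "v \<in> span B"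
 shows "dir_deriv (%x. l (chart_inv (span B, %x. x) x)) y v = l v"
proof -
 have "open_in B (span B)" by simp
 note open_along_openin[OF this]
 then have "dir_deriv (%x. l (chart_inv (span B, %x. x) x)) y v = dir_deriv l y v"
  by (rule dir_deriv_cong[OF _ assms(2,3)]) (simp add: euclid_chart_inv)
 also have "... = l v"
 proof (rule dir_deriv_eqI)
  have "((%t. y + t *\<^sub>R v) has_vector_derivative v) (at 0)" by (auto intro!: derivative_eq_intros)
  then show "((%t. l (y + t *\<^sub>R v)) has_vector_derivative l v) (at 0)"
   by (rule bounded_linear.has_vector_derivative[OF assms(1)])
 qed
 finally show ?thesis .
qed

lemma euclid_metric_eq_inner:
 assumes B: "B \<subseteq> Basis" and y: "y \<in> span B"
  and V: "V (span B, %x. x) \<in> span B" and W: "W (span B, %x. x) \<in> span B"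
 shows "euclid_metric B y V W = V (span B, %x. x) \<bullet> W (span B, %x. x)"
proof -
 have d: "differential (euclid B) (%x. x \<bullet> b) y Z = Z (span B, %x. x) \<bullet> b" if "Z (span B, %x. x) \<in> span B" for b Z
  unfolding differential_def Let_def chart_at_euclid[OF y] snd_conv comp_def
  by (rule euclid_dir_deriv[OF bounded_linear_inner_left y that])
 have "V (span B, %x. x) \<bullet> W (span B, %x. x)
   = (\<Sum>b\<in>B. (V (span B, %x. x) \<bullet> b) *\<^sub>R b) \<bullet> W (span B, %x. x)"
  unfolding sum_Basis_inner[OF B V] ..
 also have "... = (\<Sum>b\<in>B. (V (span B, %x. x) \<bullet> b) * (W (span B, %x. x) \<bullet> b))"
  unfolding inner_sum_left inner_scaleR_left by (intro sum.cong refl) (simp add: inner_commute)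
 finally show ?thesis unfolding euclid_metric_def d[where Z = V, OF V] d[where Z = W, OF W] ..
qed

lemma radiant_field_eq:
 assumes B: "B \<subseteq> Basis" and y: "y \<in> span B"
 shows "radiant_field B y = (%d. if d = (span B, %x. x) then y else 0)"
proof
 fix d :: "('a, 'a) chart"
 show "radiant_field B y d = (if d = (span B, %x. x) then y else 0)"
 proof (cases "d = (span B, %x. x)")
  case True
  have "coord_vector (euclid B) y (span B, %x. x) b d = b" if "b \<in> B" for b
   unfolding True coord_vector_def charts_at_euclid[OF y] snd_conv comp_def
   using euclid_dir_deriv[OF bounded_linear_ident y span_base[OF that]] by simp
  then show ?thesis using True by (simp add: radiant_field_def sum_Basis_inner[OF B y])
 next
  case False
  then show ?thesis by (simp add: radiant_field_def coord_vector_def charts_at_euclid[OF y])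
 qed
qed

context vanishing_ctx
begin

lemma \<Phi>_chart:
 assumes d: "d \<in> atlas M"
 shows "smooth_on B (snd d ` fst d) (%y. \<Phi> (chart_inv d y))"
  and "y \<in> snd d ` fst d ==> v \<in> span B ==> w \<in> span B ==>
   dir_deriv (%y. \<Phi> (chart_inv d y)) y v \<bullet> dir_deriv (%y. \<Phi> (chart_inv d y)) y w = gc d y v w"
  and "y \<in> snd d ` fst d ==> \<Phi> (chart_inv d y) \<in> span B"
  and "y \<in> snd d ` fst d ==> v \<in> span B ==> dir_deriv (%y. \<Phi> (chart_inv d y)) y v \<in> span B"
proof -
 note P = plot_chart_inv[OF d] and oa = open_along_openin[OF chart_image_open[OF d]]
 show sm: "smooth_on B (snd d ` fst d) (%y. \<Phi> (chart_inv d y))" by (rule \<Phi>_plot(1)[OF P])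
 have sp: "\<Phi> (chart_inv d y) \<in> span B" if "y \<in> snd d ` fst d" for y
  by (rule \<Phi>_span[OF chart_inv_topspace[OF d that]])
 assume y: "y \<in> snd d ` fst d"
 show "\<Phi> (chart_inv d y) \<in> span B" by (rule sp[OF y])
 assume v: "v \<in> span B"
 show "dir_deriv (%y. \<Phi> (chart_inv d y)) y v \<in> span B"
  by (rule smooth_dir_deriv_in_span[OF B_Basis oa sm B_Basis sp y v])
 assume w: "w \<in> span B"
 show "dir_deriv (%y. \<Phi> (chart_inv d y)) y v \<bullet> dir_deriv (%y. \<Phi> (chart_inv d y)) y w = gc d y v w"
  unfolding gc_chart_inv[OF d y] by (rule \<Phi>_plot(2)[OF P y v w])
qed

lemma \<Phi>_local_inverse:
 assumes q: "q \<in> points M"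
 obtains O' V' J where "openin (mtop M) O'" "q \<in> O'" "inj_on \<Phi> O'"
  "open_in B V'" "\<Phi> q \<in> V'" "plot M B V' J" "\<forall>w\<in>V'. \<Phi> (J w) = w"
proof -
 obtain d where d: "d \<in> atlas M" "q \<in> fst d" using atlas_cover[OF q] by blast
 let ?G = "%y. \<Phi> (chart_inv d y)"
 have y: "snd d q \<in> snd d ` fst d" using d(2) by (rule imageI)
 have inj: "v = 0" if v: "v \<in> span B" and 0: "dir_deriv ?G (snd d q) v = 0" for v
 proof (rule ccontr)
  assume "v ~= 0"
  from gc_pos[OF d(1) y v this] show False using \<Phi>_chart(2)[OF d(1) y v v] 0 by simp
 qed
 obtain U' V' Hh where U': "open_in B U'" "U' \<subseteq> snd d ` fst d" "snd d q \<in> U'"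
   and V': "open_in B V'" "?G (snd d q) \<in> V'" and hom: "homeomorphism U' V' ?G Hh"
   and Hh: "smooth_on B V' Hh"
  by (rule smooth_inverse_function[OF B_Basis chart_image_open[OF d(1)] \<Phi>_chart(1)[OF d(1)] \<Phi>_chart(3)[OF d(1)] y inj])
 have hG: "Hh (?G y) = y" if "y \<in> U'" for y using hom that unfolding homeomorphism_def by simp
 have Gh: "?G (Hh w) = w" "Hh w \<in> U'" if "w \<in> V'" for w using hom that unfolding homeomorphism_def by auto
 show ?thesis
 proof (rule that)
  show "openin (mtop M) {p \<in> fst d. snd d p \<in> U'}" by (rule open_chart_preimage[OF d(1) U'(1)])
  show "q \<in> {p \<in> fst d. snd d p \<in> U'}" using d(2) U'(3) by simp
  show "inj_on \<Phi> {p \<in> fst d. snd d p \<in> U'}"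
  proof (rule inj_onI)
   fix p p' assume p: "p \<in> {p \<in> fst d. snd d p \<in> U'}" and p': "p' \<in> {p \<in> fst d. snd d p \<in> U'}" and eq: "\<Phi> p = \<Phi> p'"
   have "snd d z = Hh (\<Phi> z)" if "z \<in> {p \<in> fst d. snd d p \<in> U'}" for z
    using hG[of "snd d z"] that d(1) by simp
   from this[OF p] this[OF p'] have "snd d p = snd d p'" using eq by simp
   then show "p = p'" using chart_inv_left[OF d(1)] p p' by (metis (lifting) mem_Collect_eq)
  qed
  show "open_in B V'" by (rule V'(1))
  show "\<Phi> q \<in> V'" using V'(2) d by simp
  have "Hh ` V' \<subseteq> snd d ` fst d" using Gh(2) U'(2) by auto
  then show "plot M B V' (%w. chart_inv d (Hh w))"
   by (rule plot_compose[OF plot_chart_inv[OF d(1)] B_Basis V'(1) Hh])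
  show "\<forall>w\<in>V'. \<Phi> (chart_inv d (Hh w)) = w" using Gh(1) by (rule ballI)
 qed
qed

lemma p0_U0: "p0 \<in> U0"
 using c(2) p0(3) m r(1) by (simp add: U0_def x0_def)

lemma \<Phi>_p0: "\<Phi> p0 = 0"
proof -
 have z: "snd c (flow (- t) p0) - x0 = 0" if t: "t \<ge> 0" for t
 proof -
  have u: "flow (- t) p0 \<in> U0" by (rule U0_backward[OF p0_U0 t])
  then have "m * (norm (snd c (flow (- t) p0) - x0))\<^sup>2 <= f (flow (- t) p0)"
   by (intro f_lower) (simp_all add: U0_def)
  also have "... = 0" unfolding f_flow[OF p0(1)] p0(3) by simp
  finally show ?thesis using m by (simp add: mult_le_0_iff)
 qed
 have "eventually (%t. exp t *\<^sub>R (snd c (flow (- t) p0) - x0) = 0) at_top"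
  using eventually_ge_at_top[of 0]
 proof eventually_elim
  case (elim t)
  show ?case unfolding z[OF elim] by simp
 qed
 then have "((%t. exp t *\<^sub>R (snd c (flow (- t) p0) - x0)) \<longlongrightarrow> 0) at_top" by (rule tendsto_eventually)
 from H_eq[OF this] show ?thesis unfolding \<Phi>_def by (simp add: linear_0[OF L(1)])
qed

lemma flow_to_p0:
 assumes q: "q \<in> points M" and O': "openin (mtop M) O'" "p0 \<in> O'"
 shows "eventually (%t. flow (- t) q \<in> O') at_top"
proof -
 obtain T where T: "flow (- T) q \<in> U0" by (rule basin[OF q])
 have inU: "flow (- t) q \<in> U0" if "t \<ge> T" for t
  using U0_backward[OF T, of "t - T"] that by (simp add: flow_add[OF q])
 have "x0 \<in> snd c ` (fst c Int O')" using c(2) O'(2) by (auto simp: x0_def)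
 then obtain \<delta> where \<delta>: "\<delta> > 0" "cball x0 \<delta> Int span B \<subseteq> snd c ` (fst c Int O')"
  by (rule cball_span_subset[OF open_chart_image[OF c(1) O'(1)]])
 have sub: "p \<in> O'" if p: "p \<in> fst c" "norm (snd c p - x0) < \<delta>" for p
 proof -
  have "snd c p \<in> span B" by (rule subsetD[OF chart_image_span[OF c(1)] imageI[OF p(1)]])
  then have "snd c p \<in> snd c ` (fst c Int O')"
   using p(2) by (intro subsetD[OF \<delta>(2)]) (simp add: dist_norm norm_minus_commute)
  then obtain p' where p': "p' \<in> fst c" "p' \<in> O'" "snd c p = snd c p'" by auto
  have "p = p'" using inj_onD[OF chart_inj[OF c(1)] p'(3) p(1) p'(1)] .
  then show ?thesis using p'(2) by simp
 qed
 have "((%t::real. exp (- t)) \<longlongrightarrow> (0::real)) at_top"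
  by (rule filterlim_compose[OF exp_at_bot filterlim_uminus_at_bot_at_top])
 from tendsto_scaleR[OF this H_limit(1)[OF q]]
 have "((%t. snd c (flow (- t) q) - x0) \<longlongrightarrow> 0) at_top" by (simp add: mult_exp_exp)
 then have "eventually (%t. dist (snd c (flow (- t) q) - x0) 0 < \<delta>) at_top" using \<delta>(1) by (rule tendstoD)
 then show ?thesis using eventually_ge_at_top[of T]
 proof eventually_elim
  case (elim t)
  have "flow (- t) q \<in> fst c" using inU[OF elim(2)] by (rule snd_U0(2))
  then show ?case by (rule sub) (use elim(1) in simp)
 qed
qed

text \<open>\<open>\<Phi>\<close> is injective near \<open>p0\<close>, and the backward flow, which \<open>\<Phi>\<close> turns into scaling, brings both points there.\<close>

lemma \<Phi>_inj: "inj_on \<Phi> (points M)"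
proof (rule inj_onI)
 fix p q assume p: "p \<in> points M" and q: "q \<in> points M" and eq: "\<Phi> p = \<Phi> q"
 obtain O' V' J where O': "openin (mtop M) O'" "p0 \<in> O'" "inj_on \<Phi> O'"
  "open_in B V'" "\<Phi> p0 \<in> V'" "plot M B V' J" "\<forall>w\<in>V'. \<Phi> (J w) = w"
  by (rule \<Phi>_local_inverse[OF p0(1)])
 have "eventually (%t. flow (- t) p \<in> O' & flow (- t) q \<in> O') at_top"
  by (intro eventually_conj flow_to_p0 p q O')
 then obtain t where t: "flow (- t) p \<in> O'" "flow (- t) q \<in> O'"
  using eventually_happens'[OF trivial_limit_at_top_linorder] by blast
 have "\<Phi> (flow (- t) p) = \<Phi> (flow (- t) q)" unfolding \<Phi>_flow[OF p] \<Phi>_flow[OF q] eq ..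
 from inj_onD[OF O'(3) this t] have "flow t (flow (- t) p) = flow t (flow (- t) q)" by simp
 then show "p = q" using flow_inverse[OF p, of "- t"] flow_inverse[OF q, of "- t"] by simp
qed

lemma \<Phi>_image: "\<Phi> ` points M = span B"
proof
 show "\<Phi> ` points M \<subseteq> span B" using \<Phi>_span by (rule image_subsetI)
 show "span B \<subseteq> \<Phi> ` points M"
 proof
  fix v assume v: "v \<in> span B"
  obtain O' V' J where J: "openin (mtop M) O'" "p0 \<in> O'" "inj_on \<Phi> O'"
   "open_in B V'" "\<Phi> p0 \<in> V'" "plot M B V' J" "\<forall>w\<in>V'. \<Phi> (J w) = w"
   by (rule \<Phi>_local_inverse[OF p0(1)])
  obtain \<epsilon> where \<epsilon>: "\<epsilon> > 0" "cball 0 \<epsilon> Int span B \<subseteq> V'"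
   by (rule cball_span_subset[OF J(4,5), unfolded \<Phi>_p0])
  define t where "t = norm v / \<epsilon>"
  have "t <= exp t" using exp_ge_add_one_self[of t] by linarith
  then have "norm v <= exp t * \<epsilon>" using \<epsilon>(1) by (simp add: t_def field_simps)
  then have "exp (- t) * norm v <= exp (- t) * (exp t * \<epsilon>)" by (rule mult_left_mono) simp
  also have "... = \<epsilon>" by (simp add: mult.assoc[symmetric] mult_exp_exp)
  finally have w: "exp (- t) *\<^sub>R v \<in> V'" using v by (intro subsetD[OF \<epsilon>(2)]) (simp add: span_scale)
  define q where "q = J (exp (- t) *\<^sub>R v)"
  have q: "q \<in> points M" unfolding q_def by (rule plotD(5)[OF J(6) w])
  have "\<Phi> q = exp (- t) *\<^sub>R v" unfolding q_def using bspec[OF J(7) w] .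
  then have "\<Phi> (flow t q) = v" unfolding \<Phi>_flow[OF q] by (simp add: mult_exp_exp)
  then show "v \<in> \<Phi> ` points M" using flow_topspace[OF q, of t] by (rule rev_image_eqI[rotated, OF sym])
 qed
qed

lemma \<Phi>_inverse_plot: "plot M B (span B) (inv_into (points M) \<Phi>)"
proof (rule plot_local[OF B_Basis])
 show "open_in B (span B)" by simp
 let ?I = "inv_into (points M) \<Phi>"
 fix v assume "v \<in> span B"
 then have v: "v \<in> \<Phi> ` points M" unfolding \<Phi>_image .
 have q: "?I v \<in> points M" "\<Phi> (?I v) = v" by (rule inv_into_into[OF v], rule f_inv_into_f[OF v])
 obtain O' V' J where J: "openin (mtop M) O'" "?I v \<in> O'" "inj_on \<Phi> O'"
   "open_in B V'" "\<Phi> (?I v) \<in> V'" "plot M B V' J" "\<forall>w\<in>V'. \<Phi> (J w) = w"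
  by (rule \<Phi>_local_inverse[OF q(1)])
 have "plot M B V' ?I"
 proof (rule plot_cong[OF J(6)])
  fix w assume w: "w \<in> V'"
  show "J w = ?I w" using inv_into_f_f[OF \<Phi>_inj plotD(5)[OF J(6) w]] bspec[OF J(7) w] by simp
 qed
 moreover have "V' \<subseteq> span B" using J(4) openin_imp_subset by blast
 ultimately show "\<exists>S'. v \<in> S' & S' \<subseteq> span B & plot M B S' ?I" using J(5) q(2) by (intro exI[of _ V']) simp
qed

lemma \<Phi>_diffeomorphism: "diffeomorphism M (euclid B) \<Phi>"
 unfolding diffeomorphism_def euclid_simps topspace_euclidean_subtopology
proof (intro conjI)
 show "bij_betw \<Phi> (points M) (span B)" unfolding bij_betw_def using \<Phi>_inj \<Phi>_image by (rule conjI)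
 show "smooth_map M (euclid B) \<Phi>"
 proof (rule smooth_map_from_plots)
  fix d assume d: "d \<in> atlas M"
  show "plot (euclid B) B (snd d ` fst d) (\<Phi> o chart_inv d)"
   unfolding comp_def by (rule plot_euclid[OF B_Basis chart_image_open[OF d] \<Phi>_chart(1,3)[OF d]])
 qed
 let ?I = "inv_into (points M) \<Phi>"
 show "smooth_map (euclid B) M ?I"
 proof (rule smooth_map_if_plots)
  show "continuous_map (mtop (euclid B)) (mtop M) ?I" using plotD(3)[OF \<Phi>_inverse_plot] by simp
  fix e assume "e \<in> atlas (euclid B)"
  then have e: "e = (span B, %x. x)" by simp
  show "inj_on (snd e) (fst e)" by (simp add: e)
  have "plot M B (span B) (?I o chart_inv (span B, %x. x))"
   by (rule plot_cong[OF \<Phi>_inverse_plot]) (simp add: euclid_chart_inv)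
  then show "plot M (coords (euclid B)) (snd e ` fst e) (?I o chart_inv e)" by (simp add: e)
 qed
qed

text \<open>The derivative of \<open>exp t *\<^sub>R \<Phi> p\<close> at \<open>t = 0\<close>.\<close>

lemma \<Phi>_radial:
 assumes p: "p \<in> points M" and d: "d \<in> atlas M" "p \<in> fst d"
 shows "dir_deriv (%y. \<Phi> (chart_inv d y)) (snd d p) (\<xi> p d) = \<Phi> p"
proof -
 let ?G = "%y. \<Phi> (chart_inv d y)"
 define x where "x = snd d p"
 have x: "x \<in> snd d ` fst d" using d(2) by (simp add: x_def)
 have Xx: "\<xi> p d = X d x" using X_at[of d p] d by (simp add: x_def charts_at_iff)
 define j where "j t = snd d (flow t p)" for t
 define T where "T = {t. flow t p \<in> fst d}"
 have p': "flow 0 p = p" by (rule flow_curve(2)[OF p])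
 have T: "open T" "0 \<in> T"
  unfolding T_def using integral_curve_open[OF flow_curve(1)[OF p] chart_open[OF d(1)]] d(2) p' by simp_all
 have j0: "j 0 = x" by (simp add: j_def x_def p')
 have dj: "(j has_vector_derivative X d x) (at 0 within T)"
 proof (rule has_vector_derivative_at_within)
  show "(j has_vector_derivative X d x) (at 0)"
   using flow_chart_derivative[OF p d(1), of 0] d(2) p' unfolding j_def x_def by simp
 qed
 have jB: "j t \<in> span B" if "t \<in> T" for t
  using that chart_image_span[OF d(1)] by (auto simp: j_def T_def)
 have "((%t. ?G (j t)) has_vector_derivative dir_deriv ?G (j 0) (X d x)) (at 0 within T)"
  by (rule C1_chain[OF B_Basis open_along_openin[OF chart_image_open[OF d(1)]] smooth_on_Ck[OF \<Phi>_chart(1)[OF d(1)]] _ dj _ X_span[OF d(1) x]])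
   (use x j0 in simp, intro span_diff jB T(2), assumption)
 then have D1: "((%t. ?G (j t)) has_vector_derivative dir_deriv ?G x (X d x)) (at 0)"
  using at_within_open[OF T(2,1)] j0 by simp
 have "((%t. exp t *\<^sub>R \<Phi> p) has_vector_derivative \<Phi> p) (at 0)"
  by (auto intro!: derivative_eq_intros)
 then have "((%t. ?G (j t)) has_vector_derivative \<Phi> p) (at 0)"
 proof (rule has_vector_derivative_transform_within_open[OF _ T])
  fix t assume "t \<in> T"
  then show "exp t *\<^sub>R \<Phi> p = ?G (j t)" using d(1) by (simp add: j_def T_def \<Phi>_flow[OF p])
 qed
 from vector_derivative_unique_at[OF D1 this] show ?thesis by (simp add: Xx x_def)
qed

theorem isomorphic_euclid: "isomorphic (M, g, \<xi>) (euclid B, euclid_metric B, radiant_field B)"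
 unfolding isomorphic_def prod.case
proof (intro exI[of _ \<Phi>] conjI ballI \<Phi>_diffeomorphism)
 fix p assume p: "p \<in> points M"
 define d where "d = chart_at M p"
 have d: "d \<in> atlas M" "p \<in> fst d" using chart_at[OF p] by (auto simp: d_def)
 have ch: "d \<in> charts_at M p" using d by (simp add: charts_at_iff)
 define x where "x = snd d p"
 have x: "x \<in> snd d ` fst d" using d by (simp add: x_def)
 have px: "chart_inv d x = p" using d by (simp add: x_def)
 let ?G = "%y. \<Phi> (chart_inv d y)" and ?e = "(span B, %x. x)"
 have sp: "\<Phi> p \<in> span B" by (rule \<Phi>_span[OF p])
 have tm: "tangent_map M (euclid B) \<Phi> p Z = (%d'. if d' = ?e then dir_deriv ?G x (Z d) else 0)" for Z
  unfolding tangent_map_def Let_def d_def[symmetric] charts_at_euclid[OF sp] x_def by (auto simp: fun_eq_iff comp_def)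
 show "tangent_map M (euclid B) \<Phi> p (\<xi> p) = radiant_field B (\<Phi> p)"
  unfolding tm radiant_field_eq[OF B_Basis sp] x_def \<Phi>_radial[OF p d] ..
 fix V W assume V: "V \<in> tangent_space M p" and W: "W \<in> tangent_space M p"
 have v: "V d \<in> span B" and w: "W d \<in> span B" using tangent_push(2)[OF V ch] tangent_push(2)[OF W ch] .
 have "euclid_metric B (\<Phi> p) (tangent_map M (euclid B) \<Phi> p V) (tangent_map M (euclid B) \<Phi> p W)
   = dir_deriv ?G x (V d) \<bullet> dir_deriv ?G x (W d)"
  using euclid_metric_eq_inner[OF B_Basis sp, of "tangent_map M (euclid B) \<Phi> p V" "tangent_map M (euclid B) \<Phi> p W"]
   \<Phi>_chart(4)[OF d(1) x v] \<Phi>_chart(4)[OF d(1) x w] unfolding tm by simp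
 also have "... = gc d x (V d) (W d)" by (rule \<Phi>_chart(2)[OF d(1) x v w])
 also have "... = g p V W" unfolding x_def by (rule tangent_metric[OF V W ch, symmetric])
 finally show "euclid_metric B (\<Phi> p) (tangent_map M (euclid B) \<Phi> p V) (tangent_map M (euclid B) \<Phi> p W) = g p V W" .
qed

end

theorem theorem1p2:
  fixes M :: "('a, 'e::euclidean_space) manifold"
    and g :: "('a, 'e) tensor2"
    and \<xi> :: "'a \<Rightarrow> ('a, 'e) tangent"
  assumes "global_selfsimilar_manifold M g \<xi>"
    and "potential_field M g \<xi>"
  shows "((\<exists>p\<in>topspace (mtop M). vanishes_at \<xi> p) \<longrightarrow>
            isomorphic (M, g, \<xi>)
              (euclid (coords M), euclid_metric (coords M), radiant_field (coords M)))
       \<and> ((\<forall>p\<in>topspace (mtop M). \<not> vanishes_at \<xi> p) \<longrightarrow>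
            (\<exists>(N :: ('a, 'e) manifold) gN. riemannian_manifold N gN \<and>
              isomorphic (M, g, \<xi>) (riemannian_cone N, cone_metric N gN, cone_field N)))"
proof (intro conjI impI)
 interpret selfsimilar_ctx M g \<xi>
  using assms
  unfolding global_selfsimilar_manifold_def selfsimilar_manifold_def riemannian_manifold_def
  by unfold_locales auto
 {
  assume "\<exists>p\<in>points M. vanishes_at \<xi> p"
  then obtain p where p: "p \<in> points M" "vanishes_at \<xi> p" by blast
  obtain c where c: "c \<in> atlas M" "p \<in> fst c" using atlas_cover[OF p(1)] by blast
  have X0: "X c (snd c p) = 0"
   using X_at[of c p] c p(2) by (simp add: charts_at_iff vanishes_at_def)
  show "isomorphic (M, g, \<xi>) (euclid (coords M), euclid_metric (coords M), radiant_field (coords M))"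
  proof (rule f_quadratic_bound[OF c X0])
   fix r \<rho> m :: real
   assume "0 < r" "r < \<rho>" "cball (snd c p) \<rho> Int span B \<subseteq> snd c ` fst c" "0 < m"
    "!!x. x \<in> cball (snd c p) r Int span B ==> m * (norm (x - snd c p))\<^sup>2 <= gc c x (X c x) (X c x)"
   then interpret vanishing_ctx M g \<xi> p c r \<rho> m
    using c X0 by unfold_locales
   show ?thesis by (rule isomorphic_euclid)
  qed
 next
  assume "\<forall>p\<in>points M. \<not> vanishes_at \<xi> p"
  then interpret nonvanishing_ctx M g \<xi>
   by unfold_locales blast
  have "riemannian_manifold N gN" unfolding riemannian_manifold_def using N_manifold N_metric by (rule conjI)
  with isomorphic_cone show "\<exists>(N :: ('a, 'e) manifold) gN. riemannian_manifold N gN &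
    isomorphic (M, g, \<xi>) (riemannian_cone N, cone_metric N gN, cone_field N)"
   by (intro exI conjI)
 }
qed

end
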